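(* Let $d,k\ge 1$ and let $B=(B^1,\ldots,B^d)$ be a $d$-dimensional fractional Brownian motion with Hurst parameter $H$. For any word $(i_1,\ldots,i_{2k})\in\{1,\ldots,d\}^{2k}$, the sum $$\frac{k!}{H^k(2H-1)^k}\,\mathbf{E}\left[\int_{\Delta^{2k}[0,1]}dB^{i_1}_{t_1}\cdots dB^{i_{2k}}_{t_{2k}}\right]=\sum_{\mathcal{P}\le(i_1,\ldots,i_{2k})}L(\mathcal{P};H)$$ (the equality being for $H\in(1/2,1)$) has a meromorphic continuation in the variable $H$ to the entire plane $\mathbf{C}$ which is holomorphic in the complement of the following union of rational progressions: $$\left\{1-\frac{|S|+l}{2[S|\mathcal{P}]}\;:\;S\subset[1,2k],\ \mathcal{P}\le(i_1,\ldots,i_{2k}),\ [S|\mathcal{P}]>0,\ l=0,1,2,\ldots\right\}\subset\mathbf{Q}.$$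
   Context: The components $B^1,\ldots,B^d$ are independent centered Gaussian processes with covariance $\mathbf{E}[B^i_tB^i_s]=\frac12(t^{2H}+s^{2H}-|t-s|^{2H})$. For $H\in(1/2,1)$ the iterated integrals over $\Delta^{2k}[0,1]=\{t\in\mathbf{R}^{2k}:0<t_1<\cdots<t_{2k}<1\}$ are defined pathwise as Young integrals. A pair partition of $\{1,\ldots,2k\}$ is a partition into $k$ blocks of size two. For a pair partition $\mathcal{P}=\{\{j_1^1,j_1^2\},\ldots,\{j_k^1,j_k^2\}\}$, the notation $\mathcal{P}\le(i_1,\ldots,i_{2k})$ means $i_{j_l^1}=i_{j_l^2}$ for every $l=1,\ldots,k$. The sum is over all pair partitions $\mathcal{P}$ of $\{1,\ldots,2k\}$ with $\mathcal{P}\le(i_1,\ldots,i_{2k})$, and $$L(\mathcal{P};H)=\int_{\Delta^{2k}[0,1]}\prod_{l=1}^k|s_{j_l^1}-s_{j_l^2}|^{2H-2}\,ds_1\wedge\cdots\wedge ds_{2k},$$ initially defined for $\operatorname{Re}H>1/2$. For natural numbers $a\le b$, $[a,b]=\{a,a+1,\ldots,b\}$. For a pair $\{j^1,j^2\}$ with $j^1\ne j^2$, $I(\{j^1,j^2\})=[\min(j^1,j^2)+1,\max(j^1,j^2)]$; $\mathcal{I}(\mathcal{P})=\{I(\{j^1,j^2\}):\{j^1,j^2\}\in\mathcal{P}\}$; and for $S\subset\{1,\ldots,2k\}$, $[S|\mathcal{P}]$ is the number of subsets of $S$ which are elements of $\mathcal{I}(\mathcal{P})$. $|S|$ is the cardinality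 of $S$.
   Formalization: The displayed equality is corrected: the factor k! on the left is matched by a factor k! on the right-hand sum, since with unordered pair partitions the printed equality fails for k ≥ 2 (e.g. d=1, k=2); the continuation is stated for the sum of L(P;H). *)

theory Defs
  imports "HOL-Probability.Probability" "HOL-Complex_Analysis.Complex_Analysis"
begin

section \<open>Fractional Brownian motion\<close>

text \<open>The point mass at 0 counts as Gaussian; the library's \<^const>\<open>normal_density\<close> is
  a probability density only for positive standard deviation.\<close>

definition centered_gaussian :: "'a measure \<Rightarrow> ('a \<Rightarrow> real) \<Rightarrow> bool" where
  "centered_gaussian M X \<longleftrightarrow> X \<in> borel_measurable M \<and>
     ((\<exists>\<sigma>>0. distributed M lborel X (normal_density 0 \<sigma>)) \<or> (AE \<omega> in M. X \<omega> = 0))"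

definition centered_gaussian_process ::
    "'a measure \<Rightarrow> real set \<Rightarrow> (real \<Rightarrow> 'a \<Rightarrow> real) \<Rightarrow> bool" where
  "centered_gaussian_process M T X \<longleftrightarrow>
     (\<forall>A c. finite A \<and> A \<subseteq> T \<longrightarrow> centered_gaussian M (\<lambda>\<omega>. \<Sum>t\<in>A. c t * X t \<omega>))"

text \<open>\<open>B i t\<close> is the \<open>i\<close>-th component at time \<open>t\<close>, for \<open>1 \<le> i \<le> d\<close> and \<open>t \<ge> 0\<close>.
  The components are independent as processes, i.e. as random elements of the product space
  of real functions on the half-line. As usual for fractional Brownian motion, the paths are almost
  surely continuous; the Gaussian law alone does not determine pathwise integrals.\<close>

locale fractional_brownian_motion = prob_space M for M :: "'a measure" +
  fixes d :: nat and H :: real and B :: "nat \<Rightarrow> real \<Rightarrow> 'a \<Rightarrow> real"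
  assumes hurst: "0 < H" "H < 1"
    and gaussian: "\<And>i. i \<in> {1..d} \<Longrightarrow> centered_gaussian_process M {0..} (B i)"
    and covariance: "\<And>i s t. i \<in> {1..d} \<Longrightarrow> 0 \<le> s \<Longrightarrow> 0 \<le> t \<Longrightarrow>
      expectation (\<lambda>\<omega>. B i t \<omega> * B i s \<omega>)
        = (t powr (2 * H) + s powr (2 * H) - \<bar>t - s\<bar> powr (2 * H)) / 2"
    and independent: "indep_vars (\<lambda>_. PiM {0..} (\<lambda>_. borel)) (\<lambda>i \<omega>. \<lambda>t\<in>{0..}. B i t \<omega>) {1..d}"
    and continuous: "AE \<omega> in M. \<forall>i\<in>{1..d}. continuous_on {0..} (\<lambda>t. B i t \<omega>)"

section \<open>Iterated Young integrals\<close>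

text \<open>The Young integral is the limit of the Riemann--Stieltjes sums as the mesh of the
  partition tends to 0, uniformly in the choice of the tags \<open>\<xi>\<close>.\<close>

definition has_young_integral ::
    "(real \<Rightarrow> real) \<Rightarrow> (real \<Rightarrow> real) \<Rightarrow> real \<Rightarrow> real \<Rightarrow> real \<Rightarrow> bool" where
  "has_young_integral f g a b I \<longleftrightarrow>
     (\<forall>\<epsilon>>0. \<exists>\<delta>>0. \<forall>n p \<xi>. p 0 = a \<and> p n = b \<and>
        (\<forall>j<n. p j \<le> \<xi> j \<and> \<xi> j \<le> p (Suc j) \<and> p (Suc j) - p j < \<delta>) \<longrightarrow>
        \<bar>(\<Sum>j<n. f (\<xi> j) * (g (p (Suc j)) - g (p j))) - I\<bar> < \<epsilon>)"

definition young_integral :: "(real \<Rightarrow> real) \<Rightarrow> (real \<Rightarrow> real) \<Rightarrow> real \<Rightarrow> real \<Rightarrow> real" where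
  "young_integral f g a b = (THE I. has_young_integral f g a b I)"

text \<open>\<open>iterated_young x w m t\<close> is the integral of
  \<open>dx\<^bsup>w 1\<^esup>\<^bsub>t 1\<^esub> \<cdots> dx\<^bsup>w m\<^esup>\<^bsub>t m\<^esub>\<close> over \<open>0 < t 1 < \<cdots> < t m < t\<close>, evaluated from the
  innermost variable \<open>t 1\<close> outwards.\<close>

primrec iterated_young ::
    "(nat \<Rightarrow> real \<Rightarrow> real) \<Rightarrow> (nat \<Rightarrow> nat) \<Rightarrow> nat \<Rightarrow> real \<Rightarrow> real" where
  "iterated_young x w 0 t = 1"
| "iterated_young x w (Suc m) t = young_integral (iterated_young x w m) (x (w (Suc m))) 0 t"

definition iterated_young_exists ::
    "(nat \<Rightarrow> real \<Rightarrow> real) \<Rightarrow> (nat \<Rightarrow> nat) \<Rightarrow> nat \<Rightarrow> real \<Rightarrow> bool" where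
  "iterated_young_exists x w n T \<longleftrightarrow>
     (\<forall>m<n. \<forall>t\<in>{0..T}. \<exists>I. has_young_integral (iterated_young x w m) (x (w (Suc m))) 0 t I)"

section \<open>Pair partitions\<close>

definition pair_partitions :: "nat \<Rightarrow> nat set set set" where
  "pair_partitions n = {P. partition_on {1..n} P \<and> (\<forall>b\<in>P. card b = 2)}"

definition pair_partitions_below :: "nat \<Rightarrow> (nat \<Rightarrow> nat) \<Rightarrow> nat set set set" where
  "pair_partitions_below n w = {P \<in> pair_partitions n. \<forall>b\<in>P. \<forall>i\<in>b. \<forall>j\<in>b. w i = w j}"

definition open_simplex :: "nat \<Rightarrow> (nat \<Rightarrow> real) set" where
  "open_simplex n = {s \<in> {1..n} \<rightarrow>\<^sub>E {0<..<1}. strict_mono_on {1..n} s}"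

text \<open>The integral below converges absolutely for \<open>Re H > 1/2\<close>; only there is it used.\<close>

definition L_integral :: "nat \<Rightarrow> nat set set \<Rightarrow> complex \<Rightarrow> complex" where
  "L_integral n P H =
     (LINT s : open_simplex n | PiM {1..n} (\<lambda>_. lborel).
        (\<Prod>b\<in>P. of_real \<bar>s (Min b) - s (Max b)\<bar> powr (2 * H - 2)))"

definition pair_interval :: "nat set \<Rightarrow> nat set" where
  "pair_interval b = {Min b + 1..Max b}"

definition interval_count :: "nat set \<Rightarrow> nat set set \<Rightarrow> nat" where
  "interval_count S P = card {J \<in> pair_interval ` P. J \<subseteq> S}"

definition exceptional_set :: "nat \<Rightarrow> (nat \<Rightarrow> nat) \<Rightarrow> complex set" where
  "exceptional_set n w =
     {1 - of_nat (card S + l) / (2 * of_nat (interval_count S P)) | S P l.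
        S \<subseteq> {1..n} \<and> P \<in> pair_partitions_below n w \<and> interval_count S P > 0}"

end

theory Submission
  imports Defs
begin

text \<open>
  Almost every path is Hoelder continuous of some order above \<open>1/2\<close>. Hence the left-point sums over
  the dyadic grids converge to the iterated Young integral, and they are dominated by a power of a
  random Hoelder constant that has moments of all orders. The Wick formula turns the expectation of
  such a sum into integrals of the covariance density \<open>H(2H-1)|s-t|\<close> to the power \<open>2H-2\<close>
  over unions of dyadic boxes, which exhaust the simplex.

  For the continuation, pass to the gaps \<open>x_j = s_j - s_{j-1}\<close>, so that each factor becomes a power
  of a sum of \<open>x_j\<close> over an interval. Splitting repeatedly according to which remaining coordinate is
  largest and rescaling the others by it gives integrals over the unit cube of a product of powers of
  the coordinates times a smooth amplitude. Integrating by parts in one coordinate raises its exponent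
  \<open>aH+b\<close> by one at the cost of a factor \<open>1/(aH+b+1)\<close>. The coordinate that is the largest of a
  set \<open>S\<close> of gaps carries the exponent \<open>|S|-1+(2H-2)[S|P]\<close>, whence the poles.
\<close>

section \<open>Young integrals of Hoelder functions\<close>

text \<open>Convergence and the location of the poles rest on one inequality: distinct pairs have
  distinct right end points, so a set \<open>S\<close> of gaps contains at most \<open>|S|\<close>
  of the intervals. Hence \<open>|S| - 1 + (2H - 2)[S|P]\<close> has real part above -1 as soon as
  \<open>Re H > 1/2\<close>, and every pole has real part at most 1/2. Dividing by the largest gap
  helps because an interval sum containing it becomes that gap times \<open>1 + p\<close>, with
  \<open>p\<close> a polynomial with nonnegative coefficients, and complex powers of
  \<open>1 + p\<close> are smooth up to the boundary of the cube. The remaining intervals avoid that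
  gap, so the recursion continues on a smaller set.

  On the stochastic side, a left-point sum multiplies an increment only with sums over strictly
  earlier cells. Each Wick pair therefore joins two cells without common interior, no diagonal term
  arises, and at each level the expectation is exactly a kernel integral over boxes inside the
  simplex. The iterated integral itself is known only as an almost sure limit, so its expectation is
  taken with respect to the completed measure.\<close>

definition young_const :: "real \<Rightarrow> real" where
  "young_const \<alpha> = 2 / (1 - 2 powr (1 - 2 * \<alpha>))"

lemma young_const_pos: "\<alpha> > 1/2 \<Longrightarrow> young_const \<alpha> > 0"
  unfolding young_const_def
  by (intro divide_pos_pos) (auto simp: powr_less_one)

text \<open>Split at the last grid point in the first half of the interval: both remaining pieces have at
  most half the length, and the single cell between them contributes no error.\<close>

lemma discrete_young:
  fixes f g p :: "nat \<Rightarrow> real"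
  assumes \<alpha>: "\<alpha> > 1/2" and F: "F \<ge> 0" and G: "G \<ge> 0"
    and p: "\<And>i j. i \<le> j \<Longrightarrow> j \<le> N \<Longrightarrow> p i \<le> p j"
    and f: "\<And>i j. i \<le> j \<Longrightarrow> j \<le> N \<Longrightarrow> \<bar>f j - f i\<bar> \<le> F * (p j - p i) powr \<alpha>"
    and g: "\<And>i j. i \<le> j \<Longrightarrow> j \<le> N \<Longrightarrow> \<bar>g j - g i\<bar> \<le> G * (p j - p i) powr \<alpha>"
  shows "i \<le> j \<Longrightarrow> j \<le> N \<Longrightarrow>
    \<bar>(\<Sum>l\<in>{i..<j}. f l * (g (Suc l) - g l)) - f i * (g j - g i)\<bar>
      \<le> young_const \<alpha> * F * G * (p j - p i) powr (2 * \<alpha>)"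
proof (induction "j - i" arbitrary: i j rule: less_induct)
  case less
  define K where "K = young_const \<alpha> * F * G"
  have K: "K \<ge> 0" unfolding K_def using young_const_pos[OF \<alpha>] F G by simp
  show ?case
  proof (cases "i = j")
    case True then show ?thesis by simp
  next
    case False
    with less have ij: "i < j" by simp
    define D where "D = p j - p i"
    have D: "D \<ge> 0" using p less.prems unfolding D_def by simp
    define A where "A = {l. i \<le> l \<and> l < j \<and> p l - p i \<le> D / 2}"
    have finA: "finite A" unfolding A_def by (rule finite_subset[of _ "{..<j}"]) auto
    have iA: "i \<in> A" unfolding A_def using ij D by auto
    define m where "m = Max A"
    have mA: "m \<in> A" unfolding m_def using finA iA by (metis Max_in empty_iff)
    hence m: "i \<le> m" "m < j" "p m - p i \<le> D/2" unfolding A_def by auto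
    have m2: "p j - p (Suc m) \<le> D / 2"
    proof (cases "Suc m = j")
      case True then show ?thesis using D by simp
    next
      case False
      have "Suc m \<notin> A" using Max_ge[OF finA, of "Suc m"] unfolding m_def[symmetric] by auto
      hence "p (Suc m) - p i > D / 2" using m False unfolding A_def by auto
      then show ?thesis unfolding D_def by argo
    qed
    define e where "e = (\<lambda>i j. (\<Sum>l\<in>{i..<j}. f l * (g (Suc l) - g l)) - f i * (g j - g i))"
    \<comment> \<open>\<open>e\<close> is the defect between a sum and its one-term approximation.
      The cell from \<open>m\<close> to \<open>Suc m\<close> has defect 0; the two extra products
      come from replacing \<open>f i\<close> by \<open>f m\<close> and by
      \<open>f (Suc m)\<close>.\<close>
    have split: "e i j = e i m + e (Suc m) j + (f m - f i) * (g (Suc m) - g m)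
                   + (f (Suc m) - f i) * (g j - g (Suc m))"
    proof -
      have "{i..<j} = {i..<m} \<union> {m} \<union> {Suc m..<j}" using m by auto
      hence "(\<Sum>l\<in>{i..<j}. f l * (g (Suc l) - g l)) = (\<Sum>l\<in>{i..<m} \<union> {m} \<union> {Suc m..<j}. f l * (g (Suc l) - g l))"
        by simp
      also have "\<dots> = (\<Sum>l\<in>{i..<m}. f l * (g (Suc l) - g l)) + f m * (g (Suc m) - g m)
          + (\<Sum>l\<in>{Suc m..<j}. f l * (g (Suc l) - g l))"
        by (subst sum.union_disjoint; simp)+
      finally show ?thesis unfolding e_def by (simp add: algebra_simps)
    qed
    have mono2: "x \<le> y \<Longrightarrow> 0 \<le> x \<Longrightarrow> x powr (2*\<alpha>) \<le> y powr (2*\<alpha>)" for x y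
      using \<alpha> by (intro powr_mono2) auto
    have pd: "D powr \<alpha> * D powr \<alpha> = D powr (2*\<alpha>)" by (simp add: powr_add[symmetric])
    have cross: "\<bar>(f b - f a) * (g d - g c)\<bar> \<le> F * G * D powr (2*\<alpha>)"
      if "i \<le> a" "a \<le> b" "b \<le> j" "i \<le> c" "c \<le> d" "d \<le> j" for a b c d
    proof -
      have "\<bar>f b - f a\<bar> \<le> F * (p b - p a) powr \<alpha>" using f that less.prems by simp
      also have "\<dots> \<le> F * D powr \<alpha>"
        using p[of a b] p[of i a] p[of b j] that less.prems F unfolding D_def
        by (intro mult_left_mono powr_mono2) (use \<alpha> in auto)
      finally have 1: "\<bar>f b - f a\<bar> \<le> F * D powr \<alpha>" .
      have "\<bar>g d - g c\<bar> \<le> G * (p d - p c) powr \<alpha>" using g that less.prems by simp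
      also have "\<dots> \<le> G * D powr \<alpha>"
        using p[of c d] p[of i c] p[of d j] that less.prems G unfolding D_def
        by (intro mult_left_mono powr_mono2) (use \<alpha> in auto)
      finally have 2: "\<bar>g d - g c\<bar> \<le> G * D powr \<alpha>" .
      have "\<bar>(f b - f a) * (g d - g c)\<bar> \<le> (F * D powr \<alpha>) * (G * D powr \<alpha>)"
        unfolding abs_mult by (intro mult_mono 1 2) (use F in auto)
      also have "\<dots> = F * G * D powr (2*\<alpha>)" using pd by (simp add: algebra_simps)
      finally show ?thesis .
    qed
    have half: "(D/2) powr (2*\<alpha>) = D powr (2*\<alpha>) * 2 powr (-2*\<alpha>)"
      using D powr_divide[of D 2 "2*\<alpha>"] powr_minus[of 2 "2*\<alpha>"] by (metis divide_inverse minus_mult_left zero_le_numeral)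
    have e1: "\<bar>e i m\<bar> \<le> K * (D powr (2*\<alpha>) * 2 powr (-2*\<alpha>))"
    proof -
      have "\<bar>e i m\<bar> \<le> K * (p m - p i) powr (2*\<alpha>)" unfolding e_def K_def
        by (rule less.hyps) (use m less.prems in auto)
      also have "\<dots> \<le> K * (D/2) powr (2*\<alpha>)"
        using m p[of i m] less.prems by (intro mult_left_mono mono2 K) auto
      finally show ?thesis by (simp add: half)
    qed
    have e2: "\<bar>e (Suc m) j\<bar> \<le> K * (D powr (2*\<alpha>) * 2 powr (-2*\<alpha>))"
    proof -
      have "\<bar>e (Suc m) j\<bar> \<le> K * (p j - p (Suc m)) powr (2*\<alpha>)" unfolding e_def K_def
        by (rule less.hyps) (use m less.prems in auto)
      also have "\<dots> \<le> K * (D/2) powr (2*\<alpha>)"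
        using m m2 p[of "Suc m" j] less.prems by (intro mult_left_mono mono2 K) auto
      finally show ?thesis by (simp add: half)
    qed
    have c1: "\<bar>(f m - f i) * (g (Suc m) - g m)\<bar> \<le> F * G * D powr (2*\<alpha>)"
      by (rule cross) (use m in auto)
    have c2: "\<bar>(f (Suc m) - f i) * (g j - g (Suc m))\<bar> \<le> F * G * D powr (2*\<alpha>)"
      by (rule cross) (use m in auto)
    have q: "2 powr (1 - 2*\<alpha>) < 1" using \<alpha> by (auto simp: powr_less_one)
    \<comment> \<open>\<open>young_const\<close> solves this fixed-point equation: the two halves
      contribute \<open>2 * 2 powr (-2*\<alpha>)\<close> times the bound, the two cross terms
      \<open>2 * (F * G)\<close>.\<close>
    have Keq: "K * 2 powr (1 - 2*\<alpha>) + 2 * (F * G) = K"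
    proof -
      define x where "x = 2 powr (1 - 2*\<alpha>)"
      have "x \<noteq> 1" using q unfolding x_def by linarith
      thus ?thesis unfolding K_def young_const_def x_def[symmetric] by (simp add: field_simps)
    qed
    have two: "2 * 2 powr (- 2*\<alpha>) = 2 powr (1 - 2*\<alpha>)" by (simp add: powr_diff powr_minus divide_inverse)
    have "\<bar>e i j\<bar> \<le> 2 * (K * (D powr (2*\<alpha>) * 2 powr (-2*\<alpha>))) + 2 * (F * G * D powr (2*\<alpha>))"
      unfolding split using e1 e2 c1 c2 by linarith
    also have "\<dots> = (K * (2 * 2 powr (-2*\<alpha>)) + 2 * (F * G)) * D powr (2*\<alpha>)"
      by (simp add: algebra_simps)
    also have "\<dots> = K * D powr (2*\<alpha>)" unfolding two Keq ..
    finally show ?thesis unfolding e_def K_def D_def .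
  qed
qed

definition hoelder_on :: "real set \<Rightarrow> real \<Rightarrow> real \<Rightarrow> (real \<Rightarrow> real) \<Rightarrow> bool" where
  "hoelder_on A \<alpha> F f \<longleftrightarrow> (\<forall>s\<in>A. \<forall>t\<in>A. s \<le> t \<longrightarrow> \<bar>f t - f s\<bar> \<le> F * (t - s) powr \<alpha>)"

lemma hoelder_onD:
  "hoelder_on A \<alpha> F f \<Longrightarrow> s \<in> A \<Longrightarrow> t \<in> A \<Longrightarrow> s \<le> t \<Longrightarrow> \<bar>f t - f s\<bar> \<le> F * (t - s) powr \<alpha>"
  unfolding hoelder_on_def by blast

lemma sum_dyadic_split:
  fixes h :: "nat \<Rightarrow> 'a::comm_monoid_add"
  shows "(\<Sum>i<2 * n. h i) = (\<Sum>i<n. h (2 * i) + h (2 * i + 1))"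
  by (induction n) (auto simp: add.assoc)

text \<open>The number of cells times the error per cell. The ratio is below 1 exactly for \<alpha>
  > 1/2, which is how the Young condition enters the dyadic limits.\<close>

lemma two_powr_split:
  "(2::real) ^ n * (1 / 2 ^ n) powr (2 * \<alpha>) = (2 powr (1 - 2 * \<alpha>)) ^ n"
proof -
  have "(1 / 2 ^ n :: real) = 2 powr (- real n)" by (simp add: powr_minus powr_realpow divide_inverse)
  hence "(1 / 2 ^ n :: real) powr (2 * \<alpha>) = 2 powr (- (real n) * (2 * \<alpha>))" by (simp add: powr_powr)
  moreover have "(2::real) ^ n = 2 powr real n" by (simp add: powr_realpow)
  moreover have "(2 powr (1 - 2 * \<alpha>)) ^ n = 2 powr ((1 - 2 * \<alpha>) * real n)"
    by (metis powr_powr powr_realpow powr_gt_zero zero_less_numeral less_numeral_extra(3) powr_realpow)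
  ultimately show ?thesis by (simp add: powr_add[symmetric] algebra_simps)
qed

text \<open>\<open>J\<close> is the limit of left-point sums over dyadic grids. Halving the mesh
  changes them by at most \<open>F * G * r ^ n\<close>, so they converge geometrically, and the
  bound of \<open>discrete_young\<close>, which does not depend on the grid, survives in the
  limit.\<close>

lemma young_sewing:
  fixes f g :: "real \<Rightarrow> real"
  assumes \<alpha>: "\<alpha> > 1/2" and F: "F \<ge> 0" and G: "G \<ge> 0"
    and f: "hoelder_on {0..1} \<alpha> F f" and g: "hoelder_on {0..1} \<alpha> G g"
  obtains J where "\<And>s t. 0 \<le> s \<Longrightarrow> s \<le> t \<Longrightarrow> t \<le> 1 \<Longrightarrow>
    \<bar>J t - J s - f s * (g t - g s)\<bar> \<le> young_const \<alpha> * F * G * (t - s) powr (2 * \<alpha>)"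
proof -
  define q where "q = (\<lambda>n i. real i / 2 ^ n)"
  \<comment> \<open>Stopping the grid at \<open>t\<close> by \<open>min\<close> defines the sums for
    every real \<open>t\<close>, not only for grid points.\<close>
  define S where "S = (\<lambda>n t. \<Sum>i<2^n. f (q n i) * (g (min t (q n (Suc i))) - g (min t (q n i))))"
  define r where "r = 2 powr (1 - 2 * \<alpha>)"
  have r: "0 < r" "r < 1" using \<alpha> unfolding r_def by (auto simp: powr_less_one)
  have q01: "i \<le> 2^n \<Longrightarrow> q n i \<in> {0..1}" for n i
    unfolding q_def by (simp add: divide_simps)
  have qSuc: "q n (Suc i) = q n i + 1 / 2^n" for n i unfolding q_def by (simp add: field_simps)
  have pd: "x powr \<alpha> * x powr \<alpha> = x powr (2*\<alpha>)" for x :: real by (simp add: powr_add[symmetric])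
  have diff: "\<bar>S (Suc n) t - S n t\<bar> \<le> F * G * r ^ n" if t: "t \<in> {0..1}" for n t
  proof -
    have qe: "q (Suc n) (2 * i) = q n i" for i unfolding q_def by (simp add: field_simps)
    have qe2: "q (Suc n) (Suc (Suc (2 * i))) = q n (Suc i)" for i unfolding q_def by (simp add: field_simps)
    define m where "m = (\<lambda>i. q (Suc n) (Suc (2 * i)))"
    have m: "q n i \<le> m i" "m i \<le> q n (Suc i)" "m i - q n i \<le> 1/2^n" "q n (Suc i) - m i \<le> 1/2^n" for i
      unfolding m_def q_def by (auto simp: field_simps)
    have "S (Suc n) t = (\<Sum>i<2^n. f (q n i) * (g (min t (m i)) - g (min t (q n i)))
          + f (m i) * (g (min t (q n (Suc i))) - g (min t (m i))))"
      unfolding S_def by (simp only: power_Suc sum_dyadic_split) (simp add: qe qe2 m_def)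
    hence "S (Suc n) t - S n t = (\<Sum>i<2^n. (f (m i) - f (q n i)) * (g (min t (q n (Suc i))) - g (min t (m i))))"
      unfolding S_def by (simp add: sum_subtractf[symmetric] algebra_simps)
    also have "\<bar>\<dots>\<bar> \<le> (\<Sum>i<(2::nat)^n. F * G * (1/2^n) powr (2*\<alpha>))"
    proof (rule order.trans[OF sum_abs sum_mono])
      fix i :: nat assume i: "i \<in> {..<2^n}"
      have ir: "q n i \<in> {0..1}" "q n (Suc i) \<in> {0..1}" using q01[of i n] q01[of "Suc i" n] i by auto
      hence mr: "m i \<in> {0..1}" using m[of i] by auto
      have "\<bar>f (m i) - f (q n i)\<bar> \<le> F * (m i - q n i) powr \<alpha>"
        by (rule hoelder_onD[OF f]) (use ir mr m in auto)
      also have "\<dots> \<le> F * (1/2^n) powr \<alpha>"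
        by (intro mult_left_mono powr_mono2 F) (use m[of i] \<alpha> in auto)
      finally have 1: "\<bar>f (m i) - f (q n i)\<bar> \<le> F * (1/2^n) powr \<alpha>" .
      have "\<bar>g (min t (q n (Suc i))) - g (min t (m i))\<bar> \<le> G * (min t (q n (Suc i)) - min t (m i)) powr \<alpha>"
        by (rule hoelder_onD[OF g]) (use ir mr m[of i] t in auto)
      also have "\<dots> \<le> G * (1/2^n) powr \<alpha>"
        by (intro mult_left_mono powr_mono2 G) (use m[of i] \<alpha> in auto)
      finally have 2: "\<bar>g (min t (q n (Suc i))) - g (min t (m i))\<bar> \<le> G * (1/2^n) powr \<alpha>" .
      have "\<bar>(f (m i) - f (q n i)) * (g (min t (q n (Suc i))) - g (min t (m i)))\<bar>
         \<le> (F * (1/2^n) powr \<alpha>) * (G * (1/2^n) powr \<alpha>)"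
        unfolding abs_mult by (intro mult_mono 1 2) (use F in auto)
      also have "\<dots> = F * G * ((1/2^n) powr \<alpha> * (1/2^n) powr \<alpha>)" by simp
      finally show "\<bar>(f (m i) - f (q n i)) * (g (min t (q n (Suc i))) - g (min t (m i)))\<bar>
         \<le> F * G * (1/2^n) powr (2*\<alpha>)" unfolding pd .
    qed
    also have "\<dots> = F * G * (2^n * (1/2^n) powr (2*\<alpha>))" by simp
    also have "\<dots> = F * G * r ^ n" unfolding two_powr_split r_def ..
    finally show ?thesis .
  qed
  have conv: "convergent (\<lambda>n. S n t)" if t: "t \<in> {0..1}" for t
  proof -
    have "summable (\<lambda>n. S (Suc n) t - S n t)"
    proof (rule summable_comparison_test')
      show "summable (\<lambda>n. F * G * r ^ n)" using r by (intro summable_mult summable_geometric) auto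
      show "norm (S (Suc n) t - S n t) \<le> F * G * r ^ n" if "n \<ge> 0" for n using diff[OF t] by simp
    qed
    hence "convergent (\<lambda>n. \<Sum>i<n. S (Suc i) t - S i t)"
      by (simp add: summable_iff_convergent)
    hence "convergent (\<lambda>n. S n t - S 0 t)" by (simp add: sum_lessThan_telescope[of "\<lambda>n. S n t"])
    from convergent_add[OF this convergent_const[of "S 0 t"]] show ?thesis by simp
  qed
  define J where "J = (\<lambda>t. lim (\<lambda>n. S n t))"
  have J: "(\<lambda>n. S n t) \<longlonglongrightarrow> J t" if "t \<in> {0..1}" for t
    using conv[OF that] unfolding J_def by (simp add: convergent_LIMSEQ_iff)
  show ?thesis
  proof (rule that)
    fix s t :: real assume st: "0 \<le> s" "s \<le> t" "t \<le> 1"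
    have main: "\<bar>S n t - S n s - f s * (g t - g s)\<bar> \<le> young_const \<alpha> * F * G * (t - s) powr (2 * \<alpha>) + F * G * r ^ n" for n
    proof -
      \<comment> \<open>The grid clamped to \<open>[s, t]\<close>. The difference
        \<open>S n t - S n s\<close> has the increments of \<open>g\<close> along \<open>c\<close>
        but takes \<open>f\<close> at the unclamped points; this matters only in the cell containing
        \<open>s\<close>, and the correction vanishes with growing \<open>n\<close>.\<close>
      define c where "c = (\<lambda>i. max s (min t (q n i)))"
      have qm: "q n i \<le> q n j" if "i \<le> j" for i j using that unfolding q_def by (simp add: divide_right_mono)
      have cm: "c i \<le> c j" if "i \<le> j" for i j using qm[OF that] unfolding c_def by auto
      have cr: "c i \<in> {0..1}" for i unfolding c_def using st by auto
      have ginc: "g (min t x) - g (min s x) = g (max s (min t x)) - g s" for x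
        using st by (auto simp: min_def max_def)
      have gi: "g (min t (q n (Suc i))) - g (min t (q n i)) - (g (min s (q n (Suc i))) - g (min s (q n i)))
          = g (c (Suc i)) - g (c i)" for i
        using ginc[of "q n i"] ginc[of "q n (Suc i)"] unfolding c_def by simp
      have "S n t - S n s = (\<Sum>i<2^n. f (q n i) * (g (c (Suc i)) - g (c i)))"
        unfolding S_def by (simp add: sum_subtractf[symmetric] right_diff_distrib[symmetric] gi)
      also have "\<dots> = (\<Sum>i<2^n. f (c i) * (g (c (Suc i)) - g (c i))) + (\<Sum>i<2^n. (f (q n i) - f (c i)) * (g (c (Suc i)) - g (c i)))"
        by (simp add: sum.distrib[symmetric] algebra_simps)
      finally have eq: "S n t - S n s = (\<Sum>i<2^n. f (c i) * (g (c (Suc i)) - g (c i))) + (\<Sum>i<2^n. (f (q n i) - f (c i)) * (g (c (Suc i)) - g (c i)))" .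
      have c0: "c 0 = s" unfolding c_def q_def using st by auto
      have c1: "c (2^n) = t" unfolding c_def q_def using st by auto
      have "\<bar>(\<Sum>l\<in>{0..<2^n}. f (c l) * (g (c (Suc l)) - g (c l))) - f (c 0) * (g (c (2^n)) - g (c 0))\<bar>
          \<le> young_const \<alpha> * F * G * (c (2^n) - c 0) powr (2 * \<alpha>)"
        by (rule discrete_young[OF \<alpha> F G, where p = c and N = "2^n" and f = "\<lambda>i. f (c i)" and g = "\<lambda>i. g (c i)"])
           (use cm cr in \<open>auto intro!: hoelder_onD[OF f] hoelder_onD[OF g]\<close>)
      hence 1: "\<bar>(\<Sum>i<2^n. f (c i) * (g (c (Suc i)) - g (c i))) - f s * (g t - g s)\<bar> \<le> young_const \<alpha> * F * G * (t - s) powr (2 * \<alpha>)"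
        unfolding c0 c1 atLeast0LessThan .
      have 2: "\<bar>\<Sum>i<2^n. (f (q n i) - f (c i)) * (g (c (Suc i)) - g (c i))\<bar> \<le> (\<Sum>i<(2::nat)^n. F * G * (1/2^n) powr (2*\<alpha>))"
      proof (rule order.trans[OF sum_abs sum_mono])
        fix i :: nat assume i: "i \<in> {..<2^n}"
        have ir: "q n i \<in> {0..1}" "q n (Suc i) \<in> {0..1}" using q01[of i n] q01[of "Suc i" n] i by auto
        show "\<bar>(f (q n i) - f (c i)) * (g (c (Suc i)) - g (c i))\<bar> \<le> F * G * (1/2^n) powr (2*\<alpha>)"
        proof (cases "q n i \<ge> s \<or> q n (Suc i) \<le> s")
          case True
          hence "c i = q n i \<or> c (Suc i) = c i"
            using qm[of i "Suc i"] st unfolding c_def max_def min_def by (simp split: if_split) linarith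
          hence "f (q n i) - f (c i) = 0 \<or> g (c (Suc i)) - g (c i) = 0" by auto
          thus ?thesis using F G by auto
        next
          case False
          hence qs: "q n i < s" "s < q n (Suc i)" by auto
          have ci: "c i = s" unfolding c_def using qs by auto
          have "\<bar>f (c i) - f (q n i)\<bar> \<le> F * (c i - q n i) powr \<alpha>"
            by (rule hoelder_onD[OF f]) (use ir cr[of i] ci qs in auto)
          also have "\<dots> \<le> F * (1/2^n) powr \<alpha>"
            by (intro mult_left_mono powr_mono2 F) (use qs ci qSuc[of n i] \<alpha> in auto)
          finally have 1: "\<bar>f (q n i) - f (c i)\<bar> \<le> F * (1/2^n) powr \<alpha>" by (simp add: abs_minus_commute)
          have "\<bar>g (c (Suc i)) - g (c i)\<bar> \<le> G * (c (Suc i) - c i) powr \<alpha>"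
            by (rule hoelder_onD[OF g]) (use cr cm in auto)
          also have "\<dots> \<le> G * (1/2^n) powr \<alpha>"
            by (intro mult_left_mono powr_mono2 G) (use qs qSuc[of n i] \<alpha> cm[of i "Suc i"] st in \<open>auto simp: c_def\<close>)
          finally have 2: "\<bar>g (c (Suc i)) - g (c i)\<bar> \<le> G * (1/2^n) powr \<alpha>" .
          have "\<bar>(f (q n i) - f (c i)) * (g (c (Suc i)) - g (c i))\<bar> \<le> (F * (1/2^n) powr \<alpha>) * (G * (1/2^n) powr \<alpha>)"
            unfolding abs_mult by (intro mult_mono 1 2) (use F in auto)
          also have "\<dots> = F * G * ((1/2^n) powr \<alpha> * (1/2^n) powr \<alpha>)" by simp
          finally show ?thesis unfolding pd .
        qed
      qed
      have 3: "(\<Sum>i<(2::nat)^n. F * G * (1/2^n) powr (2*\<alpha>)) = F * G * r ^ n"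
        using two_powr_split[of n \<alpha>] unfolding r_def by (simp add: algebra_simps)
      show ?thesis using 1 2 unfolding eq 3 by linarith
    qed
    have l1: "(\<lambda>n. \<bar>S n t - S n s - f s * (g t - g s)\<bar>) \<longlonglongrightarrow> \<bar>J t - J s - f s * (g t - g s)\<bar>"
      by (intro tendsto_intros J) (use st in auto)
    have l2: "(\<lambda>n. young_const \<alpha> * F * G * (t - s) powr (2 * \<alpha>) + F * G * r ^ n) \<longlonglongrightarrow>
       young_const \<alpha> * F * G * (t - s) powr (2 * \<alpha>) + F * G * 0"
      by (intro tendsto_intros LIMSEQ_power_zero) (use r in auto)
    show "\<bar>J t - J s - f s * (g t - g s)\<bar> \<le> young_const \<alpha> * F * G * (t - s) powr (2 * \<alpha>)"
      using LIMSEQ_le[OF l1 l2] main by auto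
  qed
qed

text \<open>A uniform partition with left tags meets both tolerances. The condition
  \<open>a \<le> b\<close> matters: for \<open>b < a\<close> there is no partition and every number
  would qualify.\<close>

lemma has_young_integral_unique:
  assumes "a \<le> b" "has_young_integral f g a b I" "has_young_integral f g a b I'"
  shows "I = I'"
proof (rule ccontr)
  assume ne: "I \<noteq> I'"
  define e where "e = \<bar>I - I'\<bar> / 2"
  have e: "e > 0" using ne unfolding e_def by simp
  from assms(2) e obtain d1 where d1: "d1 > 0" "\<And>n p \<xi>. p 0 = a \<and> p n = b \<and>
        (\<forall>j<n. p j \<le> \<xi> j \<and> \<xi> j \<le> p (Suc j) \<and> p (Suc j) - p j < d1) \<Longrightarrow>
        \<bar>(\<Sum>j<n. f (\<xi> j) * (g (p (Suc j)) - g (p j))) - I\<bar> < e"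
    unfolding has_young_integral_def by blast
  from assms(3) e obtain d2 where d2: "d2 > 0" "\<And>n p \<xi>. p 0 = a \<and> p n = b \<and>
        (\<forall>j<n. p j \<le> \<xi> j \<and> \<xi> j \<le> p (Suc j) \<and> p (Suc j) - p j < d2) \<Longrightarrow>
        \<bar>(\<Sum>j<n. f (\<xi> j) * (g (p (Suc j)) - g (p j))) - I'\<bar> < e"
    unfolding has_young_integral_def by blast
  define d where "d = min d1 d2"
  have d: "d > 0" using d1 d2 unfolding d_def by simp
  obtain n :: nat where n: "(b - a) / d < n" using reals_Archimedean2 by blast
  have n0: "n > 0" using n d assms(1) by (cases n) (auto simp: divide_simps)
  define p where "p = (\<lambda>j::nat. a + (b - a) * (j / n))"
  have step: "p (Suc j) - p j = (b - a) / n" for j unfolding p_def using n0 by (simp add: field_simps)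
  have sd: "(b - a) / n < d" using n d n0 by (simp add: field_simps)
  have P: "p 0 = a \<and> p n = b \<and> (\<forall>j<n. p j \<le> p j \<and> p j \<le> p (Suc j) \<and> p (Suc j) - p j < d)"
    using step sd n0 assms(1) unfolding p_def by (auto simp: divide_right_mono mult_left_mono)
  have "\<bar>(\<Sum>j<n. f (p j) * (g (p (Suc j)) - g (p j))) - I\<bar> < e"
    by (rule d1(2)) (use P in \<open>auto simp: d_def\<close>)
  moreover have "\<bar>(\<Sum>j<n. f (p j) * (g (p (Suc j)) - g (p j))) - I'\<bar> < e"
    by (rule d2(2)) (use P in \<open>auto simp: d_def\<close>)
  moreover have "2 * e = \<bar>I - I'\<bar>" unfolding e_def by simp
  ultimately show False by linarith
qed

lemma young_integral_eqI:
  "a \<le> b \<Longrightarrow> has_young_integral f g a b I \<Longrightarrow> young_integral f g a b = I"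
  unfolding young_integral_def by (blast intro: the_equality has_young_integral_unique)

text \<open>Moving a tag away from the left end of a cell costs \<open>F * G\<close> times the cell
  length to the power \<open>2 * \<alpha>\<close>, the same order as the error in the local
  expansion of \<open>J\<close>. Since \<open>2 * \<alpha> > 1\<close>, the sum over the cells tends
  to 0 with the mesh, uniformly in the tags.\<close>

lemma has_young_integralI:
  fixes f g J :: "real \<Rightarrow> real"
  assumes \<alpha>: "\<alpha> > 1/2" and F: "F \<ge> 0" and G: "G \<ge> 0" and C: "C \<ge> 0" and b: "0 \<le> b" "b \<le> 1"
    and f: "hoelder_on {0..1} \<alpha> F f" and g: "hoelder_on {0..1} \<alpha> G g"
    and J: "\<And>s t. 0 \<le> s \<Longrightarrow> s \<le> t \<Longrightarrow> t \<le> 1 \<Longrightarrow> \<bar>J t - J s - f s * (g t - g s)\<bar> \<le> C * (t - s) powr (2 * \<alpha>)"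
  shows "has_young_integral f g 0 b (J b - J 0)"
  unfolding has_young_integral_def
proof (intro allI impI)
  fix \<epsilon> :: real assume \<epsilon>: "\<epsilon> > 0"
  define K where "K = C + F * G"
  have K: "K \<ge> 0" unfolding K_def using C F G by simp
  define \<beta> where "\<beta> = 2 * \<alpha> - 1"
  have \<beta>: "\<beta> > 0" using \<alpha> unfolding \<beta>_def by simp
  \<comment> \<open>Chosen so that \<open>\<delta> powr \<beta> = \<epsilon> / (K + 1)\<close>; the
    total error is at most \<open>K * \<delta> powr \<beta>\<close> because the partitioned interval
    has length at most 1.\<close>
  define \<delta> where "\<delta> = (\<epsilon> / (K + 1)) powr (1 / \<beta>)"
  have \<delta>: "\<delta> > 0" unfolding \<delta>_def using \<epsilon> K by simp
  have \<delta>p: "\<delta> powr \<beta> = \<epsilon> / (K + 1)" unfolding \<delta>_def using \<beta> \<epsilon> K by (simp add: powr_powr)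
  show "\<exists>\<delta>>0. \<forall>n p \<xi>. p 0 = 0 \<and> p n = b \<and>
        (\<forall>j<n. p j \<le> \<xi> j \<and> \<xi> j \<le> p (Suc j) \<and> p (Suc j) - p j < \<delta>) \<longrightarrow>
        \<bar>(\<Sum>j<n. f (\<xi> j) * (g (p (Suc j)) - g (p j))) - (J b - J 0)\<bar> < \<epsilon>"
  proof (intro exI[of _ \<delta>] conjI \<delta> allI impI)
    fix n :: nat and p \<xi> :: "nat \<Rightarrow> real"
    assume "p 0 = 0 \<and> p n = b \<and> (\<forall>j<n. p j \<le> \<xi> j \<and> \<xi> j \<le> p (Suc j) \<and> p (Suc j) - p j < \<delta>)"
    hence p: "p 0 = 0" "p n = b" "\<And>j. j < n \<Longrightarrow> p j \<le> \<xi> j" "\<And>j. j < n \<Longrightarrow> \<xi> j \<le> p (Suc j)"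
      "\<And>j. j < n \<Longrightarrow> p (Suc j) - p j < \<delta>" by auto
    have mono: "p i \<le> p j" if "i \<le> j" "j \<le> n" for i j
      using that
    proof (induction j)
      case (Suc j)
      then show ?case using p(3)[of j] p(4)[of j] by (cases "i = Suc j") auto
    qed auto
    have range: "p j \<in> {0..1}" if "j \<le> n" for j
      using mono[of 0 j] mono[of j n] that p b by auto
    have cell: "\<bar>f (\<xi> j) * (g (p (Suc j)) - g (p j)) - (J (p (Suc j)) - J (p j))\<bar> \<le> K * \<delta> powr \<beta> * (p (Suc j) - p j)"
      if j: "j < n" for j
    proof -
      define D where "D = p (Suc j) - p j"
      have D: "D \<ge> 0" "D < \<delta>" unfolding D_def using p(3,4,5)[OF j] by auto
      have r: "p j \<in> {0..1}" "p (Suc j) \<in> {0..1}" using range j by auto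
      have x: "\<xi> j \<in> {0..1}" using r p(3,4)[OF j] by auto
      have 1: "\<bar>J (p (Suc j)) - J (p j) - f (p j) * (g (p (Suc j)) - g (p j))\<bar> \<le> C * D powr (2 * \<alpha>)"
        unfolding D_def by (rule J) (use r p(3,4)[OF j] in auto)
      have "\<bar>f (\<xi> j) - f (p j)\<bar> \<le> F * (\<xi> j - p j) powr \<alpha>"
        by (rule hoelder_onD[OF f]) (use r x p(3)[OF j] in auto)
      also have "\<dots> \<le> F * D powr \<alpha>"
        by (intro mult_left_mono powr_mono2 F) (use p(3,4)[OF j] \<alpha> in \<open>auto simp: D_def\<close>)
      finally have 2: "\<bar>f (\<xi> j) - f (p j)\<bar> \<le> F * D powr \<alpha>" .
      have 3: "\<bar>g (p (Suc j)) - g (p j)\<bar> \<le> G * D powr \<alpha>" unfolding D_def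
        by (rule hoelder_onD[OF g]) (use r D in \<open>auto simp: D_def\<close>)
      have "\<bar>(f (\<xi> j) - f (p j)) * (g (p (Suc j)) - g (p j))\<bar> \<le> (F * D powr \<alpha>) * (G * D powr \<alpha>)"
        unfolding abs_mult by (intro mult_mono 2 3) (use F in auto)
      also have "\<dots> = F * G * D powr (2*\<alpha>)" by (simp add: powr_add[symmetric])
      finally have "\<bar>(f (\<xi> j) - f (p j)) * (g (p (Suc j)) - g (p j))\<bar> \<le> F * G * D powr (2*\<alpha>)" .
      moreover have "f (\<xi> j) * (g (p (Suc j)) - g (p j)) - (J (p (Suc j)) - J (p j))
         = (f (\<xi> j) - f (p j)) * (g (p (Suc j)) - g (p j)) - (J (p (Suc j)) - J (p j) - f (p j) * (g (p (Suc j)) - g (p j)))"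
        by (simp add: algebra_simps)
      ultimately have "\<bar>f (\<xi> j) * (g (p (Suc j)) - g (p j)) - (J (p (Suc j)) - J (p j))\<bar> \<le> K * D powr (2*\<alpha>)"
        using 1 unfolding K_def by (simp add: algebra_simps)
      also have "D powr (2*\<alpha>) = D powr \<beta> * D" using D powr_add[of D \<beta> 1] unfolding \<beta>_def by (cases "D = 0") auto
      also have "K * (D powr \<beta> * D) \<le> K * (\<delta> powr \<beta> * D)"
        by (intro mult_left_mono mult_right_mono powr_mono2 K) (use D \<beta> in auto)
      finally show ?thesis unfolding D_def by simp
    qed
    have Jt: "J b - J 0 = (\<Sum>j<n. J (p (Suc j)) - J (p j))"
      using sum_lessThan_telescope[of "\<lambda>j. J (p j)" n] p by simp
    have "\<bar>(\<Sum>j<n. f (\<xi> j) * (g (p (Suc j)) - g (p j))) - (J b - J 0)\<bar>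
       = \<bar>\<Sum>j<n. f (\<xi> j) * (g (p (Suc j)) - g (p j)) - (J (p (Suc j)) - J (p j))\<bar>"
      unfolding Jt by (simp add: sum_subtractf)
    also have "\<dots> \<le> (\<Sum>j<n. K * \<delta> powr \<beta> * (p (Suc j) - p j))"
      by (rule order.trans[OF sum_abs sum_mono]) (use cell in auto)
    also have "\<dots> = K * \<delta> powr \<beta> * b"
      using sum_lessThan_telescope[of p n] p by (simp add: sum_distrib_left[symmetric])
    also have "\<dots> \<le> K * \<delta> powr \<beta> * 1" by (intro mult_left_mono) (use K b in auto)
    also have "\<dots> < \<epsilon>" unfolding \<delta>p using \<epsilon> K by (simp add: field_simps)
    finally show "\<bar>(\<Sum>j<n. f (\<xi> j) * (g (p (Suc j)) - g (p j))) - (J b - J 0)\<bar> < \<epsilon>" .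
  qed
qed

text \<open>Sup norm and Hoelder constant are carried together through the induction. In
  \<open>C\<close>, the summand 1 comes from the leading term of the local expansion and
  \<open>young_const \<alpha>\<close> from its error. The third claim is that expansion, which later
  links the integrals to the dyadic sums.\<close>

lemma iterated_young_estimates:
  fixes x :: "nat \<Rightarrow> real \<Rightarrow> real"
  assumes \<alpha>: "\<alpha> > 1/2" and Z: "Z \<ge> 0"
    and x: "\<And>m. m \<in> {1..n} \<Longrightarrow> hoelder_on {0..1} \<alpha> Z (x (w m))"
  defines "C \<equiv> 1 + young_const \<alpha>"
  shows "m \<le> n \<Longrightarrow> (\<forall>t\<in>{0..1}. \<bar>iterated_young x w m t\<bar> \<le> (C * Z) ^ m) \<and>
      hoelder_on {0..1} \<alpha> ((C * Z) ^ m) (iterated_young x w m)"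
    and "m < n \<Longrightarrow> t \<in> {0..1} \<Longrightarrow> \<exists>I. has_young_integral (iterated_young x w m) (x (w (Suc m))) 0 t I"
    and "m < n \<Longrightarrow> 0 \<le> s \<Longrightarrow> s \<le> t \<Longrightarrow> t \<le> 1 \<Longrightarrow>
      \<bar>iterated_young x w (Suc m) t - iterated_young x w (Suc m) s
         - iterated_young x w m s * (x (w (Suc m)) t - x (w (Suc m)) s)\<bar>
      \<le> young_const \<alpha> * (C * Z) ^ m * Z * (t - s) powr (2 * \<alpha>)"
proof -
  have C: "C \<ge> 1" using young_const_pos[OF \<alpha>] unfolding C_def by simp
  define good where "good = (\<lambda>m. (\<forall>t\<in>{0..1}. \<bar>iterated_young x w m t\<bar> \<le> (C * Z) ^ m) \<and>
      hoelder_on {0..1} \<alpha> ((C * Z) ^ m) (iterated_young x w m))"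
  have step: "(\<forall>t\<in>{0..1}. \<exists>I. has_young_integral (iterated_young x w m) (x (w (Suc m))) 0 t I) \<and>
     (\<forall>s t. 0 \<le> s \<longrightarrow> s \<le> t \<longrightarrow> t \<le> 1 \<longrightarrow>
      \<bar>iterated_young x w (Suc m) t - iterated_young x w (Suc m) s
         - iterated_young x w m s * (x (w (Suc m)) t - x (w (Suc m)) s)\<bar>
      \<le> young_const \<alpha> * (C * Z) ^ m * Z * (t - s) powr (2 * \<alpha>)) \<and> good (Suc m)"
    if m: "m < n" and gm: "good m" for m
  proof -
    define f where "f = iterated_young x w m"
    define g where "g = x (w (Suc m))"
    define F where "F = (C * Z) ^ m"
    have F: "F \<ge> 0" unfolding F_def using C Z by simp
    have f: "hoelder_on {0..1} \<alpha> F f" "\<And>t. t \<in> {0..1} \<Longrightarrow> \<bar>f t\<bar> \<le> F" using gm unfolding good_def f_def F_def by auto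
    have g: "hoelder_on {0..1} \<alpha> Z g" unfolding g_def using x m by simp
    obtain J where J: "\<And>s t. 0 \<le> s \<Longrightarrow> s \<le> t \<Longrightarrow> t \<le> 1 \<Longrightarrow>
      \<bar>J t - J s - f s * (g t - g s)\<bar> \<le> young_const \<alpha> * F * Z * (t - s) powr (2 * \<alpha>)"
      using young_sewing[OF \<alpha> F Z f(1) g] by blast
    have yi: "has_young_integral f g 0 t (J t - J 0)" if "t \<in> {0..1}" for t
      by (rule has_young_integralI[OF \<alpha> F Z _ _ _ f(1) g J]) (use that young_const_pos[OF \<alpha>] F Z in auto)
    have it: "iterated_young x w (Suc m) t = J t - J 0" if "t \<in> {0..1}" for t
      using young_integral_eqI[OF _ yi[OF that]] that by (simp add: f_def g_def)
    have est: "\<bar>iterated_young x w (Suc m) t - iterated_young x w (Suc m) s - f s * (g t - g s)\<bar>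
        \<le> young_const \<alpha> * F * Z * (t - s) powr (2 * \<alpha>)" if "0 \<le> s" "s \<le> t" "t \<le> 1" for s t
      using J[OF that] it[of s] it[of t] that by simp
    have hol: "\<bar>iterated_young x w (Suc m) t - iterated_young x w (Suc m) s\<bar> \<le> (C * Z) ^ Suc m * (t - s) powr \<alpha>"
      if st: "0 \<le> s" "s \<le> t" "t \<le> 1" for s t
    proof -
      \<comment> \<open>On the unit interval the power \<open>2 * \<alpha>\<close> is dominated by
        the power \<open>\<alpha>\<close>, so the expansion error fits into the Hoelder
        bound.\<close>
      have "(t - s) powr (2*\<alpha>) = (t - s) powr \<alpha> * (t - s) powr \<alpha>" by (simp add: powr_add[symmetric])
      also have "\<dots> \<le> 1 * (t - s) powr \<alpha>" 
        by (intro mult_right_mono powr_le1) (use st \<alpha> in auto)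
      finally have p: "(t - s) powr (2*\<alpha>) \<le> (t - s) powr \<alpha>" by simp
      have "\<bar>f s * (g t - g s)\<bar> \<le> F * (Z * (t - s) powr \<alpha>)"
        unfolding abs_mult by (intro mult_mono f hoelder_onD[OF g]) (use st F in auto)
      hence "\<bar>iterated_young x w (Suc m) t - iterated_young x w (Suc m) s\<bar> \<le> young_const \<alpha> * F * Z * (t - s) powr (2 * \<alpha>) + F * (Z * (t - s) powr \<alpha>)"
        using est[OF st] by linarith
      also have "\<dots> \<le> young_const \<alpha> * F * Z * (t - s) powr \<alpha> + F * (Z * (t - s) powr \<alpha>)"
        by (intro add_mono mult_left_mono p) (use young_const_pos[OF \<alpha>] F Z in auto)
      also have "\<dots> = (C * Z) ^ Suc m * (t - s) powr \<alpha>" unfolding C_def F_def by (simp add: algebra_simps)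
      finally show ?thesis .
    qed
    have zero: "iterated_young x w (Suc m) 0 = 0" using it[of 0] by simp
    have "good (Suc m)"
      unfolding good_def hoelder_on_def
    proof (intro conjI ballI impI)
      fix t :: real assume t: "t \<in> {0..1}"
      have "\<bar>iterated_young x w (Suc m) t\<bar> \<le> (C * Z) ^ Suc m * (t - 0) powr \<alpha>"
        using hol[of 0 t] t zero by simp
      also have "\<dots> \<le> (C * Z) ^ Suc m * 1"
        by (intro mult_left_mono) (use C Z t \<alpha> in \<open>auto intro!: powr_le1\<close>)
      finally show "\<bar>iterated_young x w (Suc m) t\<bar> \<le> (C * Z) ^ Suc m" by simp
    qed (use hol in auto)
    thus ?thesis using yi est unfolding f_def g_def F_def by blast
  qed
  have good: "m \<le> n \<Longrightarrow> good m" for m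
  proof (induction m)
    case 0 show ?case unfolding good_def hoelder_on_def by auto
  next
    case (Suc m) thus ?case using step[of m] by simp
  qed
  show "m \<le> n \<Longrightarrow> (\<forall>t\<in>{0..1}. \<bar>iterated_young x w m t\<bar> \<le> (C * Z) ^ m) \<and>
      hoelder_on {0..1} \<alpha> ((C * Z) ^ m) (iterated_young x w m)" using good[of m] unfolding good_def .
  show "m < n \<Longrightarrow> t \<in> {0..1} \<Longrightarrow> \<exists>I. has_young_integral (iterated_young x w m) (x (w (Suc m))) 0 t I"
    using step[of m] good[of m] by auto
  show "m < n \<Longrightarrow> 0 \<le> s \<Longrightarrow> s \<le> t \<Longrightarrow> t \<le> 1 \<Longrightarrow>
      \<bar>iterated_young x w (Suc m) t - iterated_young x w (Suc m) s
         - iterated_young x w m s * (x (w (Suc m)) t - x (w (Suc m)) s)\<bar>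
      \<le> young_const \<alpha> * (C * Z) ^ m * Z * (t - s) powr (2 * \<alpha>)"
    using step[of m] good[of m] by auto
qed

section \<open>Iterated left-point sums on dyadic grids\<close>

primrec dyadic_sum ::
    "(nat \<Rightarrow> real \<Rightarrow> real) \<Rightarrow> (nat \<Rightarrow> nat) \<Rightarrow> nat \<Rightarrow> nat \<Rightarrow> nat \<Rightarrow> real" where
  "dyadic_sum x w n 0 j = 1"
| "dyadic_sum x w n (Suc m) j = (\<Sum>i<j. dyadic_sum x w n m i *
     (x (w (Suc m)) (real (Suc i) / 2 ^ n) - x (w (Suc m)) (real i / 2 ^ n)))"

text \<open>The grid analogue of \<open>iterated_young_estimates\<close>, with the same constants.
  Uniformity in \<open>n\<close> serves twice: the first bound dominates the sums of all levels, and
  the second, applied to coarse blocks of a fine grid, gives convergence.\<close>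

lemma dyadic_sum_estimates:
  fixes x :: "nat \<Rightarrow> real \<Rightarrow> real"
  assumes \<alpha>: "\<alpha> > 1/2" and Z: "Z \<ge> 0"
    and x: "\<And>m i j. m \<in> {1..M} \<Longrightarrow> i \<le> j \<Longrightarrow> j \<le> 2 ^ n \<Longrightarrow>
      \<bar>x (w m) (real j / 2 ^ n) - x (w m) (real i / 2 ^ n)\<bar> \<le> Z * (real j / 2 ^ n - real i / 2 ^ n) powr \<alpha>"
  defines "C \<equiv> 1 + young_const \<alpha>"
  shows "m \<le> M \<Longrightarrow> i \<le> j \<Longrightarrow> j \<le> 2 ^ n \<Longrightarrow> \<bar>dyadic_sum x w n m j\<bar> \<le> (C * Z) ^ m"
    and "m < M \<Longrightarrow> i \<le> j \<Longrightarrow> j \<le> 2 ^ n \<Longrightarrow>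
      \<bar>dyadic_sum x w n (Suc m) j - dyadic_sum x w n (Suc m) i
         - dyadic_sum x w n m i * (x (w (Suc m)) (real j / 2 ^ n) - x (w (Suc m)) (real i / 2 ^ n))\<bar>
      \<le> young_const \<alpha> * (C * Z) ^ m * Z * (real j / 2 ^ n - real i / 2 ^ n) powr (2 * \<alpha>)"
proof -
  have C: "C \<ge> 1" using young_const_pos[OF \<alpha>] unfolding C_def by simp
  define p where "p = (\<lambda>i. real i / 2 ^ n)"
  have pm: "p i \<le> p j" if "i \<le> j" for i j unfolding p_def using that by (simp add: divide_right_mono)
  have p1: "p j - p i \<le> 1" if "j \<le> 2 ^ n" for i j
  proof -
    have "p j \<le> 1" using that unfolding p_def by (simp add: divide_simps)
    moreover have "p i \<ge> 0" unfolding p_def by simp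
    ultimately show ?thesis by linarith
  qed
  define good where "good = (\<lambda>m. (\<forall>j\<le>2^n. \<bar>dyadic_sum x w n m j\<bar> \<le> (C * Z) ^ m) \<and>
     (\<forall>i j. i \<le> j \<longrightarrow> j \<le> 2^n \<longrightarrow> \<bar>dyadic_sum x w n m j - dyadic_sum x w n m i\<bar> \<le> (C * Z) ^ m * (p j - p i) powr \<alpha>))"
  have step: "(\<forall>i j. i \<le> j \<longrightarrow> j \<le> 2^n \<longrightarrow>
      \<bar>dyadic_sum x w n (Suc m) j - dyadic_sum x w n (Suc m) i
         - dyadic_sum x w n m i * (x (w (Suc m)) (p j) - x (w (Suc m)) (p i))\<bar>
      \<le> young_const \<alpha> * (C * Z) ^ m * Z * (p j - p i) powr (2 * \<alpha>)) \<and> good (Suc m)"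
    if m: "m < M" and gm: "good m" for m
  proof -
    define f where "f = dyadic_sum x w n m"
    define g where "g = (\<lambda>j. x (w (Suc m)) (p j))"
    define S where "S = dyadic_sum x w n (Suc m)"
    define F where "F = (C * Z) ^ m"
    have F: "F \<ge> 0" unfolding F_def using C Z by simp
    have f: "\<And>i j. i \<le> j \<Longrightarrow> j \<le> 2^n \<Longrightarrow> \<bar>f j - f i\<bar> \<le> F * (p j - p i) powr \<alpha>"
       "\<And>j. j \<le> 2^n \<Longrightarrow> \<bar>f j\<bar> \<le> F" using gm unfolding good_def f_def F_def by auto
    have g: "\<And>i j. i \<le> j \<Longrightarrow> j \<le> 2^n \<Longrightarrow> \<bar>g j - g i\<bar> \<le> Z * (p j - p i) powr \<alpha>"
      unfolding g_def p_def using x m by simp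
    have est: "\<bar>S j - S i - f i * (g j - g i)\<bar> \<le> young_const \<alpha> * F * Z * (p j - p i) powr (2 * \<alpha>)"
      if ij: "i \<le> j" "j \<le> 2^n" for i j
    proof -
      have "S j - S i = (\<Sum>l\<in>{i..<j}. f l * (g (Suc l) - g l))"
        using sum_diff_nat_ivl[of 0 i j "\<lambda>l. f l * (g (Suc l) - g l)"] ij
        unfolding S_def by (simp add: f_def g_def p_def atLeast0LessThan)
      thus ?thesis using discrete_young[OF \<alpha> F Z pm f(1) g, where N = "2^n" and i = i and j = j] ij by simp
    qed
    have hol: "\<bar>S j - S i\<bar> \<le> (C * Z) ^ Suc m * (p j - p i) powr \<alpha>"
      if st: "i \<le> j" "j \<le> 2 ^ n" for i j
    proof -
      have "(p j - p i) powr (2*\<alpha>) = (p j - p i) powr \<alpha> * (p j - p i) powr \<alpha>" by (simp add: powr_add[symmetric])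
      also have "\<dots> \<le> 1 * (p j - p i) powr \<alpha>" 
        by (intro mult_right_mono powr_le1) (use pm[OF st(1)] p1[OF st(2)] \<alpha> in auto)
      finally have p: "(p j - p i) powr (2*\<alpha>) \<le> (p j - p i) powr \<alpha>" by simp
      have "\<bar>f i * (g j - g i)\<bar> \<le> F * (Z * (p j - p i) powr \<alpha>)"
        unfolding abs_mult by (intro mult_mono f g) (use st F in auto)
      hence "\<bar>S j - S i\<bar> \<le> young_const \<alpha> * F * Z * (p j - p i) powr (2 * \<alpha>) + F * (Z * (p j - p i) powr \<alpha>)"
        using est[OF st] by linarith
      also have "\<dots> \<le> young_const \<alpha> * F * Z * (p j - p i) powr \<alpha> + F * (Z * (p j - p i) powr \<alpha>)"
        by (intro add_mono mult_left_mono p) (use young_const_pos[OF \<alpha>] F Z in auto)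
      also have "\<dots> = (C * Z) ^ Suc m * (p j - p i) powr \<alpha>" unfolding C_def F_def by (simp add: algebra_simps)
      finally show ?thesis .
    qed
    have "\<bar>S j\<bar> \<le> (C * Z) ^ Suc m" if "j \<le> 2 ^ n" for j
    proof -
      have "\<bar>S j\<bar> \<le> (C * Z) ^ Suc m * (p j - p 0) powr \<alpha>"
        using hol[of 0 j] that by (simp add: S_def)
      also have "\<dots> \<le> (C * Z) ^ Suc m * 1"
        by (intro mult_left_mono powr_le1) (use C Z \<alpha> pm[of 0 j] p1[OF that] in auto)
      finally show ?thesis by simp
    qed
    hence "good (Suc m)" using hol unfolding good_def S_def by blast
    thus ?thesis using est unfolding f_def g_def F_def S_def by blast
  qed
  have good: "m \<le> M \<Longrightarrow> good m" for m
  proof (induction m)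
    case 0 show ?case unfolding good_def by auto
  next
    case (Suc m) thus ?case using step[of m] by simp
  qed
  show "m \<le> M \<Longrightarrow> i \<le> j \<Longrightarrow> j \<le> 2 ^ n \<Longrightarrow> \<bar>dyadic_sum x w n m j\<bar> \<le> (C * Z) ^ m"
    using good[of m] unfolding good_def by blast
  show "m < M \<Longrightarrow> i \<le> j \<Longrightarrow> j \<le> 2 ^ n \<Longrightarrow>
      \<bar>dyadic_sum x w n (Suc m) j - dyadic_sum x w n (Suc m) i
         - dyadic_sum x w n m i * (x (w (Suc m)) (real j / 2 ^ n) - x (w (Suc m)) (real i / 2 ^ n))\<bar>
      \<le> young_const \<alpha> * (C * Z) ^ m * Z * (real j / 2 ^ n - real i / 2 ^ n) powr (2 * \<alpha>)"
    using step[of m] good[of m] unfolding p_def by auto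
qed

lemma block_sum_estimate:
  fixes J f g :: "nat \<Rightarrow> real"
  assumes "\<And>b. b < B \<Longrightarrow> \<bar>J (Suc b) - J b - f b * (g (Suc b) - g b)\<bar> \<le> e"
  shows "\<bar>J B - J 0 - (\<Sum>b<B. f b * (g (Suc b) - g b))\<bar> \<le> real B * e"
proof -
  have "J B - J 0 - (\<Sum>b<B. f b * (g (Suc b) - g b)) = (\<Sum>b<B. J (Suc b) - J b - f b * (g (Suc b) - g b))"
    by (subst sum_lessThan_telescope[of J B, symmetric]) (simp add: sum_subtractf)
  also have "\<bar>\<dots>\<bar> \<le> (\<Sum>b<B. e)" by (rule order.trans[OF sum_abs sum_mono]) (use assms in auto)
  finally show ?thesis by simp
qed

text \<open>An intermediate grid of level \<open>E\<close> stays fixed while \<open>n\<close> grows.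
  On it the integral and the fine sum are each within
  \<open>B * (K * (1 / 2 ^ E) powr (2 * \<alpha>))\<close> of a block sum built from level
  \<open>m\<close>, and the finitely many values of level \<open>m\<close> converge by induction.
  The claim covers all dyadic end points because the block sums evaluate level \<open>m\<close> at
  them.\<close>

lemma dyadic_sum_tendsto:
  fixes x :: "nat \<Rightarrow> real \<Rightarrow> real"
  assumes \<alpha>: "\<alpha> > 1/2" and Z: "Z \<ge> 0"
    and x: "\<And>m. m \<in> {1..M} \<Longrightarrow> hoelder_on {0..1} \<alpha> Z (x (w m))"
  shows "m \<le> M \<Longrightarrow> i \<le> 2 ^ D \<Longrightarrow>
     (\<lambda>n. dyadic_sum x w (n + D) m (i * 2 ^ n)) \<longlonglongrightarrow> iterated_young x w m (real i / 2 ^ D)"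
proof (induction m arbitrary: i D)
  case 0 show ?case by simp
next
  case (Suc m)
  hence m: "m < M" by simp
  define F where "F = ((1 + young_const \<alpha>) * Z) ^ m"
  have F: "F \<ge> 0" unfolding F_def using young_const_pos[OF \<alpha>] Z by simp
  define K where "K = young_const \<alpha> * F * Z"
  have K: "K \<ge> 0" unfolding K_def using young_const_pos[OF \<alpha>] Z F by simp
  define r where "r = 2 powr (1 - 2 * \<alpha>)"
  have r: "0 < r" "r < 1" using \<alpha> unfolding r_def by (auto simp: powr_less_one)
  have le1: "real i / 2 ^ n \<in> {0..1}" if "i \<le> 2 ^ n" for i n
    using that by (simp add: divide_simps)
  have grid: "\<bar>x (w m) (real j / 2 ^ n) - x (w m) (real i / 2 ^ n)\<bar> \<le> Z * (real j / 2 ^ n - real i / 2 ^ n) powr \<alpha>"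
    if "m \<in> {1..M}" "i \<le> j" "j \<le> 2 ^ n" for m i j n
    by (rule hoelder_onD[OF x[OF that(1)]]) (use that le1[of i n] le1[of j n] in \<open>auto simp: divide_right_mono\<close>)
  show ?case
  proof (rule LIMSEQ_I)
    fix \<epsilon> :: real assume \<epsilon>: "\<epsilon> > 0"
    have "(\<lambda>e. K * r ^ e) \<longlonglongrightarrow> K * 0" by (intro tendsto_intros LIMSEQ_power_zero) (use r in auto)
    hence "\<forall>\<^sub>F e in sequentially. K * r ^ e < \<epsilon> / 4" by (rule order_tendstoD) (use \<epsilon> in simp)
    then obtain e where e: "K * r ^ e < \<epsilon> / 4" by (auto simp: eventually_sequentially)
    define E where "E = D + e"
    define B where "B = i * 2 ^ e"
    have B: "B \<le> 2 ^ E" unfolding B_def E_def using Suc.prems by (simp add: power_add)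
    have tB: "real B / 2 ^ E = real i / 2 ^ D" unfolding B_def E_def by (simp add: power_add)
    have rB: "real B \<le> 2 ^ E" using B by (metis of_nat_le_iff of_nat_numeral of_nat_power)
    have KE: "real B * (K * (1 / 2 ^ E) powr (2 * \<alpha>)) < \<epsilon> / 4"
    proof -
      have "real B * (K * (1 / 2 ^ E) powr (2 * \<alpha>)) \<le> 2 ^ E * (K * (1 / 2 ^ E) powr (2 * \<alpha>))"
        using rB by (rule mult_right_mono) (use K in simp)
      also have "\<dots> = K * r ^ E" using two_powr_split[of E \<alpha>] unfolding r_def by (simp add: algebra_simps)
      also have "\<dots> \<le> K * r ^ e" by (intro mult_left_mono power_decreasing K) (use r in \<open>auto simp: E_def\<close>)
      finally show ?thesis using e by simp
    qed
    define \<Delta> where "\<Delta> = (\<lambda>b. x (w (Suc m)) (real (Suc b) / 2 ^ E) - x (w (Suc m)) (real b / 2 ^ E))"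
    define L where "L = iterated_young x w (Suc m) (real i / 2 ^ D)"
    \<comment> \<open>Partitions of a degenerate interval are constant, so all their sums are 0. The
      block estimate compares values at \<open>B\<close> and at 0 and needs this starting
      value.\<close>
    have L0: "iterated_young x w (Suc m) 0 = 0"
    proof -
      have "has_young_integral (iterated_young x w m) (x (w (Suc m))) 0 0 0"
        unfolding has_young_integral_def
      proof (intro allI impI exI[of _ 1] conjI)
        fix e :: real and n :: nat and p \<xi> :: "nat \<Rightarrow> real"
        assume e: "0 < e" and "p 0 = 0 \<and> p n = 0 \<and> (\<forall>j<n. p j \<le> \<xi> j \<and> \<xi> j \<le> p (Suc j) \<and> p (Suc j) - p j < 1)"
        hence p: "p 0 = 0" "p n = 0" "\<And>j. j < n \<Longrightarrow> p j \<le> p (Suc j)" by force+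
        have mono: "p i \<le> p j" if "i \<le> j" "j \<le> n" for i j
          using that
        proof (induction j)
          case (Suc j) thus ?case using p(3)[of j] by (cases "i = Suc j") auto
        qed auto
        have "p j = 0" if "j \<le> n" for j using p(1,2) mono[of 0 j] mono[of j n] that by simp
        thus "\<bar>(\<Sum>j<n. iterated_young x w m (\<xi> j) * (x (w (Suc m)) (p (Suc j)) - x (w (Suc m)) (p j))) - 0\<bar> < e"
          using e by simp
      qed auto
      thus ?thesis using young_integral_eqI[of 0 0] by simp
    qed
    have 1: "\<bar>L - (\<Sum>b<B. iterated_young x w m (real b / 2 ^ E) * \<Delta> b)\<bar> < \<epsilon> / 4"
    proof -
      have "\<bar>iterated_young x w (Suc m) (real B / 2 ^ E) - iterated_young x w (Suc m) (real 0 / 2 ^ E)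
         - (\<Sum>b<B. iterated_young x w m (real b / 2 ^ E) * \<Delta> b)\<bar> \<le> real B * (K * (1 / 2 ^ E) powr (2 * \<alpha>))"
        unfolding \<Delta>_def
      proof (rule block_sum_estimate)
        fix b assume b: "b < B"
        have "\<bar>iterated_young x w (Suc m) (real (Suc b) / 2 ^ E) - iterated_young x w (Suc m) (real b / 2 ^ E)
             - iterated_young x w m (real b / 2 ^ E) * (x (w (Suc m)) (real (Suc b) / 2 ^ E) - x (w (Suc m)) (real b / 2 ^ E))\<bar>
           \<le> K * (real (Suc b) / 2 ^ E - real b / 2 ^ E) powr (2 * \<alpha>)"
          unfolding K_def F_def
        proof (rule iterated_young_estimates(3)[where n = M and x = x and w = w, OF \<alpha> Z _ m])
          show "real (Suc b) / 2 ^ E \<le> 1" using le1[of "Suc b" E] b B by auto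
          show "real b / 2 ^ E \<le> real (Suc b) / 2 ^ E" by (rule divide_right_mono) auto
        qed (use x in auto)
        also have "real (Suc b) / 2 ^ E - real b / 2 ^ E = 1 / 2 ^ E" by (simp add: field_simps)
        finally show "\<bar>iterated_young x w (Suc m) (real (Suc b) / 2 ^ E) - iterated_young x w (Suc m) (real b / 2 ^ E)
             - iterated_young x w m (real b / 2 ^ E) * (x (w (Suc m)) (real (Suc b) / 2 ^ E) - x (w (Suc m)) (real b / 2 ^ E))\<bar>
           \<le> K * (1 / 2 ^ E) powr (2 * \<alpha>)" .
      qed
      thus ?thesis using KE L0 unfolding tB L_def by simp
    qed
    have 2: "\<bar>dyadic_sum x w (n + E) (Suc m) (B * 2 ^ n) - (\<Sum>b<B. dyadic_sum x w (n + E) m (b * 2 ^ n) * \<Delta> b)\<bar> < \<epsilon> / 4" for n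
    proof -
      have q: "real (b * 2 ^ n) / 2 ^ (n + E) = real b / 2 ^ E" for b by (simp add: power_add)
      have "\<bar>dyadic_sum x w (n + E) (Suc m) (B * 2 ^ n) - dyadic_sum x w (n + E) (Suc m) (0 * 2 ^ n)
         - (\<Sum>b<B. dyadic_sum x w (n + E) m (b * 2 ^ n) * \<Delta> b)\<bar> \<le> real B * (K * (1 / 2 ^ E) powr (2 * \<alpha>))"
        unfolding \<Delta>_def
      proof (rule block_sum_estimate)
        fix b assume b: "b < B"
        have le: "Suc b * 2 ^ n \<le> 2 ^ (n + E)" using b B unfolding power_add mult.commute[of "2^n"] by (intro mult_right_mono) auto
        have "\<bar>dyadic_sum x w (n + E) (Suc m) (Suc b * 2 ^ n) - dyadic_sum x w (n + E) (Suc m) (b * 2 ^ n)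
             - dyadic_sum x w (n + E) m (b * 2 ^ n) * (x (w (Suc m)) (real (Suc b * 2 ^ n) / 2 ^ (n + E)) - x (w (Suc m)) (real (b * 2 ^ n) / 2 ^ (n + E)))\<bar>
           \<le> K * (real (Suc b * 2 ^ n) / 2 ^ (n + E) - real (b * 2 ^ n) / 2 ^ (n + E)) powr (2 * \<alpha>)"
          unfolding K_def F_def
          by (rule dyadic_sum_estimates(2)[where x = x and w = w and M = M, OF \<alpha> Z grid m _ le]) simp_all
        also have "real (Suc b * 2 ^ n) / 2 ^ (n + E) - real (b * 2 ^ n) / 2 ^ (n + E) = 1 / 2 ^ E"
          unfolding q by (simp add: field_simps)
        finally show "\<bar>dyadic_sum x w (n + E) (Suc m) (Suc b * 2 ^ n) - dyadic_sum x w (n + E) (Suc m) (b * 2 ^ n)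
             - dyadic_sum x w (n + E) m (b * 2 ^ n) * (x (w (Suc m)) (real (Suc b) / 2 ^ E) - x (w (Suc m)) (real b / 2 ^ E))\<bar>
           \<le> K * (1 / 2 ^ E) powr (2 * \<alpha>)" unfolding q .
      qed
      thus ?thesis using KE by simp
    qed
    have "(\<lambda>n. \<Sum>b<B. dyadic_sum x w (n + E) m (b * 2 ^ n) * \<Delta> b) \<longlonglongrightarrow>
         (\<Sum>b<B. iterated_young x w m (real b / 2 ^ E) * \<Delta> b)"
      by (intro tendsto_intros Suc.IH) (use m B in auto)
    from LIMSEQ_D[OF this, of "\<epsilon>/4"] \<epsilon> obtain N where
      N: "\<And>n. n \<ge> N \<Longrightarrow> \<bar>(\<Sum>b<B. dyadic_sum x w (n + E) m (b * 2 ^ n) * \<Delta> b)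
        - (\<Sum>b<B. iterated_young x w m (real b / 2 ^ E) * \<Delta> b)\<bar> < \<epsilon> / 4" by auto
    show "\<exists>N. \<forall>n\<ge>N. norm (dyadic_sum x w (n + D) (Suc m) (i * 2 ^ n) - iterated_young x w (Suc m) (real i / 2 ^ D)) < \<epsilon>"
    proof (intro exI[of _ "N + e"] allI impI)
      fix n assume n: "n \<ge> N + e"
      \<comment> \<open>Both descriptions refer to the grid of level \<open>n + D\<close>: level
        \<open>E = D + e\<close> refined \<open>n - e\<close> times.\<close>
      define n' where "n' = n - e"
      have n'1: "n' \<ge> N" "n' + E = n + D" "e + n' = n" using n unfolding n'_def E_def by simp_all
      have "B * 2 ^ n' = i * 2 ^ (e + n')" unfolding B_def power_add by (simp only: mult.assoc)
      hence n': "n' \<ge> N" "n' + E = n + D" "B * 2 ^ n' = i * 2 ^ n" using n'1 by simp_all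
      have "\<bar>dyadic_sum x w (n' + E) (Suc m) (B * 2 ^ n') - L\<bar> < \<epsilon>" using 1 2[of n'] N[OF n'(1)] \<epsilon> by linarith
      thus "norm (dyadic_sum x w (n + D) (Suc m) (i * 2 ^ n) - iterated_young x w (Suc m) (real i / 2 ^ D)) < \<epsilon>"
        unfolding n' L_def by simp
    qed
  qed
qed

section \<open>Hoelder continuity from dyadic increments\<close>

text \<open>The negative term absorbs the two boundary increments in the step to the next level.\<close>

lemma dyadic_chaining:
  fixes f :: "real \<Rightarrow> real"
  assumes \<alpha>: "0 < \<alpha>" "\<alpha> \<le> 1" and Z: "Z \<ge> 0"
    and inc: "\<And>n i. i < 2 ^ n \<Longrightarrow> \<bar>f (real (Suc i) / 2 ^ n) - f (real i / 2 ^ n)\<bar> \<le> Z * (1 / 2 ^ n) powr \<alpha>"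
  defines "c \<equiv> 2 * 2 powr (-\<alpha>) / (1 - 2 powr (-\<alpha>))"
  shows "i < j \<Longrightarrow> j \<le> 2 ^ n \<Longrightarrow> \<bar>f (real j / 2 ^ n) - f (real i / 2 ^ n)\<bar>
     \<le> Z * ((c + 2) * (real j / 2 ^ n - real i / 2 ^ n) powr \<alpha> - c * (1 / 2 ^ n) powr \<alpha>)"
proof (induction n arbitrary: i j)
  case 0
  hence "i = 0" "j = 1" by auto
  moreover have "\<bar>f (real (Suc 0) / 2 ^ 0) - f (real 0 / 2 ^ 0)\<bar> \<le> Z * (1 / 2 ^ 0) powr \<alpha>" by (rule inc) auto
  ultimately show ?case using Z by (simp add: algebra_simps)
next
  case (Suc n)
  define q where "q = 2 powr (-\<alpha>)"
  have q: "0 < q" "q < 1" unfolding q_def using \<alpha> by (auto simp: powr_less_one)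
  \<comment> \<open>This relation determines \<open>c\<close>: after the loss of two boundary
    increments of size \<open>q * h\<close>, the negative term \<open>c * h\<close> of level
    \<open>n\<close> becomes exactly \<open>c * (q * h)\<close>, the term required at level
    \<open>Suc n\<close>.\<close>
  have c: "c * (1 - q) = 2 * q" unfolding c_def q_def[symmetric] using q by simp
  have c0: "c \<ge> 0" unfolding c_def q_def[symmetric] using q by simp
  define h where "h = (1 / 2 ^ n :: real) powr \<alpha>"
  have hS: "(1 / 2 ^ Suc n :: real) powr \<alpha> = q * h"
    unfolding h_def q_def by (simp add: powr_mult powr_divide powr_minus_divide)
  have h: "h > 0" unfolding h_def by simp
  define F where "F = (\<lambda>i. f (real i / 2 ^ Suc n))"
  define D where "D = (real j / 2 ^ Suc n - real i / 2 ^ Suc n)"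
  have inc1: "\<bar>F (Suc i) - F i\<bar> \<le> Z * (q * h)" if "i < 2 ^ Suc n" for i
    using inc[OF that] unfolding hS F_def .
  \<comment> \<open>Rounding \<open>i\<close> up and \<open>j\<close> down to even indices moves to
    points of the coarser grid; each rounding costs at most one increment.\<close>
  define i' where "i' = (i + 1) div 2"
  define j' where "j' = j div 2"
  have e1: "\<bar>F (2 * i') - F i\<bar> \<le> Z * (q * h)"
  proof (cases "even i")
    case True then show ?thesis unfolding i'_def using Z q h by simp
  next
    case False
    hence "2 * i' = Suc i" unfolding i'_def by simp
    thus ?thesis using inc1[of i] Suc.prems by simp
  qed
  have e2: "\<bar>F j - F (2 * j')\<bar> \<le> Z * (q * h)"
  proof (cases "even j")
    case True then show ?thesis unfolding j'_def using Z q h by simp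
  next
    case False
    hence "j = Suc (2 * j')" unfolding j'_def by simp
    thus ?thesis using inc1[of "2 * j'"] Suc.prems by simp
  qed
  have half: "F (2 * k) = f (real k / 2 ^ n)" for k unfolding F_def by simp
  have goal: "\<bar>F j - F i\<bar> \<le> Z * ((c + 2) * D powr \<alpha> - c * (q * h))"
  proof (cases "i' < j'")
    case True
    have "j' \<le> 2 ^ n" using Suc.prems unfolding j'_def by auto
    from Suc.IH[OF True this] have "\<bar>F (2 * j') - F (2 * i')\<bar> \<le> Z * ((c + 2) * (real j' / 2 ^ n - real i' / 2 ^ n) powr \<alpha> - c * h)"
      unfolding half h_def .
    also have "\<dots> \<le> Z * ((c + 2) * D powr \<alpha> - c * h)"
    proof (intro mult_left_mono diff_right_mono powr_mono2)
      have "real (2 * j') \<le> real j" "real i \<le> real (2 * i')" unfolding i'_def j'_def of_nat_le_iff by auto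
      hence "real (2 * j') - real (2 * i') \<le> real j - real i" by linarith
      hence "(real (2 * j') - real (2 * i')) / 2 ^ Suc n \<le> (real j - real i) / 2 ^ Suc n" by (intro divide_right_mono) auto
      thus "real j' / 2 ^ n - real i' / 2 ^ n \<le> D" unfolding D_def by (simp add: field_simps)
      show "0 \<le> real j' / 2 ^ n - real i' / 2 ^ n" using True by (simp add: divide_right_mono)
    qed (use \<alpha> c0 Z in auto)
    finally have "\<bar>F j - F i\<bar> \<le> Z * ((c + 2) * D powr \<alpha> - c * h) + 2 * (Z * (q * h))" using e1 e2 by linarith
    also have "\<dots> = Z * ((c + 2) * D powr \<alpha> - (c - 2 * q) * h)" by (simp add: algebra_simps)
    also have "c - 2 * q = c * q" using c by (simp add: algebra_simps)
    finally show ?thesis by (simp add: algebra_simps)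
  next
    case False
    \<comment> \<open>No interval of the coarser grid fits in between, so at most two increments
      remain and are estimated directly.\<close>
    have "j \<le> i + 2" using False unfolding i'_def j'_def by presburger
    moreover have "F j - F i = (F j - F (Suc i)) + (F (Suc i) - F i)" by simp
    ultimately have le: "\<bar>F j - F i\<bar> \<le> Z * (2 * (q * h))"
    proof -
      have "j = Suc i \<or> j = Suc (Suc i)" using \<open>j \<le> i + 2\<close> Suc.prems by auto
      moreover have "Z * (q * h) \<ge> 0" using Z q h by simp
      ultimately show ?thesis using inc1[of i] inc1[of "Suc i"] Suc.prems by auto
    qed
    have "q * h \<le> D powr \<alpha>"
    proof -
      have "1 / 2 ^ Suc n \<le> D" using Suc.prems unfolding D_def by (simp add: field_simps)
      hence "(1 / 2 ^ Suc n) powr \<alpha> \<le> D powr \<alpha>" by (intro powr_mono2) (use \<alpha> in auto)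
      thus ?thesis unfolding hS .
    qed
    hence "(c + 2) * (q * h) \<le> (c + 2) * D powr \<alpha>" by (intro mult_left_mono) (use c0 in auto)
    hence "2 * (q * h) \<le> (c + 2) * D powr \<alpha> - c * (q * h)" by (simp add: algebra_simps)
    hence "Z * (2 * (q * h)) \<le> Z * ((c + 2) * D powr \<alpha> - c * (q * h))" by (intro mult_left_mono Z)
    thus ?thesis using le by linarith
  qed
  show ?case using goal unfolding F_def D_def hS .
qed

text \<open>The order of the quantifiers is the point: \<open>K\<close> depends on \<alpha> alone
  and serves all paths at once, so the random Hoelder constant is a fixed multiple of
  \<open>Z\<close>. Chaining covers the grid points of one level, continuity the rest.\<close>

lemma dyadic_hoelder:
  assumes \<alpha>: "0 < \<alpha>" "\<alpha> \<le> 1"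
  shows "\<exists>K\<ge>0. \<forall>f Z. Z \<ge> 0 \<longrightarrow>
      (\<forall>n i. i < 2 ^ n \<longrightarrow> \<bar>f (real (Suc i) / 2 ^ n) - f (real i / 2 ^ n)\<bar> \<le> Z * (1 / 2 ^ n) powr \<alpha>) \<longrightarrow>
      continuous_on {0..1} f \<longrightarrow> hoelder_on {0..1} \<alpha> (K * Z) f"
proof -
  define c where "c = 2 * 2 powr (-\<alpha>) / (1 - 2 powr (-\<alpha>))"
  have c0: "c \<ge> 0" unfolding c_def using powr_less_one[of 2 "-\<alpha>"] \<alpha> by (intro divide_nonneg_pos) auto
  show ?thesis
  proof (intro exI[of _ "c + 2"] conjI allI impI)
    show "0 \<le> c + 2" using c0 by simp
    fix f :: "real \<Rightarrow> real" and Z :: real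
    assume Z: "Z \<ge> 0"
     and "\<forall>n i. i < 2 ^ n \<longrightarrow> \<bar>f (real (Suc i) / 2 ^ n) - f (real i / 2 ^ n)\<bar> \<le> Z * (1 / 2 ^ n) powr \<alpha>"
     and cont: "continuous_on {0..1} f"
    hence inc: "\<bar>f (real (Suc i) / 2 ^ n) - f (real i / 2 ^ n)\<bar> \<le> Z * (1 / 2 ^ n) powr \<alpha>" if "i < 2 ^ n" for n i
      using that by blast
    have grid: "\<bar>f (real j / 2 ^ n) - f (real i / 2 ^ n)\<bar> \<le> (c + 2) * Z * (real j / 2 ^ n - real i / 2 ^ n) powr \<alpha>"
      if "i \<le> j" "j \<le> 2 ^ n" for i j n
    proof (cases "i = j")
      case False
      hence "\<bar>f (real j / 2 ^ n) - f (real i / 2 ^ n)\<bar>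
         \<le> Z * ((c + 2) * (real j / 2 ^ n - real i / 2 ^ n) powr \<alpha> - c * (1 / 2 ^ n) powr \<alpha>)"
        unfolding c_def using dyadic_chaining[OF \<alpha> Z inc, of i j n] that by auto
      also have "\<dots> \<le> Z * ((c + 2) * (real j / 2 ^ n - real i / 2 ^ n) powr \<alpha>)"
        using Z c0 by (intro mult_left_mono) auto
      finally show ?thesis by (simp add: algebra_simps)
    qed auto
    \<comment> \<open>Both end points are rounded down at a common level, so that the grid estimate
      applies before the limit is taken.\<close>
    define fl where "fl = (\<lambda>n (t::real). real (nat \<lfloor>t * 2 ^ n\<rfloor>) / 2 ^ n)"
    have fl: "(\<lambda>n. fl n t) \<longlonglongrightarrow> t" "fl n t \<in> {0..1}" "nat \<lfloor>t * 2 ^ n\<rfloor> \<le> 2 ^ n" if t: "t \<in> {0..1}" for t n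
    proof -
      have b: "fl n t \<le> t" "t - fl n t \<le> 1 / 2 ^ n" for n
      proof -
        define k where "k = real (nat \<lfloor>t * 2 ^ n\<rfloor>)"
        have "k = of_int \<lfloor>t * 2 ^ n\<rfloor>" using t unfolding k_def by simp
        hence k: "k \<le> t * 2 ^ n" "t * 2 ^ n - k \<le> 1" by linarith+
        show "fl n t \<le> t" using k(1) unfolding fl_def k_def[symmetric] by (simp add: divide_simps)
        have "t - k / 2 ^ n = (t * 2 ^ n - k) / 2 ^ n" by (simp add: diff_divide_distrib)
        also have "\<dots> \<le> 1 / 2 ^ n" using k(2) by (rule divide_right_mono) simp
        finally show "t - fl n t \<le> 1 / 2 ^ n" unfolding fl_def k_def .
      qed
      show "(\<lambda>n. fl n t) \<longlonglongrightarrow> t"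
      proof (rule tendsto_sandwich)
        have "t - (1/2) ^ n \<le> fl n t" for n using b(2)[of n] unfolding power_one_over by linarith
        thus "\<forall>\<^sub>F n in sequentially. t - (1/2) ^ n \<le> fl n t" by simp
        show "\<forall>\<^sub>F n in sequentially. fl n t \<le> t" using b(1) by simp
        show "(\<lambda>n. t - (1/2) ^ n) \<longlonglongrightarrow> t" by (rule tendsto_eq_intros LIMSEQ_power_zero refl | simp)+
      qed simp
      have "0 \<le> fl n t" unfolding fl_def by simp
      thus "fl n t \<in> {0..1}" using b(1)[of n] t by auto
      have "t * 2 ^ n \<le> 2 ^ n" using t by (simp add: mult_left_le_one_le)
      hence "real_of_int \<lfloor>t * 2 ^ n\<rfloor> \<le> real_of_int (2 ^ n)"
        using of_int_floor_le[of "t * 2 ^ n"] unfolding of_int_power of_int_numeral by linarith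
      hence "\<lfloor>t * 2 ^ n\<rfloor> \<le> 2 ^ n" by (simp only: of_int_le_iff)
      thus "nat \<lfloor>t * 2 ^ n\<rfloor> \<le> 2 ^ n" by (simp add: nat_le_iff)
    qed
    show "hoelder_on {0..1} \<alpha> ((c + 2) * Z) f"
      unfolding hoelder_on_def
    proof (intro ballI impI)
      fix s t :: real assume st: "s \<in> {0..1}" "t \<in> {0..1}" "s \<le> t"
      have fc: "(\<lambda>n. f (fl n t)) \<longlonglongrightarrow> f t" if "t \<in> {0..1}" for t
        by (rule continuous_on_tendsto_compose[OF cont fl(1)]) (use fl that in auto)
      have l1: "(\<lambda>n. \<bar>f (fl n t) - f (fl n s)\<bar>) \<longlonglongrightarrow> \<bar>f t - f s\<bar>" by (intro tendsto_intros fc st)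
      have ms: "nat \<lfloor>s * 2 ^ n\<rfloor> \<le> nat \<lfloor>t * 2 ^ n\<rfloor>" for n
        by (intro nat_mono floor_mono mult_right_mono) (use st in auto)
      hence flm: "0 \<le> fl n t - fl n s" for n unfolding fl_def by (simp add: divide_right_mono)
      have l2: "(\<lambda>n. (c + 2) * Z * (fl n t - fl n s) powr \<alpha>) \<longlonglongrightarrow> (c + 2) * Z * (t - s) powr \<alpha>"
      proof (intro tendsto_mult tendsto_const tendsto_powr' tendsto_diff fl(1) st)
        show "t - s \<noteq> 0 \<or> 0 < \<alpha> \<and> (\<forall>\<^sub>F n in sequentially. 0 \<le> fl n t - fl n s)"
          using flm \<alpha> by simp
      qed
      have "\<bar>f (fl n t) - f (fl n s)\<bar> \<le> (c + 2) * Z * (fl n t - fl n s) powr \<alpha>" for n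
        unfolding fl_def by (rule grid[OF ms fl(3)[OF st(2)]])
      with LIMSEQ_le[OF l1 l2] show "\<bar>f t - f s\<bar> \<le> (c + 2) * Z * (t - s) powr \<alpha>" by auto
    qed
  qed
qed

section \<open>Amplitudes on the cube\<close>

abbreviation lborel_on :: "nat set \<Rightarrow> (nat \<Rightarrow> real) measure" where
  "lborel_on U \<equiv> PiM U (\<lambda>_. lborel)"

interpretation lborel_prod: product_sigma_finite "\<lambda>_::nat. lborel :: real measure"
  by standard

text \<open>A local majorant of \<open>f\<close> itself suffices: Cauchy's estimate on circles of
  radius \<open>r / 2\<close> bounds the derivative by \<open>2 / r * g\<close>, hence the
  difference quotients, and dominated convergence along sequences differentiates under the
  integral.\<close>

lemma holomorphic_on_integral:
  fixes f :: "complex \<Rightarrow> 'a \<Rightarrow> complex"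
  assumes int: "\<And>z. z \<in> U \<Longrightarrow> integrable M (f z)"
    and hol: "\<And>y. y \<in> space M \<Longrightarrow> (\<lambda>z. f z y) holomorphic_on U"
    and dom: "\<And>z. z \<in> U \<Longrightarrow> \<exists>r>0. \<exists>g. cball z r \<subseteq> U \<and> integrable M g \<and> 
       (\<forall>w\<in>cball z r. \<forall>y\<in>space M. norm (f w y) \<le> (g y :: real))"
  shows "(\<lambda>z. LINT y|M. f z y) holomorphic_on U"
proof (rule holomorphic_onI)
  fix z assume z: "z \<in> U"
  from dom[OF z] obtain r g where r: "r > 0" "cball z r \<subseteq> U" and g: "integrable M g"
    and bd: "\<And>w y. w \<in> cball z r \<Longrightarrow> y \<in> space M \<Longrightarrow> norm (f w y) \<le> g y" by blast
  define d where "d = (\<lambda>y. deriv (\<lambda>z. f z y) z)"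
  have holb: "(\<lambda>z. f z y) holomorphic_on ball z r" if "y \<in> space M" for y
    using holomorphic_on_subset[OF hol[OF that]] r ball_subset_cball by blast
  have der: "((\<lambda>z. f z y) has_field_derivative d y) (at z)" if "y \<in> space M" for y
    unfolding d_def using holomorphic_derivI[OF holb[OF that], of z] r by simp
  have quot: "norm ((f (z + h) y - f z y) / h) \<le> 2 / r * g y" if y: "y \<in> space M" and h: "h \<noteq> 0" "norm h < r / 2" for y h
  proof -
    have "norm (f (z + h) y - f z y) \<le> (2 / r * g y) * norm (z + h - z)"
    proof (rule field_differentiable_bound[of "ball z (r/2)"])
      fix w assume w: "w \<in> ball z (r / 2)"
      have sub: "cball w (r/2) \<subseteq> ball z r"
      proof
        fix v assume "v \<in> cball w (r/2)"
        thus "v \<in> ball z r" using w dist_triangle[of z v w] by (auto simp: dist_commute)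
      qed
      have "((\<lambda>z. f z y) has_field_derivative deriv (\<lambda>z. f z y) w) (at w)"
        using holomorphic_derivI[OF holb[OF y], of w] w r by simp
      thus "((\<lambda>z. f z y) has_field_derivative deriv (\<lambda>z. f z y) w) (at w within ball z (r/2))"
        by (rule has_field_derivative_at_within)
      have "norm ((deriv ^^ 1) (\<lambda>z. f z y) w) \<le> fact 1 * g y / (r/2) ^ 1"
      proof (rule Cauchy_inequality)
        show "(\<lambda>z. f z y) holomorphic_on ball w (r/2)"
          using holomorphic_on_subset[OF holb[OF y]] sub ball_subset_cball by blast
        show "continuous_on (cball w (r/2)) (\<lambda>z. f z y)"
          using holomorphic_on_imp_continuous_on[OF holomorphic_on_subset[OF holb[OF y] sub]] .
        show "norm (f x y) \<le> g y" if "norm (w - x) = r/2" for x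
        proof -
          have "x \<in> ball z r" using sub that by (auto simp: dist_norm)
          thus ?thesis using bd[of x y] y by auto
        qed
      qed (use r in auto)
      thus "norm (deriv (\<lambda>z. f z y) w) \<le> 2 / r * g y" by (simp add: field_simps)
    qed (use h r in \<open>auto simp: dist_norm\<close>)
    thus ?thesis using h by (simp add: norm_divide pos_divide_le_eq)
  qed
  have "((\<lambda>z. LINT y|M. f z y) has_field_derivative (LINT y|M. d y)) (at z)"
    unfolding DERIV_def tendsto_at_iff_sequentially
  proof (intro allI impI)
    fix X :: "nat \<Rightarrow> complex" assume X: "\<forall>i. X i \<in> UNIV - {0}" "X \<longlonglongrightarrow> 0"
    from LIMSEQ_D[OF X(2), of "r/2"] r obtain N where N: "\<And>n. n \<ge> N \<Longrightarrow> norm (X n) < r/2" by auto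
    have inU: "z + X (n + N) \<in> U" for n
    proof -
      have "norm (X (n + N)) \<le> r" using N[of "n + N"] r by simp
      hence "z + X (n + N) \<in> cball z r" by (simp add: dist_norm)
      thus ?thesis using r by blast
    qed
    have "(\<lambda>n. LINT y|M. (f (z + X (n + N)) y - f z y) / X (n + N)) \<longlonglongrightarrow> (LINT y|M. d y)"
    proof (rule integral_dominated_convergence)
      show m: "(\<lambda>y. (f (z + X (n + N)) y - f z y) / X (n + N)) \<in> borel_measurable M" for n
        using int[OF inU[of n]] int[OF z] by (intro borel_measurable_divide borel_measurable_diff) auto
      have l: "(\<lambda>n. (f (z + X (n + N)) y - f z y) / X (n + N)) \<longlonglongrightarrow> d y" if y: "y \<in> space M" for y
      proof -
        have "(\<lambda>n. (f (z + X n) y - f z y) / X n) \<longlonglongrightarrow> d y"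
          using der[OF y, unfolded DERIV_def tendsto_at_iff_sequentially, rule_format, OF _ X(2)] X(1)
          by (simp add: o_def)
        thus ?thesis by (rule LIMSEQ_ignore_initial_segment)
      qed
      show "d \<in> borel_measurable M" by (rule borel_measurable_LIMSEQ_metric[OF m l])
      show "AE y in M. (\<lambda>n. (f (z + X (n + N)) y - f z y) / X (n + N)) \<longlonglongrightarrow> d y"
        by (rule AE_I2) (rule l)
      show "AE y in M. norm ((f (z + X (n + N)) y - f z y) / X (n + N)) \<le> 2 / r * g y" for n
        by (rule AE_I2, rule quot) (use X N in auto)
      show "integrable M (\<lambda>y. 2 / r * g y)" using g by simp
    qed
    also have "(\<lambda>n. LINT y|M. (f (z + X (n + N)) y - f z y) / X (n + N))
       = (\<lambda>n. ((LINT y|M. f (z + X (n + N)) y) - (LINT y|M. f z y)) / X (n + N))"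
      using int[OF inU] int[OF z] by (simp add: Bochner_Integration.integral_diff)
    finally have "(\<lambda>n. ((LINT y|M. f (z + X n) y) - (LINT y|M. f z y)) / X n) \<longlonglongrightarrow> (LINT y|M. d y)"
      by (rule LIMSEQ_offset[where k = N])
    thus "((\<lambda>h. ((LINT y|M. f (z + h) y) - (LINT y|M. f z y)) / h) \<circ> X) \<longlonglongrightarrow> (LINT y|M. d y)"
      unfolding o_def .
  qed
  thus "(\<lambda>z. LINT y|M. f z y) field_differentiable at z within U"
    by (meson field_differentiable_at_within field_differentiable_def)
qed

section \<open>A class of amplitudes stable under differentiation\<close>

inductive_set pos_poly :: "nat set \<Rightarrow> ((nat \<Rightarrow> real) \<Rightarrow> real) set" for V where
  pos_poly_const: "c \<ge> 0 \<Longrightarrow> (\<lambda>_. c) \<in> pos_poly V"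
| pos_poly_var: "i \<in> V \<Longrightarrow> (\<lambda>y. y i) \<in> pos_poly V"
| pos_poly_add: "p \<in> pos_poly V \<Longrightarrow> q \<in> pos_poly V \<Longrightarrow> (\<lambda>y. p y + q y) \<in> pos_poly V"
| pos_poly_mult: "p \<in> pos_poly V \<Longrightarrow> q \<in> pos_poly V \<Longrightarrow> (\<lambda>y. p y * q y) \<in> pos_poly V"

lemma pos_poly_nonneg: "p \<in> pos_poly V \<Longrightarrow> (\<And>i. i \<in> V \<Longrightarrow> y i \<ge> 0) \<Longrightarrow> p y \<ge> 0"
  by (induction rule: pos_poly.induct) auto

lemma pos_poly_bounded:
  "p \<in> pos_poly V \<Longrightarrow> \<exists>C\<ge>0. \<forall>y. (\<forall>i\<in>V. 0 \<le> y i \<and> y i \<le> 1) \<longrightarrow> p y \<le> C"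
proof (induction rule: pos_poly.induct)
  case (pos_poly_add p q)
  then obtain C D where "C \<ge> 0" "D \<ge> 0" "\<forall>y. (\<forall>i\<in>V. 0 \<le> y i \<and> y i \<le> 1) \<longrightarrow> p y \<le> C"
    "\<forall>y. (\<forall>i\<in>V. 0 \<le> y i \<and> y i \<le> 1) \<longrightarrow> q y \<le> D" by blast
  thus ?case by (intro exI[of _ "C + D"]) (auto intro!: add_mono)
next
  case (pos_poly_mult p q)
  then obtain C D where "C \<ge> 0" "D \<ge> 0" "\<forall>y. (\<forall>i\<in>V. 0 \<le> y i \<and> y i \<le> 1) \<longrightarrow> p y \<le> C"
    "\<forall>y. (\<forall>i\<in>V. 0 \<le> y i \<and> y i \<le> 1) \<longrightarrow> q y \<le> D" by blast
  thus ?case using pos_poly_nonneg[OF pos_poly_mult(1)] pos_poly_nonneg[OF pos_poly_mult(2)]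
    by (intro exI[of _ "C * D"]) (auto intro!: mult_mono)
qed (auto intro: exI[of _ 1])

lemma pos_poly_measurable [measurable]: "p \<in> pos_poly V \<Longrightarrow> p \<in> borel_measurable (lborel_on V)"
  by (induction rule: pos_poly.induct) auto

lemma pos_poly_deriv:
  "p \<in> pos_poly V \<Longrightarrow> \<exists>p'\<in>pos_poly V. \<forall>y t. ((\<lambda>t. p (y(i := t))) has_real_derivative p' (y(i := t))) (at t)"
proof (induction rule: pos_poly.induct)
  case (pos_poly_const c)
  show ?case by (intro bexI[of _ "\<lambda>_. 0"]) (auto intro: pos_poly.intros)
next
  case (pos_poly_var j)
  show ?case by (intro bexI[of _ "\<lambda>_. if i = j then 1 else 0"]) (auto intro: pos_poly.intros)
next
  case (pos_poly_add p q)
  then obtain p' q' where "p' \<in> pos_poly V" "q' \<in> pos_poly V"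
    "\<And>y t. ((\<lambda>t. p (y(i := t))) has_real_derivative p' (y(i := t))) (at t)"
    "\<And>y t. ((\<lambda>t. q (y(i := t))) has_real_derivative q' (y(i := t))) (at t)" by blast
  thus ?case by (intro bexI[of _ "\<lambda>y. p' y + q' y"]) (auto intro: pos_poly.intros DERIV_add simp del: fun_upd_apply)
next
  case (pos_poly_mult p q)
  then obtain p' q' where "p' \<in> pos_poly V" "q' \<in> pos_poly V"
    "\<And>y t. ((\<lambda>t. p (y(i := t))) has_real_derivative p' (y(i := t))) (at t)"
    "\<And>y t. ((\<lambda>t. q (y(i := t))) has_real_derivative q' (y(i := t))) (at t)" by blast
  with pos_poly_mult(1,2) show ?case
    by (intro bexI[of _ "\<lambda>y. p' y * q y + q' y * p y"]) (auto intro!: pos_poly.intros DERIV_mult simp del: fun_upd_apply)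
qed

lemma pos_poly_subst:
  "p \<in> pos_poly V \<Longrightarrow> (\<And>i. i \<in> V \<Longrightarrow> (\<lambda>y. \<phi> y i) \<in> pos_poly V') \<Longrightarrow> (\<lambda>y. p (\<phi> y)) \<in> pos_poly V'"
  by (induction rule: pos_poly.induct) (auto intro: pos_poly.intros)

lemma pos_poly_sum:
  "finite I \<Longrightarrow> (\<And>i. i \<in> I \<Longrightarrow> p i \<in> pos_poly V) \<Longrightarrow> (\<lambda>y. \<Sum>i\<in>I. p i y) \<in> pos_poly V"
  by (induction rule: finite_induct) (auto intro: pos_poly.intros)

text \<open>Built to be closed under what the continuation does to amplitudes: partial derivatives,
  setting a coordinate to 1, and polynomial substitutions, while staying entire in \<open>H\<close>
  and bounded on the cube. Powers of \<open>1 + p\<close> are spelled with \<open>exp\<close> and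
  \<open>ln\<close>; since \<open>p\<close> is nonnegative on the orthant, the logarithm stays away
  from its singularity.\<close>

inductive_set amplitude :: "nat set \<Rightarrow> ((nat \<Rightarrow> real) \<Rightarrow> complex \<Rightarrow> complex) set" for V where
  amplitude_entire: "h holomorphic_on UNIV \<Longrightarrow> (\<lambda>_. h) \<in> amplitude V"
| amplitude_poly: "p \<in> pos_poly V \<Longrightarrow> (\<lambda>y H. complex_of_real (p y)) \<in> amplitude V"
| amplitude_powr: "p \<in> pos_poly V \<Longrightarrow> h holomorphic_on UNIV \<Longrightarrow>
    (\<lambda>y H. exp (h H * complex_of_real (ln (1 + p y)))) \<in> amplitude V"
| amplitude_add: "F \<in> amplitude V \<Longrightarrow> G \<in> amplitude V \<Longrightarrow> (\<lambda>y H. F y H + G y H) \<in> amplitude V"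
| amplitude_mult: "F \<in> amplitude V \<Longrightarrow> G \<in> amplitude V \<Longrightarrow> (\<lambda>y H. F y H * G y H) \<in> amplitude V"

lemma entire_bounded:
  fixes h :: "complex \<Rightarrow> complex"
  assumes "h holomorphic_on UNIV"
  shows "\<exists>C\<ge>0. \<forall>z. norm z \<le> R \<longrightarrow> norm (h z) \<le> C"
proof -
  have "continuous_on (cball 0 R) h"
    using assms holomorphic_on_imp_continuous_on holomorphic_on_subset by blast
  hence "bounded (h ` cball 0 R)" by (intro compact_imp_bounded compact_continuous_image) auto
  then obtain C where "\<forall>x\<in>h ` cball 0 R. norm x \<le> C" unfolding bounded_iff by blast
  thus ?thesis by (intro exI[of _ "max C 0"]) (force simp: dist_norm)
qed

lemma amplitude_bounded:
  "G \<in> amplitude V \<Longrightarrow>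
    \<exists>C\<ge>0. \<forall>y H. (\<forall>i\<in>V. 0 \<le> y i \<and> y i \<le> 1) \<longrightarrow> norm H \<le> R \<longrightarrow> norm (G y H) \<le> C"
proof (induction rule: amplitude.induct)
  case (amplitude_entire h) thus ?case using entire_bounded[of h R] by blast
next
  case (amplitude_poly p)
  from pos_poly_bounded[OF this] obtain C where "C \<ge> 0" "\<forall>y. (\<forall>i\<in>V. 0 \<le> y i \<and> y i \<le> 1) \<longrightarrow> p y \<le> C" by blast
  thus ?case using pos_poly_nonneg[OF amplitude_poly] by (intro exI[of _ C]) auto
next
  case (amplitude_powr p h)
  from pos_poly_bounded[OF amplitude_powr(1)] obtain C where C: "C \<ge> 0" "\<And>y. (\<forall>i\<in>V. 0 \<le> y i \<and> y i \<le> 1) \<Longrightarrow> p y \<le> C" by blast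
  from entire_bounded[OF amplitude_powr(2), of R] obtain D where D: "D \<ge> 0" "\<And>z. norm z \<le> R \<Longrightarrow> norm (h z) \<le> D" by blast
  have "norm (exp (h H * complex_of_real (ln (1 + p y)))) \<le> exp (D * ln (1 + C))"
    if y: "\<forall>i\<in>V. 0 \<le> y i \<and> y i \<le> 1" and H: "norm H \<le> R" for y H
  proof -
    have p: "0 \<le> p y" "p y \<le> C" using pos_poly_nonneg[OF amplitude_powr(1)] C y by auto
    have "Re (h H) * ln (1 + p y) \<le> D * ln (1 + C)"
      using p D abs_Re_le_cmod[of "h H"] D(2)[OF H] by (intro mult_mono) auto
    thus ?thesis by simp
  qed
  thus ?case by (intro exI[of _ "exp (D * ln (1 + C))"]) auto
next
  case (amplitude_add F G)
  then obtain C D where "C \<ge> 0" "D \<ge> 0"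
    "\<forall>y H. (\<forall>i\<in>V. 0 \<le> y i \<and> y i \<le> 1) \<longrightarrow> norm H \<le> R \<longrightarrow> norm (F y H) \<le> C"
    "\<forall>y H. (\<forall>i\<in>V. 0 \<le> y i \<and> y i \<le> 1) \<longrightarrow> norm H \<le> R \<longrightarrow> norm (G y H) \<le> D" by blast
  thus ?case by (intro exI[of _ "C + D"]) (auto intro!: norm_triangle_mono)
next
  case (amplitude_mult F G)
  then obtain C D where "C \<ge> 0" "D \<ge> 0"
    "\<forall>y H. (\<forall>i\<in>V. 0 \<le> y i \<and> y i \<le> 1) \<longrightarrow> norm H \<le> R \<longrightarrow> norm (F y H) \<le> C"
    "\<forall>y H. (\<forall>i\<in>V. 0 \<le> y i \<and> y i \<le> 1) \<longrightarrow> norm H \<le> R \<longrightarrow> norm (G y H) \<le> D" by blast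
  thus ?case by (intro exI[of _ "C * D"]) (auto simp: norm_mult intro!: mult_mono)
qed

lemma amplitude_holomorphic: "G \<in> amplitude V \<Longrightarrow> G y holomorphic_on UNIV"
  by (induction rule: amplitude.induct) (auto intro!: holomorphic_intros)

lemma amplitude_measurable [measurable]:
  "G \<in> amplitude V \<Longrightarrow> (\<lambda>y. G y H) \<in> borel_measurable (lborel_on V)"
  by (induction rule: amplitude.induct) (auto intro!: borel_measurable_exp)

lemma amplitude_deriv:
  "G \<in> amplitude V \<Longrightarrow> i \<in> V \<Longrightarrow> \<exists>G'\<in>amplitude V. \<forall>y H t. (\<forall>j\<in>V. j \<noteq> i \<longrightarrow> y j \<ge> 0) \<longrightarrow> t \<ge> 0 \<longrightarrow>
     ((\<lambda>t. G (y(i := t)) H) has_vector_derivative G' (y(i := t)) H) (at t)"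
proof (induction rule: amplitude.induct)
  case (amplitude_entire h)
  show ?case by (intro bexI[of _ "\<lambda>_ _. 0"]) (auto intro!: amplitude.intros)
next
  case (amplitude_poly p)
  from pos_poly_deriv[OF amplitude_poly(1), of i] obtain p' where p': "p' \<in> pos_poly V"
    "\<And>y t. ((\<lambda>t. p (y(i := t))) has_real_derivative p' (y(i := t))) (at t)" by blast
  thus ?case by (intro bexI[of _ "\<lambda>y H. complex_of_real (p' y)"])
     (auto intro!: amplitude.intros has_vector_derivative_of_real simp del: fun_upd_apply)
next
  case (amplitude_powr p h)
  from pos_poly_deriv[OF amplitude_powr(1), of i] obtain p' where p': "p' \<in> pos_poly V"
    "\<And>y t. ((\<lambda>t. p (y(i := t))) has_real_derivative p' (y(i := t))) (at t)" by blast
  \<comment> \<open>Differentiation lowers the exponent \<open>h\<close> to \<open>h - 1\<close>,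
    which is again entire, so the class is not left.\<close>
  define G' where "G' = (\<lambda>y H. (h H * complex_of_real (p' y)) * exp ((h H - 1) * complex_of_real (ln (1 + p y))))"
  have G': "G' \<in> amplitude V" unfolding G'_def
    using p' amplitude_powr
    by (intro amplitude.amplitude_mult amplitude.amplitude_powr amplitude.amplitude_poly
          amplitude.amplitude_entire holomorphic_intros)
  have "((\<lambda>t. exp (h H * complex_of_real (ln (1 + p (y(i := t)))))) has_vector_derivative G' (y(i := t)) H) (at t)"
    if y: "\<forall>j\<in>V. j \<noteq> i \<longrightarrow> y j \<ge> 0" "t \<ge> 0" for y H t
  proof -
    define q where "q = p (y(i := t))"
    have q: "q \<ge> 0" unfolding q_def using y by (intro pos_poly_nonneg[OF amplitude_powr(1)]) auto
    have d1: "((\<lambda>t. ln (1 + p (y(i := t)))) has_real_derivative (p' (y(i := t)) / (1 + q))) (at t)"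
      using q p'(2)[of y t] unfolding q_def by (auto intro!: derivative_eq_intros)
    have d2: "((\<lambda>t. complex_of_real (ln (1 + p (y(i := t))))) has_vector_derivative complex_of_real (p' (y(i := t)) / (1 + q))) (at t)"
      by (rule has_vector_derivative_of_real[OF d1])
    have d3: "((\<lambda>z. exp (h H * z)) has_field_derivative (h H * exp (h H * complex_of_real (ln (1 + q))))) (at (complex_of_real (ln (1 + p (y(i := t))))))"
      unfolding q_def by (auto intro!: derivative_eq_intros)
    have "((\<lambda>z. exp (h H * z)) \<circ> (\<lambda>t. complex_of_real (ln (1 + p (y(i := t))))) has_vector_derivative
       complex_of_real (p' (y(i := t)) / (1 + q)) * (h H * exp (h H * complex_of_real (ln (1 + q))))) (at t)"
      by (rule field_vector_diff_chain_at[OF d2 d3])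
    also have "complex_of_real (p' (y(i := t)) / (1 + q)) * (h H * exp (h H * complex_of_real (ln (1 + q)))) = G' (y(i := t)) H"
    proof -
      have "exp ((h H - 1) * complex_of_real (ln (1 + q))) = exp (h H * complex_of_real (ln (1 + q))) / exp (complex_of_real (ln (1 + q)))"
        by (simp add: exp_diff[symmetric] algebra_simps)
      also have "exp (complex_of_real (ln (1 + q))) = complex_of_real (1 + q)"
        using q by (simp add: exp_of_real)
      finally show ?thesis unfolding G'_def q_def[symmetric] by (simp add: field_simps)
    qed
    finally show ?thesis unfolding o_def .
  qed
  with G' show ?case by blast
next
  case (amplitude_add F G)
  then obtain F' G' where FG: "F' \<in> amplitude V" "G' \<in> amplitude V"
    "\<And>y H t. (\<forall>j\<in>V. j \<noteq> i \<longrightarrow> y j \<ge> 0) \<Longrightarrow> t \<ge> 0 \<Longrightarrow> ((\<lambda>t. F (y(i := t)) H) has_vector_derivative F' (y(i := t)) H) (at t)"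
    "\<And>y H t. (\<forall>j\<in>V. j \<noteq> i \<longrightarrow> y j \<ge> 0) \<Longrightarrow> t \<ge> 0 \<Longrightarrow> ((\<lambda>t. G (y(i := t)) H) has_vector_derivative G' (y(i := t)) H) (at t)" by metis
  thus ?case
    by (intro bexI[of _ "\<lambda>y H. F' y H + G' y H"] allI impI has_vector_derivative_add amplitude.amplitude_add) (auto simp del: fun_upd_apply)
next
  case (amplitude_mult F G)
  then obtain F' G' where FG: "F' \<in> amplitude V" "G' \<in> amplitude V"
    "\<And>y H t. (\<forall>j\<in>V. j \<noteq> i \<longrightarrow> y j \<ge> 0) \<Longrightarrow> t \<ge> 0 \<Longrightarrow> ((\<lambda>t. F (y(i := t)) H) has_vector_derivative F' (y(i := t)) H) (at t)"
    "\<And>y H t. (\<forall>j\<in>V. j \<noteq> i \<longrightarrow> y j \<ge> 0) \<Longrightarrow> t \<ge> 0 \<Longrightarrow> ((\<lambda>t. G (y(i := t)) H) has_vector_derivative G' (y(i := t)) H) (at t)" by metis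
  with amplitude_mult(1,2) show ?case
    by (intro bexI[of _ "\<lambda>y H. F y H * G' y H + F' y H * G y H"] allI impI has_vector_derivative_mult
       amplitude.amplitude_add amplitude.amplitude_mult) (auto simp del: fun_upd_apply)
qed

lemma amplitude_subst:
  "G \<in> amplitude V \<Longrightarrow> (\<And>i. i \<in> V \<Longrightarrow> (\<lambda>y. \<phi> y i) \<in> pos_poly V') \<Longrightarrow> (\<lambda>y. G (\<phi> y)) \<in> amplitude V'"
  by (induction rule: amplitude.induct) (auto intro!: amplitude.intros intro: pos_poly_subst)

lemma amplitude_prod:
  "finite I \<Longrightarrow> (\<And>i. i \<in> I \<Longrightarrow> G i \<in> amplitude V) \<Longrightarrow> (\<lambda>y H. \<Prod>i\<in>I. G i y H) \<in> amplitude V"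
  by (induction rule: finite_induct) (auto intro: amplitude.intros)

section \<open>Integrals over the cube and integration by parts\<close>

definition cube :: "nat set \<Rightarrow> (nat \<Rightarrow> real) set" where
  "cube V = PiE V (\<lambda>_. {0<..<1})"

definition power_weight :: "nat set \<Rightarrow> (nat \<Rightarrow> real) \<Rightarrow> (nat \<Rightarrow> real) \<Rightarrow> complex \<Rightarrow> (nat \<Rightarrow> real) \<Rightarrow> complex" where
  "power_weight W a b H y = (\<Prod>i\<in>W. complex_of_real (y i) powr (complex_of_real (a i) * H + complex_of_real (b i)))"

definition cube_integral ::
    "nat set \<Rightarrow> (nat \<Rightarrow> real) \<Rightarrow> (nat \<Rightarrow> real) \<Rightarrow> ((nat \<Rightarrow> real) \<Rightarrow> complex \<Rightarrow> complex) \<Rightarrow> complex \<Rightarrow> complex" where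
  "cube_integral W a b G H = (LINT y:cube W|lborel_on W. power_weight W a b H y * G y H)"

lemma power_weight_insert:
  "finite W \<Longrightarrow> i \<notin> W \<Longrightarrow> power_weight (insert i W) a b H y =
     power_weight W a b H y * complex_of_real (y i) powr (complex_of_real (a i) * H + complex_of_real (b i))"
  unfolding power_weight_def by simp

lemma power_weight_cong:
  "(\<And>j. j \<in> W \<Longrightarrow> a j = a' j \<and> b j = b' j \<and> y j = y' j) \<Longrightarrow>
     power_weight W a b H y = power_weight W a' b' H y'"
  unfolding power_weight_def by (intro prod.cong) auto

lemma cube_sets [measurable]: "finite V \<Longrightarrow> cube V \<in> sets (lborel_on V)"
  unfolding cube_def by (intro sets_PiM_I_finite) auto

lemma power_weight_measurable [measurable]:
  "V \<subseteq> W \<Longrightarrow> power_weight V a b H \<in> borel_measurable (lborel_on W)"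
proof -
  assume VW: "V \<subseteq> W"
  have "(\<lambda>y. complex_of_real (y i)) \<in> borel_measurable (lborel_on W)" if "i \<in> V" for i
  proof -
    have "(\<lambda>y. y i) \<in> borel_measurable (lborel_on W)"
      using measurable_component_singleton[of i W "\<lambda>_. lborel :: real measure"] that VW by auto
    thus ?thesis by measurable
  qed
  thus ?thesis unfolding power_weight_def
    by (intro borel_measurable_prod powr_complex_measurable) auto
qed

lemma norm_power_weight:
  assumes "y \<in> cube W"
  shows "norm (power_weight W a b H y) = (\<Prod>i\<in>W. y i powr (a i * Re H + b i))"
  unfolding power_weight_def prod_norm[symmetric]
proof (rule prod.cong[OF refl])
  fix i assume "i \<in> W"
  hence "0 < y i" using assms unfolding cube_def by (auto simp: PiE_iff)
  thus "norm (complex_of_real (y i) powr (complex_of_real (a i) * H + complex_of_real (b i))) = y i powr (a i * Re H + b i)"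
    by (subst norm_powr_real_powr) auto
qed

lemma powr_integrable_unit:
  fixes c :: real
  assumes "c > -1"
  shows "set_integrable lborel {0<..<1} (\<lambda>t. t powr c)"
proof -
  have "(\<lambda>t. t powr c) integrable_on {0<..<1}"
    using has_integral_powr_from_0[OF assms, of 1] unfolding has_integral_Icc_iff_Ioo by auto
  hence "(\<lambda>t. t powr c) absolutely_integrable_on {0<..<1}"
    by (rule nonnegative_absolutely_integrable_1) auto
  thus ?thesis unfolding set_integrable_def by (subst (asm) integrable_completion) auto
qed

lemma cube_powr_integrable:
  assumes "finite W" "\<And>i. i \<in> W \<Longrightarrow> c i > -1"
  shows "set_integrable (lborel_on W) (cube W) (\<lambda>y. \<Prod>i\<in>W. y i powr c i)"
proof -
  have "integrable (lborel_on W) (\<lambda>y. \<Prod>i\<in>W. indicator {0<..<1} (y i) *\<^sub>R (y i powr c i))"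
    using powr_integrable_unit[OF assms(2)] unfolding set_integrable_def
    by (intro lborel_prod.product_integrable_prod assms(1)) auto
  moreover have "indicator (cube W) y *\<^sub>R (\<Prod>i\<in>W. y i powr c i) = (\<Prod>i\<in>W. indicator {0<..<1} (y i) *\<^sub>R (y i powr c i))"
    if "y \<in> space (lborel_on W)" for y
  proof (cases "y \<in> cube W")
    case True thus ?thesis unfolding cube_def by (auto simp: PiE_iff indicator_def intro!: prod.cong)
  next
    case False
    hence "\<exists>i\<in>W. y i \<notin> {0<..<1}" using that unfolding cube_def by (auto simp: PiE_iff space_PiM)
    thus ?thesis using False assms(1) by (auto simp: prod_zero_iff indicator_def)
  qed
  ultimately show ?thesis unfolding set_integrable_def
    by (subst Bochner_Integration.integrable_cong[OF refl]) auto
qed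

lemma cube_bound:
  assumes "y \<in> cube W" shows "\<forall>i\<in>W. 0 \<le> y i \<and> y i \<le> 1" "i \<in> W \<Longrightarrow> 0 < y i" "i \<in> W \<Longrightarrow> y i < 1"
  using assms unfolding cube_def by (auto simp: PiE_iff intro: less_imp_le)

lemma cube_integral_integrable:
  assumes W: "finite W" and G: "G \<in> amplitude W" and s: "\<And>i. i \<in> W \<Longrightarrow> a i * Re H + b i > -1"
  shows "set_integrable (lborel_on W) (cube W) (\<lambda>y. power_weight W a b H y * G y H)"
proof -
  obtain C where C: "C \<ge> 0" "\<And>y. (\<forall>i\<in>W. 0 \<le> y i \<and> y i \<le> 1) \<Longrightarrow> norm (G y H) \<le> C"
    using amplitude_bounded[OF G, of "norm H"] by auto
  have "set_integrable (lborel_on W) (cube W) (\<lambda>y. C * (\<Prod>i\<in>W. y i powr (a i * Re H + b i)))"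
    by (intro set_integrable_mult_right cube_powr_integrable W s)
  thus ?thesis unfolding set_integrable_def
  proof (rule Bochner_Integration.integrable_bound)
    show "(\<lambda>y. indicat_real (cube W) y *\<^sub>R (power_weight W a b H y * G y H)) \<in> borel_measurable (lborel_on W)"
      using W G by (intro borel_measurable_scaleR borel_measurable_indicator cube_sets borel_measurable_times power_weight_measurable amplitude_measurable) auto
    show "AE y in lborel_on W. norm (indicat_real (cube W) y *\<^sub>R (power_weight W a b H y * G y H))
        \<le> norm (indicat_real (cube W) y *\<^sub>R (C * (\<Prod>i\<in>W. y i powr (a i * Re H + b i))))"
    proof (rule AE_I2)
      fix y
      show "norm (indicat_real (cube W) y *\<^sub>R (power_weight W a b H y * G y H))
        \<le> norm (indicat_real (cube W) y *\<^sub>R (C * (\<Prod>i\<in>W. y i powr (a i * Re H + b i))))"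
      proof (cases "y \<in> cube W")
        case True
        have "(\<Prod>i\<in>W. y i powr (a i * Re H + b i)) \<ge> 0" by (intro prod_nonneg) auto
        with True show ?thesis using C(2)[OF cube_bound(1)[OF True]] C(1)
          by (simp add: norm_mult norm_power_weight abs_mult mult.commute mult_right_mono)
      qed auto
    qed
  qed
qed

text \<open>Coordinates are at most 1 and each \<open>a i\<close> is nonnegative, so the weight at
  any \<open>H\<close> with \<open>Re H \<ge> c\<close> is bounded by the weight at
  \<open>c\<close>, which is integrable. Times a locally uniform bound on the amplitude, it is the
  majorant for differentiation under the integral.\<close>

lemma cube_integral_holomorphic:
  assumes W: "finite W" and G: "G \<in> amplitude W" and a: "\<And>i. i \<in> W \<Longrightarrow> a i \<ge> 0"
    and s: "\<And>i. i \<in> W \<Longrightarrow> a i * c + b i > -1"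
  shows "cube_integral W a b G holomorphic_on {H. Re H > c}"
proof -
  have s': "a i * Re H + b i > -1" if "i \<in> W" "Re H > c" for i H
    using mult_left_mono[of c "Re H" "a i"] a[OF that(1)] s[OF that(1)] that(2) by simp
  show ?thesis unfolding cube_integral_def set_lebesgue_integral_def
  proof (rule holomorphic_on_integral)
    fix H :: complex assume "H \<in> {H. Re H > c}"
    hence H: "Re H > c" by simp
    show "integrable (lborel_on W) (\<lambda>y. indicat_real (cube W) y *\<^sub>R (power_weight W a b H y * G y H))"
      using cube_integral_integrable[OF W G s'[OF _ H]] unfolding set_integrable_def .
  next
    fix y :: "nat \<Rightarrow> real"
    show "(\<lambda>H. indicat_real (cube W) y *\<^sub>R (power_weight W a b H y * G y H)) holomorphic_on {H. Re H > c}"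
    proof (cases "y \<in> cube W")
      case True
      have "G y holomorphic_on {H. Re H > c}" using amplitude_holomorphic[OF G] by (rule holomorphic_on_subset) auto
      moreover have "(\<lambda>H. power_weight W a b H y) holomorphic_on {H. Re H > c}"
        unfolding power_weight_def by (intro holomorphic_intros holomorphic_on_prod)
      ultimately show ?thesis using True by (auto intro!: holomorphic_intros)
    qed auto
  next
    fix H :: complex assume "H \<in> {H. Re H > c}"
    hence H: "Re H > c" by simp
    define r where "r = (Re H - c) / 2"
    have r: "r > 0" unfolding r_def using H by simp
    have Re: "Re w \<ge> Re H - r" if "w \<in> cball H r" for w
      using that abs_Re_le_cmod[of "H - w"] by (auto simp: dist_norm)
    have sub: "cball H r \<subseteq> {H. Re H > c}" 
    proof
      fix w assume "w \<in> cball H r"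
      from Re[OF this] have "Re H - r \<le> Re w" .
      moreover have "c < Re H - r" using H unfolding r_def by (simp add: field_simps)
      ultimately show "w \<in> {H. Re H > c}" by simp
    qed
    have nr: "norm w \<le> norm H + r" if "w \<in> cball H r" for w
      using that norm_triangle_ineq2[of w H] by (auto simp: dist_norm norm_minus_commute)
    obtain C where C: "C \<ge> 0" "\<And>y w. (\<forall>i\<in>W. 0 \<le> y i \<and> y i \<le> 1) \<Longrightarrow> norm w \<le> norm H + r \<Longrightarrow> norm (G y w) \<le> C"
      using amplitude_bounded[OF G, of "norm H + r"] by auto
    define g where "g = (\<lambda>y. indicat_real (cube W) y *\<^sub>R (C * (\<Prod>i\<in>W. y i powr (a i * c + b i))))"
    have "integrable (lborel_on W) g" unfolding g_def set_integrable_def[symmetric]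
      by (intro set_integrable_mult_right cube_powr_integrable W s)
    moreover have "norm (indicat_real (cube W) y *\<^sub>R (power_weight W a b w y * G y w)) \<le> g y" if w: "w \<in> cball H r" for w y
    proof (cases "y \<in> cube W")
      case True
      have "(\<Prod>i\<in>W. y i powr (a i * Re w + b i)) \<le> (\<Prod>i\<in>W. y i powr (a i * c + b i))"
      proof (rule prod_mono)
        fix i assume i: "i \<in> W"
        have "c \<le> Re w" using sub w by (auto simp: subset_eq intro: less_imp_le)
        hence "a i * c \<le> a i * Re w" by (rule mult_left_mono) (rule a[OF i])
        thus "0 \<le> y i powr (a i * Re w + b i) \<and> y i powr (a i * Re w + b i) \<le> y i powr (a i * c + b i)"
          using cube_bound(2,3)[OF True i] by (intro conjI powr_mono') auto
      qed
      moreover have "(\<Prod>i\<in>W. y i powr (a i * Re w + b i)) \<ge> 0" by (intro prod_nonneg) auto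
      ultimately have "(\<Prod>i\<in>W. y i powr (a i * Re w + b i)) * norm (G y w) \<le> (\<Prod>i\<in>W. y i powr (a i * c + b i)) * C"
        using C(2)[OF cube_bound(1)[OF True] nr[OF w]] by (intro mult_mono) auto
      thus ?thesis using True unfolding g_def by (simp add: norm_mult norm_power_weight mult.commute)
    qed (auto simp: g_def)
    ultimately show "\<exists>r>0. \<exists>g. cball H r \<subseteq> {H. Re H > c} \<and> integrable (lborel_on W) g \<and>
        (\<forall>w\<in>cball H r. \<forall>y\<in>space (lborel_on W). norm (indicat_real (cube W) y *\<^sub>R (power_weight W a b w y * G y w)) \<le> g y)"
      using r sub by blast
  qed
qed

text \<open>The fundamental theorem for the product of \<open>g\<close> with the power
  \<open>s + 1\<close>: continuity at 0 and the vanishing boundary value there both use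
  \<open>Re s > -1\<close>.\<close>

lemma powr_parts_unit:
  fixes g g' :: "real \<Rightarrow> complex" and s :: complex
  assumes s: "Re s > -1"
    and g: "\<And>t. t \<ge> 0 \<Longrightarrow> (g has_vector_derivative g' t) (at t)"
    and i1: "set_integrable lborel {0<..<1} (\<lambda>t. complex_of_real t powr s * g t)"
    and i2: "set_integrable lborel {0<..<1} (\<lambda>t. complex_of_real t powr (s + 1) * g' t)"
  shows "(LINT t:{0<..<1}|lborel. (s + 1) * (complex_of_real t powr s * g t) + complex_of_real t powr (s + 1) * g' t) = g 1"
proof -
  define F where "F = (\<lambda>t. complex_of_real t powr (s + 1) * g t)"
  define f where "f = (\<lambda>t. (s + 1) * (complex_of_real t powr s * g t) + complex_of_real t powr (s + 1) * g' t)"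
  have "(f has_integral (F 1 - F 0)) {0..1}"
  proof (rule fundamental_theorem_of_calculus_interior)
    have "continuous_on {0..1} g"
      by (intro continuous_at_imp_continuous_on ballI has_vector_derivative_continuous[OF g]) auto
    thus "continuous_on {0..1} F" unfolding F_def using s
      by (intro continuous_intros) (auto simp: complex_eq_iff)
    fix t :: real assume t: "t \<in> {0<..<1}"
    have nt: "complex_of_real t \<notin> \<real>\<^sub>\<le>\<^sub>0" using t by (auto simp: complex_nonpos_Reals_iff)
    have "((\<lambda>z. z powr (s + 1)) \<circ> complex_of_real has_vector_derivative 1 * ((s + 1) * complex_of_real t powr (s + 1 - 1))) (at t)"
      by (rule field_vector_diff_chain_at) (auto intro!: derivative_eq_intros has_field_derivative_powr nt)
    hence "((\<lambda>t. complex_of_real t powr (s + 1)) has_vector_derivative ((s + 1) * complex_of_real t powr s)) (at t)"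
      by (simp add: o_def)
    from has_vector_derivative_mult[OF this g[of t]] t
    show "(F has_vector_derivative f t) (at t)" unfolding F_def f_def
      by (simp add: algebra_simps)
  qed simp
  hence "(f has_integral g 1) {0<..<1}" using s unfolding has_integral_Icc_iff_Ioo F_def by simp
  moreover have "set_integrable lborel {0<..<1} f"
    unfolding f_def by (intro set_integral_add set_integrable_mult_right i1 i2)
  ultimately show ?thesis unfolding f_def[symmetric]
    using set_borel_integral_eq_integral(2)[of "{0<..<1}" f] by (simp add: integral_unique)
qed

lemma cube_insert_indicator:
  "i \<notin> W \<Longrightarrow> x \<in> space (lborel_on W) \<Longrightarrow>
    indicat_real (cube (insert i W)) (x(i := t)) = indicat_real (cube W) x * indicat_real {0<..<1} t"
  unfolding cube_def by (auto simp: indicator_def PiE_iff space_PiM extensional_def split: if_splits)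

text \<open>Integration by parts in the coordinate \<open>i\<close>, inside Fubini. The end point 0
  contributes nothing, the end point 1 leaves an integral over the other coordinates, and the
  remaining term has its exponent raised by 1. Dividing by the factor on the left is what creates a
  pole.\<close>

lemma cube_integral_parts:
  assumes W: "finite W" "i \<notin> W" and G: "G \<in> amplitude (insert i W)" and G': "G' \<in> amplitude (insert i W)"
    and s: "\<And>j. j \<in> insert i W \<Longrightarrow> a j * Re H + b j > -1"
    and der: "\<And>y H t. (\<forall>j\<in>insert i W. j \<noteq> i \<longrightarrow> y j \<ge> 0) \<Longrightarrow> t \<ge> 0 \<Longrightarrow>
     ((\<lambda>t. G (y(i := t)) H) has_vector_derivative G' (y(i := t)) H) (at t)"
  shows "(complex_of_real (a i) * H + complex_of_real (b i) + 1) * cube_integral (insert i W) a b G H =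
     cube_integral W a b (\<lambda>y. G (y(i := 1))) H - cube_integral (insert i W) a (b(i := b i + 1)) G' H"
proof -
  let ?W = "insert i W"
  define z where "z = complex_of_real (a i) * H + complex_of_real (b i)"
  have z: "Re z > -1" unfolding z_def using s[of i] by simp
  define f0 where "f0 = (\<lambda>y. indicat_real (cube ?W) y *\<^sub>R (power_weight ?W a b H y * G y H))"
  define f1 where "f1 = (\<lambda>y. indicat_real (cube ?W) y *\<^sub>R (power_weight ?W a (b(i := b i + 1)) H y * G' y H))"
  have i0: "integrable (lborel_on ?W) f0"
    unfolding f0_def set_integrable_def[symmetric] using W G s by (intro cube_integral_integrable) auto
  have s1: "a j * Re H + (b(i := b i + 1)) j > -1" if "j \<in> ?W" for j using s[OF that] by auto
  have i1: "integrable (lborel_on ?W) f1"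
    unfolding f1_def set_integrable_def[symmetric] using W G' s1 by (intro cube_integral_integrable) auto
  have upd: "power_weight W a b' H (x(i := t)) = power_weight W a b H x" if "\<And>j. j \<in> W \<Longrightarrow> b' j = b j" for x t b'
    by (rule power_weight_cong) (use W that in auto)
  have pw: "power_weight ?W a b H (x(i := t)) = power_weight W a b H x * complex_of_real t powr z" for x t
    unfolding power_weight_insert[OF W] by (subst upd) (use W in \<open>auto simp: z_def\<close>)
  have pw1: "power_weight ?W a (b(i := b i + 1)) H (x(i := t)) = power_weight W a b H x * complex_of_real t powr (z + 1)" for x t
    unfolding power_weight_insert[OF W] by (subst upd) (use W in \<open>auto simp: z_def add.assoc\<close>)
  \<comment> \<open>Slices in the coordinate \<open>i\<close> are integrable for every point
    \<open>x\<close> of the cube, not merely for almost every one as Fubini would give; so the inner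
    identity holds pointwise.\<close>
  have sec: "set_integrable lborel {0<..<1} (\<lambda>t. complex_of_real t powr z' * K (x(i := t)) H)"
    if K: "K \<in> amplitude ?W" and x: "x \<in> cube W" and z': "Re z' > -1" for K x z'
  proof -
    obtain C where C: "C \<ge> 0" "\<And>y. (\<forall>i\<in>?W. 0 \<le> y i \<and> y i \<le> 1) \<Longrightarrow> norm (K y H) \<le> C"
      using amplitude_bounded[OF K, of "norm H"] by auto
    have "set_integrable lborel {0<..<1} (\<lambda>t. C * t powr Re z')"
      by (intro set_integrable_mult_right powr_integrable_unit z')
    thus ?thesis unfolding set_integrable_def
    proof (rule Bochner_Integration.integrable_bound)
      have xs: "x \<in> space (lborel_on W)" using x unfolding cube_def by (auto simp: space_PiM PiE_iff)
      have "(\<lambda>t. x(i := t)) \<in> measurable lborel (lborel_on ?W)"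
        by (rule measurable_component_update[OF xs W(2)])
      from measurable_compose[OF this amplitude_measurable[OF K]]
      show "(\<lambda>t. indicat_real {0<..<1} t *\<^sub>R (complex_of_real t powr z' * K (x(i := t)) H)) \<in> borel_measurable lborel"
        by (intro borel_measurable_scaleR borel_measurable_times powr_complex_measurable) auto
      show "AE t in lborel. norm (indicat_real {0<..<1} t *\<^sub>R (complex_of_real t powr z' * K (x(i := t)) H))
        \<le> norm (indicat_real {0<..<1} t *\<^sub>R (C * t powr Re z'))"
      proof (rule AE_I2)
        fix t :: real
        show "norm (indicat_real {0<..<1} t *\<^sub>R (complex_of_real t powr z' * K (x(i := t)) H))
           \<le> norm (indicat_real {0<..<1} t *\<^sub>R (C * t powr Re z'))"
        proof (cases "t \<in> {0<..<1}")
          case True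
          have "norm (K (x(i := t)) H) \<le> C" using cube_bound[OF x] True W by (intro C(2)) auto
          thus ?thesis using True C(1) by (simp add: norm_mult norm_powr_real_powr abs_mult mult.commute mult_right_mono)
        qed auto
      qed
    qed
  qed
  have inner: "(\<integral>t. (z + 1) * f0 (x(i := t)) + f1 (x(i := t)) \<partial>lborel) = indicat_real (cube W) x *\<^sub>R (power_weight W a b H x * G (x(i := 1)) H)"
    if x: "x \<in> space (lborel_on W)" for x
  proof (cases "x \<in> cube W")
    case False
    thus ?thesis using cube_insert_indicator[OF W(2) x] unfolding f0_def f1_def by simp
  next
    case True
    have "(z + 1) * f0 (x(i := t)) + f1 (x(i := t)) = power_weight W a b H x *
        (indicat_real {0<..<1} t *\<^sub>R ((z + 1) * (complex_of_real t powr z * G (x(i := t)) H) + complex_of_real t powr (z + 1) * G' (x(i := t)) H))" for t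
      using True unfolding f0_def f1_def cube_insert_indicator[OF W(2) x] pw pw1
      by (simp add: algebra_simps scaleR_conv_of_real)
    hence "(\<integral>t. (z + 1) * f0 (x(i := t)) + f1 (x(i := t)) \<partial>lborel) = power_weight W a b H x *
       (LINT t:{0<..<1}|lborel. (z + 1) * (complex_of_real t powr z * G (x(i := t)) H) + complex_of_real t powr (z + 1) * G' (x(i := t)) H)"
      unfolding set_lebesgue_integral_def by (simp only: integral_mult_right_zero)
    also have "(LINT t:{0<..<1}|lborel. (z + 1) * (complex_of_real t powr z * G (x(i := t)) H) + complex_of_real t powr (z + 1) * G' (x(i := t)) H)
       = G (x(i := 1)) H"
    proof (rule powr_parts_unit)
      show "((\<lambda>t. G (x(i := t)) H) has_vector_derivative G' (x(i := t)) H) (at t)" if "t \<ge> 0" for t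
        using der that cube_bound[OF True] W by (auto simp del: fun_upd_apply)
    qed (use z sec[OF G True] sec[OF G' True] in auto)
    finally show ?thesis using True by (simp del: fun_upd_apply)
  qed
  have "(z + 1) * cube_integral ?W a b G H + cube_integral ?W a (b(i := b i + 1)) G' H
      = (\<integral>y. (z + 1) * f0 y + f1 y \<partial>lborel_on ?W)"
    unfolding cube_integral_def set_lebesgue_integral_def f0_def[symmetric] f1_def[symmetric]
    using i0 i1 by (subst Bochner_Integration.integral_add) auto
  also have "\<dots> = (\<integral>x. (\<integral>t. (z + 1) * f0 (x(i := t)) + f1 (x(i := t)) \<partial>lborel) \<partial>lborel_on W)"
    using i0 i1 W by (intro lborel_prod.product_integral_insert) auto
  also have "\<dots> = (\<integral>x. indicat_real (cube W) x *\<^sub>R (power_weight W a b H x * G (x(i := 1)) H) \<partial>lborel_on W)"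
    by (intro Bochner_Integration.integral_cong refl inner)
  also have "\<dots> = cube_integral W a b (\<lambda>y. G (y(i := 1))) H"
    unfolding cube_integral_def set_lebesgue_integral_def ..
  finally show ?thesis unfolding z_def by (simp add: algebra_simps)
qed

section \<open>Analytic continuation\<close>

text \<open>Stated for each half-plane separately because the number of integrations by parts grows
  as \<open>c\<close> decreases; a single function on the plane is assembled in
  \<open>continues_off_glue\<close>.\<close>

definition continues_off :: "(complex \<Rightarrow> complex) \<Rightarrow> complex set \<Rightarrow> bool" where
  "continues_off f E \<longleftrightarrow> (\<forall>c. \<exists>F. F meromorphic_on {H. Re H > c} \<and>
     F holomorphic_on ({H. Re H > c} - E) \<and> (\<forall>H. Re H > 1 / 2 \<longrightarrow> F H = f H))"

lemma continues_off_cong: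
  "continues_off f E \<Longrightarrow> (\<And>H. Re H > 1 / 2 \<Longrightarrow> f H = g H) \<Longrightarrow> continues_off g E"
  unfolding continues_off_def by (metis (no_types, lifting))

lemma continues_off_sum:
  assumes "finite I" "\<And>i. i \<in> I \<Longrightarrow> continues_off (f i) E"
  shows "continues_off (\<lambda>H. \<Sum>i\<in>I. f i H) E"
  unfolding continues_off_def
proof
  fix c
  have "\<forall>i\<in>I. \<exists>F. F meromorphic_on {H. Re H > c} \<and> F holomorphic_on ({H. Re H > c} - E) \<and> (\<forall>H. Re H > 1 / 2 \<longrightarrow> F H = f i H)"
    using assms(2) unfolding continues_off_def by blast
  then obtain F where F: "\<And>i. i \<in> I \<Longrightarrow> F i meromorphic_on {H. Re H > c}" "\<And>i. i \<in> I \<Longrightarrow> F i holomorphic_on ({H. Re H > c} - E)"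
    "\<And>i H. i \<in> I \<Longrightarrow> Re H > 1 / 2 \<Longrightarrow> F i H = f i H" by metis
  have "(\<lambda>H. \<Sum>i\<in>I. F i H) meromorphic_on {H. Re H > c}"
    by (intro meromorphic_intros F)
  moreover have "(\<lambda>H. \<Sum>i\<in>I. F i H) holomorphic_on ({H. Re H > c} - E)"
    by (intro holomorphic_intros F)
  ultimately show "\<exists>F. F meromorphic_on {H. Re H > c} \<and> F holomorphic_on ({H. Re H > c} - E) \<and>
     (\<forall>H. Re H > 1 / 2 \<longrightarrow> F H = (\<Sum>i\<in>I. f i H))"
    using F(3) by (intro exI[of _ "\<lambda>H. \<Sum>i\<in>I. F i H"]) (auto intro!: sum.cong)
qed

text \<open>The induction measure bounds how far the exponents still have to be raised for
  convergence on \<open>Re H > c\<close>. Each step expresses the integral through a boundary term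
  in fewer coordinates and a term with a larger exponent, both of smaller measure, divided by an
  affine function of \<open>H\<close> whose zeros lie in \<open>E\<close>.\<close>

lemma cube_integral_continues:
  assumes a: "\<And>i. a i \<ge> 0"
  shows "finite W \<Longrightarrow> G \<in> amplitude W \<Longrightarrow>
    (\<And>i H. i \<in> W \<Longrightarrow> Re H > 1 / 2 \<Longrightarrow> a i * Re H + b i > -1) \<Longrightarrow>
    (\<And>i l H. i \<in> W \<Longrightarrow> complex_of_real (a i) * H + complex_of_real (b i) + 1 + of_nat l = 0 \<Longrightarrow> H \<in> E) \<Longrightarrow>
    \<exists>F. F meromorphic_on {H. Re H > c} \<and> F holomorphic_on ({H. Re H > c} - E) \<and>
        (\<forall>H. Re H > 1 / 2 \<longrightarrow> F H = cube_integral W a b G H)"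
proof (induction "\<Sum>i\<in>W. nat \<lceil>- (a i * c + b i)\<rceil>" arbitrary: W b G rule: less_induct)
  case less
  note W = less.prems(1) and G = less.prems(2) and s = less.prems(3) and E = less.prems(4)
  show ?case
  proof (cases "\<forall>i\<in>W. a i * c + b i > -1")
    case True
    have "cube_integral W a b G holomorphic_on {H. Re H > c}"
      using True a by (intro cube_integral_holomorphic W G) auto
    moreover have "open {H::complex. Re H > c}" by (rule open_halfspace_Re_gt)
    ultimately show ?thesis
      by (intro exI[of _ "cube_integral W a b G"] conjI analytic_on_imp_meromorphic_on)
         (auto simp: analytic_on_open elim: holomorphic_on_subset)
  next
    case False
    then obtain i where i: "i \<in> W" "a i * c + b i \<le> -1" by force
    define W' where "W' = W - {i}"
    have W': "finite W'" "i \<notin> W'" "insert i W' = W" using W i unfolding W'_def by auto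
    obtain G' where G': "G' \<in> amplitude W"
      "\<And>y H t. (\<forall>j\<in>W. j \<noteq> i \<longrightarrow> y j \<ge> 0) \<Longrightarrow> t \<ge> 0 \<Longrightarrow>
        ((\<lambda>t. G (y(i := t)) H) has_vector_derivative G' (y(i := t)) H) (at t)"
      using amplitude_deriv[OF G i(1)] by blast
    have G1: "(\<lambda>y. G (y(i := 1))) \<in> amplitude W'"
    proof (rule amplitude_subst[OF G])
      show "(\<lambda>y. (y(i := 1)) k) \<in> pos_poly W'" if "k \<in> W" for k
        by (cases "k = i") (use that in \<open>auto simp: W'_def intro: pos_poly.intros\<close>)
    qed
    define b' where "b' = b(i := b i + 1)"
    \<comment> \<open>The failing exponent is at most -1, so its share of the measure is at least 1
      and drops strictly when the exponent is raised.\<close>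
    define x where "x = - (a i * c + b i)"
    have x: "x \<ge> 1" using i unfolding x_def by simp
    hence cx: "nat \<lceil>x\<rceil> \<ge> 1" "nat \<lceil>x - 1\<rceil> < nat \<lceil>x\<rceil>" by linarith+
    have mu: "(\<Sum>i\<in>W. nat \<lceil>- (a i * c + b i)\<rceil>) = nat \<lceil>x\<rceil> + (\<Sum>i\<in>W'. nat \<lceil>- (a i * c + b i)\<rceil>)"
      unfolding W'(3)[symmetric] x_def by (rule sum.insert[OF W'(1,2)])
    have mu': "(\<Sum>i\<in>W. nat \<lceil>- (a i * c + b' i)\<rceil>) = nat \<lceil>x - 1\<rceil> + (\<Sum>i\<in>W'. nat \<lceil>- (a i * c + b i)\<rceil>)"
    proof -
      have "(\<Sum>i\<in>W. nat \<lceil>- (a i * c + b' i)\<rceil>) = nat \<lceil>- (a i * c + b' i)\<rceil> + (\<Sum>i\<in>W'. nat \<lceil>- (a i * c + b' i)\<rceil>)"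
        unfolding W'(3)[symmetric] by (rule sum.insert[OF W'(1,2)])
      also have "- (a i * c + b' i) = x - 1" unfolding x_def b'_def by simp
      also have "(\<Sum>i\<in>W'. nat \<lceil>- (a i * c + b' i)\<rceil>) = (\<Sum>i\<in>W'. nat \<lceil>- (a i * c + b i)\<rceil>)"
        using W' by (intro sum.cong) (auto simp: b'_def)
      finally show ?thesis .
    qed
    have "\<exists>F. F meromorphic_on {H. Re H > c} \<and> F holomorphic_on ({H. Re H > c} - E) \<and>
        (\<forall>H. Re H > 1 / 2 \<longrightarrow> F H = cube_integral W' a b (\<lambda>y. G (y(i := 1))) H)"
    proof (rule less.hyps)
      show "(\<Sum>i\<in>W'. nat \<lceil>- (a i * c + b i)\<rceil>) < (\<Sum>i\<in>W. nat \<lceil>- (a i * c + b i)\<rceil>)"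
        unfolding mu using cx by linarith
      show "- 1 < a j * Re H + b j" if "j \<in> W'" "Re H > 1/2" for j H using s that W' by auto
      show "H \<in> E" if "j \<in> W'" "complex_of_real (a j) * H + complex_of_real (b j) + 1 + of_nat l = 0" for j l H
        using E[of j H l] that W' by auto
    qed (use W' G1 in auto)
    then obtain F1 where F1: "F1 meromorphic_on {H. Re H > c}" "F1 holomorphic_on ({H. Re H > c} - E)"
      "\<And>H. Re H > 1 / 2 \<Longrightarrow> F1 H = cube_integral W' a b (\<lambda>y. G (y(i := 1))) H" by blast
    have "\<exists>F. F meromorphic_on {H. Re H > c} \<and> F holomorphic_on ({H. Re H > c} - E) \<and>
        (\<forall>H. Re H > 1 / 2 \<longrightarrow> F H = cube_integral W a b' G' H)"
    proof (rule less.hyps)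
      show "(\<Sum>i\<in>W. nat \<lceil>- (a i * c + b' i)\<rceil>) < (\<Sum>i\<in>W. nat \<lceil>- (a i * c + b i)\<rceil>)"
        unfolding mu mu' using cx by linarith
      show "- 1 < a j * Re H + b' j" if "j \<in> W" "Re H > 1/2" for j H using s[OF that] unfolding b'_def by auto
      show "H \<in> E" if j: "j \<in> W" and H: "complex_of_real (a j) * H + complex_of_real (b' j) + 1 + of_nat l = 0" for j l H
      proof (cases "j = i")
        \<comment> \<open>Raising the exponent turns the zero with index \<open>l\<close> into the
          one with index \<open>Suc l\<close>; this is the origin of the progressions in
          \<open>l\<close>.\<close>
        case True thus ?thesis using E[of j H "Suc l"] j H unfolding b'_def by (simp add: algebra_simps)
      next
        case False thus ?thesis using E[of j H l] j H unfolding b'_def by simp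
      qed
    qed (use W G' in auto)
    then obtain F2 where F2: "F2 meromorphic_on {H. Re H > c}" "F2 holomorphic_on ({H. Re H > c} - E)"
      "\<And>H. Re H > 1 / 2 \<Longrightarrow> F2 H = cube_integral W a b' G' H" by blast
    define z where "z = (\<lambda>H. complex_of_real (a i) * H + complex_of_real (b i) + 1)"
    define F where "F = (\<lambda>H. (F1 H - F2 H) / z H)"
    have zm: "z meromorphic_on {H. Re H > c}" unfolding z_def
      by (intro analytic_on_imp_meromorphic_on analytic_intros)
    have zE: "H \<in> E" if "z H = 0" for H using E[of i H 0] i that unfolding z_def by simp
    have "F meromorphic_on {H. Re H > c}" unfolding F_def by (intro meromorphic_intros F1 F2 zm)
    moreover have "F holomorphic_on ({H. Re H > c} - E)"
      unfolding F_def using zE by (intro holomorphic_on_divide holomorphic_on_diff F1 F2) (auto simp: z_def intro!: holomorphic_intros)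
    moreover have "F H = cube_integral W a b G H" if H: "Re H > 1 / 2" for H
    proof -
      have "a i * Re H + b i > -1" using s i H by auto
      hence z0: "z H \<noteq> 0" unfolding z_def by (auto simp: complex_eq_iff)
      have "z H * cube_integral W a b G H = F1 H - F2 H"
        unfolding F1(3)[OF H] F2(3)[OF H] z_def b'_def
        using cube_integral_parts[of W' i G G' a H b] W' G G' s H by simp
      thus ?thesis using z0 unfolding F_def by (simp add: field_simps)
    qed
    ultimately show ?thesis by blast
  qed
qed

section \<open>Substitutions in product Lebesgue measure\<close>

lemma measurable_PiM_lborel:
  fixes T :: "(nat \<Rightarrow> real) \<Rightarrow> nat \<Rightarrow> real"
  assumes "\<And>i. i \<in> U \<Longrightarrow> (\<lambda>y. T y i) \<in> borel_measurable N"
    and "\<And>y i. y \<in> space N \<Longrightarrow> i \<notin> U \<Longrightarrow> T y i = undefined"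
  shows "T \<in> measurable N (lborel_on U)"
proof -
  have "(\<lambda>y i. T y i) \<in> measurable N (lborel_on U)"
    by (rule measurable_PiM_single') (use assms in \<open>auto simp: PiE_iff extensional_def\<close>)
  thus ?thesis by simp
qed

lemma component_measurable_lborel [measurable]:
  "i \<in> U \<Longrightarrow> (\<lambda>y. y i) \<in> borel_measurable (lborel_on U)"
  using measurable_component_singleton[of i U "\<lambda>_. lborel :: real measure"] by simp

text \<open>One-variable scaling inside Tonelli's theorem. For \<open>x j \<le> 0\<close> the factor
  \<open>ennreal (y j)\<close> is 0, so \<open>f\<close> has to vanish there.\<close>

lemma nn_integral_scale_coordinate:
  fixes U :: "nat set"
  assumes U: "finite U" "i \<in> U" "j \<in> U" "i \<noteq> j"
    and f [measurable]: "f \<in> borel_measurable (lborel_on U)"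
    and f0: "\<And>x. x \<in> space (lborel_on U) \<Longrightarrow> x j \<le> 0 \<Longrightarrow> f x = (0::ennreal)"
  shows "(\<integral>\<^sup>+x. f x \<partial>lborel_on U) = (\<integral>\<^sup>+y. ennreal (y j) * f (y(i := y j * y i)) \<partial>lborel_on U)"
proof -
  define U' where "U' = U - {i}"
  have U': "finite U'" "i \<notin> U'" "insert i U' = U" "j \<in> U'" using U unfolding U'_def by auto
  have T: "(\<lambda>y::nat \<Rightarrow> real. y(i := y j * y i)) \<in> measurable (lborel_on U) (lborel_on U)"
  proof (rule measurable_PiM_lborel)
    fix k assume k: "k \<in> U"
    show "(\<lambda>y. (y(i := y j * y i)) k) \<in> borel_measurable (lborel_on U)"
      using component_measurable_lborel[OF U(2)] component_measurable_lborel[OF U(3)] component_measurable_lborel[OF k]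
      by (cases "k = i") auto
  qed (use U in \<open>auto simp: space_PiM PiE_iff extensional_def\<close>)
  have g [measurable]: "(\<lambda>y. ennreal (y j) * f (y(i := y j * y i))) \<in> borel_measurable (lborel_on U)"
    using measurable_compose[OF T f] component_measurable_lborel[OF U(3)] by measurable
  have "(\<integral>\<^sup>+x. f x \<partial>lborel_on U) = (\<integral>\<^sup>+x. (\<integral>\<^sup>+t. f (x(i := t)) \<partial>lborel) \<partial>lborel_on U')"
    unfolding U'(3)[symmetric]
    by (rule lborel_prod.product_nn_integral_insert) (use U' f in auto)
  also have "\<dots> = (\<integral>\<^sup>+x. (\<integral>\<^sup>+t. ennreal ((x(i := t)) j) * f ((x(i := t))(i := (x(i := t)) j * (x(i := t)) i)) \<partial>lborel) \<partial>lborel_on U')"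
  proof (rule nn_integral_cong)
    fix x assume x: "x \<in> space (lborel_on U')"
    have xt: "x(i := t) \<in> space (lborel_on U)" for t
      using x U' by (auto simp: space_PiM PiE_iff extensional_def)
    have m: "(\<lambda>t. f (x(i := t))) \<in> borel_measurable borel"
      using measurable_compose[OF measurable_component_update[OF x U'(2)], of f] f unfolding U'(3) by simp
    show "(\<integral>\<^sup>+t. f (x(i := t)) \<partial>lborel) = (\<integral>\<^sup>+t. ennreal ((x(i := t)) j) * f ((x(i := t))(i := (x(i := t)) j * (x(i := t)) i)) \<partial>lborel)"
    proof (cases "x j > 0")
      case True
      have "(\<integral>\<^sup>+t. f (x(i := t)) \<partial>lborel) = ennreal \<bar>x j\<bar> * (\<integral>\<^sup>+t. f (x(i := 0 + x j * t)) \<partial>lborel)"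
        by (rule nn_integral_real_affine[OF m]) (use True in auto)
      also have "\<dots> = (\<integral>\<^sup>+t. ennreal (x j) * f (x(i := x j * t)) \<partial>lborel)"
        using True m by (subst nn_integral_cmult) (auto intro: measurable_compose[OF _ m])
      finally show ?thesis using U by simp
    next
      case False
      hence "f (x(i := t)) = 0" for t using f0[OF xt] U by auto
      moreover have "ennreal (x j) = 0" using False by (simp add: ennreal_neg)
      ultimately show ?thesis using U by simp
    qed
  qed
  also have "\<dots> = (\<integral>\<^sup>+y. ennreal (y j) * f (y(i := y j * y i)) \<partial>lborel_on U)"
    unfolding U'(3)[symmetric]
    by (rule lborel_prod.product_nn_integral_insert[symmetric]) (use U' g in auto)
  finally show ?thesis .
qed

definition scale_by :: "nat set \<Rightarrow> nat \<Rightarrow> (nat \<Rightarrow> real) \<Rightarrow> nat \<Rightarrow> real" where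
  "scale_by A j y = (\<lambda>i. if i \<in> A then y j * y i else y i)"

lemma scale_by_measurable:
  assumes "A \<subseteq> U" "j \<in> U"
  shows "scale_by A j \<in> measurable (lborel_on U) (lborel_on U)"
proof (rule measurable_PiM_lborel)
  fix k assume k: "k \<in> U"
  show "(\<lambda>y. scale_by A j y k) \<in> borel_measurable (lborel_on U)"
    using component_measurable_lborel[OF assms(2)] component_measurable_lborel[OF k] unfolding scale_by_def
    by (cases "k \<in> A") auto
qed (use assms in \<open>auto simp: space_PiM PiE_iff extensional_def scale_by_def\<close>)

lemma nn_integral_scale_by:
  fixes U :: "nat set"
  assumes U: "finite U" "j \<in> U"
    and f: "f \<in> borel_measurable (lborel_on U)"
    and f0: "\<And>x. x \<in> space (lborel_on U) \<Longrightarrow> x j \<le> 0 \<Longrightarrow> f x = (0::ennreal)"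
  shows "finite A \<Longrightarrow> A \<subseteq> U - {j} \<Longrightarrow>
    (\<integral>\<^sup>+x. f x \<partial>lborel_on U) = (\<integral>\<^sup>+y. ennreal (y j) ^ card A * f (scale_by A j y) \<partial>lborel_on U)"
proof (induction A rule: finite_induct)
  case empty
  show ?case by (simp add: scale_by_def)
next
  case (insert i A)
  define g where "g = (\<lambda>y. ennreal (y j) ^ card A * f (scale_by A j y))"
  have A: "A \<subseteq> U" "j \<notin> A" using insert by auto
  have g: "g \<in> borel_measurable (lborel_on U)"
    unfolding g_def using measurable_compose[OF scale_by_measurable[OF A(1) U(2)] f] component_measurable_lborel[OF U(2)]
    by measurable
  have "(\<integral>\<^sup>+x. f x \<partial>lborel_on U) = (\<integral>\<^sup>+y. g y \<partial>lborel_on U)"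
    using insert unfolding g_def by simp
  also have "\<dots> = (\<integral>\<^sup>+y. ennreal (y j) * g (y(i := y j * y i)) \<partial>lborel_on U)"
  proof (rule nn_integral_scale_coordinate[OF U(1) _ U(2) _ g])
    fix x assume x: "x \<in> space (lborel_on U)" "x j \<le> 0"
    have "scale_by A j x \<in> space (lborel_on U)"
      using x A by (auto simp: space_PiM PiE_iff extensional_def scale_by_def)
    moreover have "scale_by A j x j \<le> 0" using x A by (simp add: scale_by_def)
    ultimately show "g x = 0" unfolding g_def using f0 by simp
  qed (use insert in auto)
  also have "\<dots> = (\<integral>\<^sup>+y. ennreal (y j) ^ card (insert i A) * f (scale_by (insert i A) j y) \<partial>lborel_on U)"
  proof (rule nn_integral_cong)
    fix y :: "nat \<Rightarrow> real"
    have "scale_by A j (y(i := y j * y i)) = scale_by (insert i A) j y"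
      using insert by (auto simp: scale_by_def fun_eq_iff)
    thus "ennreal (y j) * g (y(i := y j * y i)) = ennreal (y j) ^ card (insert i A) * f (scale_by (insert i A) j y)"
      using insert unfolding g_def by (auto simp: mult.assoc)
  qed
  finally show ?case .
qed

text \<open>The scale \<open>u\<close> does not depend on the coordinate \<open>j\<close>, so for
  fixed other coordinates this is a linear substitution in one variable.\<close>

lemma nn_integral_rescale_coordinate:
  fixes U :: "nat set"
  assumes U: "finite U" "j \<in> U"
    and f: "f \<in> borel_measurable (lborel_on U)"
    and u: "u \<in> borel_measurable (lborel_on U)" "\<And>y. u y > 0" "\<And>y t. u (y(j := t)) = u y"
  shows "(\<integral>\<^sup>+x. f x \<partial>lborel_on U) = (\<integral>\<^sup>+y. ennreal (1 / u y) * f (y(j := y j / u y)) \<partial>lborel_on U)"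
proof -
  define U' where "U' = U - {j}"
  have U': "finite U'" "j \<notin> U'" "insert j U' = U" using U unfolding U'_def by auto
  have T: "(\<lambda>y. y(j := y j / u y)) \<in> measurable (lborel_on U) (lborel_on U)"
  proof (rule measurable_PiM_lborel)
    fix k assume k: "k \<in> U"
    show "(\<lambda>y. (y(j := y j / u y)) k) \<in> borel_measurable (lborel_on U)"
      using u(1) component_measurable_lborel[OF U(2)] component_measurable_lborel[OF k]
      by (cases "k = j") auto
  qed (use U in \<open>auto simp: space_PiM PiE_iff extensional_def\<close>)
  have g: "(\<lambda>y. ennreal (1 / u y) * f (y(j := y j / u y))) \<in> borel_measurable (lborel_on U)"
    using measurable_compose[OF T f] u(1) by measurable
  have "(\<integral>\<^sup>+x. f x \<partial>lborel_on U) = (\<integral>\<^sup>+x. (\<integral>\<^sup>+t. f (x(j := t)) \<partial>lborel) \<partial>lborel_on U')"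
    unfolding U'(3)[symmetric]
    by (rule lborel_prod.product_nn_integral_insert) (use U' f in auto)
  also have "\<dots> = (\<integral>\<^sup>+x. (\<integral>\<^sup>+t. ennreal (1 / u (x(j := t))) * f ((x(j := t))(j := (x(j := t)) j / u (x(j := t)))) \<partial>lborel) \<partial>lborel_on U')"
  proof (rule nn_integral_cong)
    fix x assume x: "x \<in> space (lborel_on U')"
    have m: "(\<lambda>t. f (x(j := t))) \<in> borel_measurable borel"
      using measurable_compose[OF measurable_component_update[OF x U'(2)], of f] f unfolding U'(3) by simp
    have "(\<integral>\<^sup>+t. f (x(j := t)) \<partial>lborel) = ennreal \<bar>1 / u x\<bar> * (\<integral>\<^sup>+t. f (x(j := 0 + (1 / u x) * t)) \<partial>lborel)"
      by (rule nn_integral_real_affine[OF m]) (use u(2)[of x] in auto)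
    also have "\<dots> = (\<integral>\<^sup>+t. ennreal (1 / u x) * f (x(j := t / u x)) \<partial>lborel)"
      using u(2)[of x] m by (subst nn_integral_cmult) (auto intro: measurable_compose[OF _ m])
    finally show "(\<integral>\<^sup>+t. f (x(j := t)) \<partial>lborel) = (\<integral>\<^sup>+t. ennreal (1 / u (x(j := t))) * f ((x(j := t))(j := (x(j := t)) j / u (x(j := t)))) \<partial>lborel)"
      unfolding u(3) by simp
  qed
  also have "\<dots> = (\<integral>\<^sup>+y. ennreal (1 / u y) * f (y(j := y j / u y)) \<partial>lborel_on U)"
    unfolding U'(3)[symmetric]
    by (rule lborel_prod.product_nn_integral_insert[symmetric]) (use U' g in auto)
  finally show ?thesis .
qed

lemma AE_distinct_coordinates:
  fixes U :: "nat set"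
  assumes U: "finite U" "i \<in> U" "j \<in> U" "i \<noteq> j"
  shows "AE x in lborel_on U. x i \<noteq> x j"
proof -
  define U' where "U' = U - {i}"
  have U': "finite U'" "i \<notin> U'" "insert i U' = U" "j \<in> U'" using U unfolding U'_def by auto
  define f where "f = (\<lambda>x :: nat \<Rightarrow> real. if x i = x j then 1 else 0 :: ennreal)"
  have f: "f \<in> borel_measurable (lborel_on U)"
    unfolding f_def using component_measurable_lborel[OF U(2)] component_measurable_lborel[OF U(3)] by measurable
  have "(\<integral>\<^sup>+x. f x \<partial>lborel_on U) = (\<integral>\<^sup>+x. (\<integral>\<^sup>+t. f (x(i := t)) \<partial>lborel) \<partial>lborel_on U')"
    unfolding U'(3)[symmetric]
    by (rule lborel_prod.product_nn_integral_insert) (use U' f in auto)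
  also have "\<dots> = (\<integral>\<^sup>+x. (\<integral>\<^sup>+t. indicator {x j} t \<partial>lborel) \<partial>lborel_on U')"
    using U by (intro nn_integral_cong) (auto simp: f_def indicator_def)
  also have "\<dots> = 0" by simp
  finally have "AE x in lborel_on U. f x = 0" using f by (simp add: nn_integral_0_iff_AE)
  thus ?thesis by eventually_elim (auto simp: f_def split: if_splits)
qed

section \<open>Sector decomposition\<close>

text \<open>Inside the cube \<open>u = 1\<close>; for the gap simplex, \<open>u\<close> is the sum of all coordinates relative to
  the largest, which turns the constraint on that sum into \<open>y j < 1\<close>.\<close>

definition sector_map :: "nat set \<Rightarrow> nat \<Rightarrow> ((nat \<Rightarrow> real) \<Rightarrow> real) \<Rightarrow> (nat \<Rightarrow> real) \<Rightarrow> nat \<Rightarrow> real" where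
  "sector_map A j u y = scale_by A j (y(j := y j / u y))"

text \<open>The product of the Jacobians of the two substitutions that make up
  \<open>sector_map\<close>. The cut-off to 0 mirrors the restriction to \<open>x j > 0\<close> and
  keeps the density nonnegative.\<close>

definition sector_jacobian :: "nat set \<Rightarrow> nat \<Rightarrow> ((nat \<Rightarrow> real) \<Rightarrow> real) \<Rightarrow> (nat \<Rightarrow> real) \<Rightarrow> real" where
  "sector_jacobian A j u y = (if y j > 0 then (1 / u y) * (y j / u y) ^ card A else 0)"

lemma sector_map_measurable:
  assumes "A \<subseteq> U" "j \<in> U" "u \<in> borel_measurable (lborel_on U)"
  shows "sector_map A j u \<in> measurable (lborel_on U) (lborel_on U)"
proof -
  have "(\<lambda>y. y(j := y j / u y)) \<in> measurable (lborel_on U) (lborel_on U)"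
  proof (rule measurable_PiM_lborel)
    fix k assume k: "k \<in> U"
    show "(\<lambda>y. (y(j := y j / u y)) k) \<in> borel_measurable (lborel_on U)"
      using assms(3) component_measurable_lborel[OF assms(2)] component_measurable_lborel[OF k]
      by (cases "k = j") auto
  qed (use assms in \<open>auto simp: space_PiM PiE_iff extensional_def\<close>)
  from measurable_compose[OF this scale_by_measurable[OF assms(1,2)]]
  show ?thesis unfolding sector_map_def[abs_def] .
qed

lemma sector_jacobian_measurable:
  assumes "j \<in> U" "u \<in> borel_measurable (lborel_on U)"
  shows "sector_jacobian A j u \<in> borel_measurable (lborel_on U)"
  unfolding sector_jacobian_def[abs_def] using assms(2) component_measurable_lborel[OF assms(1)] by measurable

text \<open>An identity of measures, so that integrability and integrals of complex functions
  transfer by the general rules for densities and image measures. The scaling of \<open>A\<close> by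
  the coordinate \<open>j\<close> is substituted first, then the rescaling of that coordinate by
  \<open>u\<close>.\<close>

lemma sector_measure:
  assumes U: "finite U" "j \<in> U" "A \<subseteq> U - {j}"
    and u: "u \<in> borel_measurable (lborel_on U)" "\<And>y. u y > 0" "\<And>y t. u (y(j := t)) = u y"
  shows "density (lborel_on U) (\<lambda>x. ennreal (indicator {x. x j > 0} x)) =
    distr (density (lborel_on U) (\<lambda>y. ennreal (sector_jacobian A j u y))) (lborel_on U) (sector_map A j u)"
proof (rule measure_eqI)
  have A: "A \<subseteq> U" "j \<notin> A" "finite A" using U finite_subset[of A U] by auto
  have T: "sector_map A j u \<in> measurable (lborel_on U) (lborel_on U)"
    by (rule sector_map_measurable[OF A(1) U(2) u(1)])
  have ind: "(\<lambda>x. ennreal (indicator {x. x j > 0} x)) \<in> borel_measurable (lborel_on U)"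
    unfolding indicator_def using component_measurable_lborel[OF U(2)] by simp
  fix X assume "X \<in> sets (density (lborel_on U) (\<lambda>x. ennreal (indicator {x. x j > 0} x)))"
  hence X: "X \<in> sets (lborel_on U)" by simp
  define f where "f = (\<lambda>x :: nat \<Rightarrow> real. ennreal (indicator {x. x j > 0} x) * indicator X x)"
  have f: "f \<in> borel_measurable (lborel_on U)" unfolding f_def using ind X by measurable
  define h where "h = (\<lambda>y. ennreal (y j) ^ card A * f (scale_by A j y))"
  have h: "h \<in> borel_measurable (lborel_on U)"
    unfolding h_def using measurable_compose[OF scale_by_measurable[OF A(1) U(2)] f] component_measurable_lborel[OF U(2)]
    by measurable
  have "emeasure (density (lborel_on U) (\<lambda>x. ennreal (indicator {x. x j > 0} x))) X = (\<integral>\<^sup>+x. f x \<partial>lborel_on U)"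
    unfolding f_def by (rule emeasure_density[OF ind X])
  also have "\<dots> = (\<integral>\<^sup>+y. h y \<partial>lborel_on U)" unfolding h_def
    by (rule nn_integral_scale_by[OF U(1,2) f _ A(3) U(3)]) (simp add: f_def)
  also have "\<dots> = (\<integral>\<^sup>+y. ennreal (1 / u y) * h (y(j := y j / u y)) \<partial>lborel_on U)"
    by (rule nn_integral_rescale_coordinate[OF U(1,2) h u])
  also have "\<dots> = (\<integral>\<^sup>+y. ennreal (sector_jacobian A j u y) * indicator (sector_map A j u -` X \<inter> space (lborel_on U)) y \<partial>lborel_on U)"
  proof (rule nn_integral_cong)
    fix y assume y: "y \<in> space (lborel_on U)"
    have Tj: "sector_map A j u y j = y j / u y" unfolding sector_map_def scale_by_def using A by simp
    show "ennreal (1 / u y) * h (y(j := y j / u y)) = ennreal (sector_jacobian A j u y) * indicator (sector_map A j u -` X \<inter> space (lborel_on U)) y"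
    proof (cases "y j > 0")
      case True
      have up: "u y > 0" by (rule u(2))
      have "ennreal (sector_jacobian A j u y) = ennreal (1 / u y) * ennreal (y j / u y) ^ card A"
        using True up unfolding sector_jacobian_def by (simp add: ennreal_mult[symmetric] ennreal_power)
      moreover have "f (sector_map A j u y) = indicator (sector_map A j u -` X \<inter> space (lborel_on U)) y"
        using True up y Tj unfolding f_def by (simp add: indicator_def)
      ultimately show ?thesis unfolding h_def sector_map_def[symmetric] by (simp add: mult.assoc)
    next
      case False
      hence "f (sector_map A j u y) = 0" using Tj u(2)[of y] unfolding f_def by (simp add: zero_less_divide_iff)
      thus ?thesis using False unfolding h_def sector_map_def[symmetric] sector_jacobian_def by simp
    qed
  qed
  also have "\<dots> = emeasure (density (lborel_on U) (\<lambda>y. ennreal (sector_jacobian A j u y))) (sector_map A j u -` X \<inter> space (lborel_on U))"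
    using sector_jacobian_measurable[OF U(2) u(1)] measurable_sets[OF T X]
    by (subst emeasure_density) auto
  also have "\<dots> = emeasure (distr (density (lborel_on U) (\<lambda>y. ennreal (sector_jacobian A j u y))) (lborel_on U) (sector_map A j u)) X"
    using T X by (subst emeasure_distr) auto
  finally show "emeasure (density (lborel_on U) (\<lambda>x. ennreal (indicator {x. x j > 0} x))) X = \<dots>" .
qed auto

text \<open>The equivalence is later read from right to left: integrability of the singular
  integrand is not known beforehand but follows from that of its transform on the cube.\<close>

lemma sector_integral:
  fixes f :: "(nat \<Rightarrow> real) \<Rightarrow> complex"
  assumes U: "finite U" "j \<in> U" "A \<subseteq> U - {j}"
    and u: "u \<in> borel_measurable (lborel_on U)" "\<And>y. u y > 0" "\<And>y t. u (y(j := t)) = u y"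
    and f: "f \<in> borel_measurable (lborel_on U)"
    and f0: "\<And>x. x \<in> space (lborel_on U) \<Longrightarrow> x j \<le> 0 \<Longrightarrow> f x = 0"
  shows "integrable (lborel_on U) f \<longleftrightarrow> integrable (lborel_on U) (\<lambda>y. sector_jacobian A j u y *\<^sub>R f (sector_map A j u y))" (is ?I)
    and "integral\<^sup>L (lborel_on U) f = (LINT y|lborel_on U. sector_jacobian A j u y *\<^sub>R f (sector_map A j u y))" (is ?E)
proof -
  let ?M = "lborel_on U" and ?T = "sector_map A j u" and ?w = "sector_jacobian A j u"
  have A: "A \<subseteq> U" using U by auto
  have T: "?T \<in> measurable ?M ?M" by (rule sector_map_measurable[OF A U(2) u(1)])
  have Tw: "?T \<in> measurable (density ?M (\<lambda>y. ennreal (?w y))) ?M" using T by simp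
  have w: "?w \<in> borel_measurable ?M" by (rule sector_jacobian_measurable[OF U(2) u(1)])
  have w0: "AE y in ?M. 0 \<le> ?w y" unfolding sector_jacobian_def using u(2) by (auto intro!: AE_I2 simp: less_imp_le)
  have ind: "(\<lambda>x. indicat_real {x. x j > 0} x) \<in> borel_measurable ?M"
    unfolding indicator_def using component_measurable_lborel[OF U(2)] by simp
  have fT: "(\<lambda>y. f (?T y)) \<in> borel_measurable ?M" by (rule measurable_compose[OF T f])
  have eq: "indicat_real {x. x j > 0} x *\<^sub>R f x = f x" if "x \<in> space ?M" for x
    using f0[OF that] by (cases "x j > 0") auto
  have "integrable ?M f \<longleftrightarrow> integrable ?M (\<lambda>x. indicat_real {x. x j > 0} x *\<^sub>R f x)"
    by (rule Bochner_Integration.integrable_cong) (auto simp: eq)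
  also have "\<dots> \<longleftrightarrow> integrable (density ?M (\<lambda>x. ennreal (indicator {x. x j > 0} x))) f"
    by (rule integrable_density[OF f ind, symmetric]) auto
  also have "\<dots> \<longleftrightarrow> integrable (density ?M (\<lambda>y. ennreal (?w y))) (\<lambda>y. f (?T y))"
    unfolding sector_measure[OF U u] by (rule integrable_distr_eq[OF Tw f])
  also have "\<dots> \<longleftrightarrow> integrable ?M (\<lambda>y. ?w y *\<^sub>R f (?T y))"
    by (rule integrable_density[OF fT w w0])
  finally show ?I .
  have "integral\<^sup>L ?M f = integral\<^sup>L ?M (\<lambda>x. indicat_real {x. x j > 0} x *\<^sub>R f x)"
    by (rule Bochner_Integration.integral_cong) (auto simp: eq)
  also have "\<dots> = integral\<^sup>L (density ?M (\<lambda>x. ennreal (indicator {x. x j > 0} x))) f"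
    by (rule integral_density[OF f ind, symmetric]) auto
  also have "\<dots> = integral\<^sup>L (density ?M (\<lambda>y. ennreal (?w y))) (\<lambda>y. f (?T y))"
    unfolding sector_measure[OF U u] by (rule integral_distr[OF Tw f])
  also have "\<dots> = integral\<^sup>L ?M (\<lambda>y. ?w y *\<^sub>R f (?T y))"
    by (rule integral_density[OF fT w w0])
  finally show ?E .
qed

definition max_region :: "nat set \<Rightarrow> nat \<Rightarrow> (nat \<Rightarrow> real) set" where
  "max_region V j = {x. \<forall>i\<in>V - {j}. x i < x j}"

lemma max_region_indicator_measurable:
  assumes "finite V" "V \<subseteq> U" "j \<in> U"
  shows "indicat_real (max_region V j) \<in> borel_measurable (lborel_on U)"
proof -
  have eq: "indicat_real (max_region V j) x = (\<Prod>i\<in>V - {j}. indicat_real {x. x i < x j} x)" for x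
    using assms(1) by (auto simp: max_region_def indicator_def prod_zero_iff)
  have "indicat_real {x. x i < x j} \<in> borel_measurable (lborel_on U)" if "i \<in> V" for i
    unfolding indicator_def using component_measurable_lborel[of i U] component_measurable_lborel[OF assms(3)] that assms(2) by auto
  thus ?thesis unfolding eq[abs_def] by (intro borel_measurable_prod) auto
qed

text \<open>Ties form a null set; off them exactly one coordinate is the largest.\<close>

lemma AE_max_region:
  assumes U: "finite U" "V \<subseteq> U" "V \<noteq> {}"
  shows "AE x in lborel_on U. (\<Sum>j\<in>V. indicat_real (max_region V j) x) = 1"
proof -
  have V: "finite V" using U finite_subset by blast
  have "AE x in lborel_on U. \<forall>i\<in>V. \<forall>j\<in>V - {i}. x i \<noteq> x j"
    using V U by (intro AE_finite_allI) (auto intro!: AE_distinct_coordinates)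
  thus ?thesis
  proof eventually_elim
    case (elim x)
    have "Max (x ` V) \<in> x ` V" using V U by (intro Max_in) auto
    then obtain j where j: "j \<in> V" "x j = Max (x ` V)" by auto
    have le: "x i \<le> x j" if "i \<in> V" for i unfolding j(2) using V that by (intro Max_ge) auto
    have lt: "x i < x j" if "i \<in> V" "i \<noteq> j" for i
      using le[OF that(1)] elim that j(1) by (metis Diff_iff empty_iff insert_iff less_eq_real_def)
    have "indicat_real (max_region V i) x = (if i = j then 1 else 0)" if "i \<in> V" for i
      using lt that j(1) le[OF that] unfolding max_region_def indicator_def by (auto dest: less_le_not_le[THEN iffD1])
    hence "(\<Sum>i\<in>V. indicat_real (max_region V i) x) = (\<Sum>i\<in>V. if i = j then 1 else 0)" by (intro sum.cong) auto
    thus ?case using V j by simp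
  qed
qed

text \<open>Integrability is assumed for the pieces and concluded for the whole, matching the order
  in which it becomes known in the sector recursion.\<close>

lemma integral_split_max:
  fixes f :: "(nat \<Rightarrow> real) \<Rightarrow> complex"
  assumes U: "finite U" "V \<subseteq> U" "V \<noteq> {}" and f: "f \<in> borel_measurable (lborel_on U)"
    and int: "\<And>j. j \<in> V \<Longrightarrow> integrable (lborel_on U) (\<lambda>x. indicat_real (max_region V j) x *\<^sub>R f x)"
  shows "integrable (lborel_on U) f"
    and "integral\<^sup>L (lborel_on U) f = (\<Sum>j\<in>V. LINT x|lborel_on U. indicat_real (max_region V j) x *\<^sub>R f x)"
proof -
  have V: "finite V" using U finite_subset by blast
  let ?s = "\<lambda>x. \<Sum>j\<in>V. indicat_real (max_region V j) x *\<^sub>R f x"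
  have ae: "AE x in lborel_on U. f x = ?s x"
    using AE_max_region[OF U] by eventually_elim (simp add: scaleR_sum_left[symmetric])
  have s: "integrable (lborel_on U) ?s" by (intro Bochner_Integration.integrable_sum int)
  show "integrable (lborel_on U) f" using integrable_cong_AE_imp[OF s f] ae by (auto simp: eq_commute)
  have "integral\<^sup>L (lborel_on U) f = integral\<^sup>L (lborel_on U) ?s"
    by (rule integral_cong_AE[OF f _ ae]) (use s in auto)
  also have "\<dots> = (\<Sum>j\<in>V. LINT x|lborel_on U. indicat_real (max_region V j) x *\<^sub>R f x)"
    by (rule Bochner_Integration.integral_sum[OF int])
  finally show "integral\<^sup>L (lborel_on U) f = \<dots>" .
qed

definition interval_product :: "nat set set \<Rightarrow> complex \<Rightarrow> (nat \<Rightarrow> real) \<Rightarrow> complex" where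
  "interval_product I H x = (\<Prod>J\<in>I. complex_of_real (\<Sum>i\<in>J. x i) powr (2 * H - 2))"

lemma interval_product_measurable:
  assumes "\<And>J. J \<in> I \<Longrightarrow> J \<subseteq> U"
  shows "interval_product I H \<in> borel_measurable (lborel_on U)"
proof -
  have "(\<lambda>x. complex_of_real (\<Sum>i\<in>J. x i)) \<in> borel_measurable (lborel_on U)" if "J \<in> I" for J
  proof -
    have "(\<lambda>x. \<Sum>i\<in>J. x i) \<in> borel_measurable (lborel_on U)"
      using assms[OF that] by (intro borel_measurable_sum component_measurable_lborel) auto
    thus ?thesis by measurable
  qed
  thus ?thesis unfolding interval_product_def
    by (intro borel_measurable_prod powr_complex_measurable) auto
qed

lemma powr_of_real_exp:
  "t > 0 \<Longrightarrow> complex_of_real t powr s = exp (s * complex_of_real (ln t))"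
  unfolding powr_def by (simp add: Ln_of_real)

text \<open>Interval sums are homogeneous of degree 1, so every factor releases the power
  \<open>2 * H - 2\<close> of \<open>t\<close>. An interval containing \<open>j\<close> leaves 1
  plus a sum of other coordinates, whose power is an amplitude; one avoiding \<open>j\<close> keeps
  its form in the variables \<open>y\<close>.\<close>

lemma interval_product_scale:
  assumes I: "finite I" "\<And>J. J \<in> I \<Longrightarrow> finite J \<and> J \<noteq> {} \<and> J \<subseteq> V"
    and t: "t > 0" and y: "\<And>i. i \<in> V \<Longrightarrow> y i > 0"
    and x: "x j = t" "\<And>i. i \<in> V \<Longrightarrow> i \<noteq> j \<Longrightarrow> x i = t * y i"
  shows "interval_product I H x = exp (of_nat (card I) * ((2 * H - 2) * complex_of_real (ln t))) *
     ((\<Prod>J\<in>{J\<in>I. j \<in> J}. exp ((2 * H - 2) * complex_of_real (ln (1 + (\<Sum>i\<in>J - {j}. y i))))) *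
      interval_product {J\<in>I. j \<notin> J} H y)"
proof -
  let ?e = "exp ((2 * H - 2) * complex_of_real (ln t))"
  have A: "complex_of_real (\<Sum>i\<in>J. x i) powr (2 * H - 2) = ?e * exp ((2 * H - 2) * complex_of_real (ln (1 + (\<Sum>i\<in>J - {j}. y i))))"
    if J: "J \<in> I" "j \<in> J" for J
  proof -
    have "(\<Sum>i\<in>J. x i) = x j + (\<Sum>i\<in>J - {j}. x i)" using I J by (simp add: sum.remove)
    also have "(\<Sum>i\<in>J - {j}. x i) = (\<Sum>i\<in>J - {j}. t * y i)" using I(2)[OF J(1)] x by (intro sum.cong) auto
    finally have s: "(\<Sum>i\<in>J. x i) = t * (1 + (\<Sum>i\<in>J - {j}. y i))" by (simp add: x sum_distrib_left algebra_simps)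
    have p: "(\<Sum>i\<in>J - {j}. y i) \<ge> 0" using I(2)[OF J(1)] y by (intro sum_nonneg) (auto intro: less_imp_le)
    hence L: "ln (\<Sum>i\<in>J. x i) = ln t + ln (1 + (\<Sum>i\<in>J - {j}. y i))" and P: "(\<Sum>i\<in>J. x i) > 0"
      unfolding s using t by (auto intro!: ln_mult_pos)
    show ?thesis unfolding powr_of_real_exp[OF P] L by (simp add: exp_add[symmetric] algebra_simps)
  qed
  have B: "complex_of_real (\<Sum>i\<in>J. x i) powr (2 * H - 2) = ?e * complex_of_real (\<Sum>i\<in>J. y i) powr (2 * H - 2)"
    if J: "J \<in> I" "j \<notin> J" for J
  proof -
    have "(\<Sum>i\<in>J. x i) = (\<Sum>i\<in>J. t * y i)" using I(2)[OF J(1)] x J by (intro sum.cong refl) (metis subsetD)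
    hence s: "(\<Sum>i\<in>J. x i) = t * (\<Sum>i\<in>J. y i)" by (simp add: sum_distrib_left)
    have p: "(\<Sum>i\<in>J. y i) > 0" using I(2)[OF J(1)] y by (intro sum_pos) auto
    hence L: "ln (\<Sum>i\<in>J. x i) = ln t + ln (\<Sum>i\<in>J. y i)" and P: "(\<Sum>i\<in>J. x i) > 0"
      unfolding s using t by (auto intro!: ln_mult_pos)
    show ?thesis unfolding powr_of_real_exp[OF P] powr_of_real_exp[OF p] L
      by (simp add: exp_add[symmetric] algebra_simps)
  qed
  have "interval_product I H x = (\<Prod>J\<in>{J\<in>I. j \<in> J} \<union> {J\<in>I. j \<notin> J}. complex_of_real (\<Sum>i\<in>J. x i) powr (2 * H - 2))"
    unfolding interval_product_def by (intro prod.cong) auto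
  also have "\<dots> = (\<Prod>J\<in>{J\<in>I. j \<in> J}. complex_of_real (\<Sum>i\<in>J. x i) powr (2 * H - 2)) *
      (\<Prod>J\<in>{J\<in>I. j \<notin> J}. complex_of_real (\<Sum>i\<in>J. x i) powr (2 * H - 2))"
    using I by (intro prod.union_disjoint) auto
  also have "\<dots> = (\<Prod>J\<in>{J\<in>I. j \<in> J}. ?e * exp ((2 * H - 2) * complex_of_real (ln (1 + (\<Sum>i\<in>J - {j}. y i))))) *
      (\<Prod>J\<in>{J\<in>I. j \<notin> J}. ?e * complex_of_real (\<Sum>i\<in>J. y i) powr (2 * H - 2))"
    using A B by (intro arg_cong2[of _ _ _ _ "(*)"] prod.cong) auto
  also have "\<dots> = ?e ^ card {J\<in>I. j \<in> J} * ?e ^ card {J\<in>I. j \<notin> J} *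
     ((\<Prod>J\<in>{J\<in>I. j \<in> J}. exp ((2 * H - 2) * complex_of_real (ln (1 + (\<Sum>i\<in>J - {j}. y i))))) * interval_product {J\<in>I. j \<notin> J} H y)"
    unfolding interval_product_def by (simp add: prod.distrib)
  also have "?e ^ card {J\<in>I. j \<in> J} * ?e ^ card {J\<in>I. j \<notin> J} = ?e ^ card I"
  proof -
    have "card I = card ({J\<in>I. j \<in> J} \<union> {J\<in>I. j \<notin> J})" by (rule arg_cong[of _ _ card]) auto
    also have "\<dots> = card {J\<in>I. j \<in> J} + card {J\<in>I. j \<notin> J}" using I by (intro card_Un_disjoint) auto
    finally show ?thesis by (simp add: power_add)
  qed
  also have "?e ^ card I = exp (of_nat (card I) * ((2 * H - 2) * complex_of_real (ln t)))"
    by (rule exp_of_nat_mult[symmetric])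
  finally show ?thesis .
qed

text \<open>\<open>W\<close> holds the coordinates already split off, each with its own exponent;
  \<open>V\<close> holds those still coupled through the intervals in \<open>I\<close>, which lie
  inside \<open>V\<close> wherever this is used.\<close>

definition sector_integrand ::
    "nat set \<Rightarrow> nat set \<Rightarrow> (nat \<Rightarrow> real) \<Rightarrow> (nat \<Rightarrow> real) \<Rightarrow> ((nat \<Rightarrow> real) \<Rightarrow> complex \<Rightarrow> complex) \<Rightarrow>
      nat set set \<Rightarrow> complex \<Rightarrow> (nat \<Rightarrow> real) \<Rightarrow> complex" where
  "sector_integrand W V a b G I H x =
     indicat_real (cube (W \<union> V)) x *\<^sub>R (power_weight W a b H x * G x H * interval_product I H x)"

lemma sector_integrand_measurable:
  assumes "finite (W \<union> V)" "G \<in> amplitude (W \<union> V)" "\<And>J. J \<in> I \<Longrightarrow> J \<subseteq> V"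
  shows "sector_integrand W V a b G I H \<in> borel_measurable (lborel_on (W \<union> V))"
proof -
  have "interval_product I H \<in> borel_measurable (lborel_on (W \<union> V))"
    using assms by (intro interval_product_measurable) blast
  moreover have "power_weight W a b H \<in> borel_measurable (lborel_on (W \<union> V))"
    by (rule power_weight_measurable) auto
  ultimately show ?thesis unfolding sector_integrand_def[abs_def]
    using amplitude_measurable[OF assms(2)] cube_sets[OF assms(1)]
    by (intro borel_measurable_scaleR borel_measurable_times borel_measurable_indicator)
qed

lemma sector_amplitude:
  assumes "finite I" "\<And>J. J \<in> I \<Longrightarrow> finite J \<and> J \<subseteq> U"
  shows "(\<lambda>y H. \<Prod>J\<in>{J\<in>I. j \<in> J}. exp ((2 * H - 2) * complex_of_real (ln (1 + (\<Sum>i\<in>J - {j}. y i))))) \<in> amplitude U"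
  using assms by (intro amplitude_prod amplitude_powr pos_poly_sum pos_poly_var holomorphic_intros) auto

text \<open>The exponent is \<open>n - 1\<close> from the Jacobian plus \<open>m\<close> times
  \<open>2 * c - 2\<close>, and \<open>2 * c - 2 > -1\<close>. Here the bound on the number of
  intervals meets the condition \<open>c > 1/2\<close>.\<close>

lemma sector_exponent:
  assumes "(c::real) > 1 / 2" "m \<le> n" "n > 0"
  shows "2 * real m * c + (real n - 1 - 2 * real m) > -1"
proof -
  have eq: "2 * real m * c + (real n - 1 - 2 * real m) = real m * (2 * c - 2) + (real n - 1)" by (simp add: algebra_simps)
  show ?thesis
  proof (cases "m = 0")
    case False
    hence "real m * (2 * c - 2) > real m * (- 1)" using assms by (intro mult_strict_left_mono) auto
    thus ?thesis unfolding eq using assms by simp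
  qed (use assms in auto)
qed

text \<open>Without intervals the exponent is the constant \<open>n - 1\<close>, which excludes a
  zero. Otherwise solving for \<open>H\<close> gives the progression of the theorem, with
  \<open>n\<close> gaps and \<open>m\<close> intervals.\<close>

lemma sector_pole:
  assumes "complex_of_real (2 * real m) * H + complex_of_real (real n - 1 - 2 * real m) + 1 + of_nat l = 0" "n > 0"
  shows "m > 0" "H = 1 - of_nat (n + l) / (2 * of_nat m)"
proof -
  show m: "m > 0"
  proof (rule ccontr)
    assume "\<not> m > 0"
    hence "complex_of_real (real n) + of_nat l = 0" using assms(1) by (simp add: algebra_simps)
    hence "complex_of_nat (n + l) = 0" by simp
    thus False using assms(2) unfolding of_nat_eq_0_iff by simp
  qed
  show "H = 1 - of_nat (n + l) / (2 * of_nat m)" using assms(1) m by (simp add: field_simps)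
qed

text \<open>Induction on the number of coupled coordinates. On the sector where \<open>j\<close> is
  the largest coordinate of \<open>V\<close>, the others are divided by it: \<open>j\<close> moves
  to \<open>W\<close>, the intervals through \<open>j\<close> dissolve into the amplitude, and the
  rest lie in \<open>V - {j}\<close>. The set \<open>S\<close> that labels a pole is the value of
  \<open>V\<close> at the moment when its largest coordinate is split off.\<close>

lemma sector_continues:
  "card V = n \<Longrightarrow> finite V \<Longrightarrow> finite W \<Longrightarrow> W \<inter> V = {} \<Longrightarrow> G \<in> amplitude (W \<union> V) \<Longrightarrow>
   (\<And>J. J \<in> I \<Longrightarrow> J \<subseteq> V \<and> J \<noteq> {}) \<Longrightarrow>
   (\<And>S. S \<subseteq> V \<Longrightarrow> card {J\<in>I. J \<subseteq> S} \<le> card S) \<Longrightarrow>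
   (\<And>i. a i \<ge> 0) \<Longrightarrow>
   (\<And>i H. i \<in> W \<Longrightarrow> Re H > 1 / 2 \<Longrightarrow> a i * Re H + b i > -1) \<Longrightarrow>
   (\<And>i l H. i \<in> W \<Longrightarrow> complex_of_real (a i) * H + complex_of_real (b i) + 1 + of_nat l = 0 \<Longrightarrow> H \<in> E) \<Longrightarrow>
   (\<And>S l. S \<subseteq> V \<Longrightarrow> card {J\<in>I. J \<subseteq> S} > 0 \<Longrightarrow>
       1 - of_nat (card S + l) / (2 * of_nat (card {J\<in>I. J \<subseteq> S})) \<in> E) \<Longrightarrow>
   (\<forall>H. Re H > 1 / 2 \<longrightarrow> integrable (lborel_on (W \<union> V)) (sector_integrand W V a b G I H)) \<and>
   continues_off (\<lambda>H. integral\<^sup>L (lborel_on (W \<union> V)) (sector_integrand W V a b G I H)) E"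
proof (induction n arbitrary: V W a b G I)
  case 0
  hence V: "V = {}" by simp
  hence I: "I = {}" using 0(6) by blast
  have eq: "sector_integrand W V a b G I H = (\<lambda>y. indicat_real (cube W) y *\<^sub>R (power_weight W a b H y * G y H))" for H
    unfolding sector_integrand_def V I interval_product_def by auto
  have G: "G \<in> amplitude W" using 0(5) V by simp
  show ?case unfolding eq
  proof (intro conjI allI impI)
    fix H assume "Re H > 1/2"
    thus "integrable (lborel_on (W \<union> V)) (\<lambda>y. indicat_real (cube W) y *\<^sub>R (power_weight W a b H y * G y H))"
      unfolding set_integrable_def[symmetric] V Un_empty_right
      by (intro cube_integral_integrable 0 G)
  next
    show "continues_off (\<lambda>H. LINT y|lborel_on (W \<union> V). indicat_real (cube W) y *\<^sub>R (power_weight W a b H y * G y H)) E"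
      unfolding continues_off_def V Un_empty_right cube_integral_def[symmetric] set_lebesgue_integral_def[symmetric]
      by (intro allI cube_integral_continues 0 G)
  qed
next
  case (Suc n V W a b G I)
  note V = Suc.prems(1,2) and W = Suc.prems(3,4) and G = Suc.prems(5) and I = Suc.prems(6) and hered = Suc.prems(7)
  let ?U = "W \<union> V"
  have finI: "finite I" by (rule finite_subset[of _ "Pow V"]) (use I V in auto)
  have finJ: "finite J \<and> J \<noteq> {} \<and> J \<subseteq> V" if "J \<in> I" for J using I[OF that] V finite_subset by blast
  have Vne: "V \<noteq> {}" using V by auto
  have U: "finite ?U" using V W by simp
  have IV: "{J\<in>I. J \<subseteq> V} = I" using I by auto
  have mn: "card I \<le> Suc n" using hered[of V] V IV by simp
  \<comment> \<open>The new exponent \<open>card V - 1 + (2 * H - 2) * card I\<close>, written as an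
    affine function of \<open>H\<close>.\<close>
  define a' where "a' = (\<lambda>j. a(j := 2 * real (card I)))"
  define b' where "b' = (\<lambda>j. b(j := real (Suc n) - 1 - 2 * real (card I)))"
  define I' where "I' = (\<lambda>j. {J\<in>I. j \<notin> J})"
  define G' where "G' = (\<lambda>j y H. G (scale_by (V - {j}) j y) H *
     (\<Prod>J\<in>{J\<in>I. j \<in> J}. exp ((2 * H - 2) * complex_of_real (ln (1 + (\<Sum>i\<in>J - {j}. y i))))))"
  have UU: "insert j W \<union> (V - {j}) = ?U" if "j \<in> V" for j using that by auto
  have G'A: "G' j \<in> amplitude ?U" if j: "j \<in> V" for j
  proof -
    have "(\<lambda>y. G (scale_by (V - {j}) j y)) \<in> amplitude ?U"
    proof (rule amplitude_subst[OF G])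
      fix i assume "i \<in> ?U"
      thus "(\<lambda>y. scale_by (V - {j}) j y i) \<in> pos_poly ?U"
        unfolding scale_by_def using j by (cases "i \<in> V - {j}") (auto intro: pos_poly.intros)
    qed
    moreover have "(\<lambda>y H. \<Prod>J\<in>{J\<in>I. j \<in> J}. exp ((2 * H - 2) * complex_of_real (ln (1 + (\<Sum>i\<in>J - {j}. y i))))) \<in> amplitude ?U"
      using finJ by (intro sector_amplitude finI) auto
    ultimately show ?thesis unfolding G'_def by (rule amplitude_mult)
  qed
  have IH: "(\<forall>H. Re H > 1 / 2 \<longrightarrow> integrable (lborel_on ?U) (sector_integrand (insert j W) (V - {j}) (a' j) (b' j) (G' j) (I' j) H)) \<and>
     continues_off (\<lambda>H. integral\<^sup>L (lborel_on ?U) (sector_integrand (insert j W) (V - {j}) (a' j) (b' j) (G' j) (I' j) H)) E"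
    if j: "j \<in> V" for j
    unfolding UU[OF j, symmetric]
  proof (rule Suc.IH)
    show "card (V - {j}) = n" using V j by simp
    show "G' j \<in> amplitude (insert j W \<union> (V - {j}))" using G'A[OF j] UU[OF j] by simp
    show "J \<subseteq> V - {j} \<and> J \<noteq> {}" if "J \<in> I' j" for J using that I unfolding I'_def by blast
    \<comment> \<open>An interval inside a set avoiding \<open>j\<close> avoids \<open>j\<close>
      itself, so the counts for smaller sets do not change and both hypotheses on subsets are
      inherited.\<close>
    have sub: "{J\<in>I' j. J \<subseteq> S} = {J\<in>I. J \<subseteq> S}" if "S \<subseteq> V - {j}" for S using that unfolding I'_def by auto
    show "card {J\<in>I' j. J \<subseteq> S} \<le> card S" if "S \<subseteq> V - {j}" for S
      unfolding sub[OF that] using that by (intro hered) auto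
    show "a' j i \<ge> 0" for i unfolding a'_def using Suc.prems(8) by simp
    show "- 1 < a' j i * Re H + b' j i" if "i \<in> insert j W" "1 / 2 < Re H" for i H
    proof (cases "i = j")
      case True thus ?thesis unfolding a'_def b'_def using sector_exponent[OF that(2) mn] by simp
    next
      case False thus ?thesis unfolding a'_def b'_def using that Suc.prems(9) by auto
    qed
    show "H \<in> E" if H: "i \<in> insert j W" "complex_of_real (a' j i) * H + complex_of_real (b' j i) + 1 + of_nat l = 0" for i l H
    proof (cases "i = j")
      case True
      hence "complex_of_real (2 * real (card I)) * H + complex_of_real (real (Suc n) - 1 - 2 * real (card I)) + 1 + of_nat l = 0"
        using H(2) unfolding a'_def b'_def by simp
      from sector_pole[OF this] have "card I > 0" "H = 1 - of_nat (Suc n + l) / (2 * of_nat (card I))" by auto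
      thus ?thesis using Suc.prems(11)[of V l] V IV by simp
    next
      case False thus ?thesis using H Suc.prems(10)[of i H l] unfolding a'_def b'_def by auto
    qed
    show "1 - of_nat (card S + l) / (2 * of_nat (card {J\<in>I' j. J \<subseteq> S})) \<in> E"
      if "S \<subseteq> V - {j}" "card {J\<in>I' j. J \<subseteq> S} > 0" for S l
      using that(2) unfolding sub[OF that(1)] by (intro Suc.prems(11)) (use that in auto)
  qed (use V W j in auto)
  have key: "integrable (lborel_on ?U) (\<lambda>x. indicat_real (max_region V j) x *\<^sub>R sector_integrand W V a b G I H x) \<longleftrightarrow>
       integrable (lborel_on ?U) (sector_integrand (insert j W) (V - {j}) (a' j) (b' j) (G' j) (I' j) H)"
     "integral\<^sup>L (lborel_on ?U) (\<lambda>x. indicat_real (max_region V j) x *\<^sub>R sector_integrand W V a b G I H x) =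
       integral\<^sup>L (lborel_on ?U) (sector_integrand (insert j W) (V - {j}) (a' j) (b' j) (G' j) (I' j) H)"
    if j: "j \<in> V" for j H
  proof -
    let ?A = "V - {j}" and ?u = "\<lambda>_ :: nat \<Rightarrow> real. 1 :: real"
    let ?f = "\<lambda>x. indicat_real (max_region V j) x *\<^sub>R sector_integrand W V a b G I H x"
    have m: "?f \<in> borel_measurable (lborel_on ?U)"
      using sector_integrand_measurable[OF U G] I max_region_indicator_measurable[of V ?U j] V j
      by (intro borel_measurable_scaleR) auto
    have z: "?f x = 0" if "x \<in> space (lborel_on ?U)" "x j \<le> 0" for x
      using that cube_bound(2)[of x ?U j] j unfolding sector_integrand_def by (auto simp: indicator_def)
    have eq: "sector_jacobian ?A j ?u y *\<^sub>R ?f (sector_map ?A j ?u y) = sector_integrand (insert j W) (V - {j}) (a' j) (b' j) (G' j) (I' j) H y"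
      if y: "y \<in> space (lborel_on ?U)" for y
    proof -
      define x where "x = sector_map ?A j ?u y"
      have x: "x = scale_by ?A j y" unfolding x_def sector_map_def by simp
      have xj: "x j = y j" unfolding x scale_by_def by simp
      have xi: "x i = y j * y i" if "i \<in> V" "i \<noteq> j" for i unfolding x scale_by_def using that by simp
      have xw: "x i = y i" if "i \<in> W" for i unfolding x scale_by_def using that W by auto
      have xs: "x \<in> extensional ?U" using y j unfolding x scale_by_def by (auto simp: space_PiM PiE_iff extensional_def)
      have ys: "y \<in> extensional ?U" using y by (auto simp: space_PiM PiE_iff)
      \<comment> \<open>In the new coordinates the sector is the whole cube:
        \<open>x i < x j\<close> means \<open>y i < 1\<close>, and \<open>x i < 1\<close> then
        follows from \<open>x j < 1\<close>.\<close>
      have reg: "y j > 0 \<and> x \<in> cube ?U \<and> x \<in> max_region V j \<longleftrightarrow> y \<in> cube ?U"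
      proof
        assume h: "y j > 0 \<and> x \<in> cube ?U \<and> x \<in> max_region V j"
        have "0 < y i \<and> y i < 1" if "i \<in> ?U" for i
        proof (cases "i \<in> V \<and> i \<noteq> j")
          case True
          hence "0 < x i" "x i < x j" using h cube_bound(2)[of x ?U i] unfolding max_region_def by auto
          hence "0 < y j * y i" "y j * y i < y j * 1" using xi[of i] True xj by auto
          thus ?thesis using h zero_less_mult_pos mult_less_cancel_left_pos by blast
        next
          case False
          hence "x i = y i" using that xj xw by auto
          thus ?thesis using h cube_bound(2,3)[of x ?U i] that by auto
        qed
        thus "y \<in> cube ?U" using ys unfolding cube_def by (auto simp: PiE_iff)
      next
        assume h: "y \<in> cube ?U"
        have yp: "0 < y i" "y i < 1" if "i \<in> ?U" for i using cube_bound(2,3)[OF h that] by auto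
        have jU: "j \<in> ?U" using j by simp
        have lt: "0 < x i" "x i < x j" if "i \<in> V" "i \<noteq> j" for i
          using yp[of i] yp[OF jU] that unfolding xi[OF that] xj by auto
        have "0 < x i \<and> x i < 1" if "i \<in> ?U" for i
          using lt[of i] yp[OF that] yp[OF jU] xj xw that by (cases "i \<in> W"; cases "i = j") auto
        thus "y j > 0 \<and> x \<in> cube ?U \<and> x \<in> max_region V j"
          using xs yp[OF jU] lt unfolding cube_def max_region_def by (auto simp: PiE_iff)
      qed
      show ?thesis
      proof (cases "y \<in> cube ?U")
        case False
        have "sector_jacobian ?A j ?u y *\<^sub>R ?f x = 0"
          using reg False unfolding sector_jacobian_def sector_integrand_def by (auto simp: indicator_def)
        thus ?thesis using False unfolding x_def[symmetric] sector_integrand_def UU[OF j] by simp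
      next
        case True
        hence xr: "y j > 0" "x \<in> cube ?U" "x \<in> max_region V j" using reg by auto
        have yp: "0 < y i" if "i \<in> ?U" for i using cube_bound(2)[OF True that] .
        have ip: "interval_product I H x = exp (of_nat (card I) * ((2 * H - 2) * complex_of_real (ln (y j)))) *
           ((\<Prod>J\<in>{J\<in>I. j \<in> J}. exp ((2 * H - 2) * complex_of_real (ln (1 + (\<Sum>i\<in>J - {j}. y i))))) * interval_product (I' j) H y)"
          unfolding I'_def by (rule interval_product_scale[where V = V and t = "y j" and x = x and y = y and j = j, OF finI finJ xr(1) _ xj xi]) (use yp in auto)
        have pw: "power_weight W a b H x = power_weight W a b H y"
          by (rule power_weight_cong) (use xw in auto)
        have pw': "power_weight (insert j W) (a' j) (b' j) H y =
           power_weight W a b H y * (complex_of_real (y j) powr (complex_of_real (2 * real (card I)) * H + complex_of_real (real (Suc n) - 1 - 2 * real (card I))))"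
        proof -
          have "j \<notin> W" using j W by auto
          hence "power_weight W (a' j) (b' j) H y = power_weight W a b H y"
            by (intro power_weight_cong) (auto simp: a'_def b'_def)
          thus ?thesis using \<open>j \<notin> W\<close> W by (simp add: power_weight_insert a'_def b'_def)
        qed
        have ex: "complex_of_real (y j) powr (complex_of_real (2 * real (card I)) * H + complex_of_real (real (Suc n) - 1 - 2 * real (card I)))
           = complex_of_real (y j ^ n) * exp (of_nat (card I) * ((2 * H - 2) * complex_of_real (ln (y j))))"
        proof -
          have "complex_of_real (y j ^ n) = exp (of_nat n * complex_of_real (ln (y j)))"
            using xr(1) by (simp add: exp_of_nat_mult exp_of_real)
          thus ?thesis unfolding powr_of_real_exp[OF xr(1)] by (simp add: exp_add[symmetric] algebra_simps)
        qed
        have "sector_jacobian ?A j ?u y *\<^sub>R ?f x = complex_of_real (y j ^ n) * (power_weight W a b H x * G x H * interval_product I H x)"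
          using xr V j unfolding sector_jacobian_def sector_integrand_def by (simp add: scaleR_conv_of_real)
        also have "\<dots> = power_weight (insert j W) (a' j) (b' j) H y * G' j y H * interval_product (I' j) H y"
          unfolding ip pw pw' ex G'_def x[symmetric] by simp
        finally show ?thesis using True unfolding x_def[symmetric] sector_integrand_def UU[OF j] by simp
      qed
    qed
    have s: "integrable (lborel_on ?U) ?f \<longleftrightarrow> integrable (lborel_on ?U) (\<lambda>y. sector_jacobian ?A j ?u y *\<^sub>R ?f (sector_map ?A j ?u y))"
      "integral\<^sup>L (lborel_on ?U) ?f = (LINT y|lborel_on ?U. sector_jacobian ?A j ?u y *\<^sub>R ?f (sector_map ?A j ?u y))"
      by (rule sector_integral[OF U _ _ _ _ _ m z]; use j in auto)+
    show "integrable (lborel_on ?U) ?f \<longleftrightarrow>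
       integrable (lborel_on ?U) (sector_integrand (insert j W) (V - {j}) (a' j) (b' j) (G' j) (I' j) H)"
      unfolding s(1) by (rule Bochner_Integration.integrable_cong[OF refl eq])
    show "integral\<^sup>L (lborel_on ?U) ?f =
       integral\<^sup>L (lborel_on ?U) (sector_integrand (insert j W) (V - {j}) (a' j) (b' j) (G' j) (I' j) H)"
      unfolding s(2) by (rule Bochner_Integration.integral_cong[OF refl eq])
  qed
  have fm: "sector_integrand W V a b G I H \<in> borel_measurable (lborel_on ?U)" for H
    using sector_integrand_measurable[OF U G] I by auto
  have parts: "integrable (lborel_on ?U) (\<lambda>x. indicat_real (max_region V j) x *\<^sub>R sector_integrand W V a b G I H x)"
    if "j \<in> V" "Re H > 1/2" for j H using key(1)[OF that(1)] IH[OF that(1)] that(2) by blast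
  have VU: "V \<subseteq> ?U" by simp
  show ?case
  proof (intro conjI allI impI)
    fix H assume H: "Re H > 1/2"
    show "integrable (lborel_on ?U) (sector_integrand W V a b G I H)"
      by (rule integral_split_max(1)[OF U VU Vne fm parts[OF _ H]])
  next
    have "continues_off (\<lambda>H. \<Sum>j\<in>V. integral\<^sup>L (lborel_on ?U) (sector_integrand (insert j W) (V - {j}) (a' j) (b' j) (G' j) (I' j) H)) E"
      using IH by (intro continues_off_sum V(2)) blast
    thus "continues_off (\<lambda>H. integral\<^sup>L (lborel_on ?U) (sector_integrand W V a b G I H)) E"
    proof (rule continues_off_cong)
      fix H :: complex assume H: "Re H > 1/2"
      show "(\<Sum>j\<in>V. integral\<^sup>L (lborel_on ?U) (sector_integrand (insert j W) (V - {j}) (a' j) (b' j) (G' j) (I' j) H))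
         = integral\<^sup>L (lborel_on ?U) (sector_integrand W V a b G I H)"
        unfolding integral_split_max(2)[where f = "sector_integrand W V a b G I H", OF U VU Vne fm parts[OF _ H], simplified]
        by (intro sum.cong refl key(2)[symmetric])
    qed
  qed
qed

section \<open>From the simplex of gaps to the cube\<close>

definition gap_simplex :: "nat set \<Rightarrow> (nat \<Rightarrow> real) set" where
  "gap_simplex V = {x. (\<forall>i\<in>V. x i > 0) \<and> (\<Sum>i\<in>V. x i) < 1}"

lemma gap_simplex_indicator_measurable:
  assumes "finite V"
  shows "indicat_real (gap_simplex V) \<in> borel_measurable (lborel_on V)"
proof -
  have eq: "indicat_real (gap_simplex V) x = (\<Prod>i\<in>V. indicat_real {x. x i > 0} x) * indicat_real {x. (\<Sum>i\<in>V. x i) < 1} x" for x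
    using assms by (auto simp: gap_simplex_def indicator_def prod_zero_iff)
  have "indicat_real {x. x i > 0} \<in> borel_measurable (lborel_on V)" if "i \<in> V" for i
    unfolding indicator_def using component_measurable_lborel[OF that] by auto
  moreover have "(\<lambda>x. \<Sum>i\<in>V. x i) \<in> borel_measurable (lborel_on V)"
    by (intro borel_measurable_sum component_measurable_lborel)
  hence "indicat_real {x. (\<Sum>i\<in>V. x i) < 1} \<in> borel_measurable (lborel_on V)"
    unfolding indicator_def by auto
  ultimately show ?thesis unfolding eq[abs_def] by (intro borel_measurable_times borel_measurable_prod) auto
qed

text \<open>Only the first step sees the simplex; after it the integrals are those of
  \<open>sector_continues\<close> with \<open>W = {j}\<close>. The price of the rescaling by
  \<open>u\<close> is one more amplitude factor, a power of 1 plus the sum of the other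
  coordinates.\<close>

lemma gap_integral_continues:
  assumes V: "finite V" "V \<noteq> {}" and I: "\<And>J. J \<in> I \<Longrightarrow> J \<subseteq> V \<and> J \<noteq> {}"
    and hered: "\<And>S. S \<subseteq> V \<Longrightarrow> card {J\<in>I. J \<subseteq> S} \<le> card S"
    and E: "\<And>S l. S \<subseteq> V \<Longrightarrow> card {J\<in>I. J \<subseteq> S} > 0 \<Longrightarrow>
       1 - of_nat (card S + l) / (2 * of_nat (card {J\<in>I. J \<subseteq> S})) \<in> E"
  defines "f \<equiv> (\<lambda>H x. indicat_real (gap_simplex V) x *\<^sub>R interval_product I H x)"
  shows "Re H > 1 / 2 \<Longrightarrow> integrable (lborel_on V) (f H)"
    and "continues_off (\<lambda>H. integral\<^sup>L (lborel_on V) (f H)) E"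
proof -
  define n where "n = card V - 1"
  have n: "card V = Suc n" unfolding n_def using V by (simp add: card_gt_0_iff)
  have finI: "finite I" by (rule finite_subset[of _ "Pow V"]) (use I V in auto)
  have finJ: "finite J \<and> J \<noteq> {} \<and> J \<subseteq> V" if "J \<in> I" for J using I[OF that] V finite_subset by blast
  have IV: "{J\<in>I. J \<subseteq> V} = I" using I by auto
  have mn: "card I \<le> Suc n" using hered[of V] n IV by simp
  define a where "a = (\<lambda>_ :: nat. 2 * real (card I))"
  define b where "b = (\<lambda>_ :: nat. real (Suc n) - 1 - 2 * real (card I))"
  define I' where "I' = (\<lambda>j. {J\<in>I. j \<notin> J})"
  \<comment> \<open>The absolute values make \<open>u\<close> positive on the whole space, as the
    substitution demands; on the cube they change nothing.\<close>
  define u where "u = (\<lambda>j (y :: nat \<Rightarrow> real). 1 + (\<Sum>i\<in>V - {j}. \<bar>y i\<bar>))"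
  \<comment> \<open>The degree of homogeneity of the integral: \<open>card V\<close> from Lebesgue
    measure and \<open>2 * H - 2\<close> for each interval. Dividing the scale by \<open>u\<close>
    therefore produces the power \<open>- D H\<close> of \<open>u\<close>.\<close>
  define D where "D = (\<lambda>H. of_nat (Suc n) + of_nat (card I) * (2 * H - 2) :: complex)"
  define G where "G = (\<lambda>j y H. exp (- D H * complex_of_real (ln (1 + (\<Sum>i\<in>V - {j}. y i)))) *
     (\<Prod>J\<in>{J\<in>I. j \<in> J}. exp ((2 * H - 2) * complex_of_real (ln (1 + (\<Sum>i\<in>J - {j}. y i))))))"
  have UU: "{j} \<union> (V - {j}) = V" if "j \<in> V" for j using that by auto
  have GA: "G j \<in> amplitude V" if j: "j \<in> V" for j
    unfolding G_def D_def using finJ V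
    by (intro amplitude_mult amplitude_powr pos_poly_sum pos_poly_var sector_amplitude finI holomorphic_intros) auto
  have IH': "(\<forall>H. Re H > 1 / 2 \<longrightarrow> integrable (lborel_on ({j} \<union> (V - {j}))) (sector_integrand {j} (V - {j}) a b (G j) (I' j) H)) \<and>
     continues_off (\<lambda>H. integral\<^sup>L (lborel_on ({j} \<union> (V - {j}))) (sector_integrand {j} (V - {j}) a b (G j) (I' j) H)) E"
    if j: "j \<in> V" for j
  proof (rule sector_continues[OF refl])
    show "G j \<in> amplitude ({j} \<union> (V - {j}))" using GA[OF j] UU[OF j] by simp
    show "J \<subseteq> V - {j} \<and> J \<noteq> {}" if "J \<in> I' j" for J using that I unfolding I'_def by blast
    have sub: "{J\<in>I' j. J \<subseteq> S} = {J\<in>I. J \<subseteq> S}" if "S \<subseteq> V - {j}" for S using that unfolding I'_def by auto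
    show "card {J\<in>I' j. J \<subseteq> S} \<le> card S" if "S \<subseteq> V - {j}" for S
      unfolding sub[OF that] using that by (intro hered) auto
    show "a i \<ge> 0" for i unfolding a_def by simp
    show "- 1 < a i * Re H + b i" if "1 / 2 < Re H" for i H
      unfolding a_def b_def using sector_exponent[OF that mn] by simp
    show "H \<in> E" if H: "complex_of_real (a i) * H + complex_of_real (b i) + 1 + of_nat l = 0" for i l H
    proof -
      from sector_pole[OF H[unfolded a_def b_def]] have "card I > 0" "H = 1 - of_nat (Suc n + l) / (2 * of_nat (card I))" by auto
      thus ?thesis using E[of V l] n IV by simp
    qed
    show "1 - of_nat (card S + l) / (2 * of_nat (card {J\<in>I' j. J \<subseteq> S})) \<in> E"
      if "S \<subseteq> V - {j}" "card {J\<in>I' j. J \<subseteq> S} > 0" for S l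
      using that(2) unfolding sub[OF that(1)] by (intro E) (use that in auto)
  qed (use V j in auto)
  have IH: "(\<forall>H. Re H > 1 / 2 \<longrightarrow> integrable (lborel_on V) (sector_integrand {j} (V - {j}) a b (G j) (I' j) H)) \<and>
     continues_off (\<lambda>H. integral\<^sup>L (lborel_on V) (sector_integrand {j} (V - {j}) a b (G j) (I' j) H)) E"
    if j: "j \<in> V" for j
    using IH'[OF j] unfolding UU[OF j] .
  have fm: "f H \<in> borel_measurable (lborel_on V)" for H
    unfolding f_def using interval_product_measurable[of I V H] I gap_simplex_indicator_measurable[OF V(1)]
    by (intro borel_measurable_scaleR) auto
  have key: "integrable (lborel_on V) (\<lambda>x. indicat_real (max_region V j) x *\<^sub>R f H x) \<longleftrightarrow>
       integrable (lborel_on V) (sector_integrand {j} (V - {j}) a b (G j) (I' j) H)"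
     "integral\<^sup>L (lborel_on V) (\<lambda>x. indicat_real (max_region V j) x *\<^sub>R f H x) =
       integral\<^sup>L (lborel_on V) (sector_integrand {j} (V - {j}) a b (G j) (I' j) H)"
    if j: "j \<in> V" for j H
  proof -
    let ?A = "V - {j}" and ?u = "u j"
    let ?f = "\<lambda>x. indicat_real (max_region V j) x *\<^sub>R f H x"
    have m: "?f \<in> borel_measurable (lborel_on V)"
      using fm max_region_indicator_measurable[of V V j] V j by (intro borel_measurable_scaleR) auto
    have z: "?f x = 0" if "x j \<le> 0" for x
    proof -
      have "x \<notin> gap_simplex V" using that j unfolding gap_simplex_def by fastforce
      thus ?thesis unfolding f_def by simp
    qed
    have um: "?u \<in> borel_measurable (lborel_on V)" unfolding u_def
      by (intro borel_measurable_add borel_measurable_sum borel_measurable_abs component_measurable_lborel) auto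
    have u1: "?u y \<ge> 1" for y unfolding u_def by (simp add: sum_nonneg)
    have u0: "?u y > 0" for y using u1[of y] by linarith
    have uj: "?u (y(j := t)) = ?u y" for y t unfolding u_def by (auto intro!: sum.cong)
    have eq: "sector_jacobian ?A j ?u y *\<^sub>R ?f (sector_map ?A j ?u y) = sector_integrand {j} (V - {j}) a b (G j) (I' j) H y"
      if y: "y \<in> space (lborel_on V)" for y
    proof -
      define x where "x = sector_map ?A j ?u y"
      define t where "t = y j / ?u y"
      have xj: "x j = t" unfolding x_def sector_map_def scale_by_def t_def by simp
      have xi: "x i = t * y i" if "i \<in> V" "i \<noteq> j" for i unfolding x_def sector_map_def scale_by_def t_def using that by simp
      have ys: "y \<in> extensional V" using y by (auto simp: space_PiM PiE_iff)
      have tp: "t > 0 \<longleftrightarrow> y j > 0" unfolding t_def using u0[of y] by (simp add: zero_less_divide_iff)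
      have sx: "(\<Sum>i\<in>V. x i) = t * (1 + (\<Sum>i\<in>V - {j}. y i))"
      proof -
        have "(\<Sum>i\<in>V. x i) = x j + (\<Sum>i\<in>V - {j}. x i)" using V j by (simp add: sum.remove)
        also have "(\<Sum>i\<in>V - {j}. x i) = (\<Sum>i\<in>V - {j}. t * y i)" using xi by (intro sum.cong) auto
        finally show ?thesis by (simp add: xj sum_distrib_left algebra_simps)
      qed
      have upos: "?u y = 1 + (\<Sum>i\<in>V - {j}. y i)" if "\<And>i. i \<in> V \<Longrightarrow> i \<noteq> j \<Longrightarrow> y i > 0"
        unfolding u_def using that by (intro arg_cong[of _ _ "\<lambda>s. 1 + s"] sum.cong) (simp_all add: abs_of_pos)
      have reg: "y j > 0 \<and> x \<in> gap_simplex V \<and> x \<in> max_region V j \<longleftrightarrow> y \<in> cube V"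
      proof
        assume h: "y j > 0 \<and> x \<in> gap_simplex V \<and> x \<in> max_region V j"
        have yi: "0 < y i \<and> y i < 1" if "i \<in> V" "i \<noteq> j" for i
        proof -
          have "0 < x i" "x i < x j" using h that unfolding max_region_def gap_simplex_def by auto
          hence "0 < t * y i" "t * y i < t * 1" using xi[OF that] xj by auto
          thus ?thesis using h tp zero_less_mult_pos mult_less_cancel_left_pos by blast
        qed
        have "t * ?u y < 1" using h yi sx upos unfolding gap_simplex_def by auto
        hence "y j < 1" unfolding t_def using u0[of y] by simp
        thus "y \<in> cube V" using ys yi h unfolding cube_def by (auto simp: PiE_iff) 
      next
        assume h: "y \<in> cube V"
        have yp: "0 < y i" "y i < 1" if "i \<in> V" for i using cube_bound(2,3)[OF h that] by auto
        have t: "t > 0" using tp yp(1)[OF j] by simp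
        have lt: "0 < x i" "x i < x j" if "i \<in> V" "i \<noteq> j" for i
          using yp[of i] t that unfolding xi[OF that] xj by auto
        have "(\<Sum>i\<in>V. x i) = t * ?u y" using sx upos yp by simp
        also have "\<dots> = y j" unfolding t_def using u0[of y] by simp
        finally have "(\<Sum>i\<in>V. x i) < 1" using yp(2)[OF j] by simp
        moreover have "x i > 0" if "i \<in> V" for i using lt[OF that] t xj by (cases "i = j") auto
        ultimately show "y j > 0 \<and> x \<in> gap_simplex V \<and> x \<in> max_region V j"
          using yp(1)[OF j] lt unfolding gap_simplex_def max_region_def by auto
      qed
      show ?thesis
      proof (cases "y \<in> cube V")
        case False
        have "sector_jacobian ?A j ?u y *\<^sub>R ?f x = 0"
          using reg False unfolding sector_jacobian_def f_def by (auto simp: indicator_def)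
        thus ?thesis using False unfolding x_def[symmetric] sector_integrand_def UU[OF j] by simp
      next
        case True
        hence xr: "y j > 0" "x \<in> gap_simplex V" "x \<in> max_region V j" using reg by auto
        have yp: "0 < y i" if "i \<in> V" for i using cube_bound(2)[OF True that] .
        have t: "t > 0" using tp xr by simp
        define v where "v = 1 + (\<Sum>i\<in>V - {j}. y i)"
        have v: "?u y = v" "v > 0" using upos yp u0[of y] unfolding v_def by auto
        have lt: "ln t = ln (y j) - ln v" unfolding t_def v(1) using xr(1) v(2) by (simp add: ln_div)
        have ip: "interval_product I H x = exp (of_nat (card I) * ((2 * H - 2) * complex_of_real (ln t))) *
           ((\<Prod>J\<in>{J\<in>I. j \<in> J}. exp ((2 * H - 2) * complex_of_real (ln (1 + (\<Sum>i\<in>J - {j}. y i))))) * interval_product (I' j) H y)"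
          unfolding I'_def
          by (rule interval_product_scale[where V = V and t = t and x = x and y = y and j = j, OF finI finJ t _ xj xi]) (use yp in auto)
        have pw: "power_weight {j} a b H y = complex_of_real (y j) powr (complex_of_real (2 * real (card I)) * H + complex_of_real (real (Suc n) - 1 - 2 * real (card I)))"
          unfolding power_weight_def a_def b_def by simp
        have jac: "complex_of_real (sector_jacobian ?A j ?u y) = exp (of_nat n * complex_of_real (ln t) - complex_of_real (ln v))"
        proof -
          have "sector_jacobian ?A j ?u y = t ^ n / v"
            using xr(1) n j V unfolding sector_jacobian_def t_def v(1) by simp
          also have "t ^ n = exp (of_nat n * ln t)" using t by (simp add: exp_of_nat_mult)
          also have "exp (of_nat n * ln t) / v = exp (of_nat n * ln t - ln v)" using v by (simp add: exp_diff)
          finally show ?thesis by (simp add: exp_of_real[symmetric])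
        qed
        have "sector_jacobian ?A j ?u y *\<^sub>R ?f x = complex_of_real (sector_jacobian ?A j ?u y) * interval_product I H x"
          using xr unfolding f_def by (simp add: scaleR_conv_of_real)
        also have "\<dots> = power_weight {j} a b H y * G j y H * interval_product (I' j) H y"
        proof -
          have "exp (of_nat n * complex_of_real (ln t) - complex_of_real (ln v)) * exp (of_nat (card I) * ((2 * H - 2) * complex_of_real (ln t)))
             = exp ((complex_of_real (2 * real (card I)) * H + complex_of_real (real (Suc n) - 1 - 2 * real (card I))) * complex_of_real (ln (y j)))
               * exp (- D H * complex_of_real (ln v))"
            unfolding lt D_def by (simp add: exp_add[symmetric] algebra_simps)
          thus ?thesis unfolding ip pw G_def jac powr_of_real_exp[OF xr(1)] v_def[symmetric] by (simp add: mult.assoc[symmetric])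
        qed
        finally show ?thesis using True unfolding x_def[symmetric] sector_integrand_def UU[OF j] by simp
      qed
    qed
    have s: "integrable (lborel_on V) ?f \<longleftrightarrow> integrable (lborel_on V) (\<lambda>y. sector_jacobian ?A j ?u y *\<^sub>R ?f (sector_map ?A j ?u y))"
      "integral\<^sup>L (lborel_on V) ?f = (LINT y|lborel_on V. sector_jacobian ?A j ?u y *\<^sub>R ?f (sector_map ?A j ?u y))"
      by (rule sector_integral[OF V(1) j subset_refl um u0 uj m z]; assumption)+
    show "integrable (lborel_on V) ?f \<longleftrightarrow> integrable (lborel_on V) (sector_integrand {j} (V - {j}) a b (G j) (I' j) H)"
      unfolding s(1) by (rule Bochner_Integration.integrable_cong[OF refl eq])
    show "integral\<^sup>L (lborel_on V) ?f = integral\<^sup>L (lborel_on V) (sector_integrand {j} (V - {j}) a b (G j) (I' j) H)"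
      unfolding s(2) by (rule Bochner_Integration.integral_cong[OF refl eq])
  qed
  have parts: "integrable (lborel_on V) (\<lambda>x. indicat_real (max_region V j) x *\<^sub>R f H x)"
    if "j \<in> V" "Re H > 1/2" for j H
    unfolding key(1)[OF that(1)] using IH[OF that(1), THEN conjunct1] that(2) by simp
  show "integrable (lborel_on V) (f H)" if H: "Re H > 1/2"
    by (rule integral_split_max(1)[OF V(1) subset_refl V(2) fm parts[OF _ H]])
  have "continues_off (\<lambda>H. \<Sum>j\<in>V. integral\<^sup>L (lborel_on V) (sector_integrand {j} (V - {j}) a b (G j) (I' j) H)) E"
    using IH[THEN conjunct2] by (intro continues_off_sum V(1))
  thus "continues_off (\<lambda>H. integral\<^sup>L (lborel_on V) (f H)) E"
  proof (rule continues_off_cong)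
    fix H :: complex assume H: "Re H > 1/2"
    show "(\<Sum>j\<in>V. integral\<^sup>L (lborel_on V) (sector_integrand {j} (V - {j}) a b (G j) (I' j) H)) = integral\<^sup>L (lborel_on V) (f H)"
      unfolding integral_split_max(2)[where f = "f H", OF V(1) subset_refl V(2) fm parts[OF _ H], simplified] by (intro sum.cong refl key(2)[symmetric])
  qed
qed

section \<open>Passage from ordered times to gaps\<close>

definition partial_sums :: "nat \<Rightarrow> (nat \<Rightarrow> real) \<Rightarrow> nat \<Rightarrow> real" where
  "partial_sums n x = (\<lambda>i\<in>{1..n}. \<Sum>l=1..i. x l)"

lemma partial_sums_measurable: "partial_sums n \<in> measurable (lborel_on {1..n}) (lborel_on {1..n})"
proof (rule measurable_PiM_lborel)
  fix i assume i: "i \<in> {1..n}"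
  have "(\<lambda>x. \<Sum>l=1..i. x l) \<in> borel_measurable (lborel_on {1..n})"
    using i by (intro borel_measurable_sum component_measurable_lborel) auto
  thus "(\<lambda>x. partial_sums n x i) \<in> borel_measurable (lborel_on {1..n})" using i unfolding partial_sums_def by simp
qed (auto simp: partial_sums_def)

text \<open>The map is triangular with unit diagonal: for fixed earlier gaps the last time is a
  translate of the last gap.\<close>

lemma nn_integral_partial_sums:
  "f \<in> borel_measurable (lborel_on {1..n}) \<Longrightarrow>
    (\<integral>\<^sup>+s. f s \<partial>lborel_on {1..n}) = (\<integral>\<^sup>+x. f (partial_sums n x) \<partial>lborel_on {1..n})"
proof (induction n arbitrary: f)
  case 0
  have "partial_sums 0 x = x" if "x \<in> space (lborel_on {1..0})" for x
    using that unfolding partial_sums_def by (auto simp: space_PiM)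
  thus ?case by (intro nn_integral_cong) auto
next
  case (Suc n)
  have ins: "{1..Suc n} = insert (Suc n) {1..n}" by auto
  have ni: "Suc n \<notin> {1..n}" "finite {1..n}" by auto
  have f: "f \<in> borel_measurable (lborel_on (insert (Suc n) {1..n}))" using Suc.prems ins by simp
  define h where "h = (\<lambda>s. \<integral>\<^sup>+t. f (s(Suc n := t)) \<partial>lborel)"
  have h: "h \<in> borel_measurable (lborel_on {1..n})" unfolding h_def
    using measurable_compose[OF measurable_add_dim f]
    by (intro lborel.borel_measurable_nn_integral) (simp add: split_beta')
  have "(\<integral>\<^sup>+s. f s \<partial>lborel_on {1..Suc n}) = (\<integral>\<^sup>+s. h s \<partial>lborel_on {1..n})"
    unfolding ins h_def by (rule lborel_prod.product_nn_integral_insert[OF ni(2,1) f])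
  also have "\<dots> = (\<integral>\<^sup>+x. h (partial_sums n x) \<partial>lborel_on {1..n})" by (rule Suc.IH[OF h])
  also have "\<dots> = (\<integral>\<^sup>+x. (\<integral>\<^sup>+t. f (partial_sums (Suc n) (x(Suc n := t))) \<partial>lborel) \<partial>lborel_on {1..n})"
  proof (rule nn_integral_cong)
    fix x assume x: "x \<in> space (lborel_on {1..n})"
    have px: "partial_sums n x \<in> space (lborel_on {1..n})" using measurable_space[OF partial_sums_measurable x] .
    have m: "(\<lambda>t. f ((partial_sums n x)(Suc n := t))) \<in> borel_measurable borel"
      using measurable_compose[OF measurable_component_update[OF px ni(1)] f] by simp
    have "h (partial_sums n x) = ennreal \<bar>1\<bar> * (\<integral>\<^sup>+t. f ((partial_sums n x)(Suc n := (\<Sum>l=1..n. x l) + 1 * t)) \<partial>lborel)"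
      unfolding h_def by (rule nn_integral_real_affine[OF m]) auto
    also have "(\<lambda>t. (partial_sums n x)(Suc n := (\<Sum>l=1..n. x l) + 1 * t)) = (\<lambda>t. partial_sums (Suc n) (x(Suc n := t)))"
    proof (intro ext)
      fix t i
      show "((partial_sums n x)(Suc n := (\<Sum>l=1..n. x l) + 1 * t)) i = partial_sums (Suc n) (x(Suc n := t)) i"
      proof (cases "i = Suc n")
        case True
        have "(\<Sum>l=1..n. (x(Suc n := t)) l) = (\<Sum>l=1..n. x l)" by (intro sum.cong) auto
        thus ?thesis using True by (simp add: partial_sums_def)
      next
        case False
        have "(\<Sum>l=1..i. (x(Suc n := t)) l) = (\<Sum>l=1..i. x l)" if "i \<le> n" using that by (intro sum.cong) auto
        thus ?thesis using False by (auto simp: partial_sums_def)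
      qed
    qed
    finally show "h (partial_sums n x) = (\<integral>\<^sup>+t. f (partial_sums (Suc n) (x(Suc n := t))) \<partial>lborel)" by (simp add: fun_eq_iff)
  qed
  also have "\<dots> = (\<integral>\<^sup>+x. f (partial_sums (Suc n) x) \<partial>lborel_on {1..Suc n})"
  proof -
    have "(\<lambda>x. f (partial_sums (Suc n) x)) \<in> borel_measurable (lborel_on {1..Suc n})"
      by (rule measurable_compose[OF partial_sums_measurable Suc.prems])
    thus ?thesis unfolding ins by (intro lborel_prod.product_nn_integral_insert[symmetric] ni)
  qed
  finally show ?case .
qed

lemma distr_partial_sums: "distr (lborel_on {1..n}) (lborel_on {1..n}) (partial_sums n) = lborel_on {1..n}"
proof (rule measure_eqI)
  fix X assume X: "X \<in> sets (distr (lborel_on {1..n}) (lborel_on {1..n}) (partial_sums n))"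
  hence X': "X \<in> sets (lborel_on {1..n})" by simp
  have "emeasure (lborel_on {1..n}) X = (\<integral>\<^sup>+s. indicator X s \<partial>lborel_on {1..n})" using X' by simp
  also have "\<dots> = (\<integral>\<^sup>+x. indicator X (partial_sums n x) \<partial>lborel_on {1..n})"
    by (rule nn_integral_partial_sums) (use X' in simp)
  also have "\<dots> = (\<integral>\<^sup>+x. indicator (partial_sums n -` X \<inter> space (lborel_on {1..n})) x \<partial>lborel_on {1..n})"
    by (intro nn_integral_cong) (auto simp: indicator_def)
  also have "\<dots> = emeasure (lborel_on {1..n}) (partial_sums n -` X \<inter> space (lborel_on {1..n}))"
    using measurable_sets[OF partial_sums_measurable X'] by simp
  also have "\<dots> = emeasure (distr (lborel_on {1..n}) (lborel_on {1..n}) (partial_sums n)) X"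
    using X' partial_sums_measurable by (simp add: emeasure_distr)
  finally show "emeasure (distr (lborel_on {1..n}) (lborel_on {1..n}) (partial_sums n)) X = emeasure (lborel_on {1..n}) X" by simp
qed simp

lemma partial_sums_simplex:
  assumes n: "n \<ge> 1"
  shows "partial_sums n x \<in> open_simplex n \<longleftrightarrow> x \<in> gap_simplex {1..n}"
proof -
  define s where "s = (\<lambda>i. \<Sum>l=1..i. x l)"
  have ps: "partial_sums n x i = s i" if "i \<in> {1..n}" for i unfolding partial_sums_def s_def using that by simp
  have s0: "s 0 = 0" unfolding s_def by simp
  have step: "x i = s i - s (i - 1)" if "i \<ge> 1" for i using that unfolding s_def by (cases i) auto
  show ?thesis
  proof
    assume h: "partial_sums n x \<in> open_simplex n"
    hence r: "s i \<in> {0<..<1}" if "i \<in> {1..n}" for i 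
      using h that unfolding ps[OF that, symmetric] open_simplex_def by (blast dest: PiE_mem)
    have mono: "s i < s j" if "i \<in> {1..n}" "j \<in> {1..n}" "i < j" for i j
      using h that ps unfolding open_simplex_def strict_mono_on_def by (metis (mono_tags, lifting) CollectD)
    have "x i > 0" if "i \<in> {1..n}" for i
    proof (cases "i = 1")
      case True thus ?thesis using step[of 1] r[of 1] s0 that by simp
    next
      case False thus ?thesis using step[of i] mono[of "i - 1" i] that by auto
    qed
    moreover have "(\<Sum>i=1..n. x i) < 1" using r[of n] n unfolding s_def by simp
    ultimately show "x \<in> gap_simplex {1..n}" unfolding gap_simplex_def by auto
  next
    assume h: "x \<in> gap_simplex {1..n}"
    hence xp: "x i > 0" if "i \<in> {1..n}" for i using that unfolding gap_simplex_def by auto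
    have mono: "s i < s j" if "i < j" "j \<le> n" for i j
      using that
    proof (induction j)
      case (Suc j)
      have "s j < s (Suc j)" using xp[of "Suc j"] Suc.prems unfolding s_def by simp
      thus ?case using Suc by (cases "i = j") auto
    qed simp
    have "s n < 1" using h unfolding gap_simplex_def s_def by simp
    hence "s i \<in> {0<..<1}" if "i \<in> {1..n}" for i
      using mono[of 0 i] mono[of i n] that s0 by (cases "i = n") auto
    thus "partial_sums n x \<in> open_simplex n"
      using mono ps unfolding open_simplex_def strict_mono_on_def by (auto simp: PiE_iff partial_sums_def)
  qed
qed

lemma open_simplex_measurable:
  "indicat_real (open_simplex n) \<in> borel_measurable (lborel_on {1..n})"
proof -
  have eq: "indicat_real (open_simplex n) s = (\<Prod>i\<in>{1..n}. indicat_real {s. s i \<in> {0<..<1}} s) *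
      (\<Prod>i\<in>{1..n}. \<Prod>j\<in>{1..n}. if i < j then indicat_real {s. s i < s j} s else 1)"
    if s: "s \<in> space (lborel_on {1..n})" for s
  proof (cases "s \<in> open_simplex n")
    case True
    have "indicat_real {s. s i \<in> {0<..<1}} s = 1" if "i \<in> {1..n}" for i
      using True that unfolding open_simplex_def by (auto simp: PiE_iff)
    moreover have "(if i < j then indicat_real {s. s i < s j} s else 1) = 1" if "i \<in> {1..n}" "j \<in> {1..n}" for i j
      using True that unfolding open_simplex_def strict_mono_on_def by auto
    ultimately show ?thesis using True by simp
  next
    case False
    hence "(\<exists>i\<in>{1..n}. s i \<notin> {0<..<1}) \<or> (\<exists>i\<in>{1..n}. \<exists>j\<in>{1..n}. i < j \<and> \<not> s i < s j)"
      using s unfolding open_simplex_def strict_mono_on_def by (auto simp: PiE_iff space_PiM)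
    thus ?thesis
    proof
      assume "\<exists>i\<in>{1..n}. s i \<notin> {0<..<1}"
      then obtain i where "i \<in> {1..n}" "indicat_real {s. s i \<in> {0<..<1}} s = 0" by (auto simp: indicator_def)
      hence "(\<Prod>i\<in>{1..n}. indicat_real {s. s i \<in> {0<..<1}} s) = 0" by (intro prod_zero bexI[of _ i]) auto
      thus ?thesis using False by simp
    next
      assume "\<exists>i\<in>{1..n}. \<exists>j\<in>{1..n}. i < j \<and> \<not> s i < s j"
      then obtain i j where ij: "i \<in> {1..n}" "j \<in> {1..n}" "i < j" "\<not> s i < s j" by blast
      have z0: "(if i < j then indicat_real {s. s i < s j} s else 1) = 0" using ij by simp
      have z: "(\<Prod>j\<in>{1..n}. if i < j then indicat_real {s. s i < s j} s else 1) = 0"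
        by (rule prod_zero, rule finite_atLeastAtMost, rule bexI, rule z0, rule ij(2))
      have "(\<Prod>i\<in>{1..n}. \<Prod>j\<in>{1..n}. if i < j then indicat_real {s. s i < s j} s else 1) = 0"
        by (rule prod_zero, rule finite_atLeastAtMost, rule bexI, rule z, rule ij(1))
      thus ?thesis using False by simp
    qed
  qed
  have 1: "indicat_real {s. s i \<in> {0<..<1}} \<in> borel_measurable (lborel_on {1..n})" if "i \<in> {1..n}" for i
    unfolding indicator_def using component_measurable_lborel[OF that] by auto
  have 2: "(\<lambda>s. if i < j then indicat_real {s. s i < s j} s else 1) \<in> borel_measurable (lborel_on {1..n})"
    if "i \<in> {1..n}" "j \<in> {1..n}" for i j
    unfolding indicator_def using component_measurable_lborel[OF that(1)] component_measurable_lborel[OF that(2)] by auto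
  show ?thesis
    by (subst measurable_cong[OF eq], assumption) (intro borel_measurable_times borel_measurable_prod 1 2)
qed

section \<open>Pair partitions and their intervals\<close>

lemma pair_block:
  assumes "P \<in> pair_partitions n" "b \<in> P"
  shows "finite b" "b \<subseteq> {1..n}" "b = {Min b, Max b}" "Min b < Max b" "Min b \<in> {1..n}" "Max b \<in> {1..n}"
proof -
  have c: "card b = 2" and sub: "b \<subseteq> {1..n}"
    using assms unfolding pair_partitions_def partition_on_def by auto
  then obtain x y where xy: "b = {x, y}" "x \<noteq> y" by (auto simp: card_2_iff)
  thus "finite b" "b \<subseteq> {1..n}" "b = {Min b, Max b}" "Min b < Max b" using sub by (auto simp: min_def max_def)
  thus "Min b \<in> {1..n}" "Max b \<in> {1..n}" by auto
qed

lemma finite_pair_partition: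
  assumes "P \<in> pair_partitions n" shows "finite P"
proof (rule finite_subset)
  show "P \<subseteq> Pow {1..n}" using pair_block(2)[OF assms] by auto
qed simp

lemma finite_pair_partitions: "finite (pair_partitions n)"
proof (rule finite_subset)
  show "pair_partitions n \<subseteq> Pow (Pow {1..n})" using pair_block(2) by blast
qed simp

lemma Max_pair_interval:
  assumes "P \<in> pair_partitions n" "b \<in> P"
  shows "Max (pair_interval b) = Max b" "pair_interval b \<noteq> {}" "pair_interval b \<subseteq> {1..n}"
  using pair_block[OF assms] unfolding pair_interval_def by (auto intro!: Max_eqI)

lemma inj_on_Max_pairs:
  assumes "P \<in> pair_partitions n"
  shows "inj_on Max P"
proof (rule inj_onI)
  fix b c assume bc: "b \<in> P" "c \<in> P" "Max b = Max c"
  have "Max b \<in> b" "Max c \<in> c" using pair_block(3)[OF assms bc(1)] pair_block(3)[OF assms bc(2)] by auto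
  hence "b \<inter> c \<noteq> {}" using bc by auto
  thus "b = c" using bc assms unfolding pair_partitions_def partition_on_def disjoint_def by auto
qed

lemma inj_on_pair_interval:
  assumes "P \<in> pair_partitions n"
  shows "inj_on pair_interval P"
proof (rule inj_onI)
  fix b c assume bc: "b \<in> P" "c \<in> P" "pair_interval b = pair_interval c"
  hence "Max b = Max c" using Max_pair_interval(1)[OF assms bc(1)] Max_pair_interval(1)[OF assms bc(2)] by simp
  thus "b = c" by (rule inj_onD[OF inj_on_Max_pairs[OF assms] _ bc(1,2)])
qed

text \<open>Blocks are disjoint, so intervals of different pairs have different right end points,
  and those of intervals inside \<open>S\<close> belong to \<open>S\<close>. This bound yields both
  the convergence for \<open>Re H > 1/2\<close> and the position of the poles.\<close>

lemma interval_count_le: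
  assumes "P \<in> pair_partitions n" "finite S"
  shows "card {J \<in> pair_interval ` P. J \<subseteq> S} \<le> card S"
proof (rule card_inj_on_le[where f = Max])
  show "inj_on Max {J \<in> pair_interval ` P. J \<subseteq> S}"
  proof (rule inj_onI)
    fix J K assume J: "J \<in> {J \<in> pair_interval ` P. J \<subseteq> S}" and K: "K \<in> {J \<in> pair_interval ` P. J \<subseteq> S}" and eq: "Max J = Max K"
    from J obtain b where b: "b \<in> P" "J = pair_interval b" by blast
    from K obtain c where c: "c \<in> P" "K = pair_interval c" by blast
    have "Max b = Max c" using eq b c Max_pair_interval(1)[OF assms(1)] by simp
    hence "b = c" by (rule inj_onD[OF inj_on_Max_pairs[OF assms(1)] _ b(1) c(1)])
    thus "J = K" using b c by simp
  qed
  show "Max ` {J \<in> pair_interval ` P. J \<subseteq> S} \<subseteq> S"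
  proof safe
    fix b assume b: "b \<in> P" "pair_interval b \<subseteq> S"
    have "finite (pair_interval b)" unfolding pair_interval_def by simp
    hence "Max (pair_interval b) \<in> pair_interval b" using Max_pair_interval(2)[OF assms(1) b(1)] by (rule Max_in)
    thus "Max (pair_interval b) \<in> S" using b by blast
  qed
qed (rule assms(2))

definition L_integrand :: "nat \<Rightarrow> nat set set \<Rightarrow> complex \<Rightarrow> (nat \<Rightarrow> real) \<Rightarrow> complex" where
  "L_integrand n P H s = indicat_real (open_simplex n) s *\<^sub>R
     (\<Prod>b\<in>P. complex_of_real \<bar>s (Min b) - s (Max b)\<bar> powr (2 * H - 2))"

lemma L_integral_eq: "L_integral n P H = integral\<^sup>L (lborel_on {1..n}) (L_integrand n P H)"
  unfolding L_integral_def set_lebesgue_integral_def L_integrand_def ..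

lemma L_integrand_measurable:
  assumes "P \<in> pair_partitions n"
  shows "L_integrand n P H \<in> borel_measurable (lborel_on {1..n})"
proof -
  have "(\<lambda>s. complex_of_real \<bar>s (Min b) - s (Max b)\<bar>) \<in> borel_measurable (lborel_on {1..n})" if "b \<in> P" for b
    using component_measurable_lborel[OF pair_block(5)[OF assms that]]
       component_measurable_lborel[OF pair_block(6)[OF assms that]] by measurable
  thus ?thesis unfolding L_integrand_def[abs_def]
    by (intro borel_measurable_scaleR open_simplex_measurable borel_measurable_prod powr_complex_measurable) auto
qed

text \<open>The distance between the two times of a pair is the sum of the gaps with indices from
  \<open>Min b + 1\<close> to \<open>Max b\<close>; this explains the shift by 1 in
  \<open>pair_interval\<close>.\<close>

lemma L_integrand_partial_sums:
  assumes n: "n \<ge> 1" and P: "P \<in> pair_partitions n"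
  shows "L_integrand n P H (partial_sums n x) =
    indicat_real (gap_simplex {1..n}) x *\<^sub>R interval_product (pair_interval ` P) H x"
proof (cases "x \<in> gap_simplex {1..n}")
  case True
  have "complex_of_real \<bar>partial_sums n x (Min b) - partial_sums n x (Max b)\<bar> = complex_of_real (\<Sum>i\<in>pair_interval b. x i)"
    if b: "b \<in> P" for b
  proof -
    note pb = pair_block[OF P b]
    have "(\<Sum>l=1..Max b. x l) = (\<Sum>l=1..Min b. x l) + (\<Sum>i\<in>pair_interval b. x i)"
      unfolding pair_interval_def using pb(4,5)
      by (subst sum.union_disjoint[symmetric]) (auto intro!: sum.cong)
    moreover have "(\<Sum>i\<in>pair_interval b. x i) \<ge> 0"
      using True Max_pair_interval(3)[OF P b] unfolding gap_simplex_def by (intro sum_nonneg) (auto intro: less_imp_le)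
    ultimately show ?thesis using pb(5,6) unfolding partial_sums_def by simp
  qed
  thus ?thesis using True partial_sums_simplex[OF n, of x] unfolding L_integrand_def interval_product_def
    by (simp add: prod.reindex[OF inj_on_pair_interval[OF P]])
next
  case False
  thus ?thesis using partial_sums_simplex[OF n, of x] unfolding L_integrand_def by simp
qed

lemma L_integral_continues:
  assumes n: "n \<ge> 1" and P: "P \<in> pair_partitions_below n w"
  shows "Re H > 1 / 2 \<Longrightarrow> integrable (lborel_on {1..n}) (L_integrand n P H)"
    and "continues_off (L_integral n P) (exceptional_set n w)"
proof -
  have P': "P \<in> pair_partitions n" using P unfolding pair_partitions_below_def by simp
  note T = partial_sums_measurable[of n] and m = L_integrand_measurable[OF P']
  have I: "J \<subseteq> {1..n} \<and> J \<noteq> {}" if "J \<in> pair_interval ` P" for J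
    using that Max_pair_interval[OF P'] by auto
  have hered: "card {J \<in> pair_interval ` P. J \<subseteq> S} \<le> card S" if "S \<subseteq> {1..n}" for S
    by (rule interval_count_le[OF P']) (use that finite_subset in auto)
  have E: "1 - of_nat (card S + l) / (2 * of_nat (card {J \<in> pair_interval ` P. J \<subseteq> S})) \<in> exceptional_set n w"
    if "S \<subseteq> {1..n}" "card {J \<in> pair_interval ` P. J \<subseteq> S} > 0" for S l
    using that P unfolding exceptional_set_def interval_count_def by blast
  have ne: "{1..n} \<noteq> {}" using n by auto
  note gap = gap_integral_continues[OF finite_atLeastAtMost ne I hered E]
  show "integrable (lborel_on {1..n}) (L_integrand n P H)" if "Re H > 1/2"
  proof -
    have "integrable (lborel_on {1..n}) (\<lambda>x. L_integrand n P H (partial_sums n x))"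
      unfolding L_integrand_partial_sums[OF n P'] using gap(1)[OF _ _ _ _ that] by blast
    hence "integrable (distr (lborel_on {1..n}) (lborel_on {1..n}) (partial_sums n)) (L_integrand n P H)"
      using integrable_distr_eq[OF T m] by blast
    thus ?thesis unfolding distr_partial_sums .
  qed
  have "L_integral n P H = (LINT x|lborel_on {1..n}. indicat_real (gap_simplex {1..n}) x *\<^sub>R interval_product (pair_interval ` P) H x)" for H
    unfolding L_integral_eq L_integrand_partial_sums[OF n P', symmetric]
    by (subst (1) distr_partial_sums[symmetric]) (rule integral_distr[OF T m])
  thus "continues_off (L_integral n P) (exceptional_set n w)" using gap(2) by presburger
qed

section \<open>Assembling the continuation on the whole plane\<close>

lemma closed_scaled_Ints:
  fixes A :: "complex set"
  assumes "N > 0" "\<And>z. z \<in> A \<Longrightarrow> of_nat N * z \<in> \<int>"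
  shows "closed A" "countable A"
proof -
  have A: "A = (\<lambda>x. (1 / real N) *\<^sub>R x) ` ((\<lambda>z. of_nat N * z) ` A)"
    using assms(1) by (auto simp: image_image scaleR_conv_of_real)
  have sub: "(\<lambda>z. of_nat N * z) ` A \<subseteq> \<int>" using assms(2) by auto
  show "closed A" by (subst A) (intro closed_scaling closed_subset_Ints sub)
  have "countable ((\<lambda>z. of_nat N * z) ` A)" by (rule countable_subset[OF sub countable_int])
  thus "countable A" by (subst A) (rule countable_image)
qed

text \<open>Denominators have the form \<open>2 * [S|P]\<close> with
  \<open>[S|P] \<le> |S| \<le> n\<close>, so all of them divide \<open>2 * fact n\<close> and the
  exceptional points, lying in one lattice, cannot accumulate. The same inequality places them in
  \<open>Re z \<le> 1 / 2\<close>.\<close>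

lemma exceptional_set_facts:
  assumes "z \<in> exceptional_set n w"
  shows "of_nat (2 * fact n) * z \<in> \<int>" "Re z \<le> 1 / 2" "z \<in> \<rat>"
proof -
  obtain S P l where z: "z = 1 - of_nat (card S + l) / (2 * of_nat (interval_count S P))"
    and S: "S \<subseteq> {1..n}" and P: "P \<in> pair_partitions_below n w" and q: "interval_count S P > 0"
    using assms unfolding exceptional_set_def by blast
  have fS: "finite S" using S finite_subset by auto
  have qS: "interval_count S P \<le> card S" unfolding interval_count_def
    by (rule interval_count_le[OF _ fS]) (use P in \<open>auto simp: pair_partitions_below_def\<close>)
  have Sn: "card S \<le> n" using card_mono[OF _ S] by simp
  have "interval_count S P dvd fact n" using q qS Sn by (intro dvd_fact) auto
  then obtain r where r: "fact n = interval_count S P * r" by (auto elim: dvdE)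
  have "of_nat (2 * fact n) * z = of_nat (2 * fact n) - of_nat ((card S + l) * r)"
    unfolding z of_nat_mult r using q by (simp add: field_simps)
  thus "of_nat (2 * fact n) * z \<in> \<int>" by (metis Ints_diff Ints_of_nat)
  have "z = complex_of_real (1 - real (card S + l) / (2 * real (interval_count S P)))"
    unfolding z by simp
  hence "Re z = 1 - real (card S + l) / (2 * real (interval_count S P))"
    by (simp only: Re_complex_of_real)
  also have "\<dots> \<le> 1 / 2" using q qS by (simp add: field_simps)
  finally show "Re z \<le> 1 / 2" .
  show "z \<in> \<rat>" unfolding z by (intro Rats_diff Rats_divide Rats_mult Rats_of_nat Rats_1) auto
qed

text \<open>A half-plane without a countable closed set stays connected, so the identity theorem
  extends the agreement on \<open>Re H > 1/2\<close> to all half-planes. That every subset of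
  \<open>E\<close> is closed, and not just \<open>E\<close>, isolates each of its points.\<close>

lemma continues_off_glue:
  assumes f: "continues_off f E" and E: "\<And>A. A \<subseteq> E \<Longrightarrow> closed A" "countable E" "\<And>z. z \<in> E \<Longrightarrow> Re z \<le> 1 / 2"
  shows "\<exists>F. F meromorphic_on UNIV \<and> F holomorphic_on - E \<and> (\<forall>H. Re H > 1 / 2 \<longrightarrow> F H = f H)"
proof -
  define R where "R = (\<lambda>N :: nat. {H. Re H > - real N})"
  have "\<forall>N. \<exists>F. F meromorphic_on R N \<and> F holomorphic_on (R N - E) \<and> (\<forall>H. Re H > 1 / 2 \<longrightarrow> F H = f H)"
    using f unfolding continues_off_def R_def by blast
  then obtain F where F: "\<And>N. F N meromorphic_on R N" "\<And>N. F N holomorphic_on (R N - E)"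
    "\<And>N H. Re H > 1 / 2 \<Longrightarrow> F N H = f H" by metis
  have oR: "open (R N)" for N unfolding R_def by (rule open_halfspace_Re_gt)
  have oRE: "open (R N - E)" for N using oR E(1)[of E] by auto
  have cR: "connected (R N - E)" for N
  proof (rule connected_open_diff_countable)
    have "convex (R N)" unfolding R_def by (rule convex_halfspace_Re_gt)
    thus "connected (R N)" by (rule convex_connected)
  qed (use oR E(2) in auto)
  have agree: "F N H = F M H" if "N \<le> M" "H \<in> R N - E" for N M H
  proof (rule analytic_continuation_open[of "{H. Re H > 1/2}" "R N - E" "F N" "F M" H])
    show "open {H::complex. Re H > 1/2}" by (rule open_halfspace_Re_gt)
    show "{H::complex. Re H > 1/2} \<noteq> {}" by (auto intro!: exI[of _ 1])
    show "{H. Re H > 1/2} \<subseteq> R N - E" using E(3) unfolding R_def by fastforce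
    have "R N \<subseteq> R M" using that(1) unfolding R_def by auto
    thus "F M holomorphic_on R N - E" by (intro holomorphic_on_subset[OF F(2)]) auto
  qed (use oRE cR F that in auto)
  \<comment> \<open>At \<open>H\<close> the continuation belonging to some half-plane around
    \<open>H\<close> is taken; by \<open>agree\<close> the choice is immaterial off
    \<open>E\<close>.\<close>
  define K where "K = (\<lambda>H. F (nat \<lceil>- Re H\<rceil> + 1) H)"
  have inR: "H \<in> R (nat \<lceil>- Re H\<rceil> + 1)" for H unfolding R_def by (simp, linarith)
  have KF: "K H = F N H" if "H \<in> R N - E" for H N
  proof (cases "N \<le> nat \<lceil>- Re H\<rceil> + 1")
    case True thus ?thesis unfolding K_def by (rule agree[symmetric]) (rule that)
  next
    case False
    hence "nat \<lceil>- Re H\<rceil> + 1 \<le> N" by simp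
    thus ?thesis unfolding K_def by (rule agree) (use inR[of H] that in blast)
  qed
  have "K holomorphic_on - E"
  proof -
    have "open (- E)" using E(1)[of E] by auto
    moreover have "\<exists>f'. (K has_field_derivative f') (at z)" if z: "z \<in> - E" for z
    proof -
      have zR: "z \<in> R (nat \<lceil>- Re z\<rceil> + 1) - E" using inR z by auto
      have "K holomorphic_on (R (nat \<lceil>- Re z\<rceil> + 1) - E)"
        by (rule holomorphic_transform[OF F(2)]) (use KF in auto)
      thus ?thesis using holomorphic_derivI[OF _ oRE zR] by blast
    qed
    ultimately show ?thesis using holomorphic_on_open by blast
  qed
  moreover have "K meromorphic_on UNIV"
    unfolding meromorphic_on_meromorphic_at[of _ UNIV]
  proof
    fix z :: complex
    let ?N = "nat \<lceil>- Re z\<rceil> + 1"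
    \<comment> \<open>An open set around \<open>z\<close> that meets \<open>E\<close> at most in
      \<open>z\<close>: on it \<open>K\<close> agrees off \<open>z\<close> with the single
      meromorphic function \<open>F ?N\<close>.\<close>
    have "open (R ?N - (E - {z}))" using oR E(1)[of "E - {z}"] by auto
    moreover have "z \<in> R ?N - (E - {z})" using inR by auto
    ultimately have "eventually (\<lambda>w. w \<in> R ?N - (E - {z})) (at z)" by (rule eventually_at_in_open')
    moreover have "eventually (\<lambda>w. w \<noteq> z) (at z)" by (rule eventually_neq_at_within)
    ultimately have "eventually (\<lambda>w. F ?N w = K w) (at z)"
      by eventually_elim (use KF in auto)
    hence "F ?N meromorphic_on {z} \<longleftrightarrow> K meromorphic_on {z}" by (intro meromorphic_on_cong) auto
    thus "K meromorphic_on {z}" using meromorphic_on_subset[OF F(1)[of ?N], of "{z}"] inR by auto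
  qed
  moreover have "K H = f H" if "Re H > 1/2" for H unfolding K_def using F(3) that by simp
  ultimately show ?thesis by blast
qed

lemma sum_L_integral_continuation:
  assumes n: "n \<ge> 1"
  shows "\<exists>F. F meromorphic_on UNIV \<and> F holomorphic_on (- exceptional_set n w) \<and>
    (\<forall>H. Re H > 1 / 2 \<longrightarrow> F H = (\<Sum>P\<in>pair_partitions_below n w. L_integral n P H))"
proof (rule continues_off_glue)
  have "finite (pair_partitions_below n w)" unfolding pair_partitions_below_def
    using finite_pair_partitions by simp
  thus "continues_off (\<lambda>H. \<Sum>P\<in>pair_partitions_below n w. L_integral n P H) (exceptional_set n w)"
    by (intro continues_off_sum L_integral_continues(2) n)
  show "closed A" if "A \<subseteq> exceptional_set n w" for A
    by (rule closed_scaled_Ints(1)[of "2 * fact n"]) (use exceptional_set_facts(1) that in auto)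
  show "countable (exceptional_set n w)"
    by (rule closed_scaled_Ints(2)[of "2 * fact n"]) (use exceptional_set_facts(1) in auto)
qed (rule exceptional_set_facts)

section \<open>Gaussian moments and the Wick formula\<close>

text \<open>The offset \<open>x\<close> is needed for the sums over the sets \<open>B\<close> that contain a fixed index.\<close>

lemma polarization:
  fixes y :: "'i \<Rightarrow> real"
  assumes "finite A"
  shows "m \<le> card A \<Longrightarrow> (\<Sum>B\<in>Pow A. (-1) ^ (card A - card B) * (x + sum y B) ^ m) =
     (if m = card A then fact m * prod y A else 0)"
  using assms
proof (induction A arbitrary: x m rule: finite_induct)
  case empty thus ?case by simp
next
  case (insert a A)
  let ?T = "\<lambda>m x. \<Sum>B\<in>Pow A. (-1) ^ (card A - card B) * (x + sum y B) ^ m"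
  have disj: "Pow A \<inter> insert a ` Pow A = {}" using insert by auto
  have inj: "inj_on (insert a) (Pow A)"
    by (rule inj_on_inverseI[where g = "\<lambda>B. B - {a}"]) (use insert in auto)
  have fin: "finite B" if "B \<in> Pow A" for B using that insert finite_subset by auto
  have cB: "card B \<le> card A" if "B \<in> Pow A" for B using that insert card_mono by auto
  have "(\<Sum>B\<in>Pow (insert a A). (-1) ^ (card (insert a A) - card B) * (x + sum y B) ^ m) =
     (\<Sum>B\<in>Pow A. (-1) ^ (Suc (card A) - card B) * (x + sum y B) ^ m) +
     (\<Sum>B\<in>Pow A. (-1) ^ (Suc (card A) - card (insert a B)) * (x + sum y (insert a B)) ^ m)"
    unfolding Pow_insert using insert disj
    by (subst sum.union_disjoint) (auto simp: sum.reindex[OF inj])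
  also have "(\<Sum>B\<in>Pow A. (-1) ^ (Suc (card A) - card B) * (x + sum y B) ^ m) = - ?T m x"
    unfolding sum_negf[symmetric] using cB by (intro sum.cong) (auto simp: Suc_diff_le)
  also have "(\<Sum>B\<in>Pow A. (-1) ^ (Suc (card A) - card (insert a B)) * (x + sum y (insert a B)) ^ m) = ?T m (x + y a)"
  proof (intro sum.cong refl)
    fix B assume B: "B \<in> Pow A"
    hence "a \<notin> B" using insert by auto
    thus "(-1) ^ (Suc (card A) - card (insert a B)) * (x + sum y (insert a B)) ^ m = (-1) ^ (card A - card B) * (x + y a + sum y B) ^ m"
      using fin[OF B] by (simp add: add.assoc)
  qed
  \<comment> \<open>Adjoining \<open>a\<close> acts as a difference operator in \<open>x\<close>:
    the top power cancels, and every remaining degree is at most \<open>card A\<close>, so the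
    induction hypothesis applies.\<close>
  also have "- ?T m x + ?T m (x + y a) = (\<Sum>j<m. of_nat (m choose j) * y a ^ (m - j) * ?T j x)"
  proof -
    have "(x + y a + s) ^ m - (x + s) ^ m = (\<Sum>j<m. of_nat (m choose j) * (x + s) ^ j * y a ^ (m - j))" for s
    proof -
      have "(x + y a + s) ^ m = ((x + s) + y a) ^ m" by (simp add: algebra_simps)
      also have "\<dots> = (\<Sum>j\<le>m. of_nat (m choose j) * (x + s) ^ j * y a ^ (m - j))" by (rule binomial_ring)
      also have "\<dots> = (\<Sum>j<m. of_nat (m choose j) * (x + s) ^ j * y a ^ (m - j)) + (x + s) ^ m"
        unfolding lessThan_Suc_atMost[symmetric] by simp
      finally show ?thesis by simp
    qed
    note bin = this
    have "- ?T m x + ?T m (x + y a) = (\<Sum>B\<in>Pow A. (-1) ^ (card A - card B) * ((x + y a + sum y B) ^ m - (x + sum y B) ^ m))"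
      by (simp add: right_diff_distrib sum_subtractf)
    also have "\<dots> = (\<Sum>B\<in>Pow A. \<Sum>j<m. (-1) ^ (card A - card B) * (of_nat (m choose j) * (x + sum y B) ^ j * y a ^ (m - j)))"
      unfolding bin by (simp add: sum_distrib_left)
    also have "\<dots> = (\<Sum>j<m. \<Sum>B\<in>Pow A. (-1) ^ (card A - card B) * (of_nat (m choose j) * (x + sum y B) ^ j * y a ^ (m - j)))"
      by (rule sum.swap)
    also have "\<dots> = (\<Sum>j<m. of_nat (m choose j) * y a ^ (m - j) * ?T j x)"
      unfolding sum_distrib_left by (intro sum.cong refl) (simp add: algebra_simps)
    finally show ?thesis .
  qed
  also have "\<dots> = (\<Sum>j<m. if j = card A then of_nat (m choose j) * y a ^ (m - j) * (fact j * prod y A) else 0)"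
    using insert by (intro sum.cong refl) auto
  also have "\<dots> = (if m = card (insert a A) then fact m * prod y (insert a A) else 0)"
    using insert by (auto simp: sum.delta)
  finally show ?case .
qed

lemma DERIV_polynomial_at_0:
  fixes a :: "nat \<Rightarrow> real"
  shows "((\<lambda>t. \<Sum>j\<le>m. a j * t ^ j) has_real_derivative (if m \<ge> 1 then a 1 else 0)) (at 0)"
proof -
  have "((\<lambda>t. \<Sum>j\<le>m. a j * t ^ j) has_real_derivative (\<Sum>j\<le>m. a j * (real j * 0 ^ (j - 1)))) (at 0)"
    by (auto intro!: derivative_eq_intros sum.cong)
  also have "(\<Sum>j\<le>m. a j * (real j * 0 ^ (j - 1))) = (\<Sum>j\<le>m. if j = 1 then a 1 else 0)"
  proof (intro sum.cong refl)
    fix j show "a j * (real j * 0 ^ (j - 1)) = (if j = 1 then a 1 else 0)"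
      by (cases j; cases "j - 1") auto
  qed
  also have "\<dots> = (if m \<ge> 1 then a 1 else 0)" by (simp add: sum.delta)
  finally show ?thesis .
qed

context prob_space begin

text \<open>The recursion, with integrability and vanishing mean, is all that later arguments use of
  the normal law. It holds for the point mass at 0 as well, so the two cases of
  \<open>centered_gaussian\<close> are treated alike from here on.\<close>

lemma centered_gaussian_moments:
  assumes "centered_gaussian M X"
  shows "integrable M (\<lambda>\<omega>. X \<omega> ^ n)" "expectation X = 0"
    "expectation (\<lambda>\<omega>. X \<omega> ^ (n + 2)) = real (n + 1) * expectation (\<lambda>\<omega>. (X \<omega>)\<^sup>2) * expectation (\<lambda>\<omega>. X \<omega> ^ n)"
proof -
  have m: "X \<in> borel_measurable M" using assms unfolding centered_gaussian_def by simp
  have main: "(\<forall>n. integrable M (\<lambda>\<omega>. X \<omega> ^ n)) \<and> expectation X = 0 \<and>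
    (\<forall>n. expectation (\<lambda>\<omega>. X \<omega> ^ (n + 2)) = real (n + 1) * expectation (\<lambda>\<omega>. (X \<omega>)\<^sup>2) * expectation (\<lambda>\<omega>. X \<omega> ^ n))"
  proof (cases "AE \<omega> in M. X \<omega> = 0")
    case True
    have pw: "integrable M (\<lambda>\<omega>. X \<omega> ^ n)" for n
    proof (rule integrable_cong_AE_imp[of M "\<lambda>_. 0 ^ n"])
      show "AE \<omega> in M. (0::real) ^ n = X \<omega> ^ n" using True by eventually_elim simp
    qed (use m in auto)
    have e: "expectation (\<lambda>\<omega>. X \<omega> ^ n) = 0 ^ n" for n
    proof -
      have "expectation (\<lambda>\<omega>. X \<omega> ^ n) = expectation (\<lambda>\<omega>. 0 ^ n)"
        by (rule integral_cong_AE) (use True m in \<open>auto elim!: eventually_mono\<close>)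
      thus ?thesis by (simp add: prob_space)
    qed
    have "expectation (\<lambda>\<omega>. X \<omega> ^ (n + 2)) = real (n + 1) * expectation (\<lambda>\<omega>. (X \<omega>)\<^sup>2) * expectation (\<lambda>\<omega>. X \<omega> ^ n)" for n
      unfolding e by simp
    thus ?thesis using pw e[of 1] by simp
  next
    case False
    then obtain \<sigma> where \<sigma>: "\<sigma> > 0" and D: "distributed M lborel X (normal_density 0 \<sigma>)"
      using assms unfolding centered_gaussian_def by blast
    have even: "has_bochner_integral lborel (\<lambda>x. normal_density 0 \<sigma> x * x ^ (2 * k)) (fact (2 * k) / ((2 / \<sigma>\<^sup>2) ^ k * fact k))" for k
      using normal_moment_even[OF \<sigma>, of 0 k] by simp
    have odd: "has_bochner_integral lborel (\<lambda>x. normal_density 0 \<sigma> x * x ^ (2 * k + 1)) 0" for k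
      using normal_moment_odd[OF \<sigma>, of 0 k] by simp
    define v where "v = (\<lambda>n. if even n then fact n / ((2 / \<sigma>\<^sup>2) ^ (n div 2) * fact (n div 2)) else 0 :: real)"
    have hb: "has_bochner_integral lborel (\<lambda>x. normal_density 0 \<sigma> x * x ^ n) (v n)" for n
    proof (cases "even n")
      case True thus ?thesis using even[of "n div 2"] unfolding v_def by simp
    next
      case False
      then obtain k where n: "n = 2 * k + 1" by (rule oddE)
      show ?thesis using odd[of k] unfolding n v_def by simp
    qed
    have pw: "integrable M (\<lambda>\<omega>. X \<omega> ^ n)" for n
      using distributed_integrable[OF D, of "\<lambda>x. x ^ n"] hb[of n] by (auto simp: has_bochner_integral_iff)
    have e: "expectation (\<lambda>\<omega>. X \<omega> ^ n) = v n" for n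
      using distributed_integral[OF D, of "\<lambda>x. x ^ n"] hb[of n] by (auto simp: has_bochner_integral_iff)
    have v2: "v 2 = \<sigma>\<^sup>2" unfolding v_def using \<sigma> by simp
    have rec: "v (n + 2) = real (n + 1) * \<sigma>\<^sup>2 * v n" for n
    proof (cases "even n")
      case True
      then obtain k where n: "n = 2 * k" by (auto elim: evenE)
      define c where "c = 2 / \<sigma>\<^sup>2"
      have c: "c > 0" "\<sigma>\<^sup>2 = 2 / c" unfolding c_def using \<sigma> by auto
      define K where "K = real k + 1"
      have K: "K > 0" unfolding K_def by simp
      have f: "fact (2 * k + 2) = 2 * K * ((2 * real k + 1) * fact (2 * k))"
        "fact (Suc k) = K * fact k" unfolding K_def by (simp_all add: algebra_simps)
      have "v (n + 2) = (2 * K * ((2 * real k + 1) * fact (2 * k))) / (c ^ Suc k * (K * fact k))"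
        unfolding v_def n c_def[symmetric] f(1)[symmetric] f(2)[symmetric] by simp
      also have "\<dots> = (2 * real k + 1) * (2 / c) * (fact (2 * k) / (c ^ k * fact k))"
        using K c by simp
      also have "\<dots> = real (n + 1) * \<sigma>\<^sup>2 * v n"
        unfolding c(2)[symmetric] v_def n c_def[symmetric] by simp
      finally show ?thesis .
    qed (simp add: v_def)
    have v1: "v 1 = 0" unfolding v_def by simp
    have "expectation (\<lambda>\<omega>. X \<omega> ^ (n + 2)) = real (n + 1) * expectation (\<lambda>\<omega>. (X \<omega>)\<^sup>2) * expectation (\<lambda>\<omega>. X \<omega> ^ n)" for n
      unfolding e v2 rec ..
    thus ?thesis using pw e[of 1] v1 by simp
  qed
  show "integrable M (\<lambda>\<omega>. X \<omega> ^ n)" "expectation X = 0"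
    "expectation (\<lambda>\<omega>. X \<omega> ^ (n + 2)) = real (n + 1) * expectation (\<lambda>\<omega>. (X \<omega>)\<^sup>2) * expectation (\<lambda>\<omega>. X \<omega> ^ n)"
    using main by blast+
qed

lemma centered_gaussian_even_moment:
  assumes "centered_gaussian M X"
  shows "expectation (\<lambda>\<omega>. X \<omega> ^ (2 * q)) = (\<Prod>i<q. real (2 * i + 1)) * expectation (\<lambda>\<omega>. (X \<omega>)\<^sup>2) ^ q"
proof (induction q)
  case 0 show ?case by (simp add: prob_space)
next
  case (Suc q)
  have "2 * Suc q = 2 * q + 2" by simp
  thus ?case using centered_gaussian_moments(3)[OF assms, of "2 * q"] Suc by (simp only: prod.lessThan_Suc power_Suc) simp
qed

text \<open>Joint Gaussianity over an arbitrary index set instead of a set of times, so that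
  increments, possibly with shared end points, can be indexed by their position in the word.\<close>

definition gaussian_family :: "'i set \<Rightarrow> ('i \<Rightarrow> 'a \<Rightarrow> real) \<Rightarrow> bool" where
  "gaussian_family L X \<longleftrightarrow> (\<forall>A c. finite A \<and> A \<subseteq> L \<longrightarrow> centered_gaussian M (\<lambda>\<omega>. \<Sum>l\<in>A. c l * X l \<omega>))"

text \<open>The factor of larger modulus, raised to the power \<open>i + j\<close>, dominates the
  product.\<close>

lemma gaussian_pair_power_integrable:
  fixes Y Z :: "'a \<Rightarrow> real"
  assumes "\<And>n. integrable M (\<lambda>\<omega>. Y \<omega> ^ n)" "\<And>n. integrable M (\<lambda>\<omega>. Z \<omega> ^ n)"
  shows "integrable M (\<lambda>\<omega>. Z \<omega> ^ i * Y \<omega> ^ j)"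
proof (rule Bochner_Integration.integrable_bound)
  show "integrable M (\<lambda>\<omega>. \<bar>Z \<omega> ^ (i + j)\<bar> + \<bar>Y \<omega> ^ (i + j)\<bar>)"
    using assms by (intro Bochner_Integration.integrable_add integrable_abs)
  have "Y \<in> borel_measurable M" "Z \<in> borel_measurable M" using assms(1)[of 1] assms(2)[of 1] by auto
  thus "(\<lambda>\<omega>. Z \<omega> ^ i * Y \<omega> ^ j) \<in> borel_measurable M" by simp
  have "\<bar>z ^ i * y ^ j\<bar> \<le> \<bar>z ^ (i + j)\<bar> + \<bar>y ^ (i + j)\<bar>" for z y :: real
  proof (cases "\<bar>z\<bar> \<le> \<bar>y\<bar>")
    case True
    have "\<bar>z\<bar> ^ i * \<bar>y\<bar> ^ j \<le> \<bar>y\<bar> ^ i * \<bar>y\<bar> ^ j" using True by (intro mult_right_mono power_mono) auto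
    also have "\<dots> = \<bar>y\<bar> ^ (i + j)" by (simp add: power_add)
    finally show ?thesis by (simp add: abs_mult power_abs add_increasing)
  next
    case False
    have "\<bar>z\<bar> ^ i * \<bar>y\<bar> ^ j \<le> \<bar>z\<bar> ^ i * \<bar>z\<bar> ^ j" using False by (intro mult_left_mono power_mono) auto
    also have "\<dots> = \<bar>z\<bar> ^ (i + j)" by (simp add: power_add)
    finally show ?thesis by (simp add: abs_mult power_abs add_increasing2)
  qed
  thus "AE \<omega> in M. norm (Z \<omega> ^ i * Y \<omega> ^ j) \<le> norm (\<bar>Z \<omega> ^ (i + j)\<bar> + \<bar>Y \<omega> ^ (i + j)\<bar>)" by simp
qed

text \<open>Compare the coefficients of \<open>t\<close> in the moment recursion for \<open>Y + t Z\<close>.\<close>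

lemma gaussian_stein_power:
  assumes G: "\<And>t. centered_gaussian M (\<lambda>\<omega>. Y \<omega> + t * Z \<omega>)" and Z: "centered_gaussian M Z"
  shows "expectation (\<lambda>\<omega>. Z \<omega> * Y \<omega> ^ Suc n) = real (Suc n) * expectation (\<lambda>\<omega>. Z \<omega> * Y \<omega>) * expectation (\<lambda>\<omega>. Y \<omega> ^ n)"
proof (induction n rule: less_induct)
  case (less n)
  have Y: "centered_gaussian M Y" using G[of 0] by simp
  have iY: "integrable M (\<lambda>\<omega>. Y \<omega> ^ i)" for i by (rule centered_gaussian_moments(1)[OF Y])
  have iZ: "integrable M (\<lambda>\<omega>. Z \<omega> ^ i)" for i by (rule centered_gaussian_moments(1)[OF Z])
  have iZY: "integrable M (\<lambda>\<omega>. Z \<omega> ^ i * Y \<omega> ^ j)" for i j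
    by (rule gaussian_pair_power_integrable[OF iY iZ])
  define e where "e = (\<lambda>m j. of_nat (m choose j) * expectation (\<lambda>\<omega>. Z \<omega> ^ j * Y \<omega> ^ (m - j)))"
  have expand: "expectation (\<lambda>\<omega>. (Y \<omega> + t * Z \<omega>) ^ m) = (\<Sum>j\<le>m. e m j * t ^ j)" for m t
  proof -
    have "(Y \<omega> + t * Z \<omega>) ^ m = (\<Sum>j\<le>m. of_nat (m choose j) * t ^ j * (Z \<omega> ^ j * Y \<omega> ^ (m - j)))" for \<omega>
      using binomial_ring[of "t * Z \<omega>" "Y \<omega>" m] by (simp add: add.commute power_mult_distrib algebra_simps)
    hence "expectation (\<lambda>\<omega>. (Y \<omega> + t * Z \<omega>) ^ m) = expectation (\<lambda>\<omega>. \<Sum>j\<le>m. of_nat (m choose j) * t ^ j * (Z \<omega> ^ j * Y \<omega> ^ (m - j)))"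
      by simp
    also have "\<dots> = (\<Sum>j\<le>m. expectation (\<lambda>\<omega>. of_nat (m choose j) * t ^ j * (Z \<omega> ^ j * Y \<omega> ^ (m - j))))"
      by (intro Bochner_Integration.integral_sum integrable_mult_right iZY)
    also have "\<dots> = (\<Sum>j\<le>m. e m j * t ^ j)" unfolding e_def by (intro sum.cong refl) (simp add: algebra_simps)
    finally show ?thesis .
  qed
  have eq: "(\<lambda>t. \<Sum>j\<le>n + 2. e (n + 2) j * t ^ j) = (\<lambda>t. real (n + 1) * ((\<Sum>j\<le>2. e 2 j * t ^ j) * (\<Sum>j\<le>n. e n j * t ^ j)))"
  proof
    fix t
    show "(\<Sum>j\<le>n + 2. e (n + 2) j * t ^ j) = real (n + 1) * ((\<Sum>j\<le>2. e 2 j * t ^ j) * (\<Sum>j\<le>n. e n j * t ^ j))"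
      using centered_gaussian_moments(3)[OF G[of t], of n] unfolding expand by (simp only: mult.assoc)
  qed
  have d1: "((\<lambda>t. \<Sum>j\<le>n + 2. e (n + 2) j * t ^ j) has_real_derivative e (n + 2) 1) (at 0)"
    using DERIV_polynomial_at_0[where a = "e (n + 2)" and m = "n + 2"] by simp
  have z0: "(\<Sum>j\<le>m. a j * (0::real) ^ j) = a 0" for m and a :: "nat \<Rightarrow> real"
    by (simp add: sum.atMost_shift)
  have d2: "((\<lambda>t. real (n + 1) * ((\<Sum>j\<le>2. e 2 j * t ^ j) * (\<Sum>j\<le>n. e n j * t ^ j))) has_real_derivative
      real (n + 1) * (e 2 1 * e n 0 + (if n \<ge> 1 then e n 1 else 0) * e 2 0)) (at 0)"
    using DERIV_cmult[OF DERIV_mult[OF DERIV_polynomial_at_0[where a = "e 2" and m = 2] DERIV_polynomial_at_0[where a = "e n" and m = n]], of "real (n + 1)"]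
    by (simp only: z0) simp
  have key: "e (n + 2) 1 = real (n + 1) * (e 2 1 * e n 0 + (if n \<ge> 1 then e n 1 else 0) * e 2 0)"
    by (rule DERIV_unique[OF d1]) (use d2 eq in simp)
  let ?C = "expectation (\<lambda>\<omega>. Z \<omega> * Y \<omega>)"
  have e1: "e (Suc m) 1 = real (Suc m) * expectation (\<lambda>\<omega>. Z \<omega> * Y \<omega> ^ m)" for m unfolding e_def by simp
  have e0: "e m 0 = expectation (\<lambda>\<omega>. Y \<omega> ^ m)" for m unfolding e_def by simp
  have e21: "e 2 1 = 2 * ?C" using e1[of 1] by (simp add: numeral_2_eq_2)
  have key': "real (n + 2) * expectation (\<lambda>\<omega>. Z \<omega> * Y \<omega> ^ Suc n) =
      real (n + 1) * (2 * ?C * e n 0 + (if n \<ge> 1 then e n 1 else 0) * e 2 0)"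
    using key e1[of "Suc n"] unfolding e21 by simp
  \<comment> \<open>The part stemming from the dependence of the \<open>n\<close>-th moment of
    \<open>Y + t Z\<close> on \<open>t\<close>. By the induction hypothesis and the moment recursion
    it is \<open>n\<close> times the covariance times the \<open>n\<close>-th moment of
    \<open>Y\<close>; added to the leading \<open>2\<close> it produces the factor
    \<open>n + 2\<close>, which then cancels.\<close>
  have tail: "(if n \<ge> 1 then e n 1 else 0) * e 2 0 = real n * ?C * e n 0"
  proof (cases n)
    case 0 thus ?thesis by simp
  next
    case (Suc m)
    show ?thesis
    proof (cases m)
      case 0
      have "e n 0 = 0" using centered_gaussian_moments(2)[OF Y] Suc 0 unfolding e0 by simp
      moreover have "e n 1 = 0" using e1[of 0] centered_gaussian_moments(2)[OF Z] Suc 0 by simp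
      ultimately show ?thesis by simp
    next
      case (Suc m')
      have n: "n = m' + 2" using \<open>n = Suc m\<close> Suc by simp
      have "e n 1 = real n * (real (Suc m') * ?C * expectation (\<lambda>\<omega>. Y \<omega> ^ m'))"
        using e1[of "Suc m'"] less.IH[of m'] n by simp
      moreover have "e n 0 = real (m' + 1) * e 2 0 * expectation (\<lambda>\<omega>. Y \<omega> ^ m')"
        unfolding e0 n by (rule centered_gaussian_moments(3)[OF Y])
      ultimately show ?thesis using n by (simp add: algebra_simps)
    qed
  qed
  have "real (n + 2) * expectation (\<lambda>\<omega>. Z \<omega> * Y \<omega> ^ Suc n) = real (n + 2) * (real (n + 1) * ?C * e n 0)"
    unfolding key' tail by (simp add: algebra_simps)
  thus ?case unfolding e0 by simp
qed

lemma gaussian_family_sum: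
  assumes "gaussian_family L X" "finite A" "A \<subseteq> L"
  shows "centered_gaussian M (\<lambda>\<omega>. \<Sum>l\<in>A. X l \<omega>)"
  using assms unfolding gaussian_family_def by (auto dest!: spec[of _ A] spec[of _ "\<lambda>_. 1"])

lemma gaussian_family_single:
  assumes "gaussian_family L X" "z \<in> L"
  shows "centered_gaussian M (X z)"
  using gaussian_family_sum[OF assms(1), of "{z}"] assms(2) by simp

text \<open>Polarization writes the product as a combination of powers of the partial sums
  \<open>S B\<close>, to which \<open>gaussian_stein_power\<close> applies. The covariance with
  \<open>S B\<close> splits over the \<open>l\<close> in \<open>B\<close>; for fixed
  \<open>l\<close> the sets \<open>B\<close> containing \<open>l\<close> form a polarization of the
  product over \<open>A - {l}\<close> with offset \<open>X l\<close>.\<close>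

lemma gaussian_family_stein:
  assumes X: "gaussian_family L X" and A: "finite A" "A \<subseteq> L" and z: "z \<in> L" "z \<notin> A"
  shows "integrable M (\<lambda>\<omega>. \<Prod>l\<in>A. X l \<omega>)"
    and "expectation (\<lambda>\<omega>. X z \<omega> * (\<Prod>l\<in>A. X l \<omega>)) =
       (\<Sum>l\<in>A. expectation (\<lambda>\<omega>. X z \<omega> * X l \<omega>) * expectation (\<lambda>\<omega>. \<Prod>m\<in>A - {l}. X m \<omega>))"
proof -
  define S where "S = (\<lambda>B \<omega>. \<Sum>l\<in>B. X l \<omega>)"
  have fB: "finite B" if "B \<subseteq> A" for B using that A finite_subset by auto
  have SB: "centered_gaussian M (S B)" if "B \<subseteq> A" for B
    unfolding S_def by (rule gaussian_family_sum[OF X fB[OF that]]) (use that A in auto)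
  have Z: "centered_gaussian M (X z)" by (rule gaussian_family_single[OF X z(1)])
  have SZ: "centered_gaussian M (\<lambda>\<omega>. S B \<omega> + t * X z \<omega>)" if "B \<subseteq> A" for B t
  proof -
    have zB: "z \<notin> B" using that z by auto
    have "(\<lambda>\<omega>. S B \<omega> + t * X z \<omega>) = (\<lambda>\<omega>. \<Sum>l\<in>insert z B. (if l = z then t else 1) * X l \<omega>)"
    proof
      fix \<omega>
      have "(\<Sum>l\<in>insert z B. (if l = z then t else 1) * X l \<omega>) = t * X z \<omega> + (\<Sum>l\<in>B. (if l = z then t else 1) * X l \<omega>)"
        using zB fB[OF that] by simp
      also have "(\<Sum>l\<in>B. (if l = z then t else 1) * X l \<omega>) = S B \<omega>" unfolding S_def using zB by (intro sum.cong) auto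
      finally show "S B \<omega> + t * X z \<omega> = (\<Sum>l\<in>insert z B. (if l = z then t else 1) * X l \<omega>)" by simp
    qed
    moreover have "finite (insert z B)" "insert z B \<subseteq> L" using fB[OF that] that A z by auto
    ultimately show ?thesis using X unfolding gaussian_family_def by metis
  qed
  have pol: "(\<Prod>l\<in>A'. X l \<omega>) = (\<Sum>B\<in>Pow A'. (-1) ^ (card A' - card B) / fact (card A') * (x + S B \<omega>) ^ card A')"
    if "finite A'" for A' \<omega> x
  proof -
    have "fact (card A') * (\<Prod>l\<in>A'. X l \<omega>) = (\<Sum>B\<in>Pow A'. (-1) ^ (card A' - card B) * (x + S B \<omega>) ^ card A')"
      using polarization[OF that order_refl, where y = "\<lambda>l. X l \<omega>" and x = x] unfolding S_def by simp
    hence "(\<Prod>l\<in>A'. X l \<omega>) = (\<Sum>B\<in>Pow A'. (-1) ^ (card A' - card B) * (x + S B \<omega>) ^ card A') / fact (card A')"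
      by (simp add: field_simps)
    thus ?thesis by (simp add: sum_divide_distrib)
  qed
  have pol0: "(\<Prod>l\<in>A. X l \<omega>) = (\<Sum>B\<in>Pow A. (-1) ^ (card A - card B) / fact (card A) * S B \<omega> ^ card A)" for \<omega>
    using pol[OF A(1), of \<omega> 0] by simp
  have iS: "integrable M (\<lambda>\<omega>. S B \<omega> ^ n)" if "B \<subseteq> A" for B n by (rule centered_gaussian_moments(1)[OF SB[OF that]])
  have iZ: "integrable M (\<lambda>\<omega>. X z \<omega> ^ n)" for n by (rule centered_gaussian_moments(1)[OF Z])
  have iZS: "integrable M (\<lambda>\<omega>. X z \<omega> * S B \<omega> ^ n)" if "B \<subseteq> A" for B n
    using gaussian_pair_power_integrable[OF iS[OF that] iZ, of 1 n] by simp
  have iZX: "integrable M (\<lambda>\<omega>. X z \<omega> * X l \<omega>)" if "l \<in> A" for l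
    using iZS[of "{l}" 1] that unfolding S_def by simp
  show "integrable M (\<lambda>\<omega>. \<Prod>l\<in>A. X l \<omega>)"
    unfolding pol0 by (auto intro!: Bochner_Integration.integrable_sum integrable_mult_right iS)
  show "expectation (\<lambda>\<omega>. X z \<omega> * (\<Prod>l\<in>A. X l \<omega>)) =
       (\<Sum>l\<in>A. expectation (\<lambda>\<omega>. X z \<omega> * X l \<omega>) * expectation (\<lambda>\<omega>. \<Prod>m\<in>A - {l}. X m \<omega>))"
  proof (cases "A = {}")
    case True thus ?thesis using centered_gaussian_moments(2)[OF Z] by simp
  next
    case False
    define N where "N = card A - 1"
    have N: "card A = Suc N" unfolding N_def using False A by (simp add: card_gt_0_iff)
    let ?C = "\<lambda>l. expectation (\<lambda>\<omega>. X z \<omega> * X l \<omega>)"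
    let ?s = "\<lambda>B. (-1) ^ (card A - card B) / fact (card A) :: real"
    have CB: "expectation (\<lambda>\<omega>. X z \<omega> * S B \<omega>) = (\<Sum>l\<in>B. ?C l)" if "B \<subseteq> A" for B
      unfolding S_def sum_distrib_left
      by (intro Bochner_Integration.integral_sum) (use iZX that in auto)
    have "expectation (\<lambda>\<omega>. X z \<omega> * (\<Prod>l\<in>A. X l \<omega>)) = expectation (\<lambda>\<omega>. \<Sum>B\<in>Pow A. ?s B * (X z \<omega> * S B \<omega> ^ Suc N))"
      unfolding pol0 N sum_distrib_left by (simp add: algebra_simps)
    also have "\<dots> = (\<Sum>B\<in>Pow A. expectation (\<lambda>\<omega>. ?s B * (X z \<omega> * S B \<omega> ^ Suc N)))"
      by (intro Bochner_Integration.integral_sum integrable_mult_right iZS) auto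
    also have "\<dots> = (\<Sum>B\<in>Pow A. \<Sum>l\<in>A. if l \<in> B then ?s B * (real (Suc N) * ?C l * expectation (\<lambda>\<omega>. S B \<omega> ^ N)) else 0)"
    proof (intro sum.cong refl)
      fix B assume "B \<in> Pow A"
      hence B: "B \<subseteq> A" by simp
      have "expectation (\<lambda>\<omega>. ?s B * (X z \<omega> * S B \<omega> ^ Suc N)) = ?s B * (real (Suc N) * (\<Sum>l\<in>B. ?C l) * expectation (\<lambda>\<omega>. S B \<omega> ^ N))"
        using gaussian_stein_power[OF SZ[OF B] Z, of N] unfolding CB[OF B] by simp
      also have "\<dots> = (\<Sum>l\<in>B. ?s B * (real (Suc N) * ?C l * expectation (\<lambda>\<omega>. S B \<omega> ^ N)))"
        by (simp add: sum_distrib_left sum_distrib_right)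
      also have "\<dots> = (\<Sum>l\<in>A. if l \<in> B then ?s B * (real (Suc N) * ?C l * expectation (\<lambda>\<omega>. S B \<omega> ^ N)) else 0)"
        using B A by (simp add: sum.inter_restrict[symmetric] Int_absorb1)
      finally show "expectation (\<lambda>\<omega>. ?s B * (X z \<omega> * S B \<omega> ^ Suc N)) = \<dots>" .
    qed
    also have "\<dots> = (\<Sum>l\<in>A. \<Sum>B\<in>Pow A. if l \<in> B then ?s B * (real (Suc N) * ?C l * expectation (\<lambda>\<omega>. S B \<omega> ^ N)) else 0)"
      by (rule sum.swap)
    also have "\<dots> = (\<Sum>l\<in>A. ?C l * expectation (\<lambda>\<omega>. \<Prod>m\<in>A - {l}. X m \<omega>))"
    proof (intro sum.cong refl)
      fix l assume l: "l \<in> A"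
      define A' where "A' = A - {l}"
      have A': "finite A'" "l \<notin> A'" "A = insert l A'" "card A' = N" using A l N unfolding A'_def by auto
      have inj: "inj_on (insert l) (Pow A')"
        by (rule inj_on_inverseI[where g = "\<lambda>B. B - {l}"]) (use A' in auto)
      have "(\<Sum>B\<in>Pow A. if l \<in> B then ?s B * (real (Suc N) * ?C l * expectation (\<lambda>\<omega>. S B \<omega> ^ N)) else 0)
          = (\<Sum>B\<in>insert l ` Pow A'. ?s B * (real (Suc N) * ?C l * expectation (\<lambda>\<omega>. S B \<omega> ^ N)))"
      proof (rule sum.mono_neutral_cong_right)
        show "insert l ` Pow A' \<subseteq> Pow A" using A' by auto
        show "\<forall>i\<in>Pow A - insert l ` Pow A'. (if l \<in> i then ?s i * (real (Suc N) * ?C l * expectation (\<lambda>\<omega>. S i \<omega> ^ N)) else 0) = 0"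
        proof
          fix i assume i: "i \<in> Pow A - insert l ` Pow A'"
          have "l \<notin> i"
          proof
            assume "l \<in> i"
            hence "i = insert l (i - {l})" "i - {l} \<in> Pow A'" using i A' by auto
            thus False using i by blast
          qed
          thus "(if l \<in> i then ?s i * (real (Suc N) * ?C l * expectation (\<lambda>\<omega>. S i \<omega> ^ N)) else 0) = 0" by simp
        qed
      qed (use A in auto)
      also have "\<dots> = (\<Sum>B\<in>Pow A'. ?s (insert l B) * (real (Suc N) * ?C l * expectation (\<lambda>\<omega>. S (insert l B) \<omega> ^ N)))"
        by (simp add: sum.reindex[OF inj])
      also have "\<dots> = ?C l * (\<Sum>B\<in>Pow A'. (-1) ^ (N - card B) / fact N * expectation (\<lambda>\<omega>. (X l \<omega> + S B \<omega>) ^ N))"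
        unfolding sum_distrib_left
      proof (intro sum.cong refl)
        fix B assume B: "B \<in> Pow A'"
        have "l \<notin> B" "finite B" using B A' finite_subset by auto
        hence "card (insert l B) = Suc (card B)" "S (insert l B) = (\<lambda>\<omega>. X l \<omega> + S B \<omega>)" unfolding S_def by auto
        thus "?s (insert l B) * (real (Suc N) * ?C l * expectation (\<lambda>\<omega>. S (insert l B) \<omega> ^ N)) =
           ?C l * ((-1) ^ (N - card B) / fact N * expectation (\<lambda>\<omega>. (X l \<omega> + S B \<omega>) ^ N))"
          unfolding N by (simp add: field_simps del: of_nat_Suc)
      qed
      also have "(\<Sum>B\<in>Pow A'. (-1) ^ (N - card B) / fact N * expectation (\<lambda>\<omega>. (X l \<omega> + S B \<omega>) ^ N))
         = expectation (\<lambda>\<omega>. \<Sum>B\<in>Pow A'. (-1) ^ (N - card B) / fact N * (X l \<omega> + S B \<omega>) ^ N)"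
      proof (subst Bochner_Integration.integral_sum)
        fix B assume B: "B \<in> Pow A'"
        have "l \<notin> B" "finite B" using B A' finite_subset by auto
        hence "S (insert l B) = (\<lambda>\<omega>. X l \<omega> + S B \<omega>)" unfolding S_def by auto
        moreover have "insert l B \<subseteq> A" using B A' by auto
        ultimately show "integrable M (\<lambda>\<omega>. (-1) ^ (N - card B) / fact N * (X l \<omega> + S B \<omega>) ^ N)"
          using iS[of "insert l B" N] by (intro integrable_mult_right) simp
      qed simp
      also have "\<dots> = expectation (\<lambda>\<omega>. \<Prod>m\<in>A'. X m \<omega>)"
        by (rule Bochner_Integration.integral_cong[OF refl]) (use pol[OF A'(1)] A'(4) in simp)
      finally show "(\<Sum>B\<in>Pow A. if l \<in> B then ?s B * (real (Suc N) * ?C l * expectation (\<lambda>\<omega>. S B \<omega> ^ N)) else 0) =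
         ?C l * expectation (\<lambda>\<omega>. \<Prod>m\<in>A - {l}. X m \<omega>)" unfolding A'_def .
    qed
    finally show ?thesis .
  qed
qed

end

section \<open>Recursion over pairings\<close>

definition pairings :: "nat set \<Rightarrow> nat set set set" where
  "pairings A = {P. partition_on A P \<and> (\<forall>b\<in>P. card b = 2)}"

lemma finite_pairings: "finite A \<Longrightarrow> finite (pairings A)"
  by (rule finite_subset[of _ "Pow (Pow A)"]) (auto simp: pairings_def partition_on_def)

lemma pairings_decompose:
  assumes A: "finite A" "z \<in> A"
  shows "pairings A = (\<Union>l\<in>A - {z}. insert {z, l} ` pairings (A - {z} - {l}))"
proof (intro equalityI subsetI)
  fix P assume P: "P \<in> pairings A"
  hence part: "\<Union>P = A" "\<And>b c. b \<in> P \<Longrightarrow> c \<in> P \<Longrightarrow> b \<noteq> c \<Longrightarrow> b \<inter> c = {}" "{} \<notin> P"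
    and c2: "\<And>b. b \<in> P \<Longrightarrow> card b = 2"
    unfolding pairings_def partition_on_def disjoint_def by auto
  obtain b where b: "b \<in> P" "z \<in> b" using part(1) A by blast
  obtain l where l: "b = {z, l}" "l \<noteq> z" using c2[OF b(1)] b(2) by (auto simp: card_2_iff)
  have lA: "l \<in> A - {z}" using l b part(1) by auto
  have "\<Union>(P - {b}) = A - {z} - {l}"
  proof (intro equalityI subsetI)
    fix x assume "x \<in> \<Union>(P - {b})"
    then obtain c where c: "c \<in> P" "c \<noteq> b" "x \<in> c" by auto
    hence "x \<notin> b" using part(2)[OF c(1) b(1) c(2)] by blast
    thus "x \<in> A - {z} - {l}" using c part(1) l by blast
  next
    fix x assume "x \<in> A - {z} - {l}"
    hence "x \<in> \<Union>P" "x \<notin> b" using part(1) l by auto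
    thus "x \<in> \<Union>(P - {b})" by blast
  qed
  hence "P - {b} \<in> pairings (A - {z} - {l})"
    unfolding pairings_def partition_on_def disjoint_def using part(3)
    by (intro CollectI conjI ballI impI) (auto intro: c2 dest: part(2))
  moreover have "P = insert {z, l} (P - {b})" using b l by auto
  ultimately show "P \<in> (\<Union>l\<in>A - {z}. insert {z, l} ` pairings (A - {z} - {l}))" using lA by blast
next
  fix P assume "P \<in> (\<Union>l\<in>A - {z}. insert {z, l} ` pairings (A - {z} - {l}))"
  then obtain l Q where l: "l \<in> A - {z}" and Q: "Q \<in> pairings (A - {z} - {l})" and P: "P = insert {z, l} Q" by blast
  have q: "\<Union>Q = A - {z} - {l}" "\<And>b c. b \<in> Q \<Longrightarrow> c \<in> Q \<Longrightarrow> b \<noteq> c \<Longrightarrow> b \<inter> c = {}" "{} \<notin> Q"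
    "\<And>b. b \<in> Q \<Longrightarrow> card b = 2"
    using Q unfolding pairings_def partition_on_def disjoint_def by auto
  have u: "\<Union>P = A" using q(1) l A unfolding P by auto
  have d: "b \<inter> c = {}" if "b \<in> P" "c \<in> P" "b \<noteq> c" for b c
  proof -
    have "{z, l} \<inter> c = {}" if "c \<in> Q" for c using q(1) that by blast
    thus ?thesis using that q(2)[of b c] unfolding P by auto
  qed
  have "card b = 2" if "b \<in> P" for b using that q(4) l unfolding P by auto
  thus "P \<in> pairings A" using u d q(3) unfolding pairings_def partition_on_def disjoint_def P by auto
qed

text \<open>Organised by the partner of \<open>z\<close>, the sum has the shape of the expansion in
  \<open>increments_stein\<close>.\<close>

lemma sum_pairings:
  fixes f :: "nat set set \<Rightarrow> real"
  assumes A: "finite A" "z \<in> A"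
  shows "(\<Sum>P\<in>pairings A. f P) = (\<Sum>l\<in>A - {z}. \<Sum>P\<in>pairings (A - {z} - {l}). f (insert {z, l} P))"
proof -
  have notin: "z \<notin> b" if "P \<in> pairings (A - {z} - {l})" "b \<in> P" for P b l
    using that unfolding pairings_def partition_on_def by blast
  have "(\<Sum>P\<in>pairings A. f P) = (\<Sum>l\<in>A - {z}. \<Sum>P\<in>insert {z, l} ` pairings (A - {z} - {l}). f P)"
    unfolding pairings_decompose[OF A]
  proof (rule sum.UNION_disjoint)
    show "\<forall>l\<in>A - {z}. \<forall>m\<in>A - {z}. l \<noteq> m \<longrightarrow>
      insert {z, l} ` pairings (A - {z} - {l}) \<inter> insert {z, m} ` pairings (A - {z} - {m}) = {}"
    proof (intro ballI impI)
      fix l m assume lm: "l \<in> A - {z}" "m \<in> A - {z}" "l \<noteq> m"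
      have "insert {z, l} P \<noteq> insert {z, m} Q" if PQ: "P \<in> pairings (A - {z} - {l})" "Q \<in> pairings (A - {z} - {m})" for P Q
      proof
        assume "insert {z, l} P = insert {z, m} Q"
        hence "{z, l} = {z, m} \<or> {z, l} \<in> Q" by blast
        moreover have "{z, l} \<notin> Q" using notin[OF PQ(2), of "{z, l}"] by blast
        ultimately show False using lm by (auto simp: doubleton_eq_iff)
      qed
      thus "insert {z, l} ` pairings (A - {z} - {l}) \<inter> insert {z, m} ` pairings (A - {z} - {m}) = {}" by blast
    qed
  qed (use A finite_pairings in auto)
  also have "\<dots> = (\<Sum>l\<in>A - {z}. \<Sum>P\<in>pairings (A - {z} - {l}). f (insert {z, l} P))"
  proof (rule sum.cong[OF refl])
    fix l assume "l \<in> A - {z}"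
    have "inj_on (insert {z, l}) (pairings (A - {z} - {l}))"
    proof (rule inj_on_inverseI[where g = "\<lambda>P. P - {{z, l}}"])
      fix P assume "P \<in> pairings (A - {z} - {l})"
      hence "{z, l} \<notin> P" using notin by blast
      thus "insert {z, l} P - {{z, l}} = P" by simp
    qed
    thus "(\<Sum>P\<in>insert {z, l} ` pairings (A - {z} - {l}). f P) = (\<Sum>P\<in>pairings (A - {z} - {l}). f (insert {z, l} P))"
      by (simp add: sum.reindex)
  qed
  finally show ?thesis .
qed

lemma prod_pairing_insert:
  fixes g :: "nat \<Rightarrow> nat \<Rightarrow> 'b::comm_monoid_mult"
  assumes A: "finite A" and P: "P \<in> pairings (A - {z} - {l})" and lz: "z < l"
  shows "(\<Prod>b\<in>insert {z, l} P. g (Min b) (Max b)) = g z l * (\<Prod>b\<in>P. g (Min b) (Max b))"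
proof -
  have "finite P" "{z, l} \<notin> P"
    using P A finite_subset[of P "Pow A"] unfolding pairings_def partition_on_def by auto
  thus ?thesis using lz by (simp add: min_def max_def)
qed

section \<open>Wick formula for increments of the process\<close>

context fractional_brownian_motion begin

definition increment :: "(nat \<Rightarrow> nat) \<Rightarrow> (nat \<Rightarrow> real) \<Rightarrow> (nat \<Rightarrow> real) \<Rightarrow> nat \<Rightarrow> 'a \<Rightarrow> real" where
  "increment w p q l \<omega> = B (w l) (p l) \<omega> - B (w l) (q l) \<omega>"

lemma increments_gaussian_family:
  assumes i: "i \<in> {1..d}" and pq: "\<And>l. l \<in> L \<Longrightarrow> w l = i \<and> p l \<ge> 0 \<and> q l \<ge> 0"
  shows "gaussian_family L (increment w p q)"
  unfolding gaussian_family_def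
proof (intro allI impI)
  fix A :: "nat set" and c :: "nat \<Rightarrow> real" assume "finite A \<and> A \<subseteq> L"
  hence A: "finite A" "A \<subseteq> L" by auto
  define T where "T = p ` A \<union> q ` A"
  \<comment> \<open>Coefficients are collected by time, since different increments may share end
    points and the Gaussian hypothesis concerns sums over sets of times.\<close>
  define e where "e = (\<lambda>t. (\<Sum>l\<in>{l\<in>A. p l = t}. c l) - (\<Sum>l\<in>{l\<in>A. q l = t}. c l))"
  have T: "finite T" "T \<subseteq> {0..}" using A pq unfolding T_def by auto
  have grp: "(\<Sum>t\<in>T. (\<Sum>l\<in>{l\<in>A. r l = t}. c l) * B i t \<omega>) = (\<Sum>l\<in>A. c l * B i (r l) \<omega>)" if "r ` A \<subseteq> T" for r :: "nat \<Rightarrow> real" and \<omega>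
  proof -
    have "(\<Sum>t\<in>T. (\<Sum>l\<in>{l\<in>A. r l = t}. c l) * B i t \<omega>) = (\<Sum>t\<in>T. \<Sum>l\<in>{l\<in>A. r l = t}. c l * B i (r l) \<omega>)"
      unfolding sum_distrib_right by (intro sum.cong) auto
    also have "\<dots> = (\<Sum>l\<in>A. c l * B i (r l) \<omega>)" by (rule sum.group[OF A(1) T(1) that])
    finally show ?thesis .
  qed
  have "(\<Sum>l\<in>A. c l * increment w p q l \<omega>) = (\<Sum>t\<in>T. e t * B i t \<omega>)" for \<omega>
  proof -
    have "(\<Sum>l\<in>A. c l * increment w p q l \<omega>) = (\<Sum>l\<in>A. c l * B i (p l) \<omega> - c l * B i (q l) \<omega>)"
      using A pq by (intro sum.cong) (auto simp: increment_def right_diff_distrib)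
    also have "\<dots> = (\<Sum>l\<in>A. c l * B i (p l) \<omega>) - (\<Sum>l\<in>A. c l * B i (q l) \<omega>)" by (rule sum_subtractf)
    also have "\<dots> = (\<Sum>t\<in>T. e t * B i t \<omega>)"
      using grp[of p \<omega>] grp[of q \<omega>] unfolding e_def T_def by (simp add: left_diff_distrib sum_subtractf)
    finally show ?thesis .
  qed
  moreover have "centered_gaussian M (\<lambda>\<omega>. \<Sum>t\<in>T. e t * B i t \<omega>)"
    using gaussian[OF i] T unfolding centered_gaussian_process_def by blast
  ultimately show "centered_gaussian M (\<lambda>\<omega>. \<Sum>l\<in>A. c l * increment w p q l \<omega>)" by simp
qed

lemma increments_component_product:
  assumes A: "finite A" and pq: "\<And>l. l \<in> A \<Longrightarrow> w l \<in> {1..d} \<and> p l \<ge> 0 \<and> q l \<ge> 0" and i: "i \<in> {1..d}"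
  shows "integrable M (\<lambda>\<omega>. \<Prod>l\<in>{l\<in>A. w l = i}. increment w p q l \<omega>)"
proof -
  let ?L = "{l\<in>A. w l = i}"
  show ?thesis
  proof (cases "?L = {}")
    case True thus ?thesis by (simp only: True) simp
  next
    case False
    define z' where "z' = Suc (Max A)"
    have z': "z' \<notin> A" using Max_ge[OF A, of z'] unfolding z'_def by auto
    \<comment> \<open>a zero increment at a fresh index supplies the extra member that the lemma asks for\<close>
    have "gaussian_family (insert z' ?L) (increment (w(z' := i)) (p(z' := 0)) (q(z' := 0)))"
      by (rule increments_gaussian_family[OF i]) (use pq in auto)
    from gaussian_family_stein(1)[OF this, of ?L z'] A z'
    have "integrable M (\<lambda>\<omega>. \<Prod>l\<in>?L. increment (w(z' := i)) (p(z' := 0)) (q(z' := 0)) l \<omega>)" by auto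
    moreover have "(\<lambda>\<omega>. \<Prod>l\<in>?L. increment (w(z' := i)) (p(z' := 0)) (q(z' := 0)) l \<omega>) = (\<lambda>\<omega>. \<Prod>l\<in>?L. increment w p q l \<omega>)"
      using z' by (intro ext prod.cong) (auto simp: increment_def)
    ultimately show ?thesis by simp
  qed
qed

text \<open>Factors are grouped by component. The product belonging to one component is a measurable
  functional of its path, evaluated at finitely many times, so the independence of the processes
  applies.\<close>

lemma increments_product:
  assumes A: "finite A" and pq: "\<And>l. l \<in> A \<Longrightarrow> w l \<in> {1..d} \<and> p l \<ge> 0 \<and> q l \<ge> 0"
  shows "integrable M (\<lambda>\<omega>. \<Prod>l\<in>A. increment w p q l \<omega>)"
    and "expectation (\<lambda>\<omega>. \<Prod>l\<in>A. increment w p q l \<omega>) =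
       (\<Prod>i\<in>{1..d}. expectation (\<lambda>\<omega>. \<Prod>l\<in>{l\<in>A. w l = i}. increment w p q l \<omega>))"
proof -
  define \<phi> where "\<phi> = (\<lambda>i \<omega>. \<Prod>l\<in>{l\<in>A. w l = i}. increment w p q l \<omega>)"
  have eq: "(\<Prod>l\<in>A. increment w p q l \<omega>) = (\<Prod>i\<in>{1..d}. \<phi> i \<omega>)" for \<omega>
    unfolding \<phi>_def by (rule prod.group[symmetric]) (use A pq in auto)
  define Y where "Y = (\<lambda>i f. \<Prod>l\<in>{l\<in>A. w l = i}. f (p l) - f (q l) :: real)"
  have Ym: "Y i \<in> borel_measurable (PiM {0..} (\<lambda>_. borel))" for i unfolding Y_def
  proof (intro borel_measurable_prod borel_measurable_diff)
    fix l assume "l \<in> {l \<in> A. w l = i}"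
    hence "p l \<in> {0..}" "q l \<in> {0..}" using pq by auto
    thus "(\<lambda>f. f (p l)) \<in> borel_measurable (PiM {0..} (\<lambda>_. borel))" "(\<lambda>f. f (q l)) \<in> borel_measurable (PiM {0..} (\<lambda>_. borel))"
      by (auto intro: measurable_component_singleton)
  qed
  have Y\<phi>: "Y i (\<lambda>t\<in>{0..}. B i t \<omega>) = \<phi> i \<omega>" for i \<omega>
    unfolding Y_def \<phi>_def increment_def using pq by (intro prod.cong) auto
  have "indep_vars (\<lambda>_. borel) (\<lambda>i \<omega>. Y i (\<lambda>t\<in>{0..}. B i t \<omega>)) {1..d}"
    by (rule indep_vars_compose2[OF independent]) (rule Ym)
  hence ind: "indep_vars (\<lambda>_. borel) \<phi> {1..d}" unfolding Y\<phi> .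
  have int: "integrable M (\<phi> i)" if "i \<in> {1..d}" for i
    unfolding \<phi>_def by (rule increments_component_product[OF A pq that])
  show "integrable M (\<lambda>\<omega>. \<Prod>l\<in>A. increment w p q l \<omega>)"
    unfolding eq by (rule indep_vars_integrable[OF _ ind int]) simp
  show "expectation (\<lambda>\<omega>. \<Prod>l\<in>A. increment w p q l \<omega>) =
       (\<Prod>i\<in>{1..d}. expectation (\<lambda>\<omega>. \<Prod>l\<in>{l\<in>A. w l = i}. increment w p q l \<omega>))"
    unfolding eq using indep_vars_lebesgue_integral[OF _ ind int] by (simp add: \<phi>_def)
qed

text \<open>The value 0 for different components lets the Wick sum run over all pairings; those not
  below the word drop out by themselves.\<close>

definition increment_cov :: "(nat \<Rightarrow> nat) \<Rightarrow> (nat \<Rightarrow> real) \<Rightarrow> (nat \<Rightarrow> real) \<Rightarrow> nat \<Rightarrow> nat \<Rightarrow> real" where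
  "increment_cov w p q l m =
     (if w l = w m then expectation (\<lambda>\<omega>. increment w p q l \<omega> * increment w p q m \<omega>) else 0)"

text \<open>Independence isolates the component of \<open>z\<close>; the Gaussian expansion is
  applied there, and the factors of the other components are then put back unchanged.\<close>

lemma increments_stein:
  assumes A: "finite A" and z: "z \<notin> A" and pq: "\<And>l. l \<in> insert z A \<Longrightarrow> w l \<in> {1..d} \<and> p l \<ge> 0 \<and> q l \<ge> 0"
  shows "expectation (\<lambda>\<omega>. \<Prod>l\<in>insert z A. increment w p q l \<omega>) =
    (\<Sum>l\<in>A. increment_cov w p q z l * expectation (\<lambda>\<omega>. \<Prod>m\<in>A - {l}. increment w p q m \<omega>))"
proof -
  let ?X = "increment w p q"
  define i where "i = w z"
  have i: "i \<in> {1..d}" unfolding i_def using pq[of z] by simp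
  define E where "E = (\<lambda>A j. expectation (\<lambda>\<omega>. \<Prod>l\<in>{l\<in>A. w l = j}. ?X l \<omega>))"
  let ?L = "{l\<in>A. w l = i}"
  have LL: "{l \<in> insert z A. w l = i} = insert z ?L" unfolding i_def by auto
  have oth: "{l \<in> insert z A. w l = j} = {l\<in>A. w l = j}" if "j \<noteq> i" for j using that unfolding i_def by auto
  have fam: "gaussian_family (insert z ?L) ?X" by (rule increments_gaussian_family[OF i]) (use pq in \<open>auto simp: i_def\<close>)
  have "expectation (\<lambda>\<omega>. \<Prod>l\<in>insert z A. ?X l \<omega>) = (\<Prod>j\<in>{1..d}. E (insert z A) j)"
    unfolding E_def by (rule increments_product(2)) (use A pq in auto)
  also have "\<dots> = E (insert z A) i * (\<Prod>j\<in>{1..d} - {i}. E (insert z A) j)" by (rule prod.remove) (use i in auto)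
  also have "(\<Prod>j\<in>{1..d} - {i}. E (insert z A) j) = (\<Prod>j\<in>{1..d} - {i}. E A j)"
  proof (intro prod.cong refl)
    fix j assume "j \<in> {1..d} - {i}"
    hence "{l \<in> insert z A. w l = j} = {l\<in>A. w l = j}" by (intro oth) auto
    thus "E (insert z A) j = E A j" unfolding E_def by (simp only:)
  qed
  also have "E (insert z A) i = expectation (\<lambda>\<omega>. ?X z \<omega> * (\<Prod>l\<in>?L. ?X l \<omega>))"
    unfolding E_def LL using z A by simp
  also have "\<dots> = (\<Sum>l\<in>?L. expectation (\<lambda>\<omega>. ?X z \<omega> * ?X l \<omega>) * expectation (\<lambda>\<omega>. \<Prod>m\<in>?L - {l}. ?X m \<omega>))"
    by (rule gaussian_family_stein(2)[OF fam]) (use z A in auto)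
  also have "\<dots> * (\<Prod>j\<in>{1..d} - {i}. E A j) = (\<Sum>l\<in>?L. increment_cov w p q z l * expectation (\<lambda>\<omega>. \<Prod>m\<in>A - {l}. ?X m \<omega>))"
    unfolding sum_distrib_right
  proof (intro sum.cong refl)
    fix l assume l: "l \<in> ?L"
    have "expectation (\<lambda>\<omega>. \<Prod>m\<in>A - {l}. ?X m \<omega>) = (\<Prod>j\<in>{1..d}. E (A - {l}) j)"
      unfolding E_def by (rule increments_product(2)) (use A pq in auto)
    also have "\<dots> = E (A - {l}) i * (\<Prod>j\<in>{1..d} - {i}. E (A - {l}) j)" by (rule prod.remove) (use i in auto)
    also have "E (A - {l}) i = expectation (\<lambda>\<omega>. \<Prod>m\<in>?L - {l}. ?X m \<omega>)"
    proof -
      have "{m \<in> A - {l}. w m = i} = ?L - {l}" by auto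
      thus ?thesis unfolding E_def by simp
    qed
    also have "(\<Prod>j\<in>{1..d} - {i}. E (A - {l}) j) = (\<Prod>j\<in>{1..d} - {i}. E A j)"
    proof (intro prod.cong refl)
      fix j assume "j \<in> {1..d} - {i}"
      hence "{m \<in> A - {l}. w m = j} = {m \<in> A. w m = j}" using l by auto
      thus "E (A - {l}) j = E A j" unfolding E_def by simp
    qed
    finally show "expectation (\<lambda>\<omega>. ?X z \<omega> * ?X l \<omega>) * expectation (\<lambda>\<omega>. \<Prod>m\<in>?L - {l}. ?X m \<omega>) * (\<Prod>j\<in>{1..d} - {i}. E A j)
       = increment_cov w p q z l * expectation (\<lambda>\<omega>. \<Prod>m\<in>A - {l}. ?X m \<omega>)"
      using l unfolding increment_cov_def i_def by simp
  qed
  also have "\<dots> = (\<Sum>l\<in>A. increment_cov w p q z l * expectation (\<lambda>\<omega>. \<Prod>m\<in>A - {l}. ?X m \<omega>))"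
    by (rule sum.mono_neutral_left) (use A in \<open>auto simp: increment_cov_def i_def\<close>)
  finally show ?thesis .
qed

text \<open>Isserlis' formula, by expanding along one index at a time and summing over its
  partner.\<close>

lemma wick:
  assumes "finite A" "\<And>l. l \<in> A \<Longrightarrow> w l \<in> {1..d} \<and> p l \<ge> 0 \<and> q l \<ge> 0"
  shows "expectation (\<lambda>\<omega>. \<Prod>l\<in>A. increment w p q l \<omega>) =
    (\<Sum>P\<in>pairings A. \<Prod>b\<in>P. increment_cov w p q (Min b) (Max b))"
  using assms
proof (induction "card A" arbitrary: A rule: less_induct)
  case less
  let ?X = "increment w p q" and ?c = "increment_cov w p q"
  show ?case
  proof (cases "A = {}")
    case True
    have "pairings {} = {{}}" unfolding pairings_def by (auto simp: partition_on_def)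
    thus ?thesis using True by (simp add: prob_space)
  next
    case False
    \<comment> \<open>The minimum is taken so that in the new pair \<open>{z, l}\<close> the element
      \<open>z\<close> is \<open>Min\<close> and \<open>l\<close> is \<open>Max\<close>, in the
      order in which the covariance expects them.\<close>
    define z where "z = Min A"
    have z: "z \<in> A" unfolding z_def using False less.prems by simp
    define A' where "A' = A - {z}"
    have A': "finite A'" "z \<notin> A'" "A = insert z A'" using less.prems z unfolding A'_def by auto
    have zl: "z < l" if "l \<in> A'" for l
      using that less.prems Min_le[of A l] unfolding A'_def z_def by (auto simp: less_le)
    have "expectation (\<lambda>\<omega>. \<Prod>l\<in>A. ?X l \<omega>) = (\<Sum>l\<in>A'. ?c z l * expectation (\<lambda>\<omega>. \<Prod>m\<in>A' - {l}. ?X m \<omega>))"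
      unfolding A'(3) by (rule increments_stein) (use A' less.prems in auto)
    also have "\<dots> = (\<Sum>l\<in>A'. \<Sum>P\<in>pairings (A - {z} - {l}). \<Prod>b\<in>insert {z, l} P. ?c (Min b) (Max b))"
    proof (intro sum.cong refl)
      fix l assume l: "l \<in> A'"
      have sub: "A' - {l} \<subset> A" using l unfolding A'_def by auto
      have "expectation (\<lambda>\<omega>. \<Prod>m\<in>A' - {l}. ?X m \<omega>) = (\<Sum>P\<in>pairings (A' - {l}). \<Prod>b\<in>P. ?c (Min b) (Max b))"
        by (rule less.hyps) (use less.prems sub psubset_card_mono in \<open>auto simp: A'_def\<close>)
      hence "?c z l * expectation (\<lambda>\<omega>. \<Prod>m\<in>A' - {l}. ?X m \<omega>) = (\<Sum>P\<in>pairings (A - {z} - {l}). ?c z l * (\<Prod>b\<in>P. ?c (Min b) (Max b)))"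
        by (simp add: sum_distrib_left A'_def)
      also have "\<dots> = (\<Sum>P\<in>pairings (A - {z} - {l}). \<Prod>b\<in>insert {z, l} P. ?c (Min b) (Max b))"
      proof (intro sum.cong refl)
        fix P assume "P \<in> pairings (A - {z} - {l})"
        from prod_pairing_insert[OF less.prems(1) this zl[OF l], of ?c]
        show "?c z l * (\<Prod>b\<in>P. ?c (Min b) (Max b)) = (\<Prod>b\<in>insert {z, l} P. ?c (Min b) (Max b))" by (rule sym)
      qed
      finally show "?c z l * expectation (\<lambda>\<omega>. \<Prod>m\<in>A' - {l}. ?X m \<omega>) = \<dots>" .
    qed
    also have "\<dots> = (\<Sum>P\<in>pairings A. \<Prod>b\<in>P. ?c (Min b) (Max b))"
      unfolding A'_def by (rule sum_pairings[OF less.prems(1) z, symmetric])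
    finally show ?thesis .
  qed
qed

end

section \<open>Expectation of the dyadic sums\<close>

definition increasing_indices :: "nat \<Rightarrow> nat \<Rightarrow> (nat \<Rightarrow> nat) set" where
  "increasing_indices m N = {j \<in> {1..m} \<rightarrow>\<^sub>E {..<N}. strict_mono_on {1..m} j}"

lemma finite_increasing_indices: "finite (increasing_indices m N)"
  by (rule finite_subset[of _ "{1..m} \<rightarrow>\<^sub>E {..<N}"]) (auto simp: increasing_indices_def intro: finite_PiE)

lemma increasing_indices_Suc:
  "increasing_indices (Suc m) N = (\<Union>q\<in>{..<N}. (\<lambda>j. j(Suc m := q)) ` increasing_indices m q)"
proof (intro equalityI subsetI)
  fix J assume J: "J \<in> increasing_indices (Suc m) N"
  define q where "q = J (Suc m)"
  define j where "j = J(Suc m := undefined)"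
  have mono: "J l < J l'" if "l \<in> {1..Suc m}" "l' \<in> {1..Suc m}" "l < l'" for l l'
    using J that unfolding increasing_indices_def strict_mono_on_def by blast
  have "j l < q" if "l \<in> {1..m}" for l using mono[of l "Suc m"] that unfolding j_def q_def by auto
  moreover have "j l = undefined" if "l \<notin> {1..m}" for l
    using J that unfolding j_def increasing_indices_def by (cases "l = Suc m") (auto simp: PiE_iff extensional_def)
  moreover have "j l < j l'" if "l \<in> {1..m}" "l' \<in> {1..m}" "l < l'" for l l'
    using mono[of l l'] that unfolding j_def by auto
  ultimately have "j \<in> increasing_indices m q"
    unfolding increasing_indices_def strict_mono_on_def by (auto simp: PiE_iff extensional_def)
  moreover have "q < N" using J unfolding q_def increasing_indices_def by (auto simp: PiE_iff)
  moreover have "J = j(Suc m := q)" unfolding j_def q_def by auto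
  ultimately show "J \<in> (\<Union>q\<in>{..<N}. (\<lambda>j. j(Suc m := q)) ` increasing_indices m q)" by blast
next
  fix J assume "J \<in> (\<Union>q\<in>{..<N}. (\<lambda>j. j(Suc m := q)) ` increasing_indices m q)"
  then obtain q j where q: "q < N" and j: "j \<in> increasing_indices m q" and J: "J = j(Suc m := q)" by blast
  have r: "j l < q" if "l \<in> {1..m}" for l using j that unfolding increasing_indices_def by (auto simp: PiE_iff)
  have u: "j l = undefined" if "l \<notin> {1..m}" for l using j that unfolding increasing_indices_def by (auto simp: PiE_iff extensional_def)
  have mono: "j l < j l'" if "l \<in> {1..m}" "l' \<in> {1..m}" "l < l'" for l l'
    using j that unfolding increasing_indices_def strict_mono_on_def by blast
  have "J l < N" if "l \<in> {1..Suc m}" for l using r[of l] q that unfolding J by (cases "l = Suc m") auto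
  moreover have "J l = undefined" if "l \<notin> {1..Suc m}" for l using u[of l] that unfolding J by auto
  moreover have "J l < J l'" if "l \<in> {1..Suc m}" "l' \<in> {1..Suc m}" "l < l'" for l l'
    using mono[of l l'] r[of l] that unfolding J by (cases "l' = Suc m") auto
  ultimately show "J \<in> increasing_indices (Suc m) N"
    unfolding increasing_indices_def strict_mono_on_def by (auto simp: PiE_iff extensional_def)
qed

text \<open>Unfolding the recursion, the range \<open>i < j\<close> at each level makes the indices
  strictly increasing; no cell occurs twice in a product.\<close>

lemma dyadic_sum_expand:
  "dyadic_sum x w n m N = (\<Sum>j\<in>increasing_indices m N. \<Prod>l\<in>{1..m}.
     x (w l) (real (Suc (j l)) / 2 ^ n) - x (w l) (real (j l) / 2 ^ n))"
proof (induction m arbitrary: N)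
  case 0
  have "increasing_indices 0 N = {\<lambda>_. undefined}" unfolding increasing_indices_def strict_mono_on_def by auto
  thus ?case by simp
next
  case (Suc m)
  let ?t = "\<lambda>j l. x (w l) (real (Suc (j l)) / 2 ^ n) - x (w l) (real (j l) / 2 ^ n)"
  have und: "j (Suc m) = undefined" if "j \<in> increasing_indices m q" for j q
    using that unfolding increasing_indices_def by (auto simp: PiE_iff extensional_def)
  have "(\<Sum>j\<in>increasing_indices (Suc m) N. \<Prod>l\<in>{1..Suc m}. ?t j l) =
      (\<Sum>q<N. \<Sum>j\<in>(\<lambda>j. j(Suc m := q)) ` increasing_indices m q. \<Prod>l\<in>{1..Suc m}. ?t j l)"
    unfolding increasing_indices_Suc
  proof (rule sum.UNION_disjoint)
    show "\<forall>i\<in>{..<N}. \<forall>j\<in>{..<N}. i \<noteq> j \<longrightarrow>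
      (\<lambda>j. j(Suc m := i)) ` increasing_indices m i \<inter> (\<lambda>f. f(Suc m := j)) ` increasing_indices m j = {}"
      by (auto dest: fun_cong[of _ _ "Suc m"])
  qed (auto intro: finite_increasing_indices)
  also have "\<dots> = (\<Sum>q<N. \<Sum>j\<in>increasing_indices m q. (\<Prod>l\<in>{1..m}. ?t j l) *
      (x (w (Suc m)) (real (Suc q) / 2 ^ n) - x (w (Suc m)) (real q / 2 ^ n)))"
  proof (rule sum.cong[OF refl])
    fix q
    have inj: "inj_on (\<lambda>j. j(Suc m := q)) (increasing_indices m q)"
    proof (rule inj_on_inverseI[where g = "\<lambda>j. j(Suc m := undefined)"])
      fix j assume "j \<in> increasing_indices m q"
      from und[OF this] show "(j(Suc m := q))(Suc m := undefined) = j" by auto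
    qed
    have "(\<Sum>j\<in>(\<lambda>j. j(Suc m := q)) ` increasing_indices m q. \<Prod>l\<in>{1..Suc m}. ?t j l)
        = (\<Sum>j\<in>increasing_indices m q. \<Prod>l\<in>{1..Suc m}. ?t (j(Suc m := q)) l)"
      by (subst sum.reindex[OF inj]) simp
    also have "\<dots> = (\<Sum>j\<in>increasing_indices m q. (\<Prod>l\<in>{1..m}. ?t j l) *
      (x (w (Suc m)) (real (Suc q) / 2 ^ n) - x (w (Suc m)) (real q / 2 ^ n)))"
    proof (rule sum.cong[OF refl])
      fix j
      have "(\<Prod>l\<in>{1..Suc m}. ?t (j(Suc m := q)) l) = (\<Prod>l\<in>{1..m}. ?t (j(Suc m := q)) l) * ?t (j(Suc m := q)) (Suc m)"
        by (simp add: prod.nat_ivl_Suc')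
      also have "(\<Prod>l\<in>{1..m}. ?t (j(Suc m := q)) l) = (\<Prod>l\<in>{1..m}. ?t j l)" by (intro prod.cong) auto
      finally show "(\<Prod>l\<in>{1..Suc m}. ?t (j(Suc m := q)) l) = (\<Prod>l\<in>{1..m}. ?t j l) *
         (x (w (Suc m)) (real (Suc q) / 2 ^ n) - x (w (Suc m)) (real q / 2 ^ n))" by simp
    qed
    finally show "(\<Sum>j\<in>(\<lambda>j. j(Suc m := q)) ` increasing_indices m q. \<Prod>l\<in>{1..Suc m}. ?t j l) = \<dots>" .
  qed
  finally show ?case unfolding dyadic_sum.simps Suc by (simp add: sum_distrib_right)
qed

section \<open>Kernel integrals over dyadic boxes\<close>

lemma interval_indicator_AE:
  fixes X :: "real set"
  assumes "{a<..<b} \<subseteq> X" "X \<subseteq> {a..b}"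
  shows "AE s in lborel. indicator X s = (indicator {a..b} s :: 'b::zero_neq_one)"
proof -
  have "AE s in lborel. s \<noteq> a \<and> s \<noteq> b" using AE_lborel_singleton[of a] AE_lborel_singleton[of b] by eventually_elim auto
  thus ?thesis
  proof eventually_elim
    case (elim s)
    have "s \<in> X \<longleftrightarrow> s \<in> {a..b}" using elim assms by force
    thus ?case by (simp add: indicator_def)
  qed
qed

text \<open>Integrating \<open>u powr (2 * H - 2)\<close> twice gives
  \<open>u powr (2 * H) / (2 * H * (2 * H - 1))\<close>. Its mixed second difference, times
  \<open>H * (2 * H - 1)\<close>, is the covariance of the increments over the two cells. Adjacent
  cells with \<open>b = c\<close> are included: the singularity sits in a corner and is integrable.
  \<open>X\<close> and \<open>Y\<close> are fixed only up to end points, to fit cells that are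
  half-open or open.\<close>

lemma cell_double_integral:
  fixes H a b c d :: real
  assumes H: "1 / 2 < H" "H < 1" and ab: "a < b" "b \<le> c" "c < d"
    and X: "{a<..<b} \<subseteq> X" "X \<subseteq> {a..b}" and Y: "{c<..<d} \<subseteq> Y" "Y \<subseteq> {c..d}"
  shows "(\<integral>\<^sup>+s. (\<integral>\<^sup>+t. ennreal (\<bar>s - t\<bar> powr (2 * H - 2)) * indicator X s * indicator Y t \<partial>lborel) \<partial>lborel)
    = ennreal (((d - a) powr (2 * H) + (c - b) powr (2 * H) - (d - b) powr (2 * H) - (c - a) powr (2 * H)) / (2 * H * (2 * H - 1)))"
    (is "_ = ennreal ?V")
    and "0 \<le> ((d - a) powr (2 * H) + (c - b) powr (2 * H) - (d - b) powr (2 * H) - (c - a) powr (2 * H)) / (2 * H * (2 * H - 1))"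
proof -
  define p where "p = 2 * H - 1"
  have p: "p > 0" "2 * H - 2 = p - 1" "2 * H = p + 1" unfolding p_def using H by auto
  define g where "g = (\<lambda>s. ((d - s) powr p - (c - s) powr p) / p)"
  have inner: "(\<integral>\<^sup>+t. ennreal (\<bar>s - t\<bar> powr (2 * H - 2)) * indicator Y t \<partial>lborel) = ennreal (g s)" if s: "s < c" for s
  proof -
    have "(\<integral>\<^sup>+t. ennreal (\<bar>s - t\<bar> powr (2 * H - 2)) * indicator Y t \<partial>lborel) = (\<integral>\<^sup>+t. ennreal (\<bar>s - t\<bar> powr (2 * H - 2)) * indicator {c..d} t \<partial>lborel)"
      using interval_indicator_AE[OF Y, where 'b = ennreal] by (intro nn_integral_cong_AE) (auto elim!: eventually_mono)
    also have "\<dots> = ennreal (g s)"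
    proof (rule nn_integral_has_integral_lebesgue')
      have "((\<lambda>t. (t - s) powr (p - 1)) has_integral ((d - s) powr p / p - (c - s) powr p / p)) {c..d}"
      proof (rule fundamental_theorem_of_calculus)
        fix t assume t: "t \<in> {c..d}"
        have "((\<lambda>t. (t - s) powr p / p) has_real_derivative (t - s) powr (p - 1)) (at t)"
          using t s p by (auto intro!: derivative_eq_intros)
        thus "((\<lambda>t. (t - s) powr p / p) has_vector_derivative (t - s) powr (p - 1)) (at t within {c..d})"
          unfolding has_real_derivative_iff_has_vector_derivative by (rule has_vector_derivative_at_within)
      qed (use ab in auto)
      hence "((\<lambda>t. (t - s) powr (p - 1)) has_integral g s) {c..d}" unfolding g_def by (simp add: diff_divide_distrib)
      thus "((\<lambda>t. \<bar>s - t\<bar> powr (2 * H - 2)) has_integral g s) {c..d}"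
        by (rule has_integral_eq[rotated]) (use s p in auto)
    qed auto
    finally show ?thesis .
  qed
  have "(\<integral>\<^sup>+s. (\<integral>\<^sup>+t. ennreal (\<bar>s - t\<bar> powr (2 * H - 2)) * indicator X s * indicator Y t \<partial>lborel) \<partial>lborel)
      = (\<integral>\<^sup>+s. ennreal (g s) * indicator {a..b} s \<partial>lborel)"
  proof (rule nn_integral_cong_AE)
    \<comment> \<open>The point \<open>b\<close> is discarded because \<open>inner\<close> needs
      \<open>s < c\<close>, which fails there when \<open>b = c\<close>.\<close>
    show "AE s in lborel. (\<integral>\<^sup>+t. ennreal (\<bar>s - t\<bar> powr (2 * H - 2)) * indicator X s * indicator Y t \<partial>lborel) = ennreal (g s) * indicator {a..b} s"
      using interval_indicator_AE[OF X, where 'b = ennreal] AE_lborel_singleton[of b]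
    proof eventually_elim
      case (elim s)
      show ?case
      proof (cases "s \<in> {a..b}")
        case True
        hence "s < c" using elim ab by auto
        thus ?thesis using elim True inner by simp
      qed (use elim in simp)
    qed
  qed
  note outer = this
  have gpos: "0 \<le> g s" if "s \<in> {a..b}" for s
    unfolding g_def using that ab p by (intro divide_nonneg_pos) (auto intro!: powr_mono2)
  have gint: "(g has_integral ?V) {a..b}"
  proof -
    define F where "F = (\<lambda>s. ((c - s) powr (p + 1) - (d - s) powr (p + 1)) / ((p + 1) * p))"
    have "(g has_integral (F b - F a)) {a..b}"
    proof (rule fundamental_theorem_of_calculus_interior)
      show "continuous_on {a..b} F" unfolding F_def using ab p
        by (intro continuous_intros continuous_on_powr') auto
      fix s assume s: "s \<in> {a<..<b}"
      have d1: "((\<lambda>s. (r - s) powr (p + 1)) has_real_derivative - ((p + 1) * (r - s) powr p)) (at s)" if "s < r" for r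
      proof -
        have "((\<lambda>s. r - s) has_real_derivative -1) (at s)" by (auto intro!: derivative_eq_intros)
        from DERIV_fun_powr[OF this, of "p + 1"] that show ?thesis by simp
      qed
      have "(F has_real_derivative ((- ((p + 1) * (c - s) powr p) - (- ((p + 1) * (d - s) powr p))) / ((p + 1) * p))) (at s)"
        unfolding F_def using s ab by (intro DERIV_cdivide DERIV_diff d1) auto
      also have "(- ((p + 1) * (c - s) powr p) - (- ((p + 1) * (d - s) powr p))) / ((p + 1) * p) = g s"
      proof -
        have "- ((p + 1) * (c - s) powr p) - (- ((p + 1) * (d - s) powr p)) = (p + 1) * ((d - s) powr p - (c - s) powr p)"
          by (simp add: algebra_simps)
        thus ?thesis unfolding g_def using p by simp
      qed
      finally show "(F has_vector_derivative g s) (at s)" by (simp add: has_real_derivative_iff_has_vector_derivative)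
    qed (use ab in auto)
    also have "F b - F a = ((d - a) powr (2 * H) + (c - b) powr (2 * H) - (d - b) powr (2 * H) - (c - a) powr (2 * H)) / (2 * H * (2 * H - 1))"
      unfolding F_def p(3) p_def[symmetric] by (simp add: diff_divide_distrib[symmetric] algebra_simps)
    finally show ?thesis .
  qed
  show "(\<integral>\<^sup>+s. (\<integral>\<^sup>+t. ennreal (\<bar>s - t\<bar> powr (2 * H - 2)) * indicator X s * indicator Y t \<partial>lborel) \<partial>lborel) = ennreal ?V"
    unfolding outer by (rule nn_integral_has_integral_lebesgue'[OF gpos gint])
  show "0 \<le> ?V" by (rule has_integral_nonneg[OF gint gpos])
qed

text \<open>The blocks partition the variables, so Tonelli's theorem separates the integral; one
  block with its two variables is peeled off at a time.\<close>

lemma nn_integral_pairing: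
  fixes h :: "nat set \<Rightarrow> real \<Rightarrow> real \<Rightarrow> ennreal"
  assumes "finite A" "P \<in> pairings A"
    and h: "\<And>b. (\<lambda>(s, t). h b s t) \<in> borel_measurable (borel \<Otimes>\<^sub>M borel)"
  shows "(\<integral>\<^sup>+s. (\<Prod>b\<in>P. h b (s (Min b)) (s (Max b))) \<partial>lborel_on A) = (\<Prod>b\<in>P. \<integral>\<^sup>+s. (\<integral>\<^sup>+t. h b s t \<partial>lborel) \<partial>lborel)"
  using assms(1,2)
proof (induction "card A" arbitrary: A P rule: less_induct)
  case less
  have P: "\<Union>P = A" "\<And>b c. b \<in> P \<Longrightarrow> c \<in> P \<Longrightarrow> b \<noteq> c \<Longrightarrow> b \<inter> c = {}" "{} \<notin> P" "\<And>b. b \<in> P \<Longrightarrow> card b = 2"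
    using less.prems(2) unfolding pairings_def partition_on_def disjoint_def by auto
  have finP: "finite P" by (rule finite_subset[of P "Pow A"]) (use P less.prems in auto)
  have mh: "(\<lambda>x. h b (f x) (g x)) \<in> borel_measurable N" if "f \<in> borel_measurable N" "g \<in> borel_measurable N"
    for b f g and N :: "'c measure"
    using measurable_compose[OF measurable_Pair[OF that] h[of b]] by simp
  show ?case
  proof (cases "P = {}")
    case True
    hence "A = {}" using P by simp
    thus ?thesis using True by (simp add: PiM_empty)
  next
    case False
    then obtain b where b: "b \<in> P" by blast
    obtain i j where ij: "b = {i, j}" "i < j"
    proof -
      obtain x y where "b = {x, y}" "x \<noteq> y" using P(4)[OF b] by (auto simp: card_2_iff)
      thus ?thesis using that[of x y] that[of y x] by (cases "x < y") (auto simp: insert_commute)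
    qed
    have mM: "Min b = i" "Max b = j" using ij by auto
    define A' where "A' = A - b"
    define P' where "P' = P - {b}"
    have bA: "b \<subseteq> A" using b P by auto
    have A': "finite A'" "i \<notin> A'" "j \<notin> insert i A'" "A = insert j (insert i A')" "A' \<subset> A"
      using less.prems bA ij unfolding A'_def by auto
    have PP: "finite P'" "b \<notin> P'" "P = insert b P'" using finP b unfolding P'_def by auto
    have notin: "i \<notin> c" "j \<notin> c" if "c \<in> P'" for c
      using P(2)[of b c] that b ij unfolding P'_def by auto
    have UP': "\<Union>P' = A'"
    proof
      show "\<Union>P' \<subseteq> A'" using P(1) notin ij unfolding A'_def P'_def by blast
      show "A' \<subseteq> \<Union>P'" using P(1) ij unfolding A'_def P'_def by blast
    qed
    have P': "P' \<in> pairings A'"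
      unfolding pairings_def partition_on_def disjoint_def using UP' P(3)
      by (intro CollectI conjI ballI impI) (auto intro: P(4) dest: P(2) simp: P'_def)
    have mm: "Min c \<in> A'" "Max c \<in> A'" "Min c \<in> c" "Max c \<in> c" if "c \<in> P'" for c
    proof -
      have "finite c" "c \<noteq> {}" using P(4)[of c] that card_eq_0_iff[of c] unfolding P'_def by auto
      thus "Min c \<in> c" "Max c \<in> c" by auto
      thus "Min c \<in> A'" "Max c \<in> A'" using UP' that by auto
    qed
    define F where "F = (\<lambda>s :: nat \<Rightarrow> real. \<Prod>c\<in>P'. h c (s (Min c)) (s (Max c)))"
    have Fm: "F \<in> borel_measurable (lborel_on D)" if "A' \<subseteq> D" for D unfolding F_def
      using mm that by (intro borel_measurable_prod_ennreal mh component_measurable_lborel) auto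
    have Fup: "F (s(i := x, j := y)) = F s" for s x y unfolding F_def
      using mm notin by (intro prod.cong refl) (metis fun_upd_other)
    have hm: "(\<lambda>s. h b (s i) (s j) * F s) \<in> borel_measurable (lborel_on (insert j (insert i A')))"
      by (intro borel_measurable_times_ennreal mh component_measurable_lborel Fm) auto
    have hm1: "(\<lambda>x. \<integral>\<^sup>+y. h b x y \<partial>lborel) \<in> borel_measurable lborel"
      by (rule lborel.borel_measurable_nn_integral) (use h[of b] in simp)
    have hmx: "(\<lambda>y. h b x y) \<in> borel_measurable lborel" for x by (rule mh) auto
    have "(\<integral>\<^sup>+s. (\<Prod>c\<in>P. h c (s (Min c)) (s (Max c))) \<partial>lborel_on A) = (\<integral>\<^sup>+s. h b (s i) (s j) * F s \<partial>lborel_on (insert j (insert i A')))"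
      unfolding PP(3) F_def A'(4)[symmetric] using PP by (simp add: mM)
    also have "\<dots> = (\<integral>\<^sup>+s. (\<integral>\<^sup>+y. h b ((s(j := y)) i) ((s(j := y)) j) * F (s(j := y)) \<partial>lborel) \<partial>lborel_on (insert i A'))"
      by (rule lborel_prod.product_nn_integral_insert) (use A' hm in auto)
    also have "\<dots> = (\<integral>\<^sup>+s. (\<integral>\<^sup>+y. h b (s i) y \<partial>lborel) * F s \<partial>lborel_on (insert i A'))"
    proof (intro nn_integral_cong)
      fix s
      have "F (s(j := y)) = F s" for y using Fup[of s "s i" y] by simp
      thus "(\<integral>\<^sup>+y. h b ((s(j := y)) i) ((s(j := y)) j) * F (s(j := y)) \<partial>lborel) = (\<integral>\<^sup>+y. h b (s i) y \<partial>lborel) * F s"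
        using ij hmx by (simp add: nn_integral_multc)
    qed
    also have "\<dots> = (\<integral>\<^sup>+s. (\<integral>\<^sup>+x. (\<integral>\<^sup>+y. h b ((s(i := x)) i) y \<partial>lborel) * F (s(i := x)) \<partial>lborel) \<partial>lborel_on A')"
      using A' Fm measurable_compose[OF component_measurable_lborel hm1[simplified]]
      by (intro lborel_prod.product_nn_integral_insert borel_measurable_times_ennreal) auto
    also have "\<dots> = (\<integral>\<^sup>+s. (\<integral>\<^sup>+x. \<integral>\<^sup>+y. h b x y \<partial>lborel \<partial>lborel) * F s \<partial>lborel_on A')"
    proof (intro nn_integral_cong)
      fix s
      have "F (s(i := x)) = F s" for x
      proof -
        have "s(i := x) = (s(i := x, j := s j))" using ij by auto
        thus ?thesis using Fup[of s x "s j"] by simp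
      qed
      thus "(\<integral>\<^sup>+x. (\<integral>\<^sup>+y. h b ((s(i := x)) i) y \<partial>lborel) * F (s(i := x)) \<partial>lborel) = (\<integral>\<^sup>+x. \<integral>\<^sup>+y. h b x y \<partial>lborel \<partial>lborel) * F s"
        using hm1 by (simp add: nn_integral_multc)
    qed
    also have "\<dots> = (\<integral>\<^sup>+x. \<integral>\<^sup>+y. h b x y \<partial>lborel \<partial>lborel) * (\<integral>\<^sup>+s. F s \<partial>lborel_on A')"
      by (rule nn_integral_cmult[OF Fm[OF subset_refl]])
    also have "(\<integral>\<^sup>+s. F s \<partial>lborel_on A') = (\<Prod>c\<in>P'. \<integral>\<^sup>+s. \<integral>\<^sup>+t. h c s t \<partial>lborel \<partial>lborel)"
      unfolding F_def by (rule less.hyps[OF _ A'(1) P']) (use A'(5) less.prems psubset_card_mono in blast)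
    finally show ?thesis unfolding PP(3) using PP by simp
  qed
qed

text \<open>Half-open, so that the cells are disjoint, but without 0: a first coordinate equal to 0
  would leave the open simplex.\<close>

definition dyadic_cell :: "nat \<Rightarrow> nat \<Rightarrow> real set" where
  "dyadic_cell n q = {s \<in> {0<..<1}. real q / 2 ^ n \<le> s \<and> s < real (Suc q) / 2 ^ n}"

lemma dyadic_cell_unique: "s \<in> dyadic_cell n q \<Longrightarrow> s \<in> dyadic_cell n r \<Longrightarrow> q = r"
proof -
  assume "s \<in> dyadic_cell n q" "s \<in> dyadic_cell n r"
  hence "real q / 2 ^ n < real (Suc r) / 2 ^ n" "real r / 2 ^ n < real (Suc q) / 2 ^ n"
    unfolding dyadic_cell_def by auto
  hence "real q < real (Suc r)" "real r < real (Suc q)" by (simp_all add: divide_less_cancel)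
  thus "q = r" by simp
qed

lemma dyadic_cell_bounds:
  assumes "q < 2 ^ n"
  shows "{real q / 2 ^ n<..<real (Suc q) / 2 ^ n} \<subseteq> dyadic_cell n q"
    "dyadic_cell n q \<subseteq> {real q / 2 ^ n..real (Suc q) / 2 ^ n}"
proof -
  have "real (Suc q) \<le> 2 ^ n" using assms by (metis Suc_leI of_nat_le_iff of_nat_numeral of_nat_power)
  hence "real (Suc q) / 2 ^ n \<le> 1" by simp
  moreover have "0 \<le> real q / 2 ^ n" by simp
  ultimately have "0 < x \<and> x < 1" if "real q / 2 ^ n < x" "x < real (Suc q) / 2 ^ n" for x using that by linarith
  thus "{real q / 2 ^ n<..<real (Suc q) / 2 ^ n} \<subseteq> dyadic_cell n q"
    unfolding dyadic_cell_def by (auto intro: less_imp_le simp del: of_nat_Suc)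
  show "dyadic_cell n q \<subseteq> {real q / 2 ^ n..real (Suc q) / 2 ^ n}" unfolding dyadic_cell_def by auto
qed

lemma dyadic_cell_measurable [measurable]: "dyadic_cell n q \<in> sets borel"
proof -
  have "dyadic_cell n q = {0<..<1} \<inter> {real q / 2 ^ n..<real (Suc q) / 2 ^ n}" unfolding dyadic_cell_def by auto
  thus ?thesis by simp
qed

lemma dyadic_cell_floor:
  assumes "s \<in> {0<..<1}"
  shows "s \<in> dyadic_cell n (nat \<lfloor>s * 2 ^ n\<rfloor>)" "nat \<lfloor>s * 2 ^ n\<rfloor> < 2 ^ n"
proof -
  define k where "k = nat \<lfloor>s * 2 ^ n\<rfloor>"
  have "real k = of_int \<lfloor>s * 2 ^ n\<rfloor>" unfolding k_def using assms by simp
  hence k: "real k \<le> s * 2 ^ n" "s * 2 ^ n < real k + 1" by linarith+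
  show "s \<in> dyadic_cell n (nat \<lfloor>s * 2 ^ n\<rfloor>)" unfolding k_def[symmetric] dyadic_cell_def
    using assms k by (auto simp: divide_simps algebra_simps)
  have "s * 2 ^ n < 1 * 2 ^ n" using assms by (intro mult_strict_right_mono) auto
  hence "real k < 2 ^ n" using k by linarith
  hence "k < 2 ^ n" by simp
  thus "nat \<lfloor>s * 2 ^ n\<rfloor> < 2 ^ n" unfolding k_def .
qed

definition cell_region :: "nat \<Rightarrow> nat \<Rightarrow> (nat \<Rightarrow> real) set" where
  "cell_region m n = (\<Union>j\<in>increasing_indices m (2 ^ n). PiE {1..m} (\<lambda>l. dyadic_cell n (j l)))"

lemma cell_region_indicator:
  "(indicator (cell_region m n) s :: ennreal) =
    (\<Sum>j\<in>increasing_indices m (2 ^ n). indicator (PiE {1..m} (\<lambda>l. dyadic_cell n (j l))) s)"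
proof (cases "s \<in> cell_region m n")
  case True
  then obtain j where j: "j \<in> increasing_indices m (2 ^ n)" "s \<in> PiE {1..m} (\<lambda>l. dyadic_cell n (j l))"
    unfolding cell_region_def by blast
  have uniq: "j' = j" if "j' \<in> increasing_indices m (2 ^ n)" "s \<in> PiE {1..m} (\<lambda>l. dyadic_cell n (j' l))" for j'
  proof
    fix l show "j' l = j l"
    proof (cases "l \<in> {1..m}")
      case True
      thus ?thesis using that(2) j(2) by (intro dyadic_cell_unique[of "s l" n]) (auto simp: PiE_iff)
    next
      case False
      thus ?thesis using that(1) j(1) unfolding increasing_indices_def by (auto simp: PiE_iff extensional_def)
    qed
  qed
  have "(\<Sum>j\<in>increasing_indices m (2 ^ n). indicator (PiE {1..m} (\<lambda>l. dyadic_cell n (j l))) s)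
      = (\<Sum>j'\<in>increasing_indices m (2 ^ n). if j' = j then 1 else 0 :: ennreal)"
  proof (rule sum.cong[OF refl])
    fix j' assume j': "j' \<in> increasing_indices m (2 ^ n)"
    show "indicator (PiE {1..m} (\<lambda>l. dyadic_cell n (j' l))) s = (if j' = j then 1 else 0 :: ennreal)"
    proof (cases "j' = j")
      case False
      hence "s \<notin> PiE {1..m} (\<lambda>l. dyadic_cell n (j' l))" using uniq[OF j'] by blast
      thus ?thesis using False by simp
    qed (use j(2) in simp)
  qed
  thus ?thesis using True j(1) finite_increasing_indices by (simp add: sum.delta)
next
  case False
  hence "indicator (PiE {1..m} (\<lambda>l. dyadic_cell n (j l))) s = (0 :: ennreal)" if "j \<in> increasing_indices m (2 ^ n)" for j
    using that unfolding cell_region_def by auto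
  thus ?thesis using False by simp
qed

lemma cell_region_measurable [measurable]: "cell_region m n \<in> sets (lborel_on {1..m})"
  unfolding cell_region_def
  by (intro sets.finite_UN finite_increasing_indices sets_PiM_I_finite) auto

lemma cell_region_subset: "cell_region m n \<subseteq> open_simplex m"
proof
  fix s assume "s \<in> cell_region m n"
  then obtain j where j: "j \<in> increasing_indices m (2 ^ n)" "s \<in> PiE {1..m} (\<lambda>l. dyadic_cell n (j l))"
    unfolding cell_region_def by blast
  have c: "s l \<in> {0<..<1}" "real (j l) / 2 ^ n \<le> s l" "s l < real (Suc (j l)) / 2 ^ n" if "l \<in> {1..m}" for l
    using j(2) that unfolding dyadic_cell_def by (auto simp: PiE_iff)
  have "s l < s l'" if l: "l \<in> {1..m}" "l' \<in> {1..m}" "l < l'" for l l'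
  proof -
    have "j l < j l'" using j(1) l unfolding increasing_indices_def strict_mono_on_def by blast
    hence "real (Suc (j l)) / 2 ^ n \<le> real (j l') / 2 ^ n" by (intro divide_right_mono) auto
    thus ?thesis using c(3)[OF l(1)] c(2)[OF l(2)] by linarith
  qed
  thus "s \<in> open_simplex m" using j(2) c(1) unfolding open_simplex_def strict_mono_on_def by (auto simp: PiE_iff)
qed

text \<open>Once the mesh is below the smallest difference of coordinates, all coordinates lie in
  different cells. The boxes with repeated indices, which the sums never see, disappear in the
  limit.\<close>

lemma cell_region_tendsto:
  "(\<lambda>n. indicat_real (cell_region m n) s) \<longlonglongrightarrow> indicat_real (open_simplex m) s"
proof (cases "s \<in> open_simplex m")
  case False
  hence "s \<notin> cell_region m n" for n using cell_region_subset by blast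
  thus ?thesis using False by simp
next
  case True
  have r: "s l \<in> {0<..<1}" if "l \<in> {1..m}" for l using True that unfolding open_simplex_def by (auto simp: PiE_iff)
  have mono: "s l < s l'" if "l \<in> {1..m}" "l' \<in> {1..m}" "l < l'" for l l'
    using True that unfolding open_simplex_def strict_mono_on_def by auto
  have ev: "\<forall>\<^sub>F n in sequentially. \<forall>l\<in>{1..m}. \<forall>l'\<in>{1..m}. l < l' \<longrightarrow> s l * 2 ^ n + 1 \<le> s l' * 2 ^ n"
  proof (intro eventually_ball_finite ballI)
    fix l l' assume l: "l \<in> {1..m}" "l' \<in> {1..m}"
    show "\<forall>\<^sub>F n in sequentially. l < l' \<longrightarrow> s l * 2 ^ n + 1 \<le> s l' * 2 ^ n"
    proof (cases "l < l'")
      case True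
      define \<delta> where "\<delta> = s l' - s l"
      have \<delta>: "\<delta> > 0" unfolding \<delta>_def using mono l True by simp
      have "(\<lambda>n. (1 / 2 :: real) ^ n) \<longlonglongrightarrow> 0" by (rule LIMSEQ_power_zero) simp
      hence "\<forall>\<^sub>F n in sequentially. (1 / 2 :: real) ^ n < \<delta>" by (rule order_tendstoD) (rule \<delta>)
      thus ?thesis
      proof eventually_elim
        case (elim n)
        hence "1 < \<delta> * 2 ^ n" by (simp add: power_one_over field_simps)
        thus ?case unfolding \<delta>_def by (simp add: algebra_simps)
      qed
    qed simp
  qed auto
  have "\<forall>\<^sub>F n in sequentially. indicat_real (cell_region m n) s = 1"
    using ev
  proof eventually_elim
    case (elim n)
    define j where "j = (\<lambda>l\<in>{1..m}. nat \<lfloor>s l * 2 ^ n\<rfloor>)"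
    have "j l < j l'" if l: "l \<in> {1..m}" "l' \<in> {1..m}" "l < l'" for l l'
    proof -
      have "s l * 2 ^ n + 1 \<le> s l' * 2 ^ n" using elim l by blast
      hence "\<lfloor>s l * 2 ^ n\<rfloor> < \<lfloor>s l' * 2 ^ n\<rfloor>" by linarith
      moreover have "0 \<le> \<lfloor>s l * 2 ^ n\<rfloor>" using r[OF l(1)] by simp
      ultimately have "nat \<lfloor>s l * 2 ^ n\<rfloor> < nat \<lfloor>s l' * 2 ^ n\<rfloor>" by (simp only: nat_less_eq_zless)
      thus ?thesis unfolding j_def using l by simp
    qed
    moreover have "j l < 2 ^ n" if "l \<in> {1..m}" for l using dyadic_cell_floor(2)[OF r[OF that], of n] that unfolding j_def by simp
    ultimately have "j \<in> increasing_indices m (2 ^ n)"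
      unfolding increasing_indices_def strict_mono_on_def by (auto simp: PiE_iff j_def)
    moreover have "s \<in> PiE {1..m} (\<lambda>l. dyadic_cell n (j l))"
      using dyadic_cell_floor(1)[OF r, of _ n] True unfolding j_def open_simplex_def by (auto simp: PiE_iff)
    ultimately have "s \<in> cell_region m n" unfolding cell_region_def by blast
    thus ?case by simp
  qed
  thus ?thesis using True by (intro tendsto_eventually) simp
qed

definition pair_kernel :: "real \<Rightarrow> nat set set \<Rightarrow> (nat \<Rightarrow> real) \<Rightarrow> real" where
  "pair_kernel H P s = (\<Prod>b\<in>P. \<bar>s (Min b) - s (Max b)\<bar> powr (2 * H - 2))"

lemma L_integrand_of_real:
  "L_integrand n P (complex_of_real H) s = complex_of_real (indicat_real (open_simplex n) s * pair_kernel H P s)"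
proof -
  have "complex_of_real \<bar>x\<bar> powr (2 * complex_of_real H - 2) = complex_of_real (\<bar>x\<bar> powr (2 * H - 2))" for x
    using powr_of_real[of "\<bar>x\<bar>" "2 * H - 2"] by simp
  thus ?thesis unfolding L_integrand_def pair_kernel_def by (simp add: scaleR_conv_of_real)
qed

lemma pair_kernel_integrable:
  assumes "n \<ge> 1" "P \<in> pair_partitions_below n w" "H > 1 / 2"
  shows "integrable (lborel_on {1..n}) (\<lambda>s. indicat_real (open_simplex n) s * pair_kernel H P s)"
    and "L_integral n P (complex_of_real H) = complex_of_real (LINT s|lborel_on {1..n}. indicat_real (open_simplex n) s * pair_kernel H P s)"
proof -
  have "integrable (lborel_on {1..n}) (L_integrand n P (complex_of_real H))"
    using assms by (intro L_integral_continues(1)[where w = w]) auto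
  from integrable_Re[OF this]
  show "integrable (lborel_on {1..n}) (\<lambda>s. indicat_real (open_simplex n) s * pair_kernel H P s)"
    unfolding L_integrand_of_real by (simp only: Re_complex_of_real)
  show "L_integral n P (complex_of_real H) = complex_of_real (LINT s|lborel_on {1..n}. indicat_real (open_simplex n) s * pair_kernel H P s)"
    unfolding L_integral_eq L_integrand_of_real by (rule integral_complex_of_real)
qed

lemma pair_kernel_nonneg: "pair_kernel H P s \<ge> 0"
  unfolding pair_kernel_def by (intro prod_nonneg) auto

lemma pair_kernel_measurable:
  assumes "P \<in> pair_partitions n"
  shows "pair_kernel H P \<in> borel_measurable (lborel_on {1..n})"
proof -
  have "(\<lambda>s. \<bar>s (Min b) - s (Max b)\<bar> powr (2 * H - 2)) \<in> borel_measurable (lborel_on {1..n})" if "b \<in> P" for b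
    using component_measurable_lborel[OF pair_block(5)[OF assms that]]
       component_measurable_lborel[OF pair_block(6)[OF assms that]] by measurable
  thus ?thesis unfolding pair_kernel_def[abs_def] by (intro borel_measurable_prod) auto
qed

lemma cell_kernel_integrable:
  assumes "n \<ge> 1" "P \<in> pair_partitions_below n w" "H > 1 / 2"
  shows "integrable (lborel_on {1..n}) (\<lambda>s. indicat_real (cell_region n N) s * pair_kernel H P s)"
proof (rule Bochner_Integration.integrable_bound[OF pair_kernel_integrable(1)[OF assms]])
  have P: "P \<in> pair_partitions n" using assms unfolding pair_partitions_below_def by simp
  show "(\<lambda>s. indicat_real (cell_region n N) s * pair_kernel H P s) \<in> borel_measurable (lborel_on {1..n})"
    using pair_kernel_measurable[OF P] by measurable
  have "indicat_real (cell_region n N) s \<le> indicat_real (open_simplex n) s" for s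
    using cell_region_subset[of n N] by (auto simp: indicator_def)
  thus "AE s in lborel_on {1..n}. norm (indicat_real (cell_region n N) s * pair_kernel H P s)
      \<le> norm (indicat_real (open_simplex n) s * pair_kernel H P s)"
    using pair_kernel_nonneg by (auto simp: abs_mult intro!: mult_right_mono)
qed

text \<open>Dominated convergence with the kernel on the simplex as majorant; its integrability is
  the analytic result specialised to real \<open>H\<close>.\<close>

lemma cell_kernel_tendsto:
  assumes "n \<ge> 1" "P \<in> pair_partitions_below n w" "H > 1 / 2"
  shows "(\<lambda>N. LINT s|lborel_on {1..n}. indicat_real (cell_region n N) s * pair_kernel H P s)
     \<longlonglongrightarrow> (LINT s|lborel_on {1..n}. indicat_real (open_simplex n) s * pair_kernel H P s)"
proof (rule integral_dominated_convergence)
  show "integrable (lborel_on {1..n}) (\<lambda>s. indicat_real (open_simplex n) s * pair_kernel H P s)"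
    by (rule pair_kernel_integrable(1)[OF assms])
  thus "(\<lambda>s. indicat_real (open_simplex n) s * pair_kernel H P s) \<in> borel_measurable (lborel_on {1..n})" by simp
  show "(\<lambda>s. indicat_real (cell_region n N) s * pair_kernel H P s) \<in> borel_measurable (lborel_on {1..n})" for N
    using cell_kernel_integrable[OF assms] by simp
  show "AE s in lborel_on {1..n}. (\<lambda>N. indicat_real (cell_region n N) s * pair_kernel H P s) \<longlonglongrightarrow> indicat_real (open_simplex n) s * pair_kernel H P s"
    by (intro AE_I2 tendsto_mult cell_region_tendsto tendsto_const)
  have "indicat_real (cell_region n N) s \<le> indicat_real (open_simplex n) s" for s N
    using cell_region_subset[of n N] by (auto simp: indicator_def)
  thus "AE s in lborel_on {1..n}. norm (indicat_real (cell_region n N) s * pair_kernel H P s)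
      \<le> indicat_real (open_simplex n) s * pair_kernel H P s" for N
    using pair_kernel_nonneg by (auto simp: abs_mult intro!: mult_right_mono)
qed

text \<open>The computation runs in \<open>ennreal\<close>, where Tonelli's theorem covers every
  nonnegative measurable function. The disjoint boxes add up, and each contributes a product because
  the kernel has one factor per pair.\<close>

lemma cell_kernel_integral:
  assumes n: "n \<ge> 1" and P: "P \<in> pair_partitions_below n w" and H: "1 / 2 < H" "H < 1"
    and v: "\<And>j b. j \<in> increasing_indices n (2 ^ N) \<Longrightarrow> b \<in> P \<Longrightarrow> v j b \<ge> 0 \<and>
      (\<integral>\<^sup>+s. (\<integral>\<^sup>+t. ennreal (\<bar>s - t\<bar> powr (2 * H - 2)) * indicator (dyadic_cell N (j (Min b))) s * indicator (dyadic_cell N (j (Max b))) t \<partial>lborel) \<partial>lborel)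
         = ennreal (v j b)"
  shows "(LINT s|lborel_on {1..n}. indicat_real (cell_region n N) s * pair_kernel H P s) =
     (\<Sum>j\<in>increasing_indices n (2 ^ N). \<Prod>b\<in>P. v j b)"
proof -
  let ?J = "increasing_indices n (2 ^ N)"
  have P': "P \<in> pair_partitions n" using P unfolding pair_partitions_below_def by simp
  have Pp: "P \<in> pairings {1..n}" using P' unfolding pair_partitions_def pairings_def .
  have finP: "finite P" by (rule finite_pair_partition[OF P'])
  define h where "h = (\<lambda>(j :: nat \<Rightarrow> nat) b s t. ennreal (\<bar>s - t\<bar> powr (2 * H - 2)) * indicator (dyadic_cell N (j (Min b))) s * indicator (dyadic_cell N (j (Max b))) t)"
  have hm: "(\<lambda>(s, t). h j b s t) \<in> borel_measurable (borel \<Otimes>\<^sub>M borel)" for j :: "nat \<Rightarrow> nat" and b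
    unfolding h_def by measurable
  have box: "(\<Prod>b\<in>P. ennreal (\<bar>s (Min b) - s (Max b)\<bar> powr (2 * H - 2))) * indicator (PiE {1..n} (\<lambda>l. dyadic_cell N (j l))) s
      = (\<Prod>b\<in>P. h j b (s (Min b)) (s (Max b)))" if s: "s \<in> space (lborel_on {1..n})" for s j
  proof (cases "s \<in> PiE {1..n} (\<lambda>l. dyadic_cell N (j l))")
    case True
    hence "s l \<in> dyadic_cell N (j l)" if "l \<in> {1..n}" for l using that by (auto simp: PiE_iff)
    hence "h j b (s (Min b)) (s (Max b)) = ennreal (\<bar>s (Min b) - s (Max b)\<bar> powr (2 * H - 2))" if "b \<in> P" for b
      using pair_block(5,6)[OF P' that] unfolding h_def by simp
    thus ?thesis using True by simp
  next
    case False
    then obtain l where l: "l \<in> {1..n}" "s l \<notin> dyadic_cell N (j l)" using s by (auto simp: PiE_iff space_PiM)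
    have "l \<in> \<Union>P" using l(1) P' unfolding pair_partitions_def partition_on_def by simp
    then obtain b where b: "b \<in> P" "l \<in> b" by blast
    have "l = Min b \<or> l = Max b" using pair_block(3)[OF P' b(1)] b(2) by auto
    hence "h j b (s (Min b)) (s (Max b)) = 0" using l(2) unfolding h_def by auto
    hence "(\<Prod>b\<in>P. h j b (s (Min b)) (s (Max b))) = 0" using b(1) finP by (intro prod_zero) auto
    thus ?thesis using False by simp
  qed
  have "(\<integral>\<^sup>+s. ennreal (indicat_real (cell_region n N) s * pair_kernel H P s) \<partial>lborel_on {1..n})
     = (\<integral>\<^sup>+s. (\<Sum>j\<in>?J. \<Prod>b\<in>P. h j b (s (Min b)) (s (Max b))) \<partial>lborel_on {1..n})"
  proof (rule nn_integral_cong)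
    fix s assume s: "s \<in> space (lborel_on {1..n})"
    have "ennreal (indicat_real (cell_region n N) s * pair_kernel H P s)
        = (\<Prod>b\<in>P. ennreal (\<bar>s (Min b) - s (Max b)\<bar> powr (2 * H - 2))) * indicator (cell_region n N) s"
      unfolding pair_kernel_def by (cases "s \<in> cell_region n N") (auto simp: prod_ennreal)
    also have "\<dots> = (\<Sum>j\<in>?J. \<Prod>b\<in>P. h j b (s (Min b)) (s (Max b)))"
      unfolding cell_region_indicator sum_distrib_left by (rule sum.cong[OF refl box[OF s]])
    finally show "ennreal (indicat_real (cell_region n N) s * pair_kernel H P s) = \<dots>" .
  qed
  also have "\<dots> = (\<Sum>j\<in>?J. \<integral>\<^sup>+s. (\<Prod>b\<in>P. h j b (s (Min b)) (s (Max b))) \<partial>lborel_on {1..n})"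
  proof (rule nn_integral_sum)
    fix j :: "nat \<Rightarrow> nat"
    have "(\<lambda>s. h j b (s (Min b)) (s (Max b))) \<in> borel_measurable (lborel_on {1..n})" if "b \<in> P" for b
      using measurable_compose[OF measurable_Pair[OF component_measurable_lborel[OF pair_block(5)[OF P' that]]
          component_measurable_lborel[OF pair_block(6)[OF P' that]]] hm[of j b]] by simp
    thus "(\<lambda>s. \<Prod>b\<in>P. h j b (s (Min b)) (s (Max b))) \<in> borel_measurable (lborel_on {1..n})"
      by (intro borel_measurable_prod_ennreal) auto
  qed
  also have "\<dots> = (\<Sum>j\<in>?J. \<Prod>b\<in>P. \<integral>\<^sup>+s. (\<integral>\<^sup>+t. h j b s t \<partial>lborel) \<partial>lborel)"
    by (intro sum.cong refl nn_integral_pairing Pp hm) auto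
  also have "\<dots> = (\<Sum>j\<in>?J. \<Prod>b\<in>P. ennreal (v j b))"
    using v unfolding h_def by (intro sum.cong prod.cong refl) auto
  also have "\<dots> = (\<Sum>j\<in>?J. ennreal (\<Prod>b\<in>P. v j b))"
    using v by (intro sum.cong refl prod_ennreal) auto
  also have "\<dots> = ennreal (\<Sum>j\<in>?J. \<Prod>b\<in>P. v j b)"
    using v by (intro sum_ennreal prod_nonneg) auto
  finally have eq: "(\<integral>\<^sup>+s. ennreal (indicat_real (cell_region n N) s * pair_kernel H P s) \<partial>lborel_on {1..n}) = ennreal (\<Sum>j\<in>?J. \<Prod>b\<in>P. v j b)" .
  show ?thesis
  proof (rule integral_eq_nn_integral[THEN trans])
    show "(\<lambda>s. indicat_real (cell_region n N) s * pair_kernel H P s) \<in> borel_measurable (lborel_on {1..n})"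
      using cell_kernel_integrable[OF n P H(1)] by simp
    show "AE s in lborel_on {1..n}. 0 \<le> indicat_real (cell_region n N) s * pair_kernel H P s"
      using pair_kernel_nonneg by auto
    show "enn2real (\<integral>\<^sup>+s. ennreal (indicat_real (cell_region n N) s * pair_kernel H P s) \<partial>lborel_on {1..n}) = (\<Sum>j\<in>?J. \<Prod>b\<in>P. v j b)"
      unfolding eq using v by (intro enn2real_ennreal sum_nonneg prod_nonneg) auto
  qed
qed

lemma card_pair_partition:
  assumes "P \<in> pair_partitions (2 * k)" shows "card P = k"
proof -
  have "card (\<Union>P) = (\<Sum>b\<in>P. card b)"
    using assms finite_pair_partition[OF assms] pair_block(1)[OF assms]
    unfolding pair_partitions_def partition_on_def
    by (intro card_Union_disjoint) (auto simp: disjoint_def pairwise_def disjnt_def)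
  also have "\<dots> = (\<Sum>b\<in>P. 2)" using assms unfolding pair_partitions_def by (intro sum.cong) auto
  finally show ?thesis using assms unfolding pair_partitions_def partition_on_def by simp
qed

text \<open>On the null set where convergence fails, \<open>g\<close> is arbitrary, so measurability
  is claimed for the completion. For \<open>iterated_young\<close> this is the situation: on
  exceptional paths its value comes from an unspecified \<open>THE\<close>.\<close>

lemma measurable_completion_AE_limit:
  fixes f :: "nat \<Rightarrow> 'a \<Rightarrow> real"
  assumes f: "\<And>n. f n \<in> borel_measurable M" and lim: "AE \<omega> in M. (\<lambda>n. f n \<omega>) \<longlonglongrightarrow> g \<omega>"
  shows "g \<in> borel_measurable (completion M)"
proof -
  define g' where "g' = (\<lambda>\<omega>. lim (\<lambda>n. f n \<omega>))"
  have g': "g' \<in> borel_measurable (completion M)"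
    unfolding g'_def by (intro measurable_completion borel_measurable_lim_metric f)
  have ae: "AE \<omega> in M. g \<omega> = g' \<omega>" using lim unfolding g'_def by eventually_elim (simp add: limI)
  from AE_E[OF ae] obtain N where "{\<omega>\<in>space M. \<not> g \<omega> = g' \<omega>} \<subseteq> N" "emeasure M N = 0" "N \<in> sets M" .
  hence N: "N \<in> null_sets M" "{\<omega>\<in>space M. g \<omega> \<noteq> g' \<omega>} \<subseteq> N" by auto
  have Nc: "N \<in> null_sets (completion M)" by (rule null_sets_completionI[OF N(1)])
  show ?thesis
  proof (rule measurableI)
    fix S :: "real set" assume S: "S \<in> sets borel"
    have eq: "g -` S \<inter> space (completion M) = (g' -` S \<inter> space (completion M) - N) \<union> (g -` S \<inter> space (completion M) \<inter> N)"
      using N(2) by auto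
    have "g -` S \<inter> space (completion M) \<inter> N \<in> null_sets (completion M)"
      by (rule null_sets_completion_subset[OF _ Nc]) auto
    hence "g -` S \<inter> space (completion M) \<inter> N \<in> sets (completion M)" by auto
    moreover have "g' -` S \<inter> space (completion M) \<in> sets (completion M)" by (rule measurable_sets[OF g' S])
    moreover have "N \<in> sets (completion M)" using Nc by auto
    ultimately show "g -` S \<inter> space (completion M) \<in> sets (completion M)" by (subst eq) (intro sets.Un sets.Diff)
  qed simp
qed

section \<open>Moments, domination and passage to the limit\<close>

context fractional_brownian_motion begin

lemma component_gaussian:
  assumes "i \<in> {1..d}" "t \<ge> 0"
  shows "centered_gaussian M (B i t)"
proof -
  have "finite {t} \<and> {t} \<subseteq> {0..}" using assms by simp
  hence "centered_gaussian M (\<lambda>\<omega>. \<Sum>s\<in>{t}. 1 * B i s \<omega>)"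
    using gaussian[OF assms(1)] unfolding centered_gaussian_process_def by (elim allE[of _ "{t}"] allE[of _ "\<lambda>_. 1"]) simp
  thus ?thesis by simp
qed

lemma component_product_integrable:
  assumes "i \<in> {1..d}" "s \<ge> 0" "t \<ge> 0"
  shows "integrable M (\<lambda>\<omega>. B i s \<omega> * B i t \<omega>)"
  using gaussian_pair_power_integrable[of "B i t" "B i s" 1 1]
    centered_gaussian_moments(1)[OF component_gaussian[OF assms(1,2)]] centered_gaussian_moments(1)[OF component_gaussian[OF assms(1,3)]]
  by simp

text \<open>On expanding the product, the powers of the single times cancel and only the four time
  differences survive.\<close>

lemma increment_product_expectation:
  assumes i: "i \<in> {1..d}" and t: "a \<ge> 0" "b \<ge> 0" "c \<ge> 0" "e \<ge> 0"
  shows "expectation (\<lambda>\<omega>. (B i b \<omega> - B i a \<omega>) * (B i e \<omega> - B i c \<omega>)) =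
    (\<bar>e - a\<bar> powr (2 * H) + \<bar>c - b\<bar> powr (2 * H) - \<bar>e - b\<bar> powr (2 * H) - \<bar>c - a\<bar> powr (2 * H)) / 2"
proof -
  note I = component_product_integrable[OF i]
  have "(\<lambda>\<omega>. (B i b \<omega> - B i a \<omega>) * (B i e \<omega> - B i c \<omega>)) =
     (\<lambda>\<omega>. B i e \<omega> * B i b \<omega> - B i c \<omega> * B i b \<omega> - (B i e \<omega> * B i a \<omega> - B i c \<omega> * B i a \<omega>))"
    by (simp add: fun_eq_iff algebra_simps)
  hence "expectation (\<lambda>\<omega>. (B i b \<omega> - B i a \<omega>) * (B i e \<omega> - B i c \<omega>)) =
     expectation (\<lambda>\<omega>. B i e \<omega> * B i b \<omega>) - expectation (\<lambda>\<omega>. B i c \<omega> * B i b \<omega>)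
       - (expectation (\<lambda>\<omega>. B i e \<omega> * B i a \<omega>) - expectation (\<lambda>\<omega>. B i c \<omega> * B i a \<omega>))"
    using I t by (simp add: Bochner_Integration.integral_diff)
  thus ?thesis
    unfolding covariance[OF i t(2,4)] covariance[OF i t(2,3)] covariance[OF i t(1,4)] covariance[OF i t(1,3)]
    by (simp add: field_simps)
qed

lemma increment_variance:
  assumes i: "i \<in> {1..d}" and t: "0 \<le> s" "s \<le> t"
  shows "expectation (\<lambda>\<omega>. (B i t \<omega> - B i s \<omega>)\<^sup>2) = (t - s) powr (2 * H)"
proof -
  have "\<bar>t - s\<bar> = t - s" "\<bar>s - t\<bar> = t - s" using t by auto
  thus ?thesis using increment_product_expectation[OF i, of s t s t] t by (simp add: power2_eq_square)
qed

text \<open>The Wick formula is applied for each index tuple. Strictly increasing indices keep the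
  two cells of a pair from overlapping, so its covariance is \<open>H * (2 * H - 1)\<close> times
  the kernel integral over the box; the \<open>k\<close> pairs produce the power
  \<open>k\<close>.\<close>

lemma expectation_dyadic_sum:
  assumes H: "1 / 2 < H" and k: "k \<ge> 1" and w: "\<And>l. l \<in> {1..2 * k} \<Longrightarrow> w l \<in> {1..d}"
  shows "integrable M (\<lambda>\<omega>. dyadic_sum (\<lambda>i t. B i t \<omega>) w N (2 * k) (2 ^ N))"
    and "expectation (\<lambda>\<omega>. dyadic_sum (\<lambda>i t. B i t \<omega>) w N (2 * k) (2 ^ N)) =
      (H * (2 * H - 1)) ^ k * (\<Sum>P\<in>pair_partitions_below (2 * k) w.
         LINT s|lborel_on {1..2 * k}. indicat_real (cell_region (2 * k) N) s * pair_kernel H P s)"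
proof -
  let ?m = "2 * k"
  let ?J = "increasing_indices ?m (2 ^ N)"
  define q where "q = (\<lambda>(j :: nat \<Rightarrow> nat) l. real (j l) / 2 ^ N)"
  define p where "p = (\<lambda>(j :: nat \<Rightarrow> nat) l. real (Suc (j l)) / 2 ^ N)"
  have pq: "w l \<in> {1..d} \<and> p j l \<ge> 0 \<and> q j l \<ge> 0" if "l \<in> {1..?m}" for l j
    using w[OF that] unfolding p_def q_def by simp
  have expand: "dyadic_sum (\<lambda>i t. B i t \<omega>) w N ?m (2 ^ N) = (\<Sum>j\<in>?J. \<Prod>l\<in>{1..?m}. increment w (p j) (q j) l \<omega>)" for \<omega>
    unfolding dyadic_sum_expand increment_def p_def q_def ..
  have int: "integrable M (\<lambda>\<omega>. \<Prod>l\<in>{1..?m}. increment w (p j) (q j) l \<omega>)" for j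
    by (rule increments_product(1)) (use pq in auto)
  show "integrable M (\<lambda>\<omega>. dyadic_sum (\<lambda>i t. B i t \<omega>) w N ?m (2 ^ N))"
    unfolding expand by (intro Bochner_Integration.integrable_sum int)
  let ?c = "\<lambda>j b. increment_cov w (p j) (q j) (Min b) (Max b)"
  \<comment> \<open>The value that \<open>cell_double_integral\<close> gives for the kernel over the
    box of the pair \<open>b\<close>.\<close>
  define v where "v = (\<lambda>j b. ((p j (Max b) - q j (Min b)) powr (2 * H) + (q j (Max b) - p j (Min b)) powr (2 * H)
      - (p j (Max b) - p j (Min b)) powr (2 * H) - (q j (Max b) - q j (Min b)) powr (2 * H)) / (2 * H * (2 * H - 1)))"
  have finPP: "finite (pair_partitions ?m)" by (rule finite_pair_partitions)
  have main: "(\<Sum>j\<in>?J. \<Prod>b\<in>P. ?c j b) = (H * (2 * H - 1)) ^ k *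
     (LINT s|lborel_on {1..?m}. indicat_real (cell_region ?m N) s * pair_kernel H P s)"
    if P: "P \<in> pair_partitions_below ?m w" for P
  proof -
    have P': "P \<in> pair_partitions ?m" using P unfolding pair_partitions_below_def by simp
    have same: "w i = w j" if "b \<in> P" "i \<in> b" "j \<in> b" for b i j
      using P that unfolding pair_partitions_below_def by blast
    have geo: "q j (Min b) < p j (Min b)" "p j (Min b) \<le> q j (Max b)" "q j (Max b) < p j (Max b)"
      "j (Min b) < 2 ^ N" "j (Max b) < 2 ^ N" if j: "j \<in> ?J" and b: "b \<in> P" for j b
    proof -
      note pb = pair_block[OF P' b]
      have lt: "j (Min b) < j (Max b)" using j pb(4,5,6) unfolding increasing_indices_def strict_mono_on_def by blast
      show "q j (Min b) < p j (Min b)" "q j (Max b) < p j (Max b)" unfolding p_def q_def by (auto intro: divide_strict_right_mono)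
      show "p j (Min b) \<le> q j (Max b)" unfolding p_def q_def using lt by (intro divide_right_mono) auto
      show "j (Min b) < 2 ^ N" "j (Max b) < 2 ^ N" using j pb(5,6) unfolding increasing_indices_def by (auto simp: PiE_iff)
    qed
    have vv: "v j b \<ge> 0 \<and>
      (\<integral>\<^sup>+s. (\<integral>\<^sup>+t. ennreal (\<bar>s - t\<bar> powr (2 * H - 2)) * indicator (dyadic_cell N (j (Min b))) s * indicator (dyadic_cell N (j (Max b))) t \<partial>lborel) \<partial>lborel)
         = ennreal (v j b)" if j: "j \<in> ?J" and b: "b \<in> P" for j b
    proof -
      note gg = geo[OF j b]
      show ?thesis unfolding v_def
        using cell_double_integral[OF H hurst(2) gg(1,2,3), of "dyadic_cell N (j (Min b))" "dyadic_cell N (j (Max b))"]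
          dyadic_cell_bounds[OF gg(4)] dyadic_cell_bounds[OF gg(5)] unfolding p_def q_def by blast
    qed
    have cv: "?c j b = H * (2 * H - 1) * v j b" if j: "j \<in> ?J" and b: "b \<in> P" for j b
    proof -
      note gg = geo[OF j b] and pb = pair_block[OF P' b]
      have ww: "w (Min b) = w (Max b)" using same[OF b] pb(3) by blast
      have q0: "0 \<le> q j (Min b)" "0 \<le> q j (Max b)" "0 \<le> p j (Min b)" "0 \<le> p j (Max b)" unfolding p_def q_def by auto
      have "?c j b = expectation (\<lambda>\<omega>. (B (w (Min b)) (p j (Min b)) \<omega> - B (w (Min b)) (q j (Min b)) \<omega>) *
          (B (w (Min b)) (p j (Max b)) \<omega> - B (w (Min b)) (q j (Max b)) \<omega>))"
        using ww unfolding increment_cov_def increment_def by simp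
      also have "\<dots> = (\<bar>p j (Max b) - q j (Min b)\<bar> powr (2 * H) + \<bar>q j (Max b) - p j (Min b)\<bar> powr (2 * H)
          - \<bar>p j (Max b) - p j (Min b)\<bar> powr (2 * H) - \<bar>q j (Max b) - q j (Min b)\<bar> powr (2 * H)) / 2"
        by (rule increment_product_expectation[OF w[OF pb(5)] q0(1,3,2,4)])
      also have "\<dots> = ((p j (Max b) - q j (Min b)) powr (2 * H) + (q j (Max b) - p j (Min b)) powr (2 * H)
          - (p j (Max b) - p j (Min b)) powr (2 * H) - (q j (Max b) - q j (Min b)) powr (2 * H)) / 2"
        using gg by simp
      also have "\<dots> = H * (2 * H - 1) * v j b"
      proof -
        have "R / 2 = H * c * (R / (2 * H * c))" if "c \<noteq> 0" for R c :: real using that H by simp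
        thus ?thesis unfolding v_def by this (use H in simp)
      qed
      finally show ?thesis .
    qed
    have "(\<Sum>j\<in>?J. \<Prod>b\<in>P. ?c j b) = (\<Sum>j\<in>?J. \<Prod>b\<in>P. H * (2 * H - 1) * v j b)"
      by (intro sum.cong prod.cong refl cv)
    also have "\<dots> = (H * (2 * H - 1)) ^ k * (\<Sum>j\<in>?J. \<Prod>b\<in>P. v j b)"
      unfolding prod.distrib[of "\<lambda>_. H * (2 * H - 1)"] prod_constant card_pair_partition[OF P'] by (simp add: sum_distrib_left)
    also have "(\<Sum>j\<in>?J. \<Prod>b\<in>P. v j b) = (LINT s|lborel_on {1..?m}. indicat_real (cell_region ?m N) s * pair_kernel H P s)"
      by (rule cell_kernel_integral[OF _ P H hurst(2) vv, symmetric]) (use k in auto)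
    finally show ?thesis .
  qed
  have "expectation (\<lambda>\<omega>. dyadic_sum (\<lambda>i t. B i t \<omega>) w N ?m (2 ^ N)) = (\<Sum>j\<in>?J. expectation (\<lambda>\<omega>. \<Prod>l\<in>{1..?m}. increment w (p j) (q j) l \<omega>))"
    unfolding expand by (rule Bochner_Integration.integral_sum[OF int])
  also have "\<dots> = (\<Sum>j\<in>?J. \<Sum>P\<in>pair_partitions ?m. \<Prod>b\<in>P. ?c j b)"
    unfolding pair_partitions_def pairings_def[symmetric] by (intro sum.cong refl wick) (use pq in auto)
  also have "\<dots> = (\<Sum>P\<in>pair_partitions ?m. \<Sum>j\<in>?J. \<Prod>b\<in>P. ?c j b)" by (rule sum.swap)
  also have "\<dots> = (\<Sum>P\<in>pair_partitions_below ?m w. \<Sum>j\<in>?J. \<Prod>b\<in>P. ?c j b)"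
  proof (rule sum.mono_neutral_right[OF finPP])
    show "pair_partitions_below ?m w \<subseteq> pair_partitions ?m" unfolding pair_partitions_below_def by auto
    show "\<forall>P\<in>pair_partitions ?m - pair_partitions_below ?m w. (\<Sum>j\<in>?J. \<Prod>b\<in>P. ?c j b) = 0"
    proof
      fix P assume P: "P \<in> pair_partitions ?m - pair_partitions_below ?m w"
      hence P': "P \<in> pair_partitions ?m" by simp
      from P obtain b i j where b: "b \<in> P" "i \<in> b" "j \<in> b" "w i \<noteq> w j" unfolding pair_partitions_below_def by blast
      have "w (Min b) \<noteq> w (Max b)" using b(2-4) pair_block(3)[OF P' b(1)] by (metis insertE singletonD)
      hence "?c j b = 0" for j unfolding increment_cov_def by simp
      hence "(\<Prod>b\<in>P. ?c j b) = 0" for j using b(1) finite_pair_partition[OF P'] by (intro prod_zero) auto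
      thus "(\<Sum>j\<in>?J. \<Prod>b\<in>P. ?c j b) = 0" by simp
    qed
  qed
  also have "\<dots> = (H * (2 * H - 1)) ^ k * (\<Sum>P\<in>pair_partitions_below ?m w.
         LINT s|lborel_on {1..?m}. indicat_real (cell_region ?m N) s * pair_kernel H P s)"
    unfolding sum_distrib_left by (intro sum.cong refl main)
  finally show "expectation (\<lambda>\<omega>. dyadic_sum (\<lambda>i t. B i t \<omega>) w N ?m (2 ^ N)) = \<dots>" .
qed

text \<open>Kolmogorov's argument with an integrable random constant: \<open>Y\<close> sums the
  normalised powers \<open>2 * q\<close> of all dyadic increments over all levels and components,
  hence dominates each of them. The hypothesis on \<open>q\<close> makes the expected contributions
  of the levels a convergent geometric series.\<close>

lemma dyadic_increment_moments:
  assumes q: "1 < 2 * real q * (H - \<alpha>)"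
  obtains Y where "integrable M Y" "AE \<omega> in M. 0 \<le> Y \<omega> \<and> (\<forall>n. \<forall>j<2 ^ n. \<forall>i\<in>{1..d}.
     (B i (real (Suc j) / 2 ^ n) \<omega> - B i (real j / 2 ^ n) \<omega>) ^ (2 * q) \<le> Y \<omega> * ((1 / 2 ^ n) powr \<alpha>) ^ (2 * q))"
proof -
  define X where "X = (\<lambda>n j i \<omega>. (B i (real (Suc j) / 2 ^ n) \<omega> - B i (real j / 2 ^ n) \<omega>) ^ (2 * q))"
  define a where "a = (\<lambda>n. ((1 / 2 ^ n :: real) powr \<alpha>) ^ (2 * q))"
  define c where "c = (\<Prod>i<q. real (2 * i + 1))"
  \<comment> \<open>Level \<open>n\<close> has \<open>2 ^ n\<close> cells, each with a normalised
    moment proportional to \<open>2 powr (- 2 * real q * (H - \<alpha>) * real n)\<close>; the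
    product is \<open>\<rho> ^ n\<close>.\<close>
  define \<rho> where "\<rho> = 2 powr (1 - 2 * real q * (H - \<alpha>))"
  have \<rho>: "0 < \<rho>" "\<rho> < 1" unfolding \<rho>_def using q by (auto simp: powr_less_one)
  have a0: "a n > 0" for n unfolding a_def by simp
  have X0: "X n j i \<omega> \<ge> 0" for n j i \<omega> unfolding X_def by (simp add: power_mult)
  have gX: "centered_gaussian M (\<lambda>\<omega>. B i (real (Suc j) / 2 ^ n) \<omega> - B i (real j / 2 ^ n) \<omega>)" if i: "i \<in> {1..d}" for i j n
  proof -
    have "gaussian_family {0} (increment (\<lambda>_. i) (\<lambda>_. real (Suc j) / 2 ^ n) (\<lambda>_. real j / 2 ^ n))"
      by (rule increments_gaussian_family[OF i]) auto
    from gaussian_family_single[OF this, of 0] show ?thesis by (simp add: increment_def[abs_def])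
  qed
  have iX: "integrable M (X n j i)" if "i \<in> {1..d}" for n j i
    unfolding X_def by (rule centered_gaussian_moments(1)[OF gX[OF that]])
  have eX: "expectation (X n j i) = c * ((1 / 2 ^ n) powr (2 * H)) ^ q" if i: "i \<in> {1..d}" for n j i
  proof -
    have "real (Suc j) / 2 ^ n - real j / 2 ^ n = 1 / 2 ^ n" by (simp add: field_simps)
    hence "expectation (\<lambda>\<omega>. (B i (real (Suc j) / 2 ^ n) \<omega> - B i (real j / 2 ^ n) \<omega>)\<^sup>2) = (1 / 2 ^ n) powr (2 * H)"
      using increment_variance[OF i, of "real j / 2 ^ n" "real (Suc j) / 2 ^ n"] by (simp add: divide_right_mono)
    thus ?thesis unfolding X_def c_def centered_gaussian_even_moment[OF gX[OF i]] by simp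
  qed
  define T where "T = (\<lambda>n \<omega>. \<Sum>i\<in>{1..d}. \<Sum>j<2 ^ n. X n j i \<omega> / a n)"
  have T0: "T n \<omega> \<ge> 0" for n \<omega> unfolding T_def using X0 a0 by (intro sum_nonneg divide_nonneg_pos) auto
  have iT: "integrable M (T n)" for n unfolding T_def
    by (intro Bochner_Integration.integrable_sum integrable_divide iX)
  have eT: "expectation (T n) = real d * c * \<rho> ^ n" for n
  proof -
    have "expectation (T n) = (\<Sum>i\<in>{1..d}. \<Sum>j<(2::nat) ^ n. c * ((1 / 2 ^ n) powr (2 * H)) ^ q / a n)"
      unfolding T_def by (simp add: Bochner_Integration.integral_sum iX eX integrable_divide)
    also have "\<dots> = real d * c * (2 ^ n * ((1 / 2 ^ n) powr (2 * H)) ^ q / a n)" by simp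
    also have "2 ^ n * ((1 / 2 ^ n) powr (2 * H)) ^ q / a n = \<rho> ^ n"
    proof -
      have h: "(1 / 2 ^ n :: real) = 2 powr (- real n)" by (simp add: powr_minus powr_realpow divide_inverse)
      have pw: "(2 powr x) ^ m = 2 powr (x * real m)" for x :: real and m by (simp add: powr_powr flip: powr_realpow)
      have "(2::real) ^ n = 2 powr real n" by (simp add: powr_realpow)
      thus ?thesis unfolding a_def \<rho>_def h powr_powr pw
        by (simp add: powr_add[symmetric] powr_diff[symmetric] algebra_simps)
    qed
    finally show ?thesis .
  qed
  have sumE: "summable (\<lambda>n. real d * c * \<rho> ^ n)" using \<rho> by (intro summable_mult summable_geometric) auto
  have c0: "c \<ge> 0" unfolding c_def by (intro prod_nonneg) auto
  have sAE: "AE \<omega> in M. summable (\<lambda>n. T n \<omega>)"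
  proof -
    have "(\<integral>\<^sup>+\<omega>. (\<Sum>n. ennreal (T n \<omega>)) \<partial>M) = (\<Sum>n. \<integral>\<^sup>+\<omega>. ennreal (T n \<omega>) \<partial>M)"
      using iT by (intro nn_integral_suminf) auto
    also have "\<dots> = (\<Sum>n. ennreal (real d * c * \<rho> ^ n))"
      using iT T0 by (intro suminf_cong) (subst nn_integral_eq_integral, auto simp: eT)
    also have "\<dots> = ennreal (\<Sum>n. real d * c * \<rho> ^ n)"
      using sumE c0 \<rho> by (intro suminf_ennreal2) auto
    finally have "(\<integral>\<^sup>+\<omega>. (\<Sum>n. ennreal (T n \<omega>)) \<partial>M) \<noteq> \<infinity>" by simp
    moreover have "(\<lambda>\<omega>. \<Sum>n. ennreal (T n \<omega>)) \<in> borel_measurable M"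
      using iT by (intro borel_measurable_suminf_order) auto
    ultimately have "AE \<omega> in M. (\<Sum>n. ennreal (T n \<omega>)) \<noteq> \<infinity>" by (intro nn_integral_PInf_AE) auto
    thus ?thesis by eventually_elim (rule summable_suminf_not_top, use T0 in auto)
  qed
  show ?thesis
  proof (rule that)
    show "integrable M (\<lambda>\<omega>. \<Sum>n. T n \<omega>)"
    proof (rule integrable_suminf[OF iT])
      show "AE \<omega> in M. summable (\<lambda>n. norm (T n \<omega>))" using sAE T0 by simp
      show "summable (\<lambda>n. \<integral>\<omega>. norm (T n \<omega>) \<partial>M)" using sumE T0 by (simp add: eT)
    qed
    show "AE \<omega> in M. 0 \<le> (\<Sum>n. T n \<omega>) \<and> (\<forall>n. \<forall>j<2 ^ n. \<forall>i\<in>{1..d}.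
     (B i (real (Suc j) / 2 ^ n) \<omega> - B i (real j / 2 ^ n) \<omega>) ^ (2 * q) \<le> (\<Sum>n. T n \<omega>) * ((1 / 2 ^ n) powr \<alpha>) ^ (2 * q))"
      using sAE
    proof eventually_elim
      case (elim \<omega>)
      have "X n j i \<omega> \<le> (\<Sum>n. T n \<omega>) * a n" if "j < 2 ^ n" "i \<in> {1..d}" for n j i
      proof -
        have "X n j i \<omega> / a n \<le> (\<Sum>j<2 ^ n. X n j i \<omega> / a n)"
          using that X0 a0 less_imp_le[OF a0] by (intro member_le_sum) auto
        also have "\<dots> \<le> T n \<omega>" unfolding T_def
          using that X0 less_imp_le[OF a0] by (intro member_le_sum sum_nonneg divide_nonneg_nonneg) auto
        also have "T n \<omega> \<le> (\<Sum>n. T n \<omega>)"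
          using sum_le_suminf[OF elim, of "{n}"] T0 by simp
        finally show ?thesis using a0[of n] by (simp add: field_simps)
      qed
      thus ?case unfolding X_def a_def using suminf_nonneg[OF elim T0] by blast
    qed
  qed
qed

text \<open>The dyadic sums are bounded by a constant times the power \<open>2 * k\<close> of
  \<open>Z\<close>, the random factor in the Hoelder constant. With \<open>q \<ge> k\<close> this
  power is at most \<open>1 + Y\<close>, which is integrable and the same for all levels.\<close>

lemma dyadic_sum_dominated:
  assumes H: "1 / 2 < H" and w: "\<And>l. l \<in> {1..2 * k} \<Longrightarrow> w l \<in> {1..d}"
  obtains Y where "integrable M Y"
    "AE \<omega> in M. iterated_young_exists (\<lambda>i t. B i t \<omega>) w (2 * k) 1 \<and>
       (\<forall>n. \<bar>dyadic_sum (\<lambda>i t. B i t \<omega>) w n (2 * k) (2 ^ n)\<bar> \<le> Y \<omega>) \<and>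
       (\<lambda>n. dyadic_sum (\<lambda>i t. B i t \<omega>) w n (2 * k) (2 ^ n)) \<longlonglongrightarrow> iterated_young (\<lambda>i t. B i t \<omega>) w (2 * k) 1"
proof -
  \<comment> \<open>Halfway between 1/2 and \<open>H\<close>, leaving room on both sides: above 1/2
    for Young integration, below \<open>H\<close> for the moments.\<close>
  define \<alpha> where "\<alpha> = (H + 1 / 2) / 2"
  have \<alpha>: "1 / 2 < \<alpha>" "0 < \<alpha>" "\<alpha> \<le> 1" using H hurst unfolding \<alpha>_def by auto
  obtain q0 :: nat where q0: "real q0 > 1 / (H - 1 / 2)" using reals_Archimedean2 by blast
  \<comment> \<open>\<open>q0\<close> gives \<open>2 * q * (H - \<alpha>) > 1\<close>, because
    \<open>H - \<alpha>\<close> is half of \<open>H - 1/2\<close>; \<open>k + 1\<close> gives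
    \<open>q \<ge> k\<close> and \<open>q > 0\<close>.\<close>
  define q where "q = max q0 (k + 1)"
  have q: "real q > 1 / (H - 1 / 2)" "q \<ge> k" "q > 0" unfolding q_def using q0 by auto
  have "1 < real q * (H - 1 / 2)" using q(1) H by (simp add: field_simps)
  hence "1 < 2 * real q * (H - \<alpha>)" unfolding \<alpha>_def by (simp add: field_simps)
  then obtain Y where Y: "integrable M Y" "AE \<omega> in M. 0 \<le> Y \<omega> \<and> (\<forall>n. \<forall>j<2 ^ n. \<forall>i\<in>{1..d}.
     (B i (real (Suc j) / 2 ^ n) \<omega> - B i (real j / 2 ^ n) \<omega>) ^ (2 * q) \<le> Y \<omega> * ((1 / 2 ^ n) powr \<alpha>) ^ (2 * q))"
    by (rule dyadic_increment_moments)
  obtain K where K: "K \<ge> 0" "\<forall>f Z. Z \<ge> 0 \<longrightarrow>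
      (\<forall>n i. i < 2 ^ n \<longrightarrow> \<bar>f (real (Suc i) / 2 ^ n) - f (real i / 2 ^ n)\<bar> \<le> Z * (1 / 2 ^ n) powr \<alpha>) \<longrightarrow>
      continuous_on {0..1} f \<longrightarrow> hoelder_on {0..1} \<alpha> (K * Z) f"
    using dyadic_hoelder[OF \<alpha>(2,3)] by blast
  define C where "C = ((1 + young_const \<alpha>) * K) ^ (2 * k)"
  have C: "C \<ge> 0" unfolding C_def by (simp add: power_mult)
  show ?thesis
  proof (rule that)
    show "integrable M (\<lambda>\<omega>. C * (1 + Y \<omega>))" using Y(1) by simp
    show "AE \<omega> in M. iterated_young_exists (\<lambda>i t. B i t \<omega>) w (2 * k) 1 \<and>
       (\<forall>n. \<bar>dyadic_sum (\<lambda>i t. B i t \<omega>) w n (2 * k) (2 ^ n)\<bar> \<le> C * (1 + Y \<omega>)) \<and>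
       (\<lambda>n. dyadic_sum (\<lambda>i t. B i t \<omega>) w n (2 * k) (2 ^ n)) \<longlonglongrightarrow> iterated_young (\<lambda>i t. B i t \<omega>) w (2 * k) 1"
      using Y(2) continuous
    proof eventually_elim
      case (elim \<omega>)
      let ?x = "\<lambda>i t. B i t \<omega>"
      \<comment> \<open>The root turns the bound on the powers \<open>2 * q\<close> into one on the
        increments themselves, the input of \<open>dyadic_hoelder\<close>.\<close>
      define Z where "Z = root (2 * q) (Y \<omega>)"
      have Z: "Z \<ge> 0" "Z ^ (2 * q) = Y \<omega>" unfolding Z_def using elim(1) q(3) by (auto simp: real_root_pow_pos2)
      have inc: "\<bar>B i (real (Suc j) / 2 ^ n) \<omega> - B i (real j / 2 ^ n) \<omega>\<bar> \<le> Z * (1 / 2 ^ n) powr \<alpha>"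
        if "j < 2 ^ n" "i \<in> {1..d}" for n j i
      proof (rule power_le_imp_le_base)
        have "2 * q = Suc (2 * q - 1)" using q by simp
        have "\<bar>B i (real (Suc j) / 2 ^ n) \<omega> - B i (real j / 2 ^ n) \<omega>\<bar> ^ (2 * q) =
            (B i (real (Suc j) / 2 ^ n) \<omega> - B i (real j / 2 ^ n) \<omega>) ^ (2 * q)" by (simp add: power_even_abs)
        also have "\<dots> \<le> Y \<omega> * ((1 / 2 ^ n) powr \<alpha>) ^ (2 * q)" using elim(1) that by blast
        also have "\<dots> = (Z * (1 / 2 ^ n) powr \<alpha>) ^ (2 * q)" unfolding Z(2)[symmetric] by (simp add: power_mult_distrib)
        finally show "\<bar>B i (real (Suc j) / 2 ^ n) \<omega> - B i (real j / 2 ^ n) \<omega>\<bar> ^ Suc (2 * q - 1) \<le> (Z * (1 / 2 ^ n) powr \<alpha>) ^ Suc (2 * q - 1)"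
          using \<open>2 * q = Suc (2 * q - 1)\<close> by simp
        show "0 \<le> Z * (1 / 2 ^ n) powr \<alpha>" using Z by simp
      qed
      have hol: "hoelder_on {0..1} \<alpha> (K * Z) (?x (w m))" if "m \<in> {1..2 * k}" for m
      proof (rule K(2)[rule_format, OF Z(1)])
        show "continuous_on {0..1} (?x (w m))"
          by (rule continuous_on_subset[of "{0..}"]) (use elim(2) w[OF that] in auto)
      qed (rule inc[OF _ w[OF that]])
      have KZ: "K * Z \<ge> 0" using K Z by simp
      have "iterated_young_exists ?x w (2 * k) 1"
        unfolding iterated_young_exists_def
        using iterated_young_estimates(2)[where x = ?x and w = w and n = "2 * k", OF \<alpha>(1) KZ hol] by blast
      moreover have "\<bar>dyadic_sum ?x w n (2 * k) (2 ^ n)\<bar> \<le> C * (1 + Y \<omega>)" for n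
      proof -
        have le1: "real i / 2 ^ n \<in> {0..1}" if "i \<le> 2 ^ n" for i using that by (simp add: divide_simps)
        have grid: "\<bar>?x (w m) (real j / 2 ^ n) - ?x (w m) (real i / 2 ^ n)\<bar> \<le> (K * Z) * (real j / 2 ^ n - real i / 2 ^ n) powr \<alpha>"
          if "m \<in> {1..2 * k}" "i \<le> j" "j \<le> 2 ^ n" for m i j
          by (rule hoelder_onD[OF hol[OF that(1)]]) (use that le1[of i] le1[of j] in \<open>auto simp: divide_right_mono\<close>)
        have "\<bar>dyadic_sum ?x w n (2 * k) (2 ^ n)\<bar> \<le> ((1 + young_const \<alpha>) * (K * Z)) ^ (2 * k)"
          using dyadic_sum_estimates(1)[where x = ?x and w = w and M = "2 * k" and n = n and m = "2 * k" and i = 0 and j = "2 ^ n", OF \<alpha>(1) KZ grid]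
          by simp
        also have "\<dots> = C * Z ^ (2 * k)" unfolding C_def by (simp add: power_mult_distrib mult.assoc)
        also have "\<dots> \<le> C * (1 + Y \<omega>)"
        proof (rule mult_left_mono[OF _ C])
          show "Z ^ (2 * k) \<le> 1 + Y \<omega>"
          proof (cases "Z \<le> 1")
            case True
            hence "Z ^ (2 * k) \<le> 1" using Z by (intro power_le_one) auto
            thus ?thesis using elim(1) by linarith
          next
            case False
            hence "Z ^ (2 * k) \<le> Z ^ (2 * q)" using q by (intro power_increasing) auto
            thus ?thesis unfolding Z(2) by simp
          qed
        qed
        finally show ?thesis .
      qed
      moreover have "(\<lambda>n. dyadic_sum ?x w n (2 * k) (2 ^ n)) \<longlonglongrightarrow> iterated_young ?x w (2 * k) 1"
        using dyadic_sum_tendsto[where x = ?x and w = w and M = "2 * k" and m = "2 * k" and i = 1 and D = 0, OF \<alpha>(1) KZ hol]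
        by simp
      ultimately show ?case by blast
    qed
  qed
qed

text \<open>The same expectations have two limits: dominated convergence over the paths leads to the
  iterated integral, \<open>cell_kernel_tendsto\<close> on the simplex to the sum of the
  \<open>L_integral\<close>.\<close>

lemma iterated_young_expectation:
  assumes H: "1 / 2 < H" and k: "k \<ge> 1" and w: "\<And>l. l \<in> {1..2 * k} \<Longrightarrow> w l \<in> {1..d}"
  shows "AE \<omega> in M. iterated_young_exists (\<lambda>i t. B i t \<omega>) w (2 * k) 1"
    and "integrable (completion M) (\<lambda>\<omega>. iterated_young (\<lambda>i t. B i t \<omega>) w (2 * k) 1)"
    and "complex_of_real (\<integral>\<omega>. iterated_young (\<lambda>i t. B i t \<omega>) w (2 * k) 1 \<partial>completion M) =
       complex_of_real ((H * (2 * H - 1)) ^ k) * (\<Sum>P\<in>pair_partitions_below (2 * k) w. L_integral (2 * k) P (complex_of_real H))"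
proof -
  let ?I = "\<lambda>\<omega>. iterated_young (\<lambda>i t. B i t \<omega>) w (2 * k) 1"
  define S where "S = (\<lambda>n \<omega>. dyadic_sum (\<lambda>i t. B i t \<omega>) w n (2 * k) (2 ^ n))"
  obtain Y where Y: "integrable M Y" "AE \<omega> in M. iterated_young_exists (\<lambda>i t. B i t \<omega>) w (2 * k) 1 \<and>
       (\<forall>n. \<bar>S n \<omega>\<bar> \<le> Y \<omega>) \<and> (\<lambda>n. S n \<omega>) \<longlonglongrightarrow> ?I \<omega>"
    unfolding S_def by (rule dyadic_sum_dominated[OF H]) (rule w)
  show "AE \<omega> in M. iterated_young_exists (\<lambda>i t. B i t \<omega>) w (2 * k) 1" using Y(2) by eventually_elim simp
  have lim: "AE \<omega> in M. (\<lambda>n. S n \<omega>) \<longlonglongrightarrow> ?I \<omega>" using Y(2) by eventually_elim simp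
  have bd: "AE \<omega> in M. norm (S n \<omega>) \<le> Y \<omega>" for n using Y(2) by eventually_elim simp
  have iS: "integrable M (S n)" for n unfolding S_def by (rule expectation_dyadic_sum(1)[OF H k]) (rule w)
  have Sm: "S n \<in> borel_measurable M" for n using iS by auto
  have Im: "?I \<in> borel_measurable (completion M)" by (rule measurable_completion_AE_limit[OF Sm lim])
  have Sc: "S n \<in> borel_measurable (completion M)" for n by (rule measurable_completion[OF Sm])
  have Yc: "integrable (completion M) Y" using Y(1) by (subst integrable_completion) auto
  note dom = Im Sc Yc AE_completion[OF lim] AE_completion[OF bd]
  show "integrable (completion M) ?I" by (rule integrable_dominated_convergence[OF dom])
  have "(\<lambda>n. integral\<^sup>L (completion M) (S n)) \<longlonglongrightarrow> integral\<^sup>L (completion M) ?I"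
    by (rule integral_dominated_convergence[OF dom])
  hence l1: "(\<lambda>n. expectation (S n)) \<longlonglongrightarrow> integral\<^sup>L (completion M) ?I"
    by (simp only: integral_completion[OF Sm])
  let ?V = "\<Sum>P\<in>pair_partitions_below (2 * k) w. LINT s|lborel_on {1..2 * k}. indicat_real (open_simplex (2 * k)) s * pair_kernel H P s"
  have m1: "2 * k \<ge> 1" using k by simp
  have ES: "expectation (S n) = (H * (2 * H - 1)) ^ k * (\<Sum>P\<in>pair_partitions_below (2 * k) w.
         LINT s|lborel_on {1..2 * k}. indicat_real (cell_region (2 * k) n) s * pair_kernel H P s)" for n
    unfolding S_def by (rule expectation_dyadic_sum(2)[OF H k]) (rule w)
  have l2: "(\<lambda>n. expectation (S n)) \<longlonglongrightarrow> (H * (2 * H - 1)) ^ k * ?V"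
    unfolding ES by (intro tendsto_mult tendsto_const tendsto_sum cell_kernel_tendsto[OF m1 _ H])
  have "integral\<^sup>L (completion M) ?I = (H * (2 * H - 1)) ^ k * ?V" by (rule LIMSEQ_unique[OF l1 l2])
  thus "complex_of_real (integral\<^sup>L (completion M) ?I) =
       complex_of_real ((H * (2 * H - 1)) ^ k) * (\<Sum>P\<in>pair_partitions_below (2 * k) w. L_integral (2 * k) P (complex_of_real H))"
    using pair_kernel_integrable(2)[OF m1 _ H] by simp
qed

end

text \<open>Each unordered pair partition contributes \<open>(H * (2 * H - 1)) ^ k\<close> times its
  \<open>L_integral\<close> to the expectation exactly once; hence the factor \<open>fact k\<close>
  on both sides of the identity. That identity concerns real \<open>H\<close> between 1/2 and 1,
  while the continuation starts from the integrals on the whole half-plane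
  \<open>Re H > 1/2\<close>.\<close>

theorem corollary0p2:
  fixes d k :: nat and w :: "nat \<Rightarrow> nat"
  assumes "d \<ge> 1" and "k \<ge> 1" and "\<And>j. j \<in> {1..2 * k} \<Longrightarrow> w j \<in> {1..d}"
  shows "(\<forall>H (M :: 'a measure) B.
            1 / 2 < H \<and> H < 1 \<and> fractional_brownian_motion M d H B \<longrightarrow>
              (AE \<omega> in M. iterated_young_exists (\<lambda>i t. B i t \<omega>) w (2 * k) 1) \<and>
              integrable (completion M) (\<lambda>\<omega>. iterated_young (\<lambda>i t. B i t \<omega>) w (2 * k) 1) \<and>
              complex_of_real (fact k / (H ^ k * (2 * H - 1) ^ k) *
                  (\<integral>\<omega>. iterated_young (\<lambda>i t. B i t \<omega>) w (2 * k) 1 \<partial>completion M))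
                = fact k * (\<Sum>P\<in>pair_partitions_below (2 * k) w.
                              L_integral (2 * k) P (complex_of_real H)))
       \<and> (\<exists>F. F meromorphic_on UNIV
              \<and> F holomorphic_on (- exceptional_set (2 * k) w)
              \<and> (\<forall>H. Re H > 1 / 2 \<longrightarrow>
                   F H = (\<Sum>P\<in>pair_partitions_below (2 * k) w. L_integral (2 * k) P H)))
       \<and> exceptional_set (2 * k) w \<subseteq> \<rat>"
proof (intro conjI allI impI)
  fix H and M :: "'a measure" and B
  assume "1 / 2 < H \<and> H < 1 \<and> fractional_brownian_motion M d H B"
  hence H: "1 / 2 < H" "H < 1" and fbm: "fractional_brownian_motion M d H B" by auto
  interpret fractional_brownian_motion M d H B by (rule fbm)
  have E: "AE \<omega> in M. iterated_young_exists (\<lambda>i t. B i t \<omega>) w (2 * k) 1"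
    "integrable (completion M) (\<lambda>\<omega>. iterated_young (\<lambda>i t. B i t \<omega>) w (2 * k) 1)"
    "complex_of_real (\<integral>\<omega>. iterated_young (\<lambda>i t. B i t \<omega>) w (2 * k) 1 \<partial>completion M) =
       complex_of_real ((H * (2 * H - 1)) ^ k) * (\<Sum>P\<in>pair_partitions_below (2 * k) w. L_integral (2 * k) P (complex_of_real H))"
    by (rule iterated_young_expectation[OF H(1) assms(2)], rule assms(3), assumption)+
  show "AE \<omega> in M. iterated_young_exists (\<lambda>i t. B i t \<omega>) w (2 * k) 1"
    "integrable (completion M) (\<lambda>\<omega>. iterated_young (\<lambda>i t. B i t \<omega>) w (2 * k) 1)" by (rule E)+
  define c where "c = complex_of_real (H ^ k * (2 * H - 1) ^ k)"
  have c: "c \<noteq> 0" unfolding c_def of_real_eq_0_iff using H by simp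
  have "complex_of_real (\<integral>\<omega>. iterated_young (\<lambda>i t. B i t \<omega>) w (2 * k) 1 \<partial>completion M) =
     c * (\<Sum>P\<in>pair_partitions_below (2 * k) w. L_integral (2 * k) P (complex_of_real H))"
    using E(3) unfolding c_def power_mult_distrib by blast
  thus "complex_of_real (fact k / (H ^ k * (2 * H - 1) ^ k) *
                  (\<integral>\<omega>. iterated_young (\<lambda>i t. B i t \<omega>) w (2 * k) 1 \<partial>completion M))
                = fact k * (\<Sum>P\<in>pair_partitions_below (2 * k) w. L_integral (2 * k) P (complex_of_real H))"
    using c unfolding of_real_mult of_real_divide of_real_fact c_def[unfolded of_real_mult, symmetric] by simp
next
  show "\<exists>F. F meromorphic_on UNIV \<and> F holomorphic_on (- exceptional_set (2 * k) w) \<and>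
     (\<forall>H. Re H > 1 / 2 \<longrightarrow> F H = (\<Sum>P\<in>pair_partitions_below (2 * k) w. L_integral (2 * k) P H))"
    by (rule sum_L_integral_continuation) (use assms(2) in simp)
  show "exceptional_set (2 * k) w \<subseteq> \<rat>" using exceptional_set_facts(3) by blast
qed

end
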